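(* Let $\varepsilon,\mu$ be admissible weights. Then the embeddings $H_{\mathbb S,\Gamma_t}(\operatorname{Rot},\Omega)\cap\varepsilon^{-1}H_{\mathbb S,\Gamma_n}(\operatorname{divDiv},\Omega)\hookrightarrow L^2_{\mathbb S,\varepsilon}(\Omega)$ and $\mu^{-1}H_{\mathbb T,\Gamma_t}(\operatorname{Div},\Omega)\cap H_{\mathbb T,\Gamma_n}(\operatorname{symRot},\Omega)\hookrightarrow L^2_{\mathbb T,\mu}(\Omega)$ are compact (the intersections carrying the natural graph norms, e.g. $\|S\|_{L^2}+\|\operatorname{Rot}S\|_{L^2}+\|\operatorname{divDiv}\varepsilon S\|_{L^2}$). Moreover, the compactness does not depend on $\varepsilon$ or $\mu$.
   Context: Let $\Omega\subset\mathbb{R}^3$ be a bounded strong Lipschitz domain with boundary $\Gamma$, let $\Gamma_t\subset\Gamma$ be a relatively open strong Lipschitz boundary part and $\Gamma_n:=\Gamma\setminus\overline{\Gamma_t}$. For relatively open $\Sigma\subset\Gamma$, $C^\infty_\Sigma(\Omega)$ is the space of restrictions to $\Omega$ of smooth compactly supported (scalar, vector or matrix valued) functions on $\mathbb{R}^3$ whose support has positive distance to $\Sigma$. $L^2_{\mathbb S}(\Omega)$, $L^2_{\mathbb T}(\Omega)$ are the symmetric resp. trace-free $3\times3$ matrix fields in $L^2$; $C^\infty_{\mathbb S,\Sigma}:=C^\infty_\Sigma\cap L^2_{\mathbb S}$, $C^\infty_{\mathbb T,\Sigma}:=C^\infty_\Sigma\cap L^2_{\mathbb T}$. Operators act distributionally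 and row-wise: $\operatorname{Rot}$ (row-wise curl), $\operatorname{Div}$ (row-wise divergence), $\operatorname{symRot}T:=\frac12(\operatorname{Rot}T+(\operatorname{Rot}T)^\top)$, $\operatorname{divDiv}S:=\operatorname{div}\operatorname{Div}S$. $H_{\mathbb S,\Sigma}(\operatorname{Rot},\Omega)$, $H_{\mathbb S,\Sigma}(\operatorname{divDiv},\Omega)$ are the closures of $C^\infty_{\mathbb S,\Sigma}(\Omega)$ in the graph norms of $\{S\in L^2_{\mathbb S}:\operatorname{Rot}S\in L^2\}$ resp. $\{S\in L^2_{\mathbb S}:\operatorname{divDiv}S\in L^2\}$; $H_{\mathbb T,\Sigma}(\operatorname{Div},\Omega)$, $H_{\mathbb T,\Sigma}(\operatorname{symRot},\Omega)$ are the closures of $C^\infty_{\mathbb T,\Sigma}(\Omega)$ in the graph norms of $\{T\in L^2_{\mathbb T}:\operatorname{Div}T\in L^2\}$ resp. $\{T\in L^2_{\mathbb T}:\operatorname{symRot}T\in L^2\}$. Admissible weights: $\varepsilon:L^2_{\mathbb S}\to L^2_{\mathbb S}$, $\mu:L^2_{\mathbb T}\to L^2_{\mathbb T}$ symmetric, positive, bounded linear bijections; $L^2_{\mathbb S,\varepsilon}(\Omega)$ is $L^2_{\mathbb S}(\Omega)$ with inner product $\langle\varepsilon\,\cdot,\cdot\rangle_{L^2}$, likewise $L^2_{\mathbb T,\mu}(\Omega)$. *)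

theory Defs
  imports "HOL-Analysis.Analysis"
begin

type_synonym R3 = "real^3"
type_synonym M3 = "real^3^3"

definition pd :: "3 \<Rightarrow> (R3 \<Rightarrow> 'b::real_normed_vector) \<Rightarrow> R3 \<Rightarrow> 'b" where
  "pd j f x = frechet_derivative f (at x) (axis j 1)"

coinductive smooth :: "(R3 \<Rightarrow> 'b::real_normed_vector) \<Rightarrow> bool" where
  "(\<forall>x. f differentiable (at x)) \<Longrightarrow> (\<forall>j. smooth (pd j f)) \<Longrightarrow> smooth f"

definition tsupp :: "(R3 \<Rightarrow> 'b::zero) \<Rightarrow> R3 set" where
  "tsupp f = closure {x. f x \<noteq> 0}"

text \<open>Smooth compactly supported functions on R^3 whose support has positive distance to Sigma
  (restricted to Omega implicitly, since all integrals below are over Omega).\<close>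
definition C_inf_Sigma :: "R3 set \<Rightarrow> (R3 \<Rightarrow> 'b::real_normed_vector) \<Rightarrow> bool" where
  "C_inf_Sigma \<Sigma> f \<longleftrightarrow> smooth f \<and> compact (tsupp f) \<and>
     (\<exists>d>0. \<forall>x\<in>tsupp f. \<forall>y\<in>\<Sigma>. d \<le> dist x y)"

definition test_fun :: "R3 set \<Rightarrow> (R3 \<Rightarrow> 'b::real_normed_vector) \<Rightarrow> bool" where
  "test_fun \<Omega> f \<longleftrightarrow> smooth f \<and> compact (tsupp f) \<and> tsupp f \<subseteq> \<Omega>"

definition cgrad :: "(R3 \<Rightarrow> real) \<Rightarrow> R3 \<Rightarrow> R3" where
  "cgrad u x = (\<chi> j. pd j u x)"

definition cGrad :: "(R3 \<Rightarrow> R3) \<Rightarrow> R3 \<Rightarrow> M3" where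
  "cGrad v x = (\<chi> i j. pd j (\<lambda>y. v y $ i) x)"

definition cdiv :: "(R3 \<Rightarrow> R3) \<Rightarrow> R3 \<Rightarrow> real" where
  "cdiv v x = (\<Sum>j\<in>UNIV. pd j (\<lambda>y. v y $ j) x)"

definition cDiv :: "(R3 \<Rightarrow> M3) \<Rightarrow> R3 \<Rightarrow> R3" where
  "cDiv T x = (\<chi> i. \<Sum>j\<in>UNIV. pd j (\<lambda>y. T y $ i $ j) x)"

definition cRot :: "(R3 \<Rightarrow> M3) \<Rightarrow> R3 \<Rightarrow> M3" where
  "cRot T x = (\<chi> i. vector
     [pd 2 (\<lambda>y. T y $ i $ 3) x - pd 3 (\<lambda>y. T y $ i $ 2) x,
      pd 3 (\<lambda>y. T y $ i $ 1) x - pd 1 (\<lambda>y. T y $ i $ 3) x,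
      pd 1 (\<lambda>y. T y $ i $ 2) x - pd 2 (\<lambda>y. T y $ i $ 1) x])"

definition symm :: "M3 \<Rightarrow> M3" where
  "symm A = (1/2) *\<^sub>R (A + transpose A)"

definition csymRot :: "(R3 \<Rightarrow> M3) \<Rightarrow> R3 \<Rightarrow> M3" where
  "csymRot T x = symm (cRot T x)"

definition cdivDiv :: "(R3 \<Rightarrow> M3) \<Rightarrow> R3 \<Rightarrow> real" where
  "cdivDiv S = cdiv (cDiv S)"

section \<open>L^2 on Omega (pointwise representatives; equalities are a.e.)\<close>

definition L2 :: "R3 set \<Rightarrow> (R3 \<Rightarrow> 'b::euclidean_space) \<Rightarrow> bool" where
  "L2 \<Omega> f \<longleftrightarrow> f \<in> borel_measurable (lebesgue_on \<Omega>) \<and>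
     integrable (lebesgue_on \<Omega>) (\<lambda>x. (norm (f x))\<^sup>2)"

definition l2inner :: "R3 set \<Rightarrow> (R3 \<Rightarrow> 'b::euclidean_space) \<Rightarrow> (R3 \<Rightarrow> 'b) \<Rightarrow> real" where
  "l2inner \<Omega> f g = (LINT x|lebesgue_on \<Omega>. f x \<bullet> g x)"

definition l2norm :: "R3 set \<Rightarrow> (R3 \<Rightarrow> 'b::euclidean_space) \<Rightarrow> real" where
  "l2norm \<Omega> f = sqrt (LINT x|lebesgue_on \<Omega>. (norm (f x))\<^sup>2)"

text \<open>L^2_S and L^2_T (Frobenius inner product = inner product on real^3^3)\<close>
definition L2S :: "R3 set \<Rightarrow> (R3 \<Rightarrow> M3) \<Rightarrow> bool" where
  "L2S \<Omega> S \<longleftrightarrow> L2 \<Omega> S \<and> (AE x in lebesgue_on \<Omega>. transpose (S x) = S x)"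

definition L2T :: "R3 set \<Rightarrow> (R3 \<Rightarrow> M3) \<Rightarrow> bool" where
  "L2T \<Omega> T \<longleftrightarrow> L2 \<Omega> T \<and> (AE x in lebesgue_on \<Omega>. trace (T x) = 0)"

definition weak_Rot :: "R3 set \<Rightarrow> (R3 \<Rightarrow> M3) \<Rightarrow> (R3 \<Rightarrow> M3) \<Rightarrow> bool" where
  "weak_Rot \<Omega> S G \<longleftrightarrow> L2 \<Omega> G \<and>
     (\<forall>\<Phi>::R3 \<Rightarrow> M3. test_fun \<Omega> \<Phi> \<longrightarrow> l2inner \<Omega> S (cRot \<Phi>) = l2inner \<Omega> G \<Phi>)"

definition weak_Div :: "R3 set \<Rightarrow> (R3 \<Rightarrow> M3) \<Rightarrow> (R3 \<Rightarrow> R3) \<Rightarrow> bool" where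
  "weak_Div \<Omega> T v \<longleftrightarrow> L2 \<Omega> v \<and>
     (\<forall>\<phi>::R3 \<Rightarrow> R3. test_fun \<Omega> \<phi> \<longrightarrow> l2inner \<Omega> v \<phi> = - l2inner \<Omega> T (cGrad \<phi>))"

definition weak_divDiv :: "R3 set \<Rightarrow> (R3 \<Rightarrow> M3) \<Rightarrow> (R3 \<Rightarrow> real) \<Rightarrow> bool" where
  "weak_divDiv \<Omega> S u \<longleftrightarrow> L2 \<Omega> u \<and>
     (\<forall>\<psi>::R3 \<Rightarrow> real. test_fun \<Omega> \<psi> \<longrightarrow> l2inner \<Omega> u \<psi> = l2inner \<Omega> S (cGrad (cgrad \<psi>)))"

text \<open>symRot T tested against Phi equals Rot T tested against sym Phi, i.e. T tested against Rot (sym Phi).\<close>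
definition weak_symRot :: "R3 set \<Rightarrow> (R3 \<Rightarrow> M3) \<Rightarrow> (R3 \<Rightarrow> M3) \<Rightarrow> bool" where
  "weak_symRot \<Omega> T G \<longleftrightarrow> L2 \<Omega> G \<and>
     (\<forall>\<Phi>::R3 \<Rightarrow> M3. test_fun \<Omega> \<Phi> \<longrightarrow>
        l2inner \<Omega> G \<Phi> = l2inner \<Omega> T (cRot (\<lambda>x. symm (\<Phi> x))))"

definition C_inf_S :: "R3 set \<Rightarrow> R3 set \<Rightarrow> (R3 \<Rightarrow> M3) \<Rightarrow> bool" where
  "C_inf_S \<Omega> \<Sigma> \<Phi> \<longleftrightarrow> C_inf_Sigma \<Sigma> \<Phi> \<and> (\<forall>x\<in>\<Omega>. transpose (\<Phi> x) = \<Phi> x)"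

definition C_inf_T :: "R3 set \<Rightarrow> R3 set \<Rightarrow> (R3 \<Rightarrow> M3) \<Rightarrow> bool" where
  "C_inf_T \<Omega> \<Sigma> \<Phi> \<longleftrightarrow> C_inf_Sigma \<Sigma> \<Phi> \<and> (\<forall>x\<in>\<Omega>. trace (\<Phi> x) = 0)"

definition H_S_Rot :: "R3 set \<Rightarrow> R3 set \<Rightarrow> (R3 \<Rightarrow> M3) \<Rightarrow> bool" where
  "H_S_Rot \<Omega> \<Sigma> S \<longleftrightarrow> L2S \<Omega> S \<and> (\<exists>G. weak_Rot \<Omega> S G \<and>
     (\<exists>\<phi>. (\<forall>n. C_inf_S \<Omega> \<Sigma> (\<phi> n)) \<and>
       (\<lambda>n. l2norm \<Omega> (\<lambda>x. \<phi> n x - S x)) \<longlonglongrightarrow> 0 \<and>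
       (\<lambda>n. l2norm \<Omega> (\<lambda>x. cRot (\<phi> n) x - G x)) \<longlonglongrightarrow> 0))"

definition H_S_divDiv :: "R3 set \<Rightarrow> R3 set \<Rightarrow> (R3 \<Rightarrow> M3) \<Rightarrow> bool" where
  "H_S_divDiv \<Omega> \<Sigma> S \<longleftrightarrow> L2S \<Omega> S \<and> (\<exists>u. weak_divDiv \<Omega> S u \<and>
     (\<exists>\<phi>. (\<forall>n. C_inf_S \<Omega> \<Sigma> (\<phi> n)) \<and>
       (\<lambda>n. l2norm \<Omega> (\<lambda>x. \<phi> n x - S x)) \<longlonglongrightarrow> 0 \<and>
       (\<lambda>n. l2norm \<Omega> (\<lambda>x. cdivDiv (\<phi> n) x - u x)) \<longlonglongrightarrow> 0))"

definition H_T_Div :: "R3 set \<Rightarrow> R3 set \<Rightarrow> (R3 \<Rightarrow> M3) \<Rightarrow> bool" where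
  "H_T_Div \<Omega> \<Sigma> T \<longleftrightarrow> L2T \<Omega> T \<and> (\<exists>v. weak_Div \<Omega> T v \<and>
     (\<exists>\<phi>. (\<forall>n. C_inf_T \<Omega> \<Sigma> (\<phi> n)) \<and>
       (\<lambda>n. l2norm \<Omega> (\<lambda>x. \<phi> n x - T x)) \<longlonglongrightarrow> 0 \<and>
       (\<lambda>n. l2norm \<Omega> (\<lambda>x. cDiv (\<phi> n) x - v x)) \<longlonglongrightarrow> 0))"

definition H_T_symRot :: "R3 set \<Rightarrow> R3 set \<Rightarrow> (R3 \<Rightarrow> M3) \<Rightarrow> bool" where
  "H_T_symRot \<Omega> \<Sigma> T \<longleftrightarrow> L2T \<Omega> T \<and> (\<exists>G. weak_symRot \<Omega> T G \<and>
     (\<exists>\<phi>. (\<forall>n. C_inf_T \<Omega> \<Sigma> (\<phi> n)) \<and>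
       (\<lambda>n. l2norm \<Omega> (\<lambda>x. \<phi> n x - T x)) \<longlonglongrightarrow> 0 \<and>
       (\<lambda>n. l2norm \<Omega> (\<lambda>x. csymRot (\<phi> n) x - G x)) \<longlonglongrightarrow> 0))"

text \<open>A symmetric, positive, bounded linear bijection of the subspace V (= L2_S or L2_T) of L^2,
  acting on representatives and compatible with a.e. equality.\<close>
definition admissible_weight ::
  "R3 set \<Rightarrow> ((R3 \<Rightarrow> M3) \<Rightarrow> bool) \<Rightarrow> ((R3 \<Rightarrow> M3) \<Rightarrow> (R3 \<Rightarrow> M3)) \<Rightarrow> bool" where
  "admissible_weight \<Omega> V w \<longleftrightarrow>
     (\<forall>S. V S \<longrightarrow> V (w S)) \<and>
     (\<forall>S R. V S \<longrightarrow> V R \<longrightarrow> (AE x in lebesgue_on \<Omega>. S x = R x) \<longrightarrow>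
        (AE x in lebesgue_on \<Omega>. w S x = w R x)) \<and>
     (\<forall>S R a b. V S \<longrightarrow> V R \<longrightarrow>
        (AE x in lebesgue_on \<Omega>. w (\<lambda>y. a *\<^sub>R S y + b *\<^sub>R R y) x = a *\<^sub>R w S x + b *\<^sub>R w R x)) \<and>
     (\<exists>c. \<forall>S. V S \<longrightarrow> l2norm \<Omega> (w S) \<le> c * l2norm \<Omega> S) \<and>
     (\<forall>S R. V S \<longrightarrow> V R \<longrightarrow> l2inner \<Omega> (w S) R = l2inner \<Omega> S (w R)) \<and>
     (\<forall>S. V S \<longrightarrow> \<not> (AE x in lebesgue_on \<Omega>. S x = 0) \<longrightarrow> l2inner \<Omega> (w S) S > 0) \<and>
     (\<forall>S R. V S \<longrightarrow> V R \<longrightarrow> (AE x in lebesgue_on \<Omega>. w S x = w R x) \<longrightarrow>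
        (AE x in lebesgue_on \<Omega>. S x = R x)) \<and>
     (\<forall>R. V R \<longrightarrow> (\<exists>S. V S \<and> (AE x in lebesgue_on \<Omega>. w S x = R x)))"

definition wnorm :: "R3 set \<Rightarrow> ((R3 \<Rightarrow> M3) \<Rightarrow> (R3 \<Rightarrow> M3)) \<Rightarrow> (R3 \<Rightarrow> M3) \<Rightarrow> real" where
  "wnorm \<Omega> w S = sqrt (l2inner \<Omega> (w S) S)"

definition lipschitz_chart :: "R3 set \<Rightarrow> R3 \<Rightarrow> R3 set \<Rightarrow> (R3 \<Rightarrow> R3) \<Rightarrow> (real \<times> real \<Rightarrow> real) \<Rightarrow> bool" where
  "lipschitz_chart \<Omega> x U Q h \<longleftrightarrow> open U \<and> x \<in> U \<and> orthogonal_transformation Q \<and>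
     (\<exists>C. C-lipschitz_on UNIV h) \<and>
     \<Omega> \<inter> U = {y \<in> U. Q (y - x) $ 3 < h (Q (y - x) $ 1, Q (y - x) $ 2)}"

definition strong_lipschitz_domain :: "R3 set \<Rightarrow> bool" where
  "strong_lipschitz_domain \<Omega> \<longleftrightarrow> open \<Omega> \<and> connected \<Omega> \<and> \<Omega> \<noteq> {} \<and>
     (\<forall>x\<in>frontier \<Omega>. \<exists>U Q h. lipschitz_chart \<Omega> x U Q h)"

definition strong_lipschitz_boundary_part :: "R3 set \<Rightarrow> R3 set \<Rightarrow> bool" where
  "strong_lipschitz_boundary_part \<Omega> \<Gamma>t \<longleftrightarrow>
     \<Gamma>t \<subseteq> frontier \<Omega> \<and> openin (top_of_set (frontier \<Omega>)) \<Gamma>t \<and>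
     (\<forall>x\<in>frontier \<Omega>. \<exists>U Q h. lipschitz_chart \<Omega> x U Q h \<and>
        (\<Gamma>t \<inter> U = frontier \<Omega> \<inter> U \<or> \<Gamma>t \<inter> U = {} \<or>
         (\<exists>g::real \<Rightarrow> real. (\<exists>C. C-lipschitz_on UNIV g) \<and>
            \<Gamma>t \<inter> U = {y \<in> frontier \<Omega> \<inter> U. Q (y - x) $ 2 < g (Q (y - x) $ 1)})))"

end

theory Submission imports Defs "HOL-Complex_Analysis.Great_Picard" begin

text \<open>
  Integrating along a cone of directions gives, for the second order complex (Rot, divDiv) on symmetric fields and for
  (symRot, Div) on trace-free fields, explicit homotopy formulas that express a test field through its image under the
  adjoint differential operators; the operators in them gain a derivative or are of Calderon-Zygmund type. Near a
  boundary point the cone can be chosen so that the zero extension across the part with boundary condition is respected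
  and the remaining part is never crossed. By duality a weakly null sequence \<open>g\<close> is locally the sum of a strongly null
  \<open>Y\<close> and of the image of a strongly null potential \<open>u\<close>, both vanishing outside the domain near the first boundary
  part; the singular term is harmless because its argument has a uniform Hoelder modulus and tends to 0. Testing with
  the fields approximating the weighted sequence is an integration by parts without boundary terms, so the weighted
  energy of differences of a weakly convergent subsequence tends to 0 (a div-curl argument).
\<close>

section \<open>Smooth functions\<close>

text \<open>The weight is only a bounded operator on L2, neither local nor compatible with
  derivatives, so divDiv(\<epsilon> S) says nothing about derivatives of S; what survives is the
  pairing of S with \<epsilon> S. Hence the local analysis concerns the unweighted field alone, and
  the weighted one enters as a test field. One cone does not suffice. Directions along which the
  weak equation may be tested must stay in a region that contains the exterior across the first
  boundary part, and the potential they produce spreads into that exterior. Directions that preserve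
  the exterior repair this, at the price of a derivative of a ray operator, which is of order 0 and
  not compact. It only meets a remainder that has already passed through the first cone and so has a
  Hoelder modulus of order 1/4 in L2; interpolated with the vanishing norm, this beats the kernel
  singularity 1/t. Convergence is first shown for the images under the weight, because boundedness
  and positivity control these directly; surjectivity of the weight then supplies the limit
  field.\<close>

lemma smooth_differentiable: "smooth f ==> f differentiable (at x)"
  by (erule smooth.cases) auto

lemma smooth_pd: "smooth f ==> smooth (pd j f)"
  by (erule smooth.cases) auto

lemma pd_eq: "(f has_derivative f') (at x) ==> pd j f x = f' (axis j 1)"
  unfolding pd_def by (metis frechet_derivative_at)

text \<open>Finite stages of the coinductive \<open>smooth\<close>. The derivative of a product or a
  composition is a sum of such terms again, which suits induction on the order better than
  coinduction.\<close>

primrec ck :: "nat => (R3 => 'b::real_normed_vector) => bool" where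
  "ck 0 f = (\<forall>x. f differentiable (at x))"
| "ck (Suc n) f = ((\<forall>x. f differentiable (at x)) & (\<forall>j. ck n (pd j f)))"

lemma ck_differentiable: "ck n f ==> f differentiable (at x)"
  by (cases n) auto

lemma smooth_imp_ck: "smooth f ==> ck n f"
  by (induction n arbitrary: f) (auto simp: smooth_differentiable smooth_pd)

lemma ck_imp_smooth: "(!!n. ck n f) ==> smooth f"
proof (coinduction arbitrary: f)
  case smooth
  then have "ck n (pd j f)" for n j using spec[of _ "Suc n"] by (metis ck.simps(2))
  then show ?case using smooth by (auto simp: ck_differentiable)
qed

lemma smooth_iff_ck: "smooth f \<longleftrightarrow> (\<forall>n. ck n f)"
  using ck_imp_smooth smooth_imp_ck by blast

lemma ck_Suc_imp: "ck (Suc n) f ==> ck n f"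
  by (induction n arbitrary: f) auto

lemma has_derivative_frechet: "f differentiable (at x) ==> (f has_derivative frechet_derivative f (at x)) (at x)"
  by (simp add: frechet_derivative_works)

lemma pd_const: "pd j (%x. c) = (%x. 0)"
  by (rule ext, subst pd_eq[OF has_derivative_const]) auto

lemma pd_add:
  assumes "f differentiable (at x)" "g differentiable (at x)"
  shows "pd j (%x. f x + g x) x = pd j f x + pd j g x"
  by (subst pd_eq[OF has_derivative_add[OF assms[THEN has_derivative_frechet]]]) (simp add: pd_def)

lemma pd_bilinear:
  assumes "f differentiable (at x)" "g differentiable (at x)" "bounded_bilinear B"
  shows "pd j (%x. B (f x) (g x)) x = B (pd j f x) (g x) + B (f x) (pd j g x)"
  by (subst pd_eq[OF bounded_bilinear.FDERIV[OF assms(3) assms(1,2)[THEN has_derivative_frechet]]])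
     (simp add: pd_def add.commute)

lemma pd_linear:
  assumes "f differentiable (at x)" "bounded_linear L"
  shows "pd j (%x. L (f x)) x = L (pd j f x)"
  by (subst pd_eq[OF bounded_linear.has_derivative[OF assms(2) assms(1)[THEN has_derivative_frechet]]])
     (simp add: pd_def)

lemma ck_const: "ck n (%x. c)"
  by (induction n arbitrary: c) (auto simp: pd_const)

lemma ck_add: "ck n f ==> ck n g ==> ck n (%x. f x + g x)"
proof (induction n arbitrary: f g)
  case (Suc n)
  have "pd j (%x. f x + g x) = (%x. pd j f x + pd j g x)" for j
    using Suc.prems by (intro ext pd_add) auto
  then show ?case using Suc by (auto intro!: derivative_intros)
qed (auto intro!: derivative_intros)

lemma differentiable_bilinear:
  assumes "f differentiable (at x)" "g differentiable (at x)" "bounded_bilinear B"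
  shows "(%x. B (f x) (g x)) differentiable (at x)"
  using bounded_bilinear.FDERIV[OF assms(3) assms(1,2)[THEN has_derivative_frechet]]
  unfolding differentiable_def by blast

lemma differentiable_linear:
  assumes "f differentiable (at x)" "bounded_linear L"
  shows "(%x. L (f x)) differentiable (at x)"
  using bounded_linear.has_derivative[OF assms(2) assms(1)[THEN has_derivative_frechet]]
  unfolding differentiable_def by blast

lemma ck_bilinear:
  assumes B: "bounded_bilinear B"
  shows "ck n f ==> ck n g ==> ck n (%x. B (f x) (g x))"
proof (induction n arbitrary: f g)
  case (Suc n)
  have "pd j (%x. B (f x) (g x)) = (%x. B (pd j f x) (g x) + B (f x) (pd j g x))" for j
    using Suc.prems B by (intro ext pd_bilinear[OF _ _ B]) auto
  moreover have "ck n f" "ck n g" by (rule ck_Suc_imp[OF Suc.prems(1)], rule ck_Suc_imp[OF Suc.prems(2)])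
  moreover have "(%x. B (f x) (g x)) differentiable (at x)" for x
    using Suc.prems by (intro differentiable_bilinear[OF _ _ B]) auto
  moreover have "ck n (%x. B (pd j f x) (g x) + B (f x) (pd j g x))" for j
    using Suc.prems \<open>ck n f\<close> \<open>ck n g\<close> by (intro ck_add[of n "%x. B (pd j f x) (g x)"] Suc.IH) auto
  ultimately show ?case by simp
qed (auto intro: differentiable_bilinear[OF _ _ B])

lemma ck_linear:
  assumes B: "bounded_linear L"
  shows "ck n f ==> ck n (%x. L (f x))"
proof (induction n arbitrary: f)
  case (Suc n)
  have "pd j (%x. L (f x)) = (%x. L (pd j f x))" for j
    using Suc.prems B by (intro ext pd_linear[OF _ B]) auto
  moreover have "(%x. L (f x)) differentiable (at x)" for x
    using Suc.prems by (intro differentiable_linear[OF _ B]) auto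
  moreover have "ck n (%x. L (pd j f x))" for j
    using Suc.prems by (intro Suc.IH) auto
  ultimately show ?case by simp
qed (auto intro: differentiable_linear[OF _ B])

lemma smooth_const: "smooth (%x. c)" by (simp add: smooth_iff_ck ck_const)
lemma smooth_add: "smooth f ==> smooth g ==> smooth (%x. f x + g x)"
  by (simp add: smooth_iff_ck ck_add)
lemma smooth_bilinear: "bounded_bilinear B ==> smooth f ==> smooth g ==> smooth (%x. B (f x) (g x))"
  by (simp add: smooth_iff_ck ck_bilinear)
lemma smooth_linear: "bounded_linear B ==> smooth f ==> smooth (%x. B (f x))"
  by (simp add: smooth_iff_ck ck_linear)
lemmas smooth_mult = smooth_bilinear[OF bounded_bilinear_mult]
lemmas smooth_scaleR = smooth_bilinear[OF bounded_bilinear_scaleR]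
lemma smooth_uminus: "smooth f ==> smooth (%x. - f x)"
  by (rule smooth_linear[OF bounded_linear_minus[OF bounded_linear_ident]])
lemma smooth_diff: "smooth f ==> smooth g ==> smooth (%x. f x - g x)"
  using smooth_add[OF _ smooth_uminus, of f g] by simp
lemma smooth_sum: "(!!i. i \<in> A ==> smooth (f i)) ==> smooth (%x. \<Sum>i\<in>A. f i x)"
  by (induction A rule: infinite_finite_induct) (auto intro: smooth_add smooth_const)
lemma smooth_prod: "(!!i. i \<in> A ==> smooth (f i)) ==> smooth (%x. \<Prod>i\<in>A. f i x :: real)"
  by (induction A rule: infinite_finite_induct) (auto intro: smooth_mult smooth_const)

lemma pd_ident: "pd j (%x. x) = (%x. axis j 1)"
  by (rule ext, subst pd_eq[OF has_derivative_ident]) auto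

lemma smooth_ident: "smooth (%x. x)"
proof -
  have "ck n (%x::R3. x)" for n by (cases n) (auto simp: pd_ident ck_const)
  then show ?thesis by (simp add: smooth_iff_ck)
qed

lemma smooth_nth: "smooth f ==> smooth (%x. f x $ i)"
  by (rule smooth_linear[OF bounded_linear_vec_nth])

lemma smooth_coord: "smooth (%x. x $ i)"
  by (rule smooth_nth[OF smooth_ident])

lemma bounded_linear_axis: "bounded_linear (%x::'a::real_normed_vector. axis i x :: 'a^'n)"
proof (rule bounded_linear_intro[of _ 1])
  show "norm (axis i x :: 'a^'n) <= norm x * 1" for x
    by (simp add: norm_vec_def L2_set_def axis_def if_distrib[of norm] if_distrib[of "%x. x\<^sup>2"] cong: if_cong)
qed (auto simp: axis_def vec_eq_iff)

lemma vec_lambda_axis: "(\<chi> i. f i) = (\<Sum>i\<in>UNIV. axis i (f i))"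
  by (simp add: vec_eq_iff axis_def if_distrib[of "%v. v $ _"] sum.delta' cong: if_cong)

lemma smooth_vec:
  assumes "!!i. smooth (%x. f x i)"
  shows "smooth (%x. \<chi> i::'n::finite. f x i)"
  unfolding vec_lambda_axis
  by (intro smooth_sum smooth_linear[OF bounded_linear_axis] assms)

lemma ck_inverse:
  fixes f :: "R3 => real"
  assumes nz: "!!x. f x ~= 0"
  shows "ck n f ==> ck n (%x. inverse (f x))"
proof (induction n)
  case (Suc n)
  have d: "!!x. f differentiable at x" using Suc.prems by simp
  have D: "((%x. inverse (f x)) has_derivative
       (%h. - (inverse (f x) * frechet_derivative f (at x) h * inverse (f x)))) (at x)" for x
    by (rule Deriv.has_derivative_inverse[OF nz has_derivative_frechet[OF d]])
  have "pd j (%x. inverse (f x)) = (%x. - (inverse (f x) * pd j f x * inverse (f x)))" for j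
    by (rule ext, subst pd_eq[OF D]) (simp add: pd_def)
  moreover have "ck n f" by (rule ck_Suc_imp[OF Suc.prems])
  moreover have "ck n (%x. - (inverse (f x) * pd j f x * inverse (f x)))" for j
    using Suc \<open>ck n f\<close>
    by (intro ck_linear[OF bounded_linear_minus[OF bounded_linear_ident]] ck_bilinear[OF bounded_bilinear_mult]) auto
  moreover have "(%x. inverse (f x)) differentiable (at x)" for x
    using D[of x] unfolding differentiable_def by blast
  ultimately show ?case by simp
qed (simp add: nz)

lemma smooth_inverse: "(!!x. f x ~= (0::real)) ==> smooth f ==> smooth (%x. inverse (f x))"
  by (simp add: smooth_iff_ck ck_inverse)

text \<open>The outer function comes with the whole sequence of its derivatives; \<open>m\<close> is
  generalised because the chain rule passes from \<open>d m\<close> to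
  \<open>d (Suc m)\<close>.\<close>

lemma ck_compose:
  fixes d :: "nat => real => real"
  assumes d: "!!n x. (d n has_real_derivative d (Suc n) x) (at x)"
  shows "ck n f ==> ck n (%x. d m (f x))"
proof (induction n arbitrary: m)
  case 0
  have "((%x. d m (f x)) has_derivative (%h. frechet_derivative f (at x) h * d (Suc m) (f x))) (at x)" for x
    using has_derivative_compose[OF has_derivative_frechet[OF ck_differentiable[OF 0]] d[of m "f x", unfolded has_field_derivative_def]]
    by (simp add: mult.commute)
  then show ?case by (auto simp: differentiable_def)
next
  case (Suc n)
  have D: "((%x. d m (f x)) has_derivative (%h. frechet_derivative f (at x) h * d (Suc m) (f x))) (at x)" for x m
    using has_derivative_compose[OF has_derivative_frechet[OF ck_differentiable[OF Suc.prems]] d[of m "f x", unfolded has_field_derivative_def]]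
    by (simp add: mult.commute)
  have "pd j (%x. d m (f x)) = (%x. pd j f x * d (Suc m) (f x))" for j
    by (rule ext, subst pd_eq[OF D]) (simp add: pd_def)
  moreover have "ck n f" by (rule ck_Suc_imp[OF Suc.prems])
  moreover have "ck n (%x. pd j f x * d (Suc m) (f x))" for j
    using Suc \<open>ck n f\<close> by (intro ck_bilinear[OF bounded_bilinear_mult]) auto
  moreover have "(%x. d m (f x)) differentiable (at x)" for x
    using D[of m x] unfolding differentiable_def by blast
  ultimately show ?case by simp
qed

text \<open>The functions $p(1/x) e^{-1/x}$ (extended by $0$ to $x \le 0$) are closed under differentiation.\<close>

definition flat :: "real poly => real => real" where
  "flat p x = (if x > 0 then poly p (inverse x) * exp (- inverse x) else 0)"

lemma poly_exp_tendsto_0: "((%y::real. poly p y * exp (- y)) \<longlongrightarrow> 0) at_top"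
proof -
  have "((%y::real. \<Sum>i\<le>degree p. coeff p i * (y ^ i / exp y)) \<longlongrightarrow> (\<Sum>i\<le>degree p. coeff p i * 0)) at_top"
    by (intro tendsto_intros tendsto_power_div_exp_0)
  then show ?thesis
    by (simp add: poly_altdef sum_distrib_right exp_minus divide_inverse mult.assoc)
qed

text \<open>With y = 1/x, the derivative of p(y) exp(-y) in x is y^2 (p - p')(y) exp(-y), which
  explains the factor \<open>[:0,0,1:]\<close>. At 0 from the right the difference quotient is y
  p(y) exp(-y) and tends to 0.\<close>

lemma flat_derivative:
  "(flat p has_real_derivative flat ([:0,0,1:] * (p - pderiv p)) x) (at x)"
proof -
  consider "x > 0" | "x < 0" | "x = 0" by linarith
  then show ?thesis
  proof cases
    case 1
    have "((%x. poly p (inverse x) * exp (- inverse x)) has_real_derivative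
        flat ([:0,0,1:] * (p - pderiv p)) x) (at x)"
      using 1 by (auto intro!: derivative_eq_intros simp: flat_def field_simps power2_eq_square)
    then show ?thesis
      by (rule has_field_derivative_transform_within_open[of _ _ _ "{0<..}"]) (use 1 in \<open>auto simp: flat_def\<close>)
  next
    case 2
    have "((%x. 0) has_real_derivative flat ([:0,0,1:] * (p - pderiv p)) x) (at x)"
      using 2 by (auto simp: flat_def)
    then show ?thesis
      by (rule has_field_derivative_transform_within_open[of _ _ _ "{..<0}"]) (use 2 in \<open>auto simp: flat_def\<close>)
  next
    case 3
    have "((%h. flat p h / h) \<longlongrightarrow> 0) (at_right 0)"
    proof -
      have "((%h. poly (pCons 0 p) (inverse h) * exp (- inverse h)) \<longlongrightarrow> 0) (at_right (0::real))"
        by (rule filterlim_compose[OF poly_exp_tendsto_0 filterlim_inverse_at_top_right])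
      moreover have "eventually (%h. poly (pCons 0 p) (inverse h) * exp (- inverse h) = flat p h / h) (at_right (0::real))"
        by (auto simp: eventually_at_right_less flat_def field_simps eventually_at_filter)
      ultimately show ?thesis by (rule Lim_transform_eventually)
    qed
    moreover have "((%h. flat p h / h) \<longlongrightarrow> 0) (at_left 0)"
    proof (rule Lim_transform_eventually[OF tendsto_const])
      show "\<forall>\<^sub>F h in at_left 0. 0 = flat p h / h"
        by (auto simp: flat_def eventually_at_filter)
    qed
    ultimately have "((%h. flat p h / h) \<longlongrightarrow> 0) (at 0)"
      by (simp add: filterlim_split_at)
    then show ?thesis using 3 by (simp add: DERIV_def flat_def)
  qed
qed

lemma smooth_flat: "smooth f ==> smooth (%x. flat p (f x))"
proof -
  assume f: "smooth f"
  define d where "d n = flat (((%p. [:0,0,1:] * (p - pderiv p)) ^^ n) p)" for n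
  have "(d n has_real_derivative d (Suc n) x) (at x)" for n x
    using flat_derivative unfolding d_def by simp
  then have "ck n (%x. d 0 (f x))" for n
    using f by (intro ck_compose[of d n f 0]) (auto simp: smooth_iff_ck)
  then show ?thesis by (simp add: smooth_iff_ck d_def)
qed

text \<open>The quotient u / (u + v) of two flat functions: u is positive exactly on the larger
  ball, v exactly off the smaller closed ball, and r1 < r2 makes these two sets cover the
  space.\<close>

lemma smooth_bump:
  fixes a :: R3
  assumes r: "0 < r1" "r1 < r2"
  obtains f :: "R3 => real" where "smooth f" "!!x. x \<in> cball a r1 ==> f x = 1" "!!x. x \<notin> ball a r2 ==> f x = 0"
    "!!x. 0 <= f x" "!!x. f x <= 1" "!!x. x \<in> ball a r2 ==> f x > 0"
proof -
  define u where "u x = flat 1 (r2\<^sup>2 - (x - a) \<bullet> (x - a))" for x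
  define v where "v x = flat 1 ((x - a) \<bullet> (x - a) - r1\<^sup>2)" for x
  have lin: "smooth (%x::R3. (x - a) \<bullet> (x - a))"
    by (rule smooth_bilinear[OF bounded_bilinear_inner smooth_diff[OF smooth_ident smooth_const] smooth_diff[OF smooth_ident smooth_const]])
  have sm: "smooth u" "smooth v"
    unfolding u_def[abs_def] v_def[abs_def] by (rule smooth_flat[OF smooth_diff[OF smooth_const lin]], rule smooth_flat[OF smooth_diff[OF lin smooth_const]])
  have nn: "u x >= 0" "v x >= 0" for x by (auto simp: u_def v_def flat_def)
  have dd: "(x - a) \<bullet> (x - a) = (dist a x)\<^sup>2" for x
    by (simp add: dist_norm norm_minus_commute[of a x] power2_norm_eq_inner)
  have q: "(dist a x)\<^sup>2 < r2\<^sup>2 \<longleftrightarrow> dist a x < r2" "(dist a x)\<^sup>2 <= r1\<^sup>2 \<longleftrightarrow> dist a x <= r1" for x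
    using r power_mono_iff[of r2 "dist a x" 2] power_mono_iff[of "dist a x" r1 2] by (auto simp: not_le[symmetric])
  have u0: "u x = 0 \<longleftrightarrow> x \<notin> ball a r2" for x
    by (simp add: u_def flat_def dd q)
  have v0: "v x = 0 \<longleftrightarrow> x \<in> cball a r1" for x
    by (simp add: v_def flat_def dd q flip: not_le)
  have ne: "u x + v x ~= 0" for x
    using nn[of x] u0[of x] v0[of x] r by (auto simp: add_nonneg_eq_0_iff)
  show ?thesis
  proof (rule that[of "%x. u x * inverse (u x + v x)"])
    show "smooth (%x. u x * inverse (u x + v x))"
      by (rule smooth_mult[OF sm(1) smooth_inverse[OF ne smooth_add[OF sm]]])
    show "u x * inverse (u x + v x) = 1" if "x \<in> cball a r1" for x
      using v0[of x] that ne[of x] by simp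
    show "u x * inverse (u x + v x) = 0" if "x \<notin> ball a r2" for x
      using u0[of x] that by simp
    show "0 <= u x * inverse (u x + v x)" "u x * inverse (u x + v x) <= 1" for x
      using nn[of x] by (auto simp: divide_inverse[symmetric] divide_le_eq)
    show "0 < u x * inverse (u x + v x)" if "x \<in> ball a r2" for x
      using nn[of x] u0[of x] that ne[of x] by (auto simp: less_le)
  qed
qed

section \<open>Compactly supported smooth functions on the whole space\<close>

definition tf :: "(R3 => 'b::real_normed_vector) => bool" where
  "tf f \<longleftrightarrow> smooth f & compact (tsupp f)"

lemma closed_tsupp: "closed (tsupp f)" by (simp add: tsupp_def)

lemma tsuppD: "x \<notin> tsupp f ==> f x = 0"
  using closure_subset[of "{x. f x ~= 0}"] by (auto simp: tsupp_def)

lemma tsupp_subset: "closed K ==> (!!x. x \<notin> K ==> f x = 0) ==> tsupp f \<subseteq> K"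
  unfolding tsupp_def by (rule closure_minimal) auto

lemma tfI: "smooth f ==> compact K ==> (!!x. x \<notin> K ==> f x = 0) ==> tf f"
  unfolding tf_def using tsupp_subset[OF compact_imp_closed]
  by (metis closed_tsupp compact_Int_closed inf.absorb_iff2)

lemma tf_smooth: "tf f ==> smooth f" by (simp add: tf_def)
lemma tf_compact: "tf f ==> compact (tsupp f)" by (simp add: tf_def)
lemma test_fun_iff: "test_fun \<Omega> f \<longleftrightarrow> tf f & tsupp f \<subseteq> \<Omega>"
  by (auto simp: test_fun_def tf_def)

lemma pd_local:
  assumes "open U" "x \<in> U" "!!y. y \<in> U ==> f y = g y"
  shows "pd j f x = pd j g x"
proof -
  have "(f has_derivative D) (at x) \<longleftrightarrow> (g has_derivative D) (at x)" for D
    using has_derivative_transform_within_open[of f D x UNIV U g]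
      has_derivative_transform_within_open[of g D x UNIV U f] assms by fastforce
  then show ?thesis by (simp add: pd_def frechet_derivative_def)
qed

lemma tsupp_pd: "tsupp (pd j f) \<subseteq> tsupp f"
proof (rule tsupp_subset[OF closed_tsupp])
  fix x assume "x \<notin> tsupp f"
  then have "pd j f x = pd j (%x. 0) x"
    by (intro pd_local[of "- tsupp f"]) (auto simp: closed_tsupp open_Compl tsuppD)
  then show "pd j f x = 0" by (simp add: pd_const)
qed

lemma compact_tsupp_subset: "tsupp f \<subseteq> K ==> compact K ==> compact (tsupp f)"
  by (metis closed_tsupp compact_Int_closed inf.absorb_iff2)

lemma tf_pd: "tf f ==> tf (pd j f)"
  using compact_tsupp_subset[OF tsupp_pd] by (auto simp: tf_def smooth_pd)

lemma tf_linear: "bounded_linear L ==> tf f ==> tf (%x. L (f x))"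
  by (rule tfI[of _ "tsupp f"])
     (auto simp: tf_def smooth_linear linear_simps tsuppD dest: bounded_linear.linear linear_0)

lemma tf_add: "tf f ==> tf g ==> tf (%x. f x + g x)"
  by (rule tfI[of _ "tsupp f \<union> tsupp g"]) (auto simp: tf_def smooth_add tsuppD compact_Un)

lemma tf_zero: "tf (%x. 0)" by (rule tfI[of _ "{}"]) (auto simp: smooth_const)

lemma tf_uminus: "tf f ==> tf (%x. - f x)"
  by (rule tf_linear[OF bounded_linear_minus[OF bounded_linear_ident]])

lemma tf_diff: "tf f ==> tf g ==> tf (%x. f x - g x)"
  using tf_add[OF _ tf_uminus, of f g] by simp

lemma tf_sum: "(!!i. i \<in> A ==> tf (f i)) ==> tf (%x. \<Sum>i\<in>A. f i x)"
  by (induction A rule: infinite_finite_induct) (auto intro: tf_add tf_zero)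

lemma tf_bilinear1:
  assumes B: "bounded_bilinear B" and f: "tf f" and g: "smooth g"
  shows "tf (%x. B (f x) (g x))"
  by (rule tfI[of _ "tsupp f"])
     (use f in \<open>auto simp: tf_def smooth_bilinear[OF B _ g] tsuppD bounded_bilinear.zero_left[OF B]\<close>)

lemma tf_bilinear2:
  assumes B: "bounded_bilinear B" and f: "smooth f" and g: "tf g"
  shows "tf (%x. B (f x) (g x))"
  by (rule tfI[of _ "tsupp g"])
     (use g in \<open>auto simp: tf_def smooth_bilinear[OF B f] tsuppD bounded_bilinear.zero_right[OF B]\<close>)

lemmas tf_mult1 = tf_bilinear1[OF bounded_bilinear_mult]
lemmas tf_mult2 = tf_bilinear2[OF bounded_bilinear_mult]
lemmas tf_scaleR1 = tf_bilinear1[OF bounded_bilinear_scaleR]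
lemmas tf_scaleR2 = tf_bilinear2[OF bounded_bilinear_scaleR]

lemma tf_nth: "tf f ==> tf (%x. f x $ i)"
  by (rule tf_linear[OF bounded_linear_vec_nth])

lemma tf_vec: "(!!i. tf (%x. f x i)) ==> tf (%x. \<chi> i::'n::finite. f x i)"
  unfolding vec_lambda_axis by (intro tf_sum tf_linear[OF bounded_linear_axis]) auto

lemma smooth_continuous: "smooth f ==> continuous_on S f"
  by (meson continuous_at_imp_continuous_on differentiable_imp_continuous_within smooth_differentiable)

lemma tf_continuous: "tf f ==> continuous_on S f"
  by (simp add: smooth_continuous tf_def)

lemma smooth_borel: "smooth f ==> (f::R3 => 'b::euclidean_space) \<in> borel_measurable borel"
  by (simp add: borel_measurable_continuous_onI smooth_continuous)

lemma tf_bounded: assumes "tf f" obtains B where "B > 0" "!!x. norm (f x) <= B"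
proof -
  have "bounded (f ` tsupp f)"
    using assms by (intro compact_imp_bounded compact_continuous_image) (auto simp: tf_continuous tf_compact)
  then obtain B where B: "B > 0" "!!x. x \<in> tsupp f ==> norm (f x) <= B"
    by (auto simp: bounded_pos)
  show ?thesis
  proof (rule that[OF B(1)])
    show "norm (f x) <= B" for x using B(1) B(2)[of x] tsuppD[of x f] by (cases "x \<in> tsupp f") auto
  qed
qed

lemma tf_support: assumes "tf f" obtains r where "r > 0" "!!x. x \<notin> cball 0 r ==> f x = 0"
proof -
  obtain r where "r > 0" "tsupp f \<subseteq> cball 0 r"
    using compact_imp_bounded[OF tf_compact[OF assms]] by (auto simp: bounded_pos subset_eq)
  then show ?thesis by (intro that) (auto intro!: tsuppD)
qed

lemma frechet_pd_sum:
  assumes "f differentiable (at x)"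
  shows "frechet_derivative f (at x) h = (\<Sum>j\<in>UNIV. h $ j *\<^sub>R pd j f x)"
proof -
  have l: "linear (frechet_derivative f (at x))"
    using assms by (rule linear_frechet_derivative)
  have "h = (\<Sum>j\<in>UNIV. h $ j *\<^sub>R axis j 1)"
    by (simp add: vec_eq_iff axis_def if_distrib sum.delta' cong: if_cong)
  then have "frechet_derivative f (at x) h = frechet_derivative f (at x) (\<Sum>j\<in>UNIV. h $ j *\<^sub>R axis j 1)"
    by simp
  then show ?thesis
    by (simp add: linear_sum[OF l] linear_scale[OF l] pd_def)
qed

lemma smooth_has_derivative:
  "smooth f ==> (f has_derivative (%h. \<Sum>j\<in>UNIV. h $ j *\<^sub>R pd j f x)) (at x)"
  by (metis (no_types, lifting) ext frechet_pd_sum has_derivative_frechet smooth_differentiable)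

lemma norm_sum_components_le:
  assumes "!!j. norm (c j) <= (C::real)"
  shows "norm (\<Sum>j\<in>UNIV. (h::R3) $ j *\<^sub>R c j) <= 3 * C * norm h"
proof -
  have "norm (\<Sum>j\<in>UNIV. h $ j *\<^sub>R c j) <= (\<Sum>j\<in>(UNIV::3 set). norm h * C)"
    using assms by (intro sum_norm_le) (auto intro!: mult_mono component_le_norm_cart)
  then show ?thesis by (simp add: mult_ac)
qed

lemma tf_lipschitz: assumes "tf f" obtains C where "C > 0" "!!x y. norm (f x - f y) <= C * norm (x - y)"
proof -
  have "\<exists>B>0. \<forall>x. norm (pd j f x) <= B" for j using tf_bounded[OF tf_pd[OF assms]] by metis
  then obtain B where B: "!!j. B j > 0" "!!j x. norm (pd j f x) <= B j" by metis
  define C where "C = (\<Sum>j\<in>UNIV. B j)"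
  have C: "C > 0" "norm (pd j f x) <= C" for j x
  proof -
    show "C > 0" using B(1) by (auto simp: C_def intro!: sum_pos)
    have "B j <= C" unfolding C_def using B(1) by (intro member_le_sum) (auto intro: less_imp_le)
    then show "norm (pd j f x) <= C" using B(2)[of j x] by linarith
  qed
  show ?thesis
  proof (rule that[of "3 * C"])
    show "norm (f x - f y) <= 3 * C * norm (x - y)" for x y
    proof (rule differentiable_bound[of UNIV f "%x h. \<Sum>j\<in>UNIV. h $ j *\<^sub>R pd j f x"])
      show "onorm (%h. \<Sum>j\<in>UNIV. h $ j *\<^sub>R pd j f x) <= 3 * C" for x
        by (rule onorm_le) (rule norm_sum_components_le[OF C(2)])
    qed (use smooth_has_derivative[OF tf_smooth[OF assms]] in auto)
  qed (use C in auto)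
qed

lemma tf_taylor: assumes "tf f"
  obtains C where "C > 0" "!!(x::R3) (h::R3). norm (f (x + h) - f x - (\<Sum>j\<in>UNIV. h $ j *\<^sub>R pd j f x)) <= C * (norm h)\<^sup>2"
proof -
  have "\<exists>B>0. \<forall>x y. norm (pd j f x - pd j f y) <= B * norm (x - y)" for j
    using tf_lipschitz[OF tf_pd[OF assms]] by metis
  then obtain B where B: "!!j. B j > 0" "!!j x y. norm (pd j f x - pd j f y) <= B j * norm (x - y)" by metis
  define C where "C = (\<Sum>j\<in>UNIV. B j)"
  have C: "C > 0" "norm (pd j f x - pd j f y) <= C * norm (x - y)" for j x y
  proof -
    show "C > 0" using B(1) by (auto simp: C_def intro!: sum_pos)
    have "B j <= C" unfolding C_def using B(1) by (intro member_le_sum) (auto intro: less_imp_le)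
    then show "norm (pd j f x - pd j f y) <= C * norm (x - y)"
      using B(2)[of j x y] by (meson mult_right_mono norm_ge_zero order_trans)
  qed
  show ?thesis
  proof (rule that[of "3 * C"])
    fix x h :: R3
    \<comment> \<open>Mean value inequality for f minus its linearisation at x: on the ball of
      radius |h| its derivative is an increment of the gradient, hence at most a multiple of
      |h|.\<close>
    define g where "g y = f y - (\<Sum>j\<in>UNIV. (y - x) $ j *\<^sub>R pd j f x)" for y
    have D: "(g has_derivative (%k. \<Sum>j\<in>UNIV. k $ j *\<^sub>R (pd j f y - pd j f x))) (at y within cball x (norm h))" for y
    proof -
      have l: "bounded_linear (%k::R3. \<Sum>j\<in>UNIV. k $ j *\<^sub>R pd j f x)"
        by (intro bounded_linear_sum bounded_linear_scaleR_const bounded_linear_vec_nth)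
      have "(g has_derivative (%k. (\<Sum>j\<in>UNIV. k $ j *\<^sub>R pd j f y) - (\<Sum>j\<in>UNIV. (k - 0) $ j *\<^sub>R pd j f x))) (at y)"
        unfolding g_def
        by (intro has_derivative_diff smooth_has_derivative tf_smooth assms bounded_linear.has_derivative[OF l]
           has_derivative_ident has_derivative_const)
      then show ?thesis
        by (auto simp: scaleR_diff_right sum_subtractf intro: has_derivative_at_withinI)
    qed
    have "norm (g (x + h) - g x) <= 3 * (C * norm h) * norm (x + h - x)"
    proof (rule differentiable_bound[OF _ D])
      show "onorm (%k. \<Sum>j\<in>UNIV. k $ j *\<^sub>R (pd j f y - pd j f x)) <= 3 * (C * norm h)" if "y \<in> cball x (norm h)" for y
      proof (rule onorm_le, rule norm_sum_components_le)
        have "C * norm (y - x) <= C * norm h"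
          using that C(1) by (simp add: dist_norm norm_minus_commute)
        then show "norm (pd j f y - pd j f x) <= C * norm h" for j
          using C(2)[of j y x] by linarith
      qed
    qed (auto simp: dist_norm)
    then show "norm (f (x + h) - f x - (\<Sum>j\<in>UNIV. h $ j *\<^sub>R pd j f x)) <= 3 * C * (norm h)\<^sup>2"
      by (simp add: g_def power2_eq_square mult_ac algebra_simps)
  qed (use C in auto)
qed

section \<open>Integrals of derivatives and symmetry of second derivatives\<close>

lemma tf_integrable:
  fixes f :: "R3 => 'b::euclidean_space" assumes "tf f" shows "integrable lborel f"
proof -
  have "integrable lborel (%x. indicator (tsupp f) x *\<^sub>R f x)"
    by (rule borel_integrable_compact) (auto simp: tf_compact tf_continuous assms)
  also have "(%x. indicator (tsupp f) x *\<^sub>R f x) = f"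
    by (auto simp: indicator_def tsuppD)
  finally show ?thesis .
qed

lemma integral_shift:
  fixes f :: "'a::euclidean_space => 'b::euclidean_space"
  assumes [measurable]: "f \<in> borel_measurable borel"
  shows "(\<integral>x. f (x + a) \<partial>lborel) = (\<integral>x. f x \<partial>lborel)"
  by (subst (2) lborel_distr_plus[of a, symmetric]) (simp add: integral_distr add.commute)

lemma norm_integral_le_measure:
  fixes f :: "'a => 'b::{banach, second_countable_topology}"
  assumes "S \<in> sets M" "emeasure M S < \<infinity>" and b: "!!x. norm (f x) <= B * indicator S x"
  shows "norm (integral\<^sup>L M f) <= B * measure M S"
proof (cases "integrable M f")
  case True
  have "norm (integral\<^sup>L M f) <= (\<integral>x. norm (f x) \<partial>M)" by (rule integral_norm_bound)
  also have "\<dots> <= (\<integral>x. B * indicator S x \<partial>M)"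
    using assms True by (intro integral_mono) auto
  finally show ?thesis using assms by simp
next
  case False
  have "\<exists>x. 0 <= B * indicator S x & True" by (meson b norm_ge_zero order_trans)
  have "0 <= B * measure M S"
  proof (cases "S = {}")
    case False
    then obtain x where "x \<in> S" by auto
    then have "0 <= B" using order_trans[OF norm_ge_zero b[of x]] by simp
    then show ?thesis by simp
  qed simp
  then show ?thesis using False by (simp add: not_integrable_integral_eq)
qed

lemma le_small_imp_le_0:
  fixes a K :: real assumes "!!s. 0 < s ==> s <= 1 ==> a <= K * s"
  shows "a <= 0"
proof (rule ccontr)
  assume "\<not> a <= 0"
  define s where "s = min 1 (a / (2 * (\<bar>K\<bar> + 1)))"
  have s: "0 < s" "s <= 1" "s <= a / (2 * (\<bar>K\<bar> + 1))" using \<open>\<not> a <= 0\<close> by (auto simp: s_def)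
  have "a <= K * s" using assms s by auto
  also have "\<dots> <= (\<bar>K\<bar> + 1) * s" using s(1) by (intro mult_right_mono) auto
  also have "\<dots> <= (\<bar>K\<bar> + 1) * (a / (2 * (\<bar>K\<bar> + 1)))" using s(3) by (intro mult_left_mono) auto
  also have "\<dots> = a / 2" by (simp add: field_simps add_eq_0_iff abs_minus_commute)
  finally show False using \<open>\<not> a <= 0\<close> by simp
qed

lemma pd_taylor:
  assumes "tf f"
  obtains C where "C > 0" "!!(x::R3) s. norm (f (x + s *\<^sub>R axis j 1) - f x - s *\<^sub>R pd j f x) <= C * s\<^sup>2"
proof -
  obtain C where C: "C > 0" "!!(x::R3) (h::R3). norm (f (x + h) - f x - (\<Sum>j\<in>UNIV. h $ j *\<^sub>R pd j f x)) <= C * (norm h)\<^sup>2"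
    using tf_taylor[OF assms] by blast
  have "(\<Sum>i\<in>UNIV. (s *\<^sub>R axis j 1 :: R3) $ i *\<^sub>R pd i f x) = s *\<^sub>R pd j f x" for s x
  proof -
    have "(\<Sum>i\<in>UNIV. (s *\<^sub>R axis j 1 :: R3) $ i *\<^sub>R pd i f x) = (\<Sum>i\<in>UNIV. if i = j then s *\<^sub>R pd i f x else 0)"
      by (intro sum.cong) (auto simp: axis_def)
    then show ?thesis by simp
  qed
  then show ?thesis using C(2)[of _ "_ *\<^sub>R axis j 1"] by (intro that[OF C(1)]) (simp add: norm_axis_1)
qed

lemma emeasure_cball_less_top [simp]: fixes a :: R3 shows "emeasure lborel (cball a r) < top"
  using emeasure_bounded_finite[of "cball a r"] by (simp add: less_top)

text \<open>By translation invariance the integral of f(x + s e) - f(x) is 0, while this increment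
  differs from s times the derivative by at most C s^2 on a fixed ball. Dividing by s bounds the
  integral of the derivative by a multiple of s.\<close>

lemma integral_pd_zero:
  fixes f :: "R3 => 'b::euclidean_space" assumes f: "tf f"
  shows "(\<integral>x. pd j f x \<partial>lborel) = 0"
proof -
  let ?e = "axis j 1 :: R3"
  obtain C where C: "C > 0" "!!(x::R3) s. norm (f (x + s *\<^sub>R ?e) - f x - s *\<^sub>R pd j f x) <= C * s\<^sup>2"
    using pd_taylor[OF f] by blast
  obtain r where r: "r > 0" "!!x. x \<notin> cball 0 r ==> f x = 0" using tf_support[OF f] by blast
  obtain r' where r': "r' > 0" "!!x. x \<notin> cball 0 r' ==> pd j f x = 0" using tf_support[OF tf_pd[OF f]] by blast
  \<comment> \<open>The radius covers the supports of f, of its derivative and, for s at most 1, of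
    the shifted f.\<close>
  define V where "V = measure lborel (cball (0::R3) (r + r' + 1))"
  note [measurable] = smooth_borel[OF tf_smooth[OF f]]
  have int: "integrable lborel f" "integrable lborel (pd j f)"
    by (auto intro: tf_integrable f tf_pd)
  have "norm (\<integral>x. pd j f x \<partial>lborel) <= 0"
  proof (rule le_small_imp_le_0[of _ "C * V"])
    fix s :: real assume s: "0 < s" "s <= 1"
    have "norm (\<integral>x. f (x + s *\<^sub>R ?e) - f x - s *\<^sub>R pd j f x \<partial>lborel) <= C * s\<^sup>2 * V"
      unfolding V_def
    proof (rule norm_integral_le_measure)
      fix x
      show "norm (f (x + s *\<^sub>R ?e) - f x - s *\<^sub>R pd j f x) <= C * s\<^sup>2 * indicator (cball 0 (r + r' + 1)) x"
      proof (cases "x \<in> cball 0 (r + r' + 1)")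
        case False
        then have "norm x > r + r' + 1" by auto
        moreover have "norm x <= norm (x + s *\<^sub>R ?e) + norm (s *\<^sub>R ?e)"
          using norm_triangle_ineq4[of "x + s *\<^sub>R ?e" "s *\<^sub>R ?e"] by simp
        moreover have "norm (s *\<^sub>R ?e) <= 1" using s by (simp add: norm_axis_1)
        ultimately have "norm (x + s *\<^sub>R ?e) > r" "norm x > r" "norm x > r'" using r r' by linarith+
        then show ?thesis using r(2) r'(2) False by simp
      qed (use C in simp)
    qed auto
    also have "(\<integral>x. f (x + s *\<^sub>R ?e) - f x - s *\<^sub>R pd j f x \<partial>lborel) = - s *\<^sub>R (\<integral>x. pd j f x \<partial>lborel)"
    proof -
      have "integrable lborel (%x. f (x + s *\<^sub>R ?e))"
        by (rule integrable_distr[of "%x. x + s *\<^sub>R ?e" lborel borel])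
           (simp_all add: add.commute[of _ "s *\<^sub>R ?e"] lborel_distr_plus int)
      then show ?thesis using int by (simp add: integral_shift)
    qed
    finally have "s * norm (\<integral>x. pd j f x \<partial>lborel) <= s * (C * V * s)"
      using s by (simp add: power2_eq_square mult_ac)
    then show "norm (\<integral>x. pd j f x \<partial>lborel) <= C * V * s" using s by simp
  qed
  then show ?thesis by simp
qed

lemma pd_cmult: "smooth f ==> pd j (%x. c * f x :: real) x = c * pd j f x"
  by (rule pd_linear[OF smooth_differentiable bounded_linear_mult_right])

lemma pd_uminus: "smooth f ==> pd j (%x. - f x) x = - pd j f x"
  by (rule pd_linear[OF smooth_differentiable bounded_linear_minus[OF bounded_linear_ident]])

lemma pd_diff: "smooth f ==> smooth g ==> pd j (%x. f x - g x) x = pd j f x - pd j g x"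
  using pd_add[of f x "%x. - g x" j] by (simp add: smooth_differentiable smooth_uminus pd_uminus)

lemma pd_mult: "smooth f ==> smooth g ==> pd j (%x. f x * g x :: real) = (%x. pd j f x * g x + f x * pd j g x)"
  by (intro ext pd_bilinear smooth_differentiable bounded_bilinear_mult)

lemma integration_by_parts:
  fixes f g :: "R3 => real" assumes f: "tf f" and g: "smooth g"
  shows "(\<integral>x. pd j f x * g x \<partial>lborel) = - (\<integral>x. f x * pd j g x \<partial>lborel)"
proof -
  have "(\<integral>x. pd j f x * g x + f x * pd j g x \<partial>lborel) = 0"
    using integral_pd_zero[OF tf_mult1[OF f g], of j] pd_mult[OF tf_smooth[OF f] g] by simp
  moreover have "integrable lborel (%x. pd j f x * g x)" "integrable lborel (%x. f x * pd j g x)"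
    by (intro tf_integrable tf_mult1 f g tf_pd smooth_pd)+
  ultimately show ?thesis by simp
qed

lemma ck_shift: "ck n f ==> ck n (%x. f (x + a))"
  and pd_shift: "(!!x. (f :: R3 => 'b::real_normed_vector) differentiable (at x)) ==> pd j (%x. f (x + a)) = (%x. pd j f (x + a))"
proof -
  have D: "((%x. f (x + a)) has_derivative (%h. frechet_derivative f (at (x + a)) h)) (at x)"
    if "!!x. f differentiable (at x)" for f :: "R3 => 'b" and x
  proof (rule has_derivative_compose[of "%x. x + a" "%h. h" x UNIV f, OF _ has_derivative_frechet[OF that]])
    show "((%x. x + a) has_derivative (%h. h)) (at x)"
      by (auto intro!: derivative_eq_intros)
  qed
  show pd: "pd j (%x. f (x + a)) = (%x. pd j f (x + a))" if "!!x. f differentiable (at x)" for f :: "R3 => 'b" and j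
    by (rule ext, subst pd_eq[OF D[OF that]]) (simp add: pd_def)
  show "ck n f ==> ck n (%x. f (x + a))"
  proof (induction n arbitrary: f)
    case 0
    then show ?case using D[of f] by (auto simp: differentiable_def)
  next
    case (Suc n)
    then have d: "!!x. f differentiable (at x)" by simp
    then have "(%x. f (x + a)) differentiable (at x)" for x using D[of f x] unfolding differentiable_def by blast
    then show ?case using Suc pd[OF d] by simp
  qed
qed

lemma smooth_shift: "smooth f ==> smooth (%x. f (x + a))"
  by (simp add: smooth_iff_ck ck_shift)

lemma tf_shift: fixes a :: R3 assumes f: "tf f" shows "tf (%x. f (x + a))"
proof -
  obtain r where r: "!!x. x \<notin> cball 0 r ==> f x = 0" using tf_support[OF f] by blast
  show ?thesis
  proof (rule tfI[OF smooth_shift[OF tf_smooth[OF f]], of "cball 0 (r + norm a)"])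
    fix x :: R3 assume "x \<notin> cball 0 (r + norm a)"
    then have "x + a \<notin> cball 0 r" using norm_triangle_ineq4[of "x + a" a] by simp
    then show "f (x + a) = 0" by (rule r)
  qed simp
qed

text \<open>The set where F is nonzero is open and null, hence empty.\<close>

lemma continuous_zero_if_integral_zero:
  fixes F :: "R3 => real" assumes F: "tf F" "(\<integral>x. F x * F x \<partial>lborel) = 0"
  shows "F x = 0"
proof -
  have "integrable lborel (%x. F x * F x)" by (intro tf_integrable tf_mult1 F tf_smooth)
  then have "AE x in lborel. F x * F x = 0" using F(2) by (subst (asm) integral_nonneg_eq_0_iff_AE) auto
  then have "AE x in lborel. x \<notin> {x. F x ~= 0}" by simp
  moreover have o: "open {x. F x ~= 0}"
    using open_Collect_neq[OF tf_continuous[OF F(1)] continuous_on_const] by simp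
  ultimately have "{x. F x ~= 0} \<in> null_sets lborel"
    by (subst AE_iff_null_sets) (auto intro: borel_open)
  then have "negligible {x. F x ~= 0}"
    by (simp add: negligible_iff_null_sets null_sets_completionI)
  then have "{x. F x ~= 0} = {}" using open_not_negligible[OF o] by blast
  then show ?thesis by auto
qed

text \<open>Let F be the commutator applied to f. The Taylor remainders g of f and h of
  \<open>pd j f\<close> in direction i satisfy pd j g = h + s F and are both O(s^2). Pairing with F
  and moving \<open>pd j\<close> from g onto F gives s times the integral of F^2 as O(s^2); so this
  integral is 0.\<close>

lemma pd_commute:
  fixes f :: "R3 => real" assumes f: "tf f"
  shows "pd i (pd j f) = pd j (pd i f)"
proof
  fix x0
  define F where "F x = pd i (pd j f) x - pd j (pd i f) x" for x
  have F: "tf F" unfolding F_def by (intro tf_diff tf_pd f)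
  let ?e = "axis i 1 :: R3"
  obtain C where C: "C > 0" "!!(x::R3) s. norm (f (x + s *\<^sub>R ?e) - f x - s *\<^sub>R pd i f x) <= C * s\<^sup>2"
    using pd_taylor[OF f] by blast
  obtain C' where C': "C' > 0" "!!(x::R3) s. norm (pd j f (x + s *\<^sub>R ?e) - pd j f x - s *\<^sub>R pd i (pd j f) x) <= C' * s\<^sup>2"
    using pd_taylor[OF tf_pd[OF f]] by blast
  obtain r where r: "r > 0" "!!x. x \<notin> cball 0 r ==> F x = 0" using tf_support[OF F] by blast
  obtain r' where r': "r' > 0" "!!x. x \<notin> cball 0 r' ==> pd j F x = 0" using tf_support[OF tf_pd[OF F]] by blast
  obtain B where B: "B > 0" "!!x. norm (F x) <= B" using tf_bounded[OF F] by blast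
  obtain B' where B': "B' > 0" "!!x. norm (pd j F x) <= B'" using tf_bounded[OF tf_pd[OF F]] by blast
  define V where "V = measure lborel (cball (0::R3) r)"
  define V' where "V' = measure lborel (cball (0::R3) r')"
  have "\<bar>\<integral>x. F x * F x \<partial>lborel\<bar> <= 0"
  proof (rule le_small_imp_le_0[of _ "C' * B * V + C * B' * V'"])
    fix s :: real assume s: "0 < s" "s <= 1"
    define g where "g x = f (x + s *\<^sub>R ?e) - f x - s *\<^sub>R pd i f x" for x
    define h where "h x = pd j f (x + s *\<^sub>R ?e) - pd j f x - s *\<^sub>R pd i (pd j f) x" for x
    have sm: "smooth f" "smooth (%x. f (x + s *\<^sub>R ?e))" "smooth (pd i f)" "tf (%x. f (x + s *\<^sub>R ?e))"
      using f by (auto intro: tf_smooth smooth_shift smooth_pd tf_shift)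
    have g: "tf g" unfolding g_def real_scaleR_def
      by (intro tf_diff sm f tf_mult2 smooth_const tf_pd)
    have h: "tf h" unfolding h_def real_scaleR_def
      by (intro tf_diff tf_shift f tf_mult2 smooth_const tf_pd)
    have pg: "pd j g x = h x - s * (pd j (pd i f) x - pd i (pd j f) x)" for x
      unfolding g_def h_def real_scaleR_def
      using sm by (simp add: pd_diff pd_cmult smooth_diff smooth_mult[OF smooth_const] smooth_pd pd_shift[OF smooth_differentiable])
        (simp add: algebra_simps)
    have ih: "integrable lborel (%x. h x * F x)" "integrable lborel (%x. s * (F x * F x))"
      by (intro tf_integrable tf_mult1[OF _ tf_smooth] tf_mult2[OF smooth_const] h F)+
    have "s * (\<integral>x. F x * F x \<partial>lborel) = (\<integral>x. s * (F x * F x) \<partial>lborel)" by simp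
    also have "\<dots> = (\<integral>x. pd j g x * F x - h x * F x \<partial>lborel)"
      by (rule Bochner_Integration.integral_cong) (auto simp: pg F_def algebra_simps)
    also have "\<dots> = (\<integral>x. pd j g x * F x \<partial>lborel) - (\<integral>x. h x * F x \<partial>lborel)"
      by (intro Bochner_Integration.integral_diff tf_integrable tf_mult1[OF _ tf_smooth] tf_pd g h F)
    also have "(\<integral>x. pd j g x * F x \<partial>lborel) = - (\<integral>x. g x * pd j F x \<partial>lborel)"
      by (rule integration_by_parts[OF g tf_smooth[OF F]])
    finally have "s * \<bar>\<integral>x. F x * F x \<partial>lborel\<bar> <= \<bar>\<integral>x. g x * pd j F x \<partial>lborel\<bar> + \<bar>\<integral>x. h x * F x \<partial>lborel\<bar>"
      using s by (simp add: abs_mult)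
    also have "\<bar>\<integral>x. g x * pd j F x \<partial>lborel\<bar> <= C * s\<^sup>2 * B' * V'"
      unfolding V'_def real_norm_def[symmetric]
    proof (rule norm_integral_le_measure)
      show "norm (g x * pd j F x) <= C * s\<^sup>2 * B' * indicator (cball 0 r') x" for x
        using C(2)[of x s] B'(2)[of x] r'(2)[of x] C(1)
        by (cases "x \<in> cball 0 r'") (auto simp: g_def abs_mult intro!: mult_mono)
    qed auto
    also have "\<bar>\<integral>x. h x * F x \<partial>lborel\<bar> <= C' * s\<^sup>2 * B * V"
      unfolding V_def real_norm_def[symmetric]
    proof (rule norm_integral_le_measure)
      show "norm (h x * F x) <= C' * s\<^sup>2 * B * indicator (cball 0 r) x" for x
        using C'(2)[of x s] B(2)[of x] r(2)[of x] C'(1)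
        by (cases "x \<in> cball 0 r") (auto simp: h_def abs_mult intro!: mult_mono)
    qed auto
    finally have "s * \<bar>\<integral>x. F x * F x \<partial>lborel\<bar> <= s * ((C' * B * V + C * B' * V') * s)"
      by (simp add: algebra_simps power2_eq_square)
    then show "\<bar>\<integral>x. F x * F x \<partial>lborel\<bar> <= (C' * B * V + C * B' * V') * s" using s by simp
  qed
  then have "(\<integral>x. F x * F x \<partial>lborel) = 0" by linarith
  then have "F x0 = 0" by (rule continuous_zero_if_integral_zero[OF F])
  then show "pd i (pd j f) x0 = pd j (pd i f) x0" by (simp add: F_def)
qed

section \<open>Smooth partitions of unity and cutoffs\<close>

lemma partition_aux:
  fixes \<psi> :: "'i => R3 => real"
  assumes "finite A" "!!a. a \<in> A ==> smooth (\<psi> a)"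
  shows "\<exists>\<theta>. (\<forall>a\<in>A. smooth (\<theta> a) & (\<forall>x. \<psi> a x = 0 --> \<theta> a x = 0)) \<and>
    (\<forall>x. (\<Sum>a\<in>A. \<theta> a x) = 1 - (\<Prod>a\<in>A. 1 - \<psi> a x))"
  using assms
proof (induction A rule: finite_induct)
  case (insert b A)
  then obtain \<theta> where \<theta>: "\<forall>a\<in>A. smooth (\<theta> a) & (\<forall>x. \<psi> a x = 0 --> \<theta> a x = 0)"
    "\<forall>x. (\<Sum>a\<in>A. \<theta> a x) = 1 - (\<Prod>a\<in>A. 1 - \<psi> a x)" by auto
  \<comment> \<open>Telescoping: each new function is multiplied by the product of 1 - \<psi> over
    those already treated, so the sum always equals 1 minus the full product.\<close>
  define \<theta>' where "\<theta>' = \<theta>(b := %x. \<psi> b x * (\<Prod>a\<in>A. 1 - \<psi> a x))"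
  have "smooth (\<theta>' b)" unfolding \<theta>'_def fun_upd_same
    using insert.prems by (intro smooth_mult smooth_prod smooth_diff smooth_const) auto
  moreover have "(\<Sum>a\<in>A. \<theta>' a x) = (\<Sum>a\<in>A. \<theta> a x)" for x
    using insert.hyps by (intro sum.cong) (auto simp: \<theta>'_def)
  ultimately show ?case using \<theta> insert.hyps
    by (intro exI[of _ \<theta>']) (auto simp: \<theta>'_def algebra_simps)
qed auto

lemma partition_of_unity:
  assumes K: "compact K" and U: "!!x. x \<in> K ==> open (U x) & x \<in> U x"
  obtains A :: "R3 set" and \<theta> :: "R3 => R3 => real" and V where "finite A" "A \<subseteq> K" "open V" "K \<subseteq> V"
    "!!a. a \<in> A ==> tf (\<theta> a)" "!!a. a \<in> A ==> tsupp (\<theta> a) \<subseteq> U a"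
    "!!x. x \<in> V ==> (\<Sum>a\<in>A. \<theta> a x) = 1" "!!x. 0 <= (\<Sum>a\<in>A. \<theta> a x) & (\<Sum>a\<in>A. \<theta> a x) <= 1"
proof -
  \<comment> \<open>On the ball of radius r the bump equals 1, and such balls cover K; the ball of
    radius 2 r carries its support and still lies in \<open>U x\<close>.\<close>
  have "\<exists>r>0. cball x (2 * r) \<subseteq> U x" if x: "x \<in> K" for x
  proof -
    obtain e where "e > 0" "cball x e \<subseteq> U x" using U[OF x] open_contains_cball by blast
    then show ?thesis by (intro exI[of _ "e / 2"]) auto
  qed
  then obtain r where r: "!!x. x \<in> K ==> r x > 0 & cball x (2 * r x) \<subseteq> U x" by metis
  have "\<exists>\<psi>. smooth \<psi> & (\<forall>y\<in>cball x (r x). \<psi> y = 1) & (\<forall>y. y \<notin> ball x (2 * r x) --> \<psi> y = (0::real)) & (\<forall>y. 0 <= \<psi> y & \<psi> y <= 1)" if xK: "x \<in> K" for x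
  proof (rule smooth_bump[of "r x" "2 * r x" x])
    show "0 < r x" "r x < 2 * r x" using r[OF xK] by auto
    fix f :: "R3 => real"
    assume "smooth f" "!!y. y \<in> cball x (r x) ==> f y = 1" "!!y. y \<notin> ball x (2 * r x) ==> f y = 0"
      "!!y. 0 <= f y" "!!y. f y <= 1"
    then show ?thesis by (intro exI[of _ f]) simp
  qed
  then obtain \<psi> :: "R3 => R3 => real" where \<psi>: "!!x. x \<in> K ==> smooth (\<psi> x)" "!!x y. x \<in> K ==> y \<in> cball x (r x) ==> \<psi> x y = 1"
    "!!x y. x \<in> K ==> y \<notin> ball x (2 * r x) ==> \<psi> x y = 0" "!!x y. x \<in> K ==> 0 <= \<psi> x y & \<psi> x y <= 1" by metis
  obtain A where A: "A \<subseteq> K" "finite A" "K \<subseteq> (\<Union>x\<in>A. ball x (r x))"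
  proof (rule compactE_image[OF K, of K "%x. ball x (r x)"])
    show "K \<subseteq> (\<Union>x\<in>K. ball x (r x))" using r by force
  qed auto
  obtain \<theta> where \<theta>: "\<forall>a\<in>A. smooth (\<theta> a) & (\<forall>x. \<psi> a x = 0 --> \<theta> a x = 0)"
    "\<forall>x. (\<Sum>a\<in>A. \<theta> a x) = 1 - (\<Prod>a\<in>A. 1 - \<psi> a x)"
    using partition_aux[OF A(2), of \<psi>] \<psi>(1) A(1) by blast
  show ?thesis
  proof (rule that[of A "\<Union>x\<in>A. ball x (r x)" \<theta>])
    fix a assume a: "a \<in> A"
    have z: "\<theta> a y = 0" if "y \<notin> cball a (2 * r a)" for y
      using \<psi>(3)[of a y] \<theta>(1) a A(1) that by auto
    show "tf (\<theta> a)" using \<theta>(1) a z by (intro tfI[of _ "cball a (2 * r a)"]) auto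
    show "tsupp (\<theta> a) \<subseteq> U a" using tsupp_subset[of "cball a (2 * r a)" "\<theta> a"] z r[of a] a A(1) by auto
  next
    fix x assume "x \<in> (\<Union>x\<in>A. ball x (r x))"
    then obtain a where "a \<in> A" "x \<in> ball a (r a)" by auto
    then have "\<psi> a x = 1" using \<psi>(2)[of a x] A(1) by auto
    then have "(\<Prod>a\<in>A. 1 - \<psi> a x) = 0" using \<open>a \<in> A\<close> A(2) by (simp add: prod_zero_iff bexI[of _ a])
    then show "(\<Sum>a\<in>A. \<theta> a x) = 1" using \<theta>(2) by simp
  next
    fix x
    have "0 <= (\<Prod>a\<in>A. 1 - \<psi> a x)" "(\<Prod>a\<in>A. 1 - \<psi> a x) <= 1"
      using \<psi>(4) A(1) by (auto intro!: prod_nonneg prod_le_1)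
    then show "0 <= (\<Sum>a\<in>A. \<theta> a x) & (\<Sum>a\<in>A. \<theta> a x) <= 1" using \<theta>(2) by simp
  qed (use A in auto)
qed

text \<open>The sum of a partition of unity subordinate to the constant cover U.\<close>

lemma smooth_cutoff:
  assumes "compact K" "open U" "K \<subseteq> U"
  obtains \<zeta> :: "R3 => real" and V where "tf \<zeta>" "tsupp \<zeta> \<subseteq> U" "open V" "K \<subseteq> V" "!!x. x \<in> V ==> \<zeta> x = 1"
    "!!x. 0 <= \<zeta> x & \<zeta> x <= 1"
proof -
  obtain A :: "R3 set" and \<theta> V where A: "finite A" "A \<subseteq> K" "open V" "K \<subseteq> V"
    "!!a. a \<in> A ==> tf (\<theta> a)" "!!a. a \<in> A ==> tsupp (\<theta> a) \<subseteq> U"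
    "!!x. x \<in> V ==> (\<Sum>a\<in>A. \<theta> a x) = (1::real)" "!!x. 0 <= (\<Sum>a\<in>A. \<theta> a x) & (\<Sum>a\<in>A. \<theta> a x) <= 1"
    by (rule partition_of_unity[of K "%_. U"]) (use assms in auto)
  have "tsupp (%x. \<Sum>a\<in>A. \<theta> a x) \<subseteq> (\<Union>a\<in>A. tsupp (\<theta> a))"
  proof (rule tsupp_subset)
    show "closed (\<Union>a\<in>A. tsupp (\<theta> a))" using A(1) by (intro closed_UN) (auto simp: closed_tsupp)
    show "(\<Sum>a\<in>A. \<theta> a x) = 0" if "x \<notin> (\<Union>a\<in>A. tsupp (\<theta> a))" for x
      using that by (intro sum.neutral ballI tsuppD) blast
  qed
  moreover have "tf (%x. \<Sum>a\<in>A. \<theta> a x)" using A(5) by (rule tf_sum)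
  moreover have "(\<Union>a\<in>A. tsupp (\<theta> a)) \<subseteq> U" using A(6) by (rule UN_least)
  ultimately show ?thesis using that[of "%x. \<Sum>a\<in>A. \<theta> a x" V] A(3,4,7,8) by (meson order_trans)
qed

section \<open>Square integrable functions\<close>

text \<open>Stated for an arbitrary measure so that the same Hilbert space facts serve
  \<open>lebesgue_on \<Omega>\<close>, where the spaces of the theorem live, and
  \<open>lborel\<close>, where the translation operators act.\<close>

definition sqi :: "'a measure => ('a => 'b::euclidean_space) => bool" where
  "sqi M f \<longleftrightarrow> f \<in> borel_measurable M & integrable M (%x. (norm (f x))\<^sup>2)"

definition ip :: "'a measure => ('a => 'b::euclidean_space) => ('a => 'b) => real" where
  "ip M f g = (\<integral>x. f x \<bullet> g x \<partial>M)"

definition nrm :: "'a measure => ('a => 'b::euclidean_space) => real" where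
  "nrm M f = sqrt (\<integral>x. (norm (f x))\<^sup>2 \<partial>M)"

abbreviation "sqiL \<equiv> sqi lborel"
abbreviation "ipL \<equiv> ip lborel"
abbreviation "nrmL \<equiv> nrm lborel"

lemma L2_sqi: "L2 \<Omega> f \<longleftrightarrow> sqi (lebesgue_on \<Omega>) f"
  by (simp add: L2_def sqi_def)
lemma l2inner_ip: "l2inner \<Omega> f g = ip (lebesgue_on \<Omega>) f g"
  by (simp add: l2inner_def ip_def)
lemma l2norm_nrm: "l2norm \<Omega> f = nrm (lebesgue_on \<Omega>) f"
  by (simp add: l2norm_def nrm_def)

lemma sqi_measurable: "sqi M f ==> f \<in> borel_measurable M" by (simp add: sqi_def)

lemma sqi_bound:
  assumes "sqi M f" "g \<in> borel_measurable M" "!!x. norm (g x) <= C * norm (f x)"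
  shows "sqi M g"
  unfolding sqi_def
proof (intro conjI assms(2))
  have "integrable M (%x. C\<^sup>2 * (norm (f x))\<^sup>2)" using assms(1) by (simp add: sqi_def)
  then show "integrable M (%x. (norm (g x))\<^sup>2)"
  proof (rule Bochner_Integration.integrable_bound)
    show "(%x. (norm (g x))\<^sup>2) \<in> borel_measurable M" using assms(2) by measurable
    show "AE x in M. norm ((norm (g x))\<^sup>2) <= norm (C\<^sup>2 * (norm (f x))\<^sup>2)"
      using power_mono[OF assms(3) norm_ge_zero, of _ 2] by (auto simp: power_mult_distrib)
  qed
qed

lemma sqi_inner: assumes "sqi M f" "sqi M g" shows "integrable M (%x. f x \<bullet> g x)"
proof (rule Bochner_Integration.integrable_bound)
  show "integrable M (%x. (norm (f x))\<^sup>2 + (norm (g x))\<^sup>2)" using assms by (auto simp: sqi_def)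
  show "(%x. f x \<bullet> g x) \<in> borel_measurable M" using assms by (auto simp: sqi_def)
  have "\<bar>f x \<bullet> g x\<bar> <= (norm (f x))\<^sup>2 + (norm (g x))\<^sup>2" for x
  proof -
    have "\<bar>f x \<bullet> g x\<bar> <= norm (f x) * norm (g x)" by (rule Cauchy_Schwarz_ineq2)
    also have "2 * norm (f x) * norm (g x) <= (norm (f x))\<^sup>2 + (norm (g x))\<^sup>2" by (rule sum_squares_bound)
    then have "norm (f x) * norm (g x) <= (norm (f x))\<^sup>2 + (norm (g x))\<^sup>2"
      using mult_nonneg_nonneg[OF norm_ge_zero norm_ge_zero, of "f x" "g x"] by linarith
    finally show ?thesis .
  qed
  then show "AE x in M. norm (f x \<bullet> g x) <= norm ((norm (f x))\<^sup>2 + (norm (g x))\<^sup>2)" by auto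
qed

lemma sqi_add: assumes "sqi M f" "sqi M g" shows "sqi M (%x. f x + g x)"
proof -
  have "integrable M (%x. (norm (f x))\<^sup>2 + 2 * (f x \<bullet> g x) + (norm (g x))\<^sup>2)"
    using assms sqi_inner[OF assms] by (auto simp: sqi_def)
  also have "(%x. (norm (f x))\<^sup>2 + 2 * (f x \<bullet> g x) + (norm (g x))\<^sup>2) = (%x. (norm (f x + g x))\<^sup>2)"
    by (auto simp: power2_norm_eq_inner inner_add inner_commute)
  finally show ?thesis using assms by (auto simp: sqi_def)
qed

lemma sqi_linear: assumes "bounded_linear L" "sqi M f" shows "sqi M (%x. L (f x))"
proof -
  obtain C where C: "!!x. norm (L x) <= norm x * C" using bounded_linear.bounded[OF assms(1)] by blast
  have "continuous_on UNIV L" using assms(1) by (simp add: linear_continuous_on)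
  then have "(%x. L (f x)) \<in> borel_measurable M"
    using assms(2) by (intro measurable_compose[OF sqi_measurable borel_measurable_continuous_onI])
  then show ?thesis using C by (intro sqi_bound[OF assms(2), of _ C]) (auto simp: mult.commute)
qed

lemma sqi_uminus: "sqi M f ==> sqi M (%x. - f x)"
  by (rule sqi_linear[OF bounded_linear_minus[OF bounded_linear_ident]])
lemma sqi_diff: "sqi M f ==> sqi M g ==> sqi M (%x. f x - g x)"
  using sqi_add[OF _ sqi_uminus, of M f g] by simp
lemma sqi_zero: "sqi M (%x. 0)" by (simp add: sqi_def)
lemma sqi_sum: "(!!i. i \<in> A ==> sqi M (f i)) ==> sqi M (%x. \<Sum>i\<in>A. f i x)"
  by (induction A rule: infinite_finite_induct) (auto intro: sqi_add sqi_zero)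
lemma sqi_scaleR: "sqi M f ==> sqi M (%x. c *\<^sub>R f x)"
  by (rule sqi_linear[OF bounded_linear_scaleR_right])

lemma sqi_mult_bounded:
  fixes c :: "'a => real"
  assumes "sqi M f" "c \<in> borel_measurable M" "!!x. \<bar>c x\<bar> <= B"
  shows "sqi M (%x. c x *\<^sub>R f x)"
proof (rule sqi_bound[OF assms(1), of _ B])
  show "(%x. c x *\<^sub>R f x) \<in> borel_measurable M" using assms(2) sqi_measurable[OF assms(1)] by measurable
  show "norm (c x *\<^sub>R f x) <= B * norm (f x)" for x using assms(3)[of x] by (auto intro: mult_right_mono)
qed

lemma nrm_nonneg [simp]: "0 <= nrm M f" by (simp add: nrm_def)
lemma nrm_sq: "(nrm M f)\<^sup>2 = (\<integral>x. (norm (f x))\<^sup>2 \<partial>M)" by (simp add: nrm_def)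
lemma ip_add_left: "sqi M f ==> sqi M g ==> sqi M h ==> ip M (%x. f x + g x) h = ip M f h + ip M g h"
  by (simp add: ip_def inner_add_left sqi_inner)
lemma ip_diff_left: "sqi M f ==> sqi M g ==> sqi M h ==> ip M (%x. f x - g x) h = ip M f h - ip M g h"
  by (simp add: ip_def inner_diff_left sqi_inner)
lemma ip_commute: "ip M f g = ip M g f" by (simp add: ip_def inner_commute)
lemma ip_add_right: "sqi M f ==> sqi M g ==> sqi M h ==> ip M h (%x. f x + g x) = ip M h f + ip M h g"
  by (simp add: ip_commute[of M h] ip_add_left)
lemma ip_zero_left: "ip M (%x. 0) f = 0" by (simp add: ip_def)
lemma ip_sum_left: "(!!i. i \<in> A ==> sqi M (f i)) ==> sqi M h ==> ip M (%x. \<Sum>i\<in>A. f i x) h = (\<Sum>i\<in>A. ip M (f i) h)"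
  by (simp add: ip_def inner_sum_left sqi_inner)
lemma ip_sum_right: "(!!i. i \<in> A ==> sqi M (f i)) ==> sqi M h ==> ip M h (%x. \<Sum>i\<in>A. f i x) = (\<Sum>i\<in>A. ip M h (f i))"
  by (simp add: ip_def inner_sum_right sqi_inner)
lemma ip_cong_AE:
  assumes "AE x in M. f x = f' x" "f \<in> borel_measurable M" "f' \<in> borel_measurable M" "g \<in> borel_measurable M"
  shows "ip M f g = ip M f' g"
  unfolding ip_def using assms by (intro integral_cong_AE) auto
lemma nrm_cong_AE:
  assumes "AE x in M. f x = f' x" "f \<in> borel_measurable M" "f' \<in> borel_measurable M"
  shows "nrm M f = nrm M f'"
  unfolding nrm_def using assms by (auto intro!: integral_cong_AE arg_cong[where f=sqrt])

lemma nrm_eq_0: assumes "sqi M f" shows "nrm M f = 0 \<longleftrightarrow> (AE x in M. f x = 0)"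
  using assms by (simp add: nrm_def sqi_def integral_nonneg_eq_0_iff_AE)

text \<open>Nonnegativity of the square norm of f - t g at the minimising t; the case of vanishing g
  is separate because t has the norm of g in its denominator.\<close>

lemma ip_Cauchy_Schwarz: assumes "sqi M f" "sqi M g" shows "\<bar>ip M f g\<bar> <= nrm M f * nrm M g"
proof (cases "nrm M g = 0")
  case True
  then have "AE x in M. g x = 0" using nrm_eq_0 assms by blast
  then have "ip M f g = (\<integral>x. 0 \<partial>M)" unfolding ip_def
    using assms by (intro integral_cong_AE) (auto simp: sqi_def)
  then show ?thesis by simp
next
  case False
  define t where "t = ip M f g / (nrm M g)\<^sup>2"
  have s: "sqi M (%x. - t *\<^sub>R g x)" using assms by (intro sqi_scaleR)
  have "0 <= ip M (%x. f x + - t *\<^sub>R g x) (%x. f x + - t *\<^sub>R g x)"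
    by (simp add: ip_def)
  also have "\<dots> = (\<integral>x. (norm (f x))\<^sup>2 - 2 * t * (f x \<bullet> g x) + t\<^sup>2 * (norm (g x))\<^sup>2 \<partial>M)"
    unfolding ip_def
    by (intro Bochner_Integration.integral_cong refl)
      (simp add: power2_norm_eq_inner inner_diff_left inner_diff_right inner_commute power2_eq_square[of t] algebra_simps)
  also have "\<dots> = (nrm M f)\<^sup>2 - 2 * t * ip M f g + t\<^sup>2 * (nrm M g)\<^sup>2"
    using assms sqi_inner[OF assms] by (simp add: nrm_sq ip_def sqi_def)
  finally have "0 <= (nrm M f)\<^sup>2 - (ip M f g)\<^sup>2 / (nrm M g)\<^sup>2"
    using False by (simp add: t_def power2_eq_square field_simps)
  then have "(ip M f g)\<^sup>2 <= (nrm M f * nrm M g)\<^sup>2"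
    using False by (simp add: field_simps power_mult_distrib)
  then show ?thesis using power2_le_imp_le[of "\<bar>ip M f g\<bar>" "nrm M f * nrm M g"] by simp
qed

lemma nrm_triangle: assumes "sqi M f" "sqi M g" shows "nrm M (%x. f x + g x) <= nrm M f + nrm M g"
proof (rule power2_le_imp_le)
  have "(nrm M (%x. f x + g x))\<^sup>2 = (nrm M f)\<^sup>2 + 2 * ip M f g + (nrm M g)\<^sup>2"
  proof -
    have "(nrm M (%x. f x + g x))\<^sup>2 = (\<integral>x. (norm (f x))\<^sup>2 + 2 * (f x \<bullet> g x) + (norm (g x))\<^sup>2 \<partial>M)"
      unfolding nrm_sq
      by (intro Bochner_Integration.integral_cong refl)
        (simp add: power2_norm_eq_inner inner_add_left inner_add_right inner_commute)
    then show ?thesis using assms sqi_inner[OF assms] by (simp add: nrm_sq ip_def sqi_def)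
  qed
  also have "\<dots> <= (nrm M f + nrm M g)\<^sup>2"
    using ip_Cauchy_Schwarz[OF assms] by (simp add: power2_sum)
  finally show "(nrm M (%x. f x + g x))\<^sup>2 <= (nrm M f + nrm M g)\<^sup>2" .
qed simp

lemma nrm_uminus: "nrm M (%x. - f x) = nrm M f" by (simp add: nrm_def)
lemma nrm_minus_commute: "nrm M (%x. f x - g x) = nrm M (%x. g x - f x)"
  by (simp add: nrm_def norm_minus_commute)
lemma nrm_triangle_diff: "sqi M f ==> sqi M g ==> nrm M (%x. f x - g x) <= nrm M f + nrm M g"
  using nrm_triangle[OF _ sqi_uminus, of M f g] by (simp add: nrm_uminus)
lemma nrm_bound:
  assumes f: "sqi M f" and g: "g \<in> borel_measurable M" and C: "0 <= C" "!!x. norm (g x) <= C * norm (f x)"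
  shows "nrm M g <= C * nrm M f"
proof (rule power2_le_imp_le)
  have "(nrm M g)\<^sup>2 <= (\<integral>x. C\<^sup>2 * (norm (f x))\<^sup>2 \<partial>M)" unfolding nrm_sq
    using sqi_bound[OF f g C(2)] f power_mono[OF C(2) norm_ge_zero, of _ 2]
    by (intro integral_mono) (auto simp: sqi_def power_mult_distrib)
  then show "(nrm M g)\<^sup>2 <= (C * nrm M f)\<^sup>2" by (simp add: power_mult_distrib nrm_sq)
qed (use C in simp)

lemma nrm_linear: assumes "bounded_linear L" obtains C where "C > 0" "!!f. sqi M f ==> nrm M (%x. L (f x)) <= C * nrm M f"
proof -
  obtain C where C: "C > 0" "!!x. norm (L x) <= norm x * C" using bounded_linear.pos_bounded[OF assms(1)] by blast
  show ?thesis
    by (rule that[OF C(1)], rule nrm_bound) (use C sqi_linear[OF assms] in \<open>auto simp: mult.commute sqi_def\<close>)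
qed

section \<open>Completeness of L2\<close>

lemma nn_integral_sq: "sqi M f ==> (\<integral>\<^sup>+x. ennreal ((norm (f x))\<^sup>2) \<partial>M) = ennreal ((nrm M f)\<^sup>2)"
  unfolding nrm_sq by (rule nn_integral_eq_integral) (auto simp: sqi_def)

lemma sqi_if_nn_integral:
  assumes [measurable]: "f \<in> borel_measurable M" and b: "(\<integral>\<^sup>+x. ennreal ((norm (f x))\<^sup>2) \<partial>M) <= ennreal (c\<^sup>2)" and c: "0 <= c"
  shows "sqi M f & nrm M f <= c"
proof -
  have "integrable M (%x. (norm (f x))\<^sup>2)"
    using b by (intro integrableI_bounded) (auto intro: le_less_trans)
  then have s: "sqi M f" by (simp add: sqi_def)
  then have "(nrm M f)\<^sup>2 <= c\<^sup>2" using b by (simp add: nn_integral_sq)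
  then show ?thesis using s c power2_le_imp_le by blast
qed

text \<open>Riesz-Fischer: a fast subsequence converges almost everywhere, and Fatou's lemma
  identifies its pointwise limit as the limit in norm of the whole sequence.\<close>

lemma sqi_complete:
  fixes f :: "nat => 'a => 'b::euclidean_space"
  assumes s: "!!n. sqi M (f n)"
    and C: "!!e. e > 0 ==> \<exists>N. \<forall>m\<ge>N. \<forall>n\<ge>N. nrm M (%x. f m x - f n x) <= e"
  obtains g where "sqi M g" "(%n. nrm M (%x. f n x - g x)) \<longlonglongrightarrow> 0"
proof -
  have [measurable]: "f n \<in> borel_measurable M" for n using s by (simp add: sqi_def)
  have "\<exists>N. \<forall>k. \<forall>m\<ge>N k. \<forall>n\<ge>N k. nrm M (%x. f m x - f n x) <= (1/2) ^ k"
    using C by (intro choice) simp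
  then obtain N where N: "!!k m n. m >= N k ==> n >= N k ==> nrm M (%x. f m x - f n x) <= (1/2) ^ k" by blast
  \<comment> \<open>The sum dominates every \<open>N j\<close> with j \<le> k, so the index
    \<open>r k\<close> is late enough for all these tolerances at once.\<close>
  define r where "r k = (\<Sum>i\<le>k. N i) + k" for k
  have rN: "r k >= N j" if "k >= j" for k j
    using that member_le_sum[of j "{..k}" N] by (simp add: r_def)
  \<comment> \<open>These increments have L2 norm at most 2^-k. Weighting their squares by 2^k still
    leaves the convergent sum of 2^-k, and finiteness of the weighted series at a point forces
    geometric decay of \<open>d k x\<close> there.\<close>
  define d where "d k x = norm (f (r (Suc k)) x - f (r k) x)" for k x
  have [measurable]: "d k \<in> borel_measurable M" for k unfolding d_def by measurable
  have "(\<integral>\<^sup>+x. (\<Sum>k. ennreal (2 ^ k * (d k x)\<^sup>2)) \<partial>M) = (\<Sum>k. \<integral>\<^sup>+x. ennreal (2 ^ k * (d k x)\<^sup>2) \<partial>M)"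
    by (rule nn_integral_suminf) simp
  also have "\<dots> <= (\<Sum>k. ennreal ((1/2) ^ k))"
  proof (rule suminf_le)
    fix k
    have "(\<integral>\<^sup>+x. ennreal (2 ^ k * (d k x)\<^sup>2) \<partial>M) = ennreal (2 ^ k) * (\<integral>\<^sup>+x. ennreal ((d k x)\<^sup>2) \<partial>M)"
      by (simp add: ennreal_mult nn_integral_cmult)
    also have "\<dots> = ennreal (2 ^ k * (nrm M (%x. f (r (Suc k)) x - f (r k) x))\<^sup>2)"
      by (simp add: d_def nn_integral_sq sqi_diff s ennreal_mult)
    also have "\<dots> <= ennreal (2 ^ k * ((1/2) ^ k)\<^sup>2)"
      using rN[of k k] rN[of k "Suc k"] by (intro ennreal_leI mult_left_mono power_mono N) auto
    also have "2 ^ k * ((1/2) ^ k)\<^sup>2 = (1/2::real) ^ k"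
      by (simp add: power2_eq_square power_mult_distrib[symmetric] flip: power_mult_distrib)
    finally show "(\<integral>\<^sup>+x. ennreal (2 ^ k * (d k x)\<^sup>2) \<partial>M) <= ennreal ((1/2) ^ k)" .
  qed auto
  also have "\<dots> = ennreal (\<Sum>k. (1/2) ^ k)" by (intro suminf_ennreal2 summable_geometric) auto
  finally have "(\<integral>\<^sup>+x. (\<Sum>k. ennreal (2 ^ k * (d k x)\<^sup>2)) \<partial>M) ~= \<infinity>" by (auto simp: top_unique)
  then have "AE x in M. (\<Sum>k. ennreal (2 ^ k * (d k x)\<^sup>2)) ~= \<infinity>"
    by (intro nn_integral_noteq_infinite) auto
  then have conv: "AE x in M. convergent (%k. f (r k) x)"
  proof eventually_elim
    case (elim x)
    define B where "B = enn2real (\<Sum>k. ennreal (2 ^ k * (d k x)\<^sup>2))"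
    have B: "(\<Sum>k. ennreal (2 ^ k * (d k x)\<^sup>2)) = ennreal B" "B >= 0"
      using elim by (simp_all add: B_def ennreal_enn2real_if)
    have le: "d k x <= sqrt B * (sqrt (1/2)) ^ k" for k
    proof -
      have "ennreal (2 ^ k * (d k x)\<^sup>2) <= ennreal B"
        using sum_le_suminf[of "%k. ennreal (2 ^ k * (d k x)\<^sup>2)" "{k}"] B by simp
      then have "2 ^ k * (d k x)\<^sup>2 <= B" using B by simp
      then have "(d k x)\<^sup>2 <= B * (1/2) ^ k" by (simp add: field_simps)
      then have "sqrt ((d k x)\<^sup>2) <= sqrt (B * (1/2) ^ k)" by (rule real_sqrt_le_mono)
      then show ?thesis by (simp add: d_def real_sqrt_mult real_sqrt_power del: real_sqrt_divide)
    qed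
    have "summable (%k. sqrt B * (sqrt (1/2)) ^ k)"
      by (intro summable_mult summable_geometric) (auto simp: real_sqrt_divide)
    then have "summable (%k. norm (f (r (Suc k)) x - f (r k) x))"
      by (rule summable_comparison_test'[where N=0]) (use le in \<open>auto simp: d_def\<close>)
    then have "summable (%k. f (r (Suc k)) x - f (r k) x)" by (rule summable_norm_cancel)
    then have "convergent (%n. \<Sum>k<n. f (r (Suc k)) x - f (r k) x)" by (simp add: summable_iff_convergent)
    then have "convergent (%n. f (r n) x - f (r 0) x)" by (simp add: sum_lessThan_telescope[of "%k. f (r k) x"])
    then have "convergent (%n. (f (r n) x - f (r 0) x) + f (r 0) x)" by (rule convergent_add[OF _ convergent_const])
    then show "convergent (%k. f (r k) x)" by simp
  qed
  define g where "g x = lim (%k. f (r k) x)" for x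
  have [measurable]: "g \<in> borel_measurable M" unfolding g_def
    by measurable
  \<comment> \<open>Fatou in j: the bound on f n - f (r j) survives the limit f (r j) -> g.\<close>
  have key: "(\<integral>\<^sup>+x. ennreal ((norm (f n x - g x))\<^sup>2) \<partial>M) <= ennreal (((1/2) ^ k)\<^sup>2)" if n: "n >= N k" for n k
  proof -
    have "(\<integral>\<^sup>+x. ennreal ((norm (f n x - g x))\<^sup>2) \<partial>M) = (\<integral>\<^sup>+x. liminf (%j. ennreal ((norm (f n x - f (r j) x))\<^sup>2)) \<partial>M)"
    proof (rule nn_integral_cong_AE)
      show "AE x in M. ennreal ((norm (f n x - g x))\<^sup>2) = liminf (%j. ennreal ((norm (f n x - f (r j) x))\<^sup>2))"
        using conv
      proof eventually_elim
      case (elim x)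
      then have "(%j. f (r j) x) \<longlonglongrightarrow> g x" by (simp add: g_def convergent_LIMSEQ_iff)
      then have "(%j. ennreal ((norm (f n x - f (r j) x))\<^sup>2)) \<longlonglongrightarrow> ennreal ((norm (f n x - g x))\<^sup>2)"
        by (intro tendsto_intros)
      then show "ennreal ((norm (f n x - g x))\<^sup>2) = liminf (%j. ennreal ((norm (f n x - f (r j) x))\<^sup>2))"
        by (rule lim_imp_Liminf[OF sequentially_bot, symmetric])
      qed
    qed
    also have "\<dots> <= liminf (%j. \<integral>\<^sup>+x. ennreal ((norm (f n x - f (r j) x))\<^sup>2) \<partial>M)"
      by (rule nn_integral_liminf) simp
    also have "\<dots> <= liminf (%j. ennreal (((1/2) ^ k)\<^sup>2))"
    proof (rule Liminf_mono, rule eventually_sequentiallyI[of k])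
      fix j assume "k <= j"
      then have "nrm M (%x. f n x - f (r j) x) <= (1/2) ^ k" using n rN by (intro N) auto
      then show "(\<integral>\<^sup>+x. ennreal ((norm (f n x - f (r j) x))\<^sup>2) \<partial>M) <= ennreal (((1/2) ^ k)\<^sup>2)"
        by (simp add: nn_integral_sq sqi_diff s ennreal_leI power_mono)
    qed
    finally show ?thesis by (simp add: Liminf_const)
  qed
  have kk: "sqi M (%x. f n x - g x) & nrm M (%x. f n x - g x) <= (1/2) ^ k" if n: "n >= N k" for n k
    by (rule sqi_if_nn_integral) (use key[OF n] in auto)
  show ?thesis
  proof (rule that)
    show "sqi M g" using sqi_diff[OF s[of "N 0"], of "%x. f (N 0) x - g x"] kk[of 0 "N 0"] by simp
    show "(%n. nrm M (%x. f n x - g x)) \<longlonglongrightarrow> 0"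
    proof (rule LIMSEQ_I)
      fix e :: real assume "0 < e"
      then obtain k where "(1/2::real) ^ k < e" using real_arch_pow_inv[of e "1/2"] by auto
      then show "\<exists>no. \<forall>n\<ge>no. norm (nrm M (%x. f n x - g x) - 0) < e"
        using kk[of k] by (intro exI[of _ "N k"]) (auto intro: le_less_trans)
    qed
  qed
qed

section \<open>From Lebesgue measurable fields on the domain to Borel fields on the whole
  space\<close>

lemma set_integrable_zero_off:
  assumes "h \<in> borel_measurable borel" "\<Omega> \<in> sets borel" "!!x. x \<notin> \<Omega> ==> h x = (0::'b::euclidean_space)"
  shows integral_lebesgue_on: "integral\<^sup>L (lebesgue_on \<Omega>) h = integral\<^sup>L lborel h"
    and integrable_lebesgue_on: "integrable (lebesgue_on \<Omega>) h \<longleftrightarrow> integrable lborel h"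
proof -
  have "(%x. indicator \<Omega> x *\<^sub>R h x) = h"
    using assms(3) by (auto simp: indicator_def)
  moreover have "\<Omega> \<inter> space lebesgue \<in> sets lebesgue" using assms(2) by simp
  ultimately show "integral\<^sup>L (lebesgue_on \<Omega>) h = integral\<^sup>L lborel h" "integrable (lebesgue_on \<Omega>) h \<longleftrightarrow> integrable lborel h"
    using assms(1) by (simp_all add: integral_restrict_space integrable_restrict_space integral_completion integrable_completion)
qed

lemma borel_measurable_lebesgue_on:
  "h \<in> borel_measurable borel ==> h \<in> borel_measurable (lebesgue_on \<Omega>)"
  by (intro measurable_restrict_space1 measurable_completion) simp

lemma AE_lebesgue_on: "\<Omega> \<in> sets borel ==> (AE x in lebesgue_on \<Omega>. P x) \<longleftrightarrow> (AE x in lborel. x \<in> \<Omega> --> P x)"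
  by (simp add: AE_restrict_space_iff AE_completion_iff)

text \<open>Assembled from Borel versions of the real coordinates. The indicator enforces vanishing
  at every point off \<Omega>, so that integrals over \<Omega> become integrals over the whole space
  and translation is available.\<close>

lemma borel_representative:
  fixes f :: "R3 => 'b::euclidean_space"
  assumes \<Omega>: "\<Omega> \<in> sets borel" and f: "f \<in> borel_measurable (lebesgue_on \<Omega>)"
  obtains g where "g \<in> borel_measurable borel" "!!x. x \<notin> \<Omega> ==> g x = 0" "AE x in lebesgue_on \<Omega>. f x = g x"
proof -
  have F: "(%x. if x \<in> \<Omega> then f x else 0) \<in> borel_measurable lebesgue"
    using f \<Omega> by (subst borel_measurable_if) auto
  have "\<exists>g'\<in>borel_measurable lborel. AE x in lborel. (if x \<in> \<Omega> then f x else 0) \<bullet> b = g' x" for b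
    by (intro completion_ex_borel_measurable_real borel_measurable_inner F) simp
  then have "\<forall>b. \<exists>h. h \<in> borel_measurable lborel & (AE x in lborel. (if x \<in> \<Omega> then f x else 0) \<bullet> b = h x)"
    by (simp add: Bex_def)
  from choice[OF this] obtain g' where g': "!!b. g' b \<in> borel_measurable lborel" "!!b. AE x in lborel. (if x \<in> \<Omega> then f x else 0) \<bullet> b = g' b x"
    by auto
  define g where "g x = indicator \<Omega> x *\<^sub>R (\<Sum>b\<in>Basis. g' b x *\<^sub>R b)" for x
  have [measurable]: "g' b \<in> borel_measurable borel" for b using g'(1) by simp
  note \<Omega>[measurable]
  show ?thesis
  proof (rule that[of g])
    show "g \<in> borel_measurable borel" unfolding g_def by measurable
    have "AE x in lborel. \<forall>b\<in>Basis. (if x \<in> \<Omega> then f x else 0) \<bullet> b = g' b x"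
      using g'(2) by (subst AE_ball_countable) (auto intro: countable_finite)
    then have "AE x in lborel. x \<in> \<Omega> --> f x = g x"
    proof eventually_elim
      case (elim x)
      show ?case
      proof
        assume "x \<in> \<Omega>"
        then have "(\<Sum>b\<in>Basis. (f x \<bullet> b) *\<^sub>R b) = g x" using elim by (simp add: g_def)
        then show "f x = g x" by (simp add: euclidean_representation)
      qed
    qed
    then show "AE x in lebesgue_on \<Omega>. f x = g x" using \<Omega> by (simp add: AE_lebesgue_on)
  qed (simp add: g_def)
qed

lemma
  fixes f :: "R3 => 'b::euclidean_space"
  assumes \<Omega>: "\<Omega> \<in> sets borel" and f: "f \<in> borel_measurable (lebesgue_on \<Omega>)"
    and g: "g \<in> borel_measurable borel" "!!x. x \<notin> \<Omega> ==> g x = 0" and eq: "AE x in lebesgue_on \<Omega>. f x = g x"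
  shows ip_representative: "\<phi> \<in> borel_measurable borel ==> ip (lebesgue_on \<Omega>) f \<phi> = ipL g \<phi>"
    and nrm_representative: "nrm (lebesgue_on \<Omega>) f = nrmL g"
    and sqi_representative: "sqi (lebesgue_on \<Omega>) f \<longleftrightarrow> sqiL g"
proof -
  note [measurable] = g(1) f borel_measurable_lebesgue_on[OF g(1)]
  show "ip (lebesgue_on \<Omega>) f \<phi> = ipL g \<phi>" if [measurable]: "\<phi> \<in> borel_measurable borel"
  proof -
    note [measurable] = borel_measurable_lebesgue_on[OF that]
    have "ip (lebesgue_on \<Omega>) f \<phi> = ip (lebesgue_on \<Omega>) g \<phi>"
      using eq by (rule ip_cong_AE) measurable
    then show ?thesis unfolding ip_def
      by (subst (asm) (2) integral_lebesgue_on[OF _ \<Omega>]) (auto simp: g(2))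
  qed
  show "nrm (lebesgue_on \<Omega>) f = nrmL g"
    unfolding nrm_cong_AE[OF eq f borel_measurable_lebesgue_on[OF g(1)]]
    unfolding nrm_def by (subst integral_lebesgue_on[OF _ \<Omega>]) (auto simp: g(2))
  have "integrable (lebesgue_on \<Omega>) (%x. (norm (f x))\<^sup>2) \<longleftrightarrow> integrable (lebesgue_on \<Omega>) (%x. (norm (g x))\<^sup>2)"
    by (rule integrable_cong_AE, measurable) (use eq in auto)
  also have "\<dots> \<longleftrightarrow> integrable lborel (%x. (norm (g x))\<^sup>2)"
    by (rule integrable_lebesgue_on[OF _ \<Omega>]) (auto simp: g(2))
  finally show "sqi (lebesgue_on \<Omega>) f \<longleftrightarrow> sqiL g"
    using f g(1) by (simp add: sqi_def)
qed

section \<open>The fundamental lemma of the calculus of variations\<close>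

lemma integral_compact_zero:
  fixes f :: "R3 => real"
  assumes f: "f \<in> borel_measurable borel" "!!r. integrable lborel (%x. indicator (cball 0 r) x * f x)"
    and V: "open V" and z: "!!\<psi>. tf \<psi> ==> tsupp \<psi> \<subseteq> V ==> (\<integral>x. f x * \<psi> x \<partial>lborel) = 0"
    and K: "compact K" "K \<subseteq> V" "K ~= {}"
  shows "(\<integral>x. indicator K x * f x \<partial>lborel) = 0"
proof -
  obtain R where R: "K \<subseteq> ball 0 R" using bounded_subset_ballD[OF compact_imp_bounded[OF K(1)]] by blast
  \<comment> \<open>Cutoffs supported in these shrinking neighbourhoods and equal to 1 on K tend
    pointwise to the indicator of K. The fixed ball gives an integrable majorant, and K is nonempty
    so that \<open>infdist\<close> separates K from its complement.\<close>
  define U where "U n = V \<inter> ball 0 R \<inter> {x. infdist x K < 1 / Suc n}" for n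
  have oU: "open (U n)" for n unfolding U_def
    by (intro open_Int V open_ball open_Collect_less continuous_intros)
  have KU: "K \<subseteq> U n" for n using K R by (auto simp: U_def)
  have "\<exists>\<zeta>. tf \<zeta> & tsupp \<zeta> \<subseteq> U n & (\<forall>x\<in>K. \<zeta> x = 1) & (\<forall>x. 0 <= \<zeta> x & \<zeta> x <= (1::real))" for n
  proof -
    obtain \<zeta> :: "R3 => real" and W where "tf \<zeta>" "tsupp \<zeta> \<subseteq> U n" "open W" "K \<subseteq> W" "!!x. x \<in> W ==> \<zeta> x = 1"
      "!!x. 0 <= \<zeta> x & \<zeta> x <= 1" using smooth_cutoff[OF K(1) oU KU] by metis
    then show ?thesis by (intro exI[of _ \<zeta>]) auto
  qed
  then obtain \<zeta> :: "nat => R3 => real" where \<zeta>: "!!n. tf (\<zeta> n)" "!!n. tsupp (\<zeta> n) \<subseteq> U n" "!!n x. x \<in> K ==> \<zeta> n x = 1"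
    "!!n x. 0 <= \<zeta> n x & \<zeta> n x <= 1" by metis
  have z0: "\<zeta> n x = 0" if "x \<notin> U n" for n x using \<zeta>(2)[of n] that by (intro tsuppD) auto
  have "(%n. \<integral>x. \<zeta> n x * f x \<partial>lborel) \<longlonglongrightarrow> (\<integral>x. indicator K x * f x \<partial>lborel)"
  proof (rule integral_dominated_convergence)
    have [measurable]: "\<zeta> n \<in> borel_measurable borel" for n using smooth_borel[OF tf_smooth[OF \<zeta>(1)]] .
    note [measurable] = f(1) borel_compact[OF K(1)]
    show "(%x. indicator K x * f x) \<in> borel_measurable lborel" "(%x. \<zeta> n x * f x) \<in> borel_measurable lborel" for n
      by measurable
    show "integrable lborel (%x. norm (indicator (cball 0 R) x * f x))"
      using f(2)[of R] by (rule integrable_norm)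
    show "AE x in lborel. norm (\<zeta> n x * f x) <= norm (indicator (cball 0 R) x * f x)" for n
    proof (rule AE_I2)
      fix x
      show "norm (\<zeta> n x * f x) <= norm (indicator (cball 0 R) x * f x)"
      proof (cases "x \<in> U n")
        case True
        then show ?thesis using \<zeta>(4)[of n x] by (auto simp: U_def abs_mult intro!: mult_left_le_one_le)
      qed (simp add: z0)
    qed
    show "AE x in lborel. (%n. \<zeta> n x * f x) \<longlonglongrightarrow> indicator K x * f x"
    proof (rule AE_I2)
      fix x
      show "(%n. \<zeta> n x * f x) \<longlonglongrightarrow> indicator K x * f x"
      proof (cases "x \<in> K")
        case False
        then have "infdist x K > 0"
          using in_closed_iff_infdist_zero[OF compact_imp_closed[OF K(1)] K(3)] infdist_nonneg[of x K] by (auto simp: less_le)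
        then obtain N where "1 / real (Suc N) < infdist x K" using nat_approx_posE by blast
        have "\<zeta> n x = 0" if "n >= N" for n
        proof (rule z0)
          have "1 / real (Suc n) <= 1 / real (Suc N)" using that by (auto simp: frac_le)
          then show "x \<notin> U n" using \<open>1 / real (Suc N) < infdist x K\<close> by (auto simp: U_def)
        qed
        then show ?thesis using False by (intro tendsto_eventually eventually_sequentiallyI[of N]) auto
      qed (use \<zeta>(3) in simp)
    qed
  qed
  moreover have "(\<integral>x. \<zeta> n x * f x \<partial>lborel) = 0" for n
    using z[OF \<zeta>(1)[of n]] \<zeta>(2)[of n] by (auto simp: U_def mult.commute)
  ultimately show ?thesis by (simp add: LIMSEQ_const_iff)
qed

text \<open>Every compact subset T of the set where f is positive has integral 0 of f over it, hence
  is null; inner regularity then makes the whole set null.\<close>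

lemma fundamental_pos:
  fixes f :: "R3 => real"
  assumes f: "f \<in> borel_measurable borel" "!!r. integrable lborel (%x. indicator (cball 0 r) x * f x)"
    and V: "open V" and z: "!!\<psi>. tf \<psi> ==> tsupp \<psi> \<subseteq> V ==> (\<integral>x. f x * \<psi> x \<partial>lborel) = 0"
  shows "AE x in lborel. x \<in> V --> f x <= 0"
proof -
  note [measurable] = f(1) borel_open[OF V]
  define A where "A n = {x \<in> V \<inter> cball 0 (real n). f x > 0}" for n :: nat
  have A[measurable]: "A n \<in> sets borel" for n unfolding A_def by measurable
  have "A n \<in> null_sets lebesgue" for n
  proof -
    have "emeasure lebesgue (A n) < ennreal e" if e: "e > 0" for e
    proof -
      obtain T where T: "closed T" "T \<subseteq> A n" "A n - T \<in> lmeasurable" "emeasure lebesgue (A n - T) < ennreal e"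
        using sets_lebesgue_inner_closed[of "A n" e] e A by (metis sets_completionI_sets sets_lborel)
      have cT: "compact T"
        using T(1) bounded_subset[OF bounded_cball[of 0 "real n"], of T] T(2)
        unfolding compact_eq_bounded_closed A_def by (auto simp: subset_eq)
      have "T \<in> null_sets lborel"
      proof (cases "T = {}")
        case False
        note [measurable] = borel_compact[OF cT]
        have "(\<integral>x. indicator T x * f x \<partial>lborel) = 0"
          by (rule integral_compact_zero[OF f V z cT _ False]) (use T in \<open>auto simp: A_def\<close>)
        moreover have "integrable lborel (%x. indicator T x * f x)"
        proof (rule Bochner_Integration.integrable_bound[OF f(2)[of n]])
          show "AE x in lborel. norm (indicator T x * f x) <= norm (indicator (cball 0 (real n)) x * f x)"
            using T(2) by (auto simp: A_def indicator_def)
        qed measurable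
        moreover have "0 <= indicator T x * f x" for x using T(2) by (auto simp: A_def indicator_def)
        ultimately have "AE x in lborel. indicator T x * f x = 0"
          by (subst (asm) integral_nonneg_eq_0_iff_AE) auto
        then have "AE x in lborel. x \<notin> T"
        proof eventually_elim
          case (elim x)
          then show ?case using T(2) by (auto simp: A_def)
        qed
        then show ?thesis by (subst AE_iff_null_sets) auto
      qed simp
      then have "T \<in> null_sets lebesgue" by (rule null_sets_completionI)
      then have "emeasure lebesgue ((A n - T) \<union> T) = emeasure lebesgue (A n - T)"
        by (intro emeasure_Un_null_set) (use T(3) in auto)
      moreover have "(A n - T) \<union> T = A n" using T(2) by auto
      ultimately show ?thesis using T(4) by simp
    qed
    note small = this
    have "emeasure lebesgue (A n) = 0"
    proof (cases "emeasure lebesgue (A n)" rule: ennreal_cases)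
      case (real r)
      then show ?thesis using small[of r] by (cases "r = 0") auto
    next
      case top
      then show ?thesis using small[of 1] by simp
    qed
    then show ?thesis using A by (simp add: null_sets_def)
  qed
  then have "AE x in lebesgue. x \<notin> A n" for n using A by (intro AE_not_in) auto
  then have "AE x in lborel. \<forall>n. x \<notin> A n" by (subst AE_all_countable) (simp add: AE_completion_iff)
  then show ?thesis
  proof eventually_elim
    case (elim x)
    obtain n :: nat where "norm x <= real n" using real_arch_simple by blast
    then show ?case using elim[rule_format, of n] by (auto simp: A_def)
  qed
qed

lemma sqi_locally_integrable:
  fixes f :: "R3 => real" assumes "sqiL f"
  shows "integrable lborel (%x. indicator (cball 0 r) x * f x)"
proof -
  have "sqiL (%x::R3. indicator (cball 0 r) x :: real)"
    by (auto simp: sqi_def power2_eq_square indicator_inter_arith[symmetric] intro!: borel_measurable_indicator)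
  then show ?thesis using sqi_inner[of lborel _ f] assms by fastforce
qed

lemma tf_sqi: fixes f :: "R3 => 'b::euclidean_space" assumes "tf f" shows "sqiL f"
proof -
  have "integrable lborel (%x. f x \<bullet> f x)"
    by (intro tf_integrable tf_bilinear1[OF bounded_bilinear_inner] assms tf_smooth)
  then show ?thesis using smooth_borel[OF tf_smooth[OF assms]] by (simp add: sqi_def power2_norm_eq_inner)
qed

lemma fundamental_lemma:
  fixes f :: "R3 => 'b::euclidean_space"
  assumes f: "sqiL f" and V: "open V" and z: "!!\<psi>. tf \<psi> ==> tsupp \<psi> \<subseteq> V ==> ipL f \<psi> = 0"
  shows "AE x in lborel. x \<in> V --> f x = 0"
proof -
  have "AE x in lborel. x \<in> V --> f x \<bullet> b = 0" for b
  proof -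
    have s: "sqiL (%x. f x \<bullet> b)" "sqiL (%x. - (f x \<bullet> b))"
      by (intro sqi_uminus sqi_linear[OF bounded_linear_inner_left] f)+
    have zz: "(\<integral>x. (f x \<bullet> b) * \<psi> x \<partial>lborel) = 0" if "tf \<psi>" "tsupp \<psi> \<subseteq> V" for \<psi>
    proof -
      have "tf (%x. \<psi> x *\<^sub>R b)" by (intro tf_scaleR1 smooth_const that)
      moreover have "tsupp (%x. \<psi> x *\<^sub>R b) \<subseteq> tsupp \<psi>" by (rule tsupp_subset) (auto simp: closed_tsupp tsuppD)
      ultimately show ?thesis using z[of "%x. \<psi> x *\<^sub>R b"] that by (auto simp: ip_def mult.commute)
    qed
    have "AE x in lborel. x \<in> V --> f x \<bullet> b <= 0"
      using s(1) zz by (intro fundamental_pos V sqi_locally_integrable) (auto simp: sqi_def)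
    moreover have "AE x in lborel. x \<in> V --> - (f x \<bullet> b) <= 0"
      using s(2) zz by (intro fundamental_pos V sqi_locally_integrable) (auto simp: sqi_def)
    ultimately show ?thesis by eventually_elim auto
  qed
  then have "AE x in lborel. \<forall>b\<in>Basis. x \<in> V --> f x \<bullet> b = 0"
    by (subst AE_ball_countable) (auto intro: countable_finite)
  then show ?thesis by eventually_elim (auto intro: euclidean_eqI)
qed

section \<open>Averaged translation operators\<close>

lemma nn_integral_shift:
  fixes a :: "'a::euclidean_space"
  assumes [measurable]: "g \<in> borel_measurable borel"
  shows "(\<integral>\<^sup>+x. g (x + a) \<partial>lborel) = (\<integral>\<^sup>+x. g x \<partial>lborel)"
  by (subst (2) lborel_distr_plus[of a, symmetric]) (simp add: nn_integral_distr add.commute)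

lemma fubini:
  fixes f :: "'p::euclidean_space => 'x::euclidean_space => real"
  assumes f[measurable]: "case_prod f \<in> borel_measurable (borel \<Otimes>\<^sub>M borel)"
    and fin: "(\<integral>\<^sup>+p. \<integral>\<^sup>+x. ennreal \<bar>f p x\<bar> \<partial>lborel \<partial>lborel) < \<infinity>"
  shows fubini_swap: "(\<integral>p. \<integral>x. f p x \<partial>lborel \<partial>lborel) = (\<integral>x. \<integral>p. f p x \<partial>lborel \<partial>lborel)"
    and fubini_AE: "AE x in lborel. integrable lborel (%p. f p x)"
    and fubini_integrable: "integrable lborel (%(p, x). f p x)"
    and fubini_pair: "(\<integral>z. (case z of (p, x) => f p x) \<partial>lborel) = (\<integral>p. \<integral>x. f p x \<partial>lborel \<partial>lborel)"
    and fubini_fst: "integrable lborel (%p. \<integral>x. f p x \<partial>lborel)"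
proof -
  have i: "integrable (lborel \<Otimes>\<^sub>M lborel) (case_prod f)"
  proof (rule integrableI_bounded)
    have "(\<integral>\<^sup>+ z. ennreal (norm (case_prod f z)) \<partial>(lborel \<Otimes>\<^sub>M lborel)) = (\<integral>\<^sup>+p. \<integral>\<^sup>+x. ennreal \<bar>f p x\<bar> \<partial>lborel \<partial>lborel)"
      by (subst lborel.nn_integral_fst[symmetric]) simp_all
    then show "(\<integral>\<^sup>+ z. ennreal (norm (case_prod f z)) \<partial>(lborel \<Otimes>\<^sub>M lborel)) < \<infinity>" using fin by simp
  qed simp
  then have i': "integrable (lborel \<Otimes>\<^sub>M lborel) (%(p, x). f p x)" by simp
  show "(\<integral>p. \<integral>x. f p x \<partial>lborel \<partial>lborel) = (\<integral>x. \<integral>p. f p x \<partial>lborel \<partial>lborel)"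
    by (rule lborel_pair.Fubini_integral[OF i, symmetric])
  show "AE x in lborel. integrable lborel (%p. f p x)"
    using lborel_pair.AE_integrable_snd[OF i] .
  show "integrable lborel (%(p, x). f p x)" using i' by (simp add: lborel_prod)
  show "integrable lborel (%p. \<integral>x. f p x \<partial>lborel)"
    using lborel_pair.integrable_fst[OF i] .
  show "(\<integral>z. (case z of (p, x) => f p x) \<partial>lborel) = (\<integral>p. \<integral>x. f p x \<partial>lborel \<partial>lborel)"
    using lborel_pair.integral_fst[OF i] by (simp add: lborel_prod)
qed

text \<open>Writing |w F| as sqrt|w| times sqrt|w| |F|, Cauchy-Schwarz bounds the square of the
  average by W times the |w|-average of F^2. Integrating in x and exchanging integrals leaves only
  the norms of the slices \<open>F p\<close>. Every L2 bound for ray operators below comes from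
  this.\<close>

lemma jensen:
  fixes w :: "'p::euclidean_space => real" and F :: "'p => R3 => real"
  assumes w[measurable]: "w \<in> borel_measurable borel" and F[measurable]: "case_prod F \<in> borel_measurable (borel \<Otimes>\<^sub>M borel)"
    and W: "(\<integral>\<^sup>+p. ennreal \<bar>w p\<bar> \<partial>lborel) <= ennreal W" "0 <= W"
    and V: "(\<integral>\<^sup>+p. ennreal \<bar>w p\<bar> * (\<integral>\<^sup>+x. ennreal ((F p x)\<^sup>2) \<partial>lborel) \<partial>lborel) <= ennreal V" "0 <= V"
  shows jensen_sqi: "sqiL (%x. \<integral>p. w p * F p x \<partial>lborel)"
    and jensen_nrm: "nrmL (%x. \<integral>p. w p * F p x \<partial>lborel) <= sqrt (W * V)"
    and jensen_AE: "AE x in lborel. integrable lborel (%p. w p * F p x)"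
proof -
  define G where "G x = (\<integral>\<^sup>+p. ennreal \<bar>w p * F p x\<bar> \<partial>lborel)" for x
  have [measurable]: "G \<in> borel_measurable borel" unfolding G_def by measurable
  have G2: "(G x)\<^sup>2 <= ennreal W * (\<integral>\<^sup>+p. ennreal (\<bar>w p\<bar> * (F p x)\<^sup>2) \<partial>lborel)" for x
  proof -
    have "(G x)\<^sup>2 = (\<integral>\<^sup>+p. ennreal (sqrt \<bar>w p\<bar>) * ennreal (sqrt \<bar>w p\<bar> * \<bar>F p x\<bar>) \<partial>lborel)\<^sup>2"
      unfolding G_def by (intro arg_cong[where f="%z. z\<^sup>2"] nn_integral_cong)
        (simp add: abs_mult ennreal_mult[symmetric] mult.assoc[symmetric])
    also have "\<dots> <= (\<integral>\<^sup>+p. (ennreal (sqrt \<bar>w p\<bar>))\<^sup>2 \<partial>lborel) * (\<integral>\<^sup>+p. (ennreal (sqrt \<bar>w p\<bar> * \<bar>F p x\<bar>))\<^sup>2 \<partial>lborel)"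
      by (rule Cauchy_Schwarz_nn_integral) simp_all
    also have "\<dots> = (\<integral>\<^sup>+p. ennreal \<bar>w p\<bar> \<partial>lborel) * (\<integral>\<^sup>+p. ennreal (\<bar>w p\<bar> * (F p x)\<^sup>2) \<partial>lborel)"
      by (simp add: ennreal_power power_mult_distrib)
    also have "\<dots> <= ennreal W * (\<integral>\<^sup>+p. ennreal (\<bar>w p\<bar> * (F p x)\<^sup>2) \<partial>lborel)"
      using W by (intro mult_right_mono) auto
    finally show ?thesis .
  qed
  have "(\<integral>\<^sup>+x. (G x)\<^sup>2 \<partial>lborel) <= (\<integral>\<^sup>+x. ennreal W * (\<integral>\<^sup>+p. ennreal (\<bar>w p\<bar> * (F p x)\<^sup>2) \<partial>lborel) \<partial>lborel)"
    by (intro nn_integral_mono G2)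
  also have "\<dots> = ennreal W * (\<integral>\<^sup>+x. (\<integral>\<^sup>+p. ennreal (\<bar>w p\<bar> * (F p x)\<^sup>2) \<partial>lborel) \<partial>lborel)"
    by (rule nn_integral_cmult) measurable
  also have "(\<integral>\<^sup>+x. (\<integral>\<^sup>+p. ennreal (\<bar>w p\<bar> * (F p x)\<^sup>2) \<partial>lborel) \<partial>lborel) =
      (\<integral>\<^sup>+p. (\<integral>\<^sup>+x. ennreal (\<bar>w p\<bar> * (F p x)\<^sup>2) \<partial>lborel) \<partial>lborel)"
    by (rule lborel_pair.Fubini') measurable
  also have "\<dots> = (\<integral>\<^sup>+p. ennreal \<bar>w p\<bar> * (\<integral>\<^sup>+x. ennreal ((F p x)\<^sup>2) \<partial>lborel) \<partial>lborel)"
    by (intro nn_integral_cong, subst nn_integral_cmult[symmetric]) (simp_all add: ennreal_mult)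
  also have "ennreal W * \<dots> <= ennreal W * ennreal V" by (rule mult_left_mono[OF V(1)]) simp
  also have "\<dots> = ennreal (W * V)" using V W by (simp add: ennreal_mult)
  finally have le: "(\<integral>\<^sup>+x. (G x)\<^sup>2 \<partial>lborel) <= ennreal (W * V)" .
  have "AE x in lborel. (G x)\<^sup>2 ~= \<infinity>"
    by (rule nn_integral_noteq_infinite) (use le in \<open>auto simp: top_unique\<close>)
  then show "AE x in lborel. integrable lborel (%p. w p * F p x)"
  proof eventually_elim
    case (elim x)
    then have "G x ~= \<infinity>" by (auto simp: power2_eq_square)
    then have "G x < \<infinity>" by (simp add: less_top)
    then show ?case by (intro integrableI_bounded) (auto simp: G_def)
  qed
  have nb: "ennreal ((norm (\<integral>p. w p * F p x \<partial>lborel))\<^sup>2) <= (G x)\<^sup>2" for x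
  proof (cases "integrable lborel (%p. w p * F p x)")
    case True
    have "ennreal (norm (\<integral>p. w p * F p x \<partial>lborel)) <= G x"
      using integral_norm_bound_ennreal[OF True] by (simp add: G_def)
    then have "(ennreal (norm (\<integral>p. w p * F p x \<partial>lborel)))\<^sup>2 <= (G x)\<^sup>2" by (intro power_mono) auto
    then show ?thesis by (simp only: ennreal_power[OF norm_ge_zero])
  qed (simp add: not_integrable_integral_eq)
  have "(\<integral>\<^sup>+x. ennreal ((norm (\<integral>p. w p * F p x \<partial>lborel))\<^sup>2) \<partial>lborel) <= ennreal (W * V)"
    using order_trans[OF nn_integral_mono[OF nb] le] .
  then have "sqiL (%x. \<integral>p. w p * F p x \<partial>lborel) & nrmL (%x. \<integral>p. w p * F p x \<partial>lborel) <= sqrt (W * V)"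
    using V W by (intro sqi_if_nn_integral) (simp_all add: zero_le_mult_iff)
  then show "sqiL (%x. \<integral>p. w p * F p x \<partial>lborel)" "nrmL (%x. \<integral>p. w p * F p x \<partial>lborel) <= sqrt (W * V)"
    by auto
qed

text \<open>In effect convolution with the image of the measure w dp under -q. The parameter p is
  kept explicit, so that it can be a single direction k or a pair (t, k) of length and
  direction.\<close>

definition aop :: "('p::euclidean_space => real) => ('p => R3) => (R3 => real) => R3 => real" where
  "aop w q h x = (\<integral>p. w p * h (x + q p) \<partial>lborel)"

lemma nn_integral_sqi_shift:
  fixes h :: "R3 => real" assumes "sqiL h"
  shows "(\<integral>\<^sup>+x. ennreal ((h (x + a))\<^sup>2) \<partial>lborel) = ennreal ((nrmL h)\<^sup>2)"
  using nn_integral_sq[OF assms] sqi_measurable[OF assms]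
  by (subst nn_integral_shift[of "%x. ennreal ((h x)\<^sup>2)"]) simp_all

lemma sqi_shift:
  fixes h :: "R3 => real" assumes "sqiL h"
  shows "sqiL (%x. h (x + a))" "nrmL (%x. h (x + a)) = nrmL h"
proof -
  have [measurable]: "h \<in> borel_measurable borel" using sqi_measurable[OF assms] by simp
  have "sqiL (%x. h (x + a)) & nrmL (%x. h (x + a)) <= nrmL h"
    by (rule sqi_if_nn_integral) (simp_all add: nn_integral_sqi_shift assms)
  then show s: "sqiL (%x. h (x + a))" by simp
  have "ennreal ((nrmL (%x. h (x + a)))\<^sup>2) = ennreal ((nrmL h)\<^sup>2)"
    using nn_integral_sq[OF s] nn_integral_sqi_shift[OF assms, of a] by simp
  then show "nrmL (%x. h (x + a)) = nrmL h" by (simp add: power2_eq_iff_nonneg)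
qed

locale averaging =
  fixes w :: "'p::euclidean_space => real" and q :: "'p => R3"
  assumes w_int: "integrable lborel w" and q[measurable]: "q \<in> borel_measurable borel"
begin

lemma w[measurable]: "w \<in> borel_measurable borel" using w_int by (auto dest: borel_measurable_integrable)

definition "W = (\<integral>p. \<bar>w p\<bar> \<partial>lborel)"

lemma W0: "0 <= W" by (simp add: W_def)

lemma nn_W: "(\<integral>\<^sup>+p. ennreal \<bar>w p\<bar> \<partial>lborel) = ennreal W"
  unfolding W_def by (rule nn_integral_eq_integral) (auto simp: w_int)

lemma aop_sqi:
  assumes h: "sqiL h"
  shows "sqiL (aop w q h)" "nrmL (aop w q h) <= W * nrmL h"
    "AE x in lborel. integrable lborel (%p. w p * h (x + q p))"
proof -
  have [measurable]: "h \<in> borel_measurable borel" using sqi_measurable[OF h] by simp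
  have m: "(%(p, x). h (x + q p)) \<in> borel_measurable (borel \<Otimes>\<^sub>M borel)" by measurable
  have V: "(\<integral>\<^sup>+p. ennreal \<bar>w p\<bar> * (\<integral>\<^sup>+x. ennreal ((h (x + q p))\<^sup>2) \<partial>lborel) \<partial>lborel) <= ennreal (W * (nrmL h)\<^sup>2)"
    by (simp add: nn_integral_sqi_shift[OF h] nn_integral_multc nn_W ennreal_mult W0)
  have nn: "0 <= W * (nrmL h)\<^sup>2" by (simp add: W0)
  note J = jensen[where w=w and F="%p x. h (x + q p)" and W=W and V="W * (nrmL h)\<^sup>2", OF w m eq_refl[OF nn_W] W0 V nn]
  show "sqiL (aop w q h)" unfolding aop_def[abs_def] using J(1) .
  show "AE x in lborel. integrable lborel (%p. w p * h (x + q p))" using J(3) .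
  have "sqrt (W * (W * (nrmL h)\<^sup>2)) = W * nrmL h"
    using W0 by (simp add: real_sqrt_mult mult.assoc[symmetric])
  then show "nrmL (aop w q h) <= W * nrmL h" unfolding aop_def[abs_def] using J(2) by simp
qed

text \<open>Fubini, and for each fixed p the substitution x -> x - q p.\<close>

lemma aop_dual:
  assumes h: "sqiL h" and \<phi>: "sqiL \<phi>"
  shows "ipL (aop w q h) \<phi> = ipL h (aop w (%p. - q p) \<phi>)"
proof -
  have [measurable]: "h \<in> borel_measurable borel" "\<phi> \<in> borel_measurable borel"
    using sqi_measurable[OF h] sqi_measurable[OF \<phi>] by simp_all
  have am: "\<bar>a * b\<bar> <= a\<^sup>2 + b\<^sup>2" for a b :: real
  proof -
    have "0 <= (\<bar>a\<bar> - \<bar>b\<bar>)\<^sup>2" by simp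
    then have "2 * (\<bar>a\<bar> * \<bar>b\<bar>) <= a\<^sup>2 + b\<^sup>2" by (simp add: power2_diff)
    moreover have "0 <= \<bar>a\<bar> * \<bar>b\<bar>" by simp
    ultimately show ?thesis unfolding abs_mult by linarith
  qed
  have fin: "(\<integral>\<^sup>+p. \<integral>\<^sup>+x. ennreal \<bar>w p * h (x + q p) * \<phi> x\<bar> \<partial>lborel \<partial>lborel) < \<infinity>"
  proof -
    have "(\<integral>\<^sup>+x. ennreal \<bar>w p * h (x + q p) * \<phi> x\<bar> \<partial>lborel) <=
      ennreal \<bar>w p\<bar> * ennreal ((nrmL h)\<^sup>2 + (nrmL \<phi>)\<^sup>2)" for p
    proof -
      have "(\<integral>\<^sup>+x. ennreal \<bar>w p * h (x + q p) * \<phi> x\<bar> \<partial>lborel) = (\<integral>\<^sup>+x. ennreal \<bar>w p\<bar> * ennreal \<bar>h (x + q p) * \<phi> x\<bar> \<partial>lborel)"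
        by (simp add: abs_mult ennreal_mult mult.assoc)
      also have "\<dots> = ennreal \<bar>w p\<bar> * (\<integral>\<^sup>+x. ennreal \<bar>h (x + q p) * \<phi> x\<bar> \<partial>lborel)"
        by (rule nn_integral_cmult) measurable
      also have "(\<integral>\<^sup>+x. ennreal \<bar>h (x + q p) * \<phi> x\<bar> \<partial>lborel) <= (\<integral>\<^sup>+x. ennreal ((h (x + q p))\<^sup>2) + ennreal ((\<phi> x)\<^sup>2) \<partial>lborel)"
        using am by (intro nn_integral_mono) (simp flip: ennreal_plus)
      also have "\<dots> = ennreal ((nrmL h)\<^sup>2 + (nrmL \<phi>)\<^sup>2)"
        using nn_integral_sq[OF \<phi>] by (simp add: nn_integral_add nn_integral_sqi_shift[OF h])
      finally show ?thesis by (simp add: mult_left_mono)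
    qed
    then have "(\<integral>\<^sup>+p. \<integral>\<^sup>+x. ennreal \<bar>w p * h (x + q p) * \<phi> x\<bar> \<partial>lborel \<partial>lborel) \<le>
      (\<integral>\<^sup>+p. ennreal \<bar>w p\<bar> * ennreal ((nrmL h)\<^sup>2 + (nrmL \<phi>)\<^sup>2) \<partial>lborel)"
      by (rule nn_integral_mono)
    also have "\<dots> = ennreal W * ennreal ((nrmL h)\<^sup>2 + (nrmL \<phi>)\<^sup>2)"
      by (simp add: nn_integral_multc nn_W)
    also have "\<dots> < \<infinity>" by (simp add: ennreal_mult_less_top)
    finally show ?thesis .
  qed
  have fin': "(\<integral>\<^sup>+p. \<integral>\<^sup>+x. ennreal \<bar>h x * (w p * \<phi> (x + - q p))\<bar> \<partial>lborel \<partial>lborel) < \<infinity>"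
  proof -
    have "(\<integral>\<^sup>+x. ennreal \<bar>h x * (w p * \<phi> (x + - q p))\<bar> \<partial>lborel) = (\<integral>\<^sup>+x. ennreal \<bar>w p * h (x + q p) * \<phi> x\<bar> \<partial>lborel)" for p
      using nn_integral_shift[where a="q p" and g="%x. ennreal \<bar>h x * (w p * \<phi> (x + - q p))\<bar>"] by (simp add: mult_ac)
    then show ?thesis using fin by simp
  qed
  have "ipL (aop w q h) \<phi> = (\<integral>x. \<integral>p. w p * h (x + q p) * \<phi> x \<partial>lborel \<partial>lborel)"
    by (simp add: ip_def aop_def)
  also have "\<dots> = (\<integral>p. \<integral>x. w p * h (x + q p) * \<phi> x \<partial>lborel \<partial>lborel)"
    by (rule fubini_swap[where f="%p x. w p * h (x + q p) * \<phi> x", OF _ fin, symmetric]) measurable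
  also have "\<dots> = (\<integral>p. \<integral>x. h x * (w p * \<phi> (x + - q p)) \<partial>lborel \<partial>lborel)"
  proof (rule Bochner_Integration.integral_cong[OF refl])
    fix p
    show "(\<integral>x. w p * h (x + q p) * \<phi> x \<partial>lborel) = (\<integral>x. h x * (w p * \<phi> (x + - q p)) \<partial>lborel)"
      using integral_shift[where a="q p" and f="%x. h x * (w p * \<phi> (x + - q p))"] by (simp add: mult_ac)
  qed
  also have "\<dots> = (\<integral>x. \<integral>p. h x * (w p * \<phi> (x + - q p)) \<partial>lborel \<partial>lborel)"
    by (rule fubini_swap[where f="%p x. h x * (w p * \<phi> (x + - q p))", OF _ fin']) measurable
  also have "\<dots> = ipL h (aop w (%p. - q p) \<phi>)"
    by (simp add: ip_def aop_def)
  finally show ?thesis .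
qed

lemma aop_integrable_tf:
  assumes "tf \<phi>" shows "integrable lborel (%p. w p * \<phi> (x + q p))"
proof -
  obtain B where B: "B > 0" "!!x. norm (\<phi> x) <= B" using tf_bounded[OF assms] by blast
  have [measurable]: "\<phi> \<in> borel_measurable borel" by (rule smooth_borel[OF tf_smooth[OF assms]])
  show ?thesis
  proof (rule Bochner_Integration.integrable_bound)
    show "integrable lborel (%p. B * \<bar>w p\<bar>)" using w_int by simp
    show "AE p in lborel. norm (w p * \<phi> (x + q p)) <= norm (B * \<bar>w p\<bar>)"
    proof (rule AE_I2)
      fix p
      have "\<bar>w p\<bar> * \<bar>\<phi> (x + q p)\<bar> <= \<bar>w p\<bar> * B" using B(2) by (intro mult_left_mono) auto
      then show "norm (w p * \<phi> (x + q p)) <= norm (B * \<bar>w p\<bar>)" using B(1) by (simp add: abs_mult mult.commute)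
    qed
  qed measurable
qed

text \<open>The quadratic Taylor bound for \<phi> is uniform in the base point and so integrates
  against |w|, which gives an explicit error W C |h|^2.\<close>

lemma aop_has_derivative:
  assumes \<phi>: "tf \<phi>"
  shows "(aop w q \<phi> has_derivative (%h. \<Sum>j\<in>UNIV. h $ j *\<^sub>R aop w q (pd j \<phi>) x)) (at x)"
proof -
  obtain C where C: "C > 0" "!!(x::R3) (h::R3). norm (\<phi> (x + h) - \<phi> x - (\<Sum>j\<in>UNIV. h $ j *\<^sub>R pd j \<phi> x)) <= C * (norm h)\<^sup>2"
    using tf_taylor[OF \<phi>] by blast
  have est: "norm (aop w q \<phi> (x + h) - aop w q \<phi> x - (\<Sum>j\<in>UNIV. h $ j *\<^sub>R aop w q (pd j \<phi>) x)) <= (W * C) * (norm h)\<^sup>2" for h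
  proof -
    note i = aop_integrable_tf[OF \<phi>] aop_integrable_tf[OF tf_pd[OF \<phi>]]
    have "aop w q \<phi> (x + h) - aop w q \<phi> x - (\<Sum>j\<in>UNIV. h $ j *\<^sub>R aop w q (pd j \<phi>) x) =
      (\<integral>p. w p * (\<phi> ((x + q p) + h) - \<phi> (x + q p) - (\<Sum>j\<in>UNIV. h $ j *\<^sub>R pd j \<phi> (x + q p))) \<partial>lborel)"
    proof -
      have "(\<Sum>j\<in>UNIV. h $ j *\<^sub>R aop w q (pd j \<phi>) x) = (\<integral>p. (\<Sum>j\<in>UNIV. h $ j * (w p * pd j \<phi> (x + q p))) \<partial>lborel)"
        using i by (simp add: aop_def)
      moreover have "integrable lborel (%p. \<Sum>j\<in>UNIV. h $ j * (w p * pd j \<phi> (x + q p)))"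
        using i by simp
      ultimately have "aop w q \<phi> (x + h) - aop w q \<phi> x - (\<Sum>j\<in>UNIV. h $ j *\<^sub>R aop w q (pd j \<phi>) x) =
        (\<integral>p. w p * \<phi> (x + h + q p) - w p * \<phi> (x + q p) - (\<Sum>j\<in>UNIV. h $ j * (w p * pd j \<phi> (x + q p))) \<partial>lborel)"
        using i(1)[of "x + h"] i(1)[of x] by (simp add: aop_def)
      then show ?thesis by (simp add: algebra_simps sum_distrib_left)
    qed
    also have "norm \<dots> <= (\<integral>p. \<bar>w p\<bar> * (C * (norm h)\<^sup>2) \<partial>lborel)"
    proof (rule order_trans[OF integral_norm_bound], rule integral_mono')
      show "integrable lborel (%p. \<bar>w p\<bar> * (C * (norm h)\<^sup>2))" using w_int by simp
      show "norm (w p * (\<phi> ((x + q p) + h) - \<phi> (x + q p) - (\<Sum>j\<in>UNIV. h $ j *\<^sub>R pd j \<phi> (x + q p)))) <= \<bar>w p\<bar> * (C * (norm h)\<^sup>2)" for p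
        unfolding norm_mult using C(2)[of "x + q p" h] by (intro mult_mono) auto
    qed (use C(1) in auto)
    finally show ?thesis by (simp add: W_def mult_ac)
  qed
  have bl: "bounded_linear (%h::R3. \<Sum>j\<in>UNIV. h $ j *\<^sub>R aop w q (pd j \<phi>) x)"
    by (intro bounded_linear_sum bounded_linear_scaleR_const bounded_linear_vec_nth)
  show ?thesis
    unfolding has_derivative_at
  proof (intro conjI bl)
    show "(%h. norm (aop w q \<phi> (x + h) - aop w q \<phi> x - (\<Sum>j\<in>UNIV. h $ j *\<^sub>R aop w q (pd j \<phi>) x)) / norm h) \<midarrow>0\<rightarrow> 0"
    proof (rule Lim_null_comparison)
      show "\<forall>\<^sub>F h in at 0. norm (norm (aop w q \<phi> (x + h) - aop w q \<phi> x - (\<Sum>j\<in>UNIV. h $ j *\<^sub>R aop w q (pd j \<phi>) x)) / norm h) <= W * C * norm h"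
        using est by (auto simp: eventually_at_filter divide_le_eq power2_eq_square mult.assoc intro!: always_eventually)
      show "(%h::R3. W * C * norm h) \<midarrow>0\<rightarrow> 0" by (auto intro!: tendsto_eq_intros)
    qed
  qed
qed

lemma aop_pd: "tf \<phi> ==> pd j (aop w q \<phi>) = aop w q (pd j \<phi>)"
proof
  fix x assume "tf \<phi>"
  have "pd j (aop w q \<phi>) x = (\<Sum>i\<in>UNIV. (axis j 1 :: R3) $ i *\<^sub>R aop w q (pd i \<phi>) x)"
    by (rule pd_eq[OF aop_has_derivative[OF \<open>tf \<phi>\<close>]])
  also have "\<dots> = (\<Sum>i\<in>UNIV. if i = j then aop w q (pd i \<phi>) x else 0)"
    by (intro sum.cong) (auto simp: axis_def)
  finally show "pd j (aop w q \<phi>) x = aop w q (pd j \<phi>) x" by simp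
qed

lemma aop_smooth: "tf \<phi> ==> smooth (aop w q \<phi>)"
proof -
  have "ck n (aop w q \<phi>)" if "tf \<phi>" for n \<phi>
    using that
  proof (induction n arbitrary: \<phi>)
    case (Suc n)
    then show ?case using aop_has_derivative[OF Suc.prems]
      by (auto simp: differentiable_def aop_pd tf_pd)
  qed (use aop_has_derivative in \<open>auto simp: differentiable_def\<close>)
  then show "tf \<phi> ==> smooth (aop w q \<phi>)" by (simp add: smooth_iff_ck)
qed

lemma aop_support:
  assumes S: "compact S" "!!p. w p ~= 0 ==> - q p \<in> S" and \<phi>: "!!x. x \<notin> K ==> \<phi> x = 0"
    and x: "x \<notin> {y + s | y s. y \<in> K & s \<in> S}"
  shows "aop w q \<phi> x = 0"
proof -
  have z: "w p * \<phi> (x + q p) = 0" for p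
  proof (cases "w p = 0")
    case False
    then have "x + q p \<notin> K" using S(2)[of p] x by (auto simp: algebra_simps)
    then show ?thesis using \<phi> by simp
  qed simp
  show ?thesis unfolding aop_def z by simp
qed

lemma aop_tf:
  assumes S: "compact S" "!!p. w p ~= 0 ==> - q p \<in> S" and \<phi>: "tf \<phi>"
  shows "tf (aop w q \<phi>) & tsupp (aop w q \<phi>) \<subseteq> {y + s | y s. y \<in> tsupp \<phi> & s \<in> S}"
proof -
  have c: "compact {y + s | y s. y \<in> tsupp \<phi> & s \<in> S}"
    by (intro compact_sums S tf_compact \<phi>)
  have z: "aop w q \<phi> x = 0" if "x \<notin> {y + s | y s. y \<in> tsupp \<phi> & s \<in> S}" for x
    by (rule aop_support[OF S _ that]) (auto intro: tsuppD)
  show ?thesis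
    using tfI[OF aop_smooth[OF \<phi>] c z] tsupp_subset[OF compact_imp_closed[OF c], of "aop w q \<phi>", OF z] by simp
qed

end

section \<open>Averages along the rays t k with t in [0, T]\<close>

definition ray :: "real \<times> R3 => R3" where "ray p = fst p *\<^sub>R snd p"

lemma ray_measurable[measurable]: "ray \<in> borel_measurable borel"
  unfolding ray_def[abs_def] by (intro borel_measurable_continuous_onI continuous_intros)

text \<open>Density in ray coordinates p = (t, k). The exponent m counts the powers of t available
  to pay for derivatives, see \<open>Iop_rule2\<close>.\<close>

definition Wt :: "real => nat => (R3 => real) => real \<times> R3 => real" where
  "Wt T m \<eta> p = indicator {0..T} (fst p) * fst p ^ m * \<eta> (snd p)"

text \<open>\<open>Iop\<close> acts on test functions and pushes their supports forward along the
  directions k; \<open>Jop\<close> below is its L2 adjoint and acts on the rough sequences.\<close>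

definition Iop :: "real => nat => (R3 => real) => (R3 => real) => R3 => real" where
  "Iop T m \<eta> = aop (Wt T m \<eta>) (%p. - ray p)"

definition Jop :: "real => nat => (R3 => real) => (R3 => real) => R3 => real" where
  "Jop T m \<eta> = aop (Wt T m \<eta>) ray"

definition rays :: "real => R3 set => R3 set" where
  "rays T K = {t *\<^sub>R k | t k. t \<in> {0..T} & k \<in> K}"

lemma compact_rays: "compact K ==> compact (rays T K)"
proof -
  assume "compact K"
  have "rays T K = (%p. fst p *\<^sub>R snd p) ` ({0..T} \<times> K)" by (force simp: rays_def)
  then show ?thesis using \<open>compact K\<close>
    by (simp only:) (intro compact_continuous_image continuous_intros compact_Times compact_Icc)
qed

lemma integrable_product:
  fixes f :: "real => real" and g :: "R3 => real"
  assumes f: "integrable lborel f" and g: "integrable lborel g"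
  shows "integrable lborel (%p. f (fst p) * g (snd p))"
proof -
  have [measurable]: "f \<in> borel_measurable borel" "g \<in> borel_measurable borel"
    using f g by (auto dest: borel_measurable_integrable)
  have "integrable lborel (%(t, k). f t * g k)"
  proof (rule fubini_integrable)
    have "(\<integral>\<^sup>+t. \<integral>\<^sup>+k. ennreal \<bar>f t * g k\<bar> \<partial>lborel \<partial>lborel) = (\<integral>\<^sup>+t. ennreal \<bar>f t\<bar> \<partial>lborel) * (\<integral>\<^sup>+k. ennreal \<bar>g k\<bar> \<partial>lborel)"
      by (simp add: abs_mult ennreal_mult nn_integral_cmult nn_integral_multc)
    also have "\<dots> < \<infinity>" using f g by (simp add: integrable_iff_bounded ennreal_mult_less_top)
    finally show "(\<integral>\<^sup>+t. \<integral>\<^sup>+k. ennreal \<bar>f t * g k\<bar> \<partial>lborel \<partial>lborel) < \<infinity>" .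
  qed measurable
  then show ?thesis by (simp add: case_prod_beta')
qed

lemma integrable_Icc_power: "integrable lborel (%t. indicator {0..T} t * t ^ m :: real)"
  using borel_integrable_compact[of "{0..T}" "%t::real. t ^ m"] by (simp add: continuous_intros)

lemma integrable_powr:
  assumes "a > -1" shows "integrable lborel (%t. indicator {0<..T} t * t powr a :: real)"
proof (cases "T >= 0")
  case True
  have m: "(%t. indicator {0<..T} t * t powr a) \<in> borel_measurable borel" by measurable
  have "((%t. t powr a) has_integral (T powr (a + 1) / (a + 1))) {0..T}"
    using has_integral_powr_from_0[OF assms True] .
  then have "((%t. indicator {0<..T} t * t powr a) has_integral (T powr (a + 1) / (a + 1))) {0..T}"
    by (rule has_integral_spike_finite[of "{0}", rotated -1]) (auto simp: indicator_def)
  then have "((%t. if t \<in> {0..T} then indicator {0<..T} t * t powr a else 0) has_integral (T powr (a + 1) / (a + 1))) UNIV"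
    by (simp only: has_integral_restrict_UNIV)
  moreover have "(%t. if t \<in> {0..T} then indicator {0<..T} t * t powr a else 0) = (%t. indicator {0<..T} t * t powr a)"
    by (auto simp: indicator_def)
  ultimately have "((%t. indicator {0<..T} t * t powr a) has_integral (T powr (a + 1) / (a + 1))) UNIV" by simp
  then have "(\<integral>\<^sup>+t. ennreal (indicator {0<..T} t * t powr a) \<partial>lborel) = ennreal (T powr (a + 1) / (a + 1))"
    using m by (intro nn_integral_has_integral_lborel) auto
  then show ?thesis using m by (intro integrableI_nonneg) auto
qed (simp add: greaterThanAtMost_empty)

lemma Wt_integrable: "tf \<eta> ==> integrable lborel (Wt T m \<eta>)"
  unfolding Wt_def[abs_def]
  using integrable_product[OF integrable_Icc_power tf_integrable, of \<eta> T m] by simp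

lemma averaging_Wt: "tf \<eta> ==> averaging (Wt T m \<eta>) ray" "tf \<eta> ==> averaging (Wt T m \<eta>) (%p. - ray p)"
  by (auto simp: averaging_def Wt_integrable)

lemma averaging_fixed: "tf \<eta> ==> averaging \<eta> (%k. t *\<^sub>R k)"
  by (auto simp: averaging_def tf_integrable)

lemma Wt_support: "Wt T m \<eta> p ~= 0 ==> ray p \<in> rays T (tsupp \<eta>)"
  using tsuppD[of "snd p" \<eta>] by (auto simp: Wt_def rays_def ray_def indicator_def split: if_splits)

lemma Iop_tf: assumes "tf \<eta>" "tf \<phi>"
  shows "tf (Iop T m \<eta> \<phi>)" "tsupp (Iop T m \<eta> \<phi>) \<subseteq> {y + s | y s. y \<in> tsupp \<phi> & s \<in> rays T (tsupp \<eta>)}"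
  using averaging.aop_tf[OF averaging_Wt(2)[OF assms(1)] compact_rays[OF tf_compact[OF assms(1)], of T] _ assms(2)]
    Wt_support[of T m \<eta>] by (auto simp: Iop_def)

lemma Iop_pd: "tf \<eta> ==> tf \<phi> ==> pd j (Iop T m \<eta> \<phi>) = Iop T m \<eta> (pd j \<phi>)"
  unfolding Iop_def by (rule averaging.aop_pd[OF averaging_Wt(2)])

lemma Jop_sqi: "tf \<eta> ==> sqiL h ==> sqiL (Jop T m \<eta> h)"
  unfolding Jop_def by (rule averaging.aop_sqi(1)[OF averaging_Wt(1)])

lemma Jop_bounded: assumes "tf \<eta>" obtains C where "C >= 0" "!!h. sqiL h ==> nrmL (Jop T m \<eta> h) <= C * nrmL h"
  by (rule that[OF averaging.W0[OF averaging_Wt(1)[OF assms, of T m]]])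
     (simp add: Jop_def averaging.aop_sqi(2)[OF averaging_Wt(1)[OF assms]])

lemma Jop_dual: "tf \<eta> ==> sqiL h ==> sqiL \<phi> ==> ipL (Jop T m \<eta> h) \<phi> = ipL h (Iop T m \<eta> \<phi>)"
  unfolding Jop_def Iop_def by (rule averaging.aop_dual[OF averaging_Wt(1)])

lemma Jop_support:
  assumes \<eta>: "tf \<eta>" and h: "!!x. x \<notin> cball 0 r ==> h x = 0" and S: "rays T (tsupp \<eta>) \<subseteq> cball 0 s" and x: "x \<notin> cball 0 (r + s)"
  shows "Jop T m \<eta> h x = 0"
  unfolding Jop_def
proof (rule averaging.aop_support[OF averaging_Wt(1)[OF \<eta>], where K="cball 0 r" and S="cball 0 s"])
  show "- ray p \<in> cball 0 s" if "Wt T m \<eta> p ~= 0" for p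
    using Wt_support[OF that] S by auto
  show "x \<notin> {y + z |y z. y \<in> cball 0 r & z \<in> cball 0 s}"
    using x norm_triangle_mono by fastforce
qed (use h in auto)

lemma iterated:
  assumes "integrable lborel (%p. Wt T m \<eta> p * f (ray p))"
  shows "integrable lborel (%t. indicator {0..T} t * t ^ m * (\<integral>k. \<eta> k * f (t *\<^sub>R k) \<partial>lborel))"
    and "(\<integral>p. Wt T m \<eta> p * f (ray p) \<partial>lborel) = (\<integral>t. indicator {0..T} t * t ^ m * (\<integral>k. \<eta> k * f (t *\<^sub>R k) \<partial>lborel) \<partial>lborel)"
proof -
  have i: "integrable (lborel \<Otimes>\<^sub>M lborel) (%(t, k). Wt T m \<eta> (t, k) * f (ray (t, k)))"
    using assms by (simp add: lborel_prod case_prod_beta')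
  have e: "(\<integral>k. Wt T m \<eta> (t, k) * f (ray (t, k)) \<partial>lborel) = indicator {0..T} t * t ^ m * (\<integral>k. \<eta> k * f (t *\<^sub>R k) \<partial>lborel)" for t
    by (simp add: Wt_def ray_def mult.assoc)
  show "integrable lborel (%t. indicator {0..T} t * t ^ m * (\<integral>k. \<eta> k * f (t *\<^sub>R k) \<partial>lborel))"
    using lborel_pair.integrable_fst[OF i] by (simp add: e)
  show "(\<integral>p. Wt T m \<eta> p * f (ray p) \<partial>lborel) = (\<integral>t. indicator {0..T} t * t ^ m * (\<integral>k. \<eta> k * f (t *\<^sub>R k) \<partial>lborel) \<partial>lborel)"
    using lborel_pair.integral_fst[OF i] by (simp add: e lborel_prod case_prod_beta')
qed

lemma ck_affine: "ck n f ==> ck n (%x. f (a + c *\<^sub>R x))"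
  and pd_affine: "(!!x. (f :: R3 => real) differentiable (at x)) ==> pd j (%x. f (a + c *\<^sub>R x)) = (%x. c * pd j f (a + c *\<^sub>R x))"
proof -
  have D: "((%x. f (a + c *\<^sub>R x)) has_derivative (%h. frechet_derivative f (at (a + c *\<^sub>R x)) (c *\<^sub>R h))) (at x)"
    if "!!x. f differentiable (at x)" for f :: "R3 => real" and x
  proof (rule has_derivative_compose[of "%x. a + c *\<^sub>R x" "%h. c *\<^sub>R h" x UNIV f, OF _ has_derivative_frechet[OF that]])
    show "((%x. a + c *\<^sub>R x) has_derivative (%h. c *\<^sub>R h)) (at x)"
      by (auto intro!: derivative_eq_intros)
  qed
  show pd: "pd j (%x. f (a + c *\<^sub>R x)) = (%x. c * pd j f (a + c *\<^sub>R x))" if "!!x. f differentiable (at x)" for f :: "R3 => real" and j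
    by (rule ext, subst pd_eq[OF D[OF that]]) (simp add: pd_def linear_scale[OF linear_frechet_derivative[OF that]])
  show "ck n f ==> ck n (%x. f (a + c *\<^sub>R x))"
  proof (induction n arbitrary: f)
    case 0
    then show ?case using D[of f] by (auto simp: differentiable_def)
  next
    case (Suc n)
    then have d: "!!x. f differentiable (at x)" by simp
    then have "(%x. f (a + c *\<^sub>R x)) differentiable (at x)" for x using D[of f x] unfolding differentiable_def by blast
    moreover have "ck n (%x. c * pd j f (a + c *\<^sub>R x))" for j
      using Suc by (intro ck_linear[OF bounded_linear_mult_right]) auto
    ultimately show ?case using pd[OF d] by simp
  qed
qed

text \<open>The gradient of \<phi>(y - t k) in k is -t times the gradient of \<phi>; so integrating
  by parts in the direction variable moves a derivative onto \<eta> and consumes one factor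
  t.\<close>

lemma direction_by_parts:
  assumes \<eta>: "tf \<eta>" and \<phi>: "tf \<phi>"
  shows "t * (\<integral>k. \<eta> k * pd j \<phi> (y - t *\<^sub>R k) \<partial>lborel) = (\<integral>k. pd j \<eta> k * \<phi> (y - t *\<^sub>R k) \<partial>lborel)"
proof -
  have s: "smooth (%k. \<phi> (y + (- t) *\<^sub>R k))"
    using tf_smooth[OF \<phi>] by (simp only: smooth_iff_ck) (blast intro: ck_affine)
  have "(\<integral>k. pd j \<eta> k * \<phi> (y + (- t) *\<^sub>R k) \<partial>lborel) = - (\<integral>k. \<eta> k * pd j (%k. \<phi> (y + (- t) *\<^sub>R k)) k \<partial>lborel)"
    by (rule integration_by_parts[OF \<eta> s])
  also have "pd j (%k. \<phi> (y + (- t) *\<^sub>R k)) = (%k. (- t) * pd j \<phi> (y + (- t) *\<^sub>R k))"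
    by (rule pd_affine[OF smooth_differentiable[OF tf_smooth[OF \<phi>]]])
  also have "- (\<integral>k. \<eta> k * ((- t) * pd j \<phi> (y + (- t) *\<^sub>R k)) \<partial>lborel) = t * (\<integral>k. \<eta> k * pd j \<phi> (y + (- t) *\<^sub>R k) \<partial>lborel)"
    by (simp add: mult.left_commute)
  finally show ?thesis by simp
qed

lemma Iop_iterated:
  assumes "tf \<eta>" "tf \<phi>"
  shows "Iop T m \<eta> \<phi> y = (\<integral>t. indicator {0..T} t * t ^ m * (\<integral>k. \<eta> k * \<phi> (y - t *\<^sub>R k) \<partial>lborel) \<partial>lborel)"
    "integrable lborel (%t. indicator {0..T} t * t ^ m * (\<integral>k. \<eta> k * \<phi> (y - t *\<^sub>R k) \<partial>lborel))"
  using iterated[of T m \<eta> "%z. \<phi> (y - z)"] averaging.aop_integrable_tf[OF averaging_Wt(2)[OF assms(1)] assms(2), of T m y]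
  by (simp_all add: Iop_def aop_def)

lemma Iop_rule2:
  assumes "tf \<eta>" "tf \<phi>" shows "Iop T (Suc m) \<eta> (pd j \<phi>) = Iop T m (pd j \<eta>) \<phi>"
proof
  fix y
  show "Iop T (Suc m) \<eta> (pd j \<phi>) y = Iop T m (pd j \<eta>) \<phi> y"
    unfolding Iop_iterated(1)[OF assms(1) tf_pd[OF assms(2)]] Iop_iterated(1)[OF tf_pd[OF assms(1)] assms(2)]
      direction_by_parts[OF assms, symmetric] by (simp add: mult_ac)
qed

text \<open>A Hoelder modulus of order 1/4 in L2, written for squared norms. The square root of |y|
  is what remains after \<open>min1_le_sqrt\<close> has reduced the dependence on 1/t to an
  integrable power.\<close>

definition hold :: "real => (R3 => 'b::euclidean_space) => bool" where
  "hold B Z \<longleftrightarrow> sqiL Z & (\<forall>y. (nrmL (%x. Z (x + y) - Z x))\<^sup>2 <= B * sqrt (norm y))"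

lemma min1_le_sqrt:
  fixes z :: real assumes "0 <= z" shows "(min 1 z)\<^sup>2 <= sqrt z"
proof (cases "z <= 1")
  case True
  have "z\<^sup>2 <= z" using True assms by (simp add: power2_eq_square mult_left_le)
  also have "z <= sqrt z" using True assms
    by (metis mult_left_le real_sqrt_ge_0_iff real_sqrt_le_1_iff real_sqrt_mult_self abs_of_nonneg)
  finally show ?thesis using True by simp
qed (use assms in simp)

text \<open>Used for interpolation: one bound carries the Hoelder modulus, the other the small
  norm.\<close>

lemma min_le_geometric:
  fixes x a b :: real assumes "0 <= x" "x <= a" "x <= b" shows "x <= sqrt (a * b)"
proof -
  have "x * x <= a * b" using assms by (intro mult_mono) auto
  then show ?thesis using assms(1) real_le_rsqrt[of x "a * b"] by (simp add: power2_eq_square)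
qed

text \<open>Short shifts are handled by the Lipschitz bound on a fixed ball, long ones by the
  triangle inequality.\<close>

lemma tf_kernel_shift:
  assumes \<eta>: "tf \<eta>"
  obtains L where "L >= 0" "!!y::R3. (\<integral>k. \<bar>\<eta> (k + y) - \<eta> k\<bar> \<partial>lborel) <= L * min 1 (norm y)"
proof -
  obtain C where C: "C > 0" "!!x y. norm (\<eta> x - \<eta> y) <= C * norm (x - y)" using tf_lipschitz[OF \<eta>] by blast
  obtain r where r: "r > 0" "!!x. x \<notin> cball 0 r ==> \<eta> x = 0" using tf_support[OF \<eta>] by blast
  define E where "E = (\<integral>k. \<bar>\<eta> k\<bar> \<partial>lborel)"
  define V where "V = measure lborel (cball (0::R3) (r + 1))"
  have [measurable]: "\<eta> \<in> borel_measurable borel" by (rule smooth_borel[OF tf_smooth[OF \<eta>]])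
  have i: "integrable lborel (%k. \<bar>\<eta> k\<bar>)" using tf_integrable[OF \<eta>] by simp
  have iy: "integrable lborel (%k. \<bar>\<eta> (k + y)\<bar>)" for y using tf_integrable[OF tf_shift[OF \<eta>]] by simp
  have E0: "0 <= E" "0 <= C * V" using C by (auto simp: E_def V_def)
  show ?thesis
  proof (rule that[of "2 * E + C * V"])
    fix y :: R3
    have a: "(\<integral>k. \<bar>\<eta> (k + y) - \<eta> k\<bar> \<partial>lborel) <= 2 * E"
    proof -
      have "(\<integral>k. \<bar>\<eta> (k + y) - \<eta> k\<bar> \<partial>lborel) <= (\<integral>k. \<bar>\<eta> (k + y)\<bar> + \<bar>\<eta> k\<bar> \<partial>lborel)"
        using i iy by (intro integral_mono') auto
      also have "\<dots> = 2 * E" using i iy[of y] integral_shift[of "%k. \<bar>\<eta> k\<bar>" y] by (simp add: E_def)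
      finally show ?thesis .
    qed
    have b: "(\<integral>k. \<bar>\<eta> (k + y) - \<eta> k\<bar> \<partial>lborel) <= C * norm y * V" if "norm y <= 1"
    proof -
      have "norm (\<integral>k. \<bar>\<eta> (k + y) - \<eta> k\<bar> \<partial>lborel) <= C * norm y * V"
        unfolding V_def
      proof (rule norm_integral_le_measure)
        fix k
        show "norm \<bar>\<eta> (k + y) - \<eta> k\<bar> <= C * norm y * indicator (cball 0 (r + 1)) k"
        proof (cases "k \<in> cball 0 (r + 1)")
          case False
          then have "norm k > r + 1" by auto
          moreover have "norm k <= norm (k + y) + norm y" using norm_triangle_ineq4[of "k + y" y] by simp
          ultimately show ?thesis using r(2)[of k] r(2)[of "k + y"] that r(1) False by simp
        qed (use C(2)[of "k + y" k] in simp)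
      qed auto
      then show ?thesis by simp
    qed
    show "(\<integral>k. \<bar>\<eta> (k + y) - \<eta> k\<bar> \<partial>lborel) <= (2 * E + C * V) * min 1 (norm y)"
    proof (cases "norm y <= 1")
      case True
      have "C * norm y * V <= (2 * E + C * V) * norm y" using E0 by (simp add: algebra_simps)
      then show ?thesis using b[OF True] True by simp
    qed (use a E0 in simp)
  qed (use E0 in simp)
qed

lemma Jop_iterated:
  assumes \<eta>: "tf \<eta>" and h: "sqiL h"
  shows "AE x in lborel. integrable lborel (%t. indicator {0..T} t * t ^ m * aop \<eta> (%k. t *\<^sub>R k) h x)
     & Jop T m \<eta> h x = (\<integral>t. indicator {0..T} t * t ^ m * aop \<eta> (%k. t *\<^sub>R k) h x \<partial>lborel)"
  using averaging.aop_sqi(3)[OF averaging_Wt(1)[OF \<eta>] h, of T m]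
proof eventually_elim
  case (elim x)
  then show ?case using iterated[of T m \<eta> "%z. h (x + z)"] by (simp add: Jop_def aop_def)
qed

lemma AE_shift:
  fixes a :: R3 assumes "AE x in lborel. P x" shows "AE x in lborel. P (x + a)"
proof -
  obtain N where N: "{x \<in> space lborel. \<not> P x} \<subseteq> N" "N \<in> null_sets lborel"
    using assms by (auto simp: eventually_ae_filter)
  then have [measurable]: "N \<in> sets borel" by auto
  have "AE x in lborel. x \<notin> N" using N(2) by (rule AE_not_in)
  then have "AE x in distr lborel borel ((+) a). x \<notin> N" by (subst lborel_distr_plus)
  then have "AE x in lborel. a + x \<notin> N" by (subst (asm) AE_distr_iff) measurable
  then show ?thesis by eventually_elim (use N(1) in \<open>auto simp: add.commute\<close>)
qed

lemma aop_joint_measurable: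
  assumes [measurable]: "\<eta> \<in> borel_measurable borel" "h \<in> borel_measurable borel"
  shows "(%(t, x). aop \<eta> (%k. t *\<^sub>R k) h (x + y)) \<in> borel_measurable (borel \<Otimes>\<^sub>M borel)"
  unfolding aop_def by measurable

text \<open>At fixed length t, translating the slice by y is the same as translating \<eta> by y/t,
  so the slice changes by at most L min(1, |y|/t) times the norm of h. The square is at most a
  multiple of |y|^(1/2) t^(-1/2), and t^(-1/2) is integrable at 0.\<close>

lemma Jop_hold:
  assumes \<eta>: "tf \<eta>"
  obtains C where "C >= 0" "!!h. sqiL h ==> hold (C * (nrmL h)\<^sup>2) (Jop T m \<eta> h)"
proof -
  obtain L where L: "L >= 0" "!!y::R3. (\<integral>k. \<bar>\<eta> (k + y) - \<eta> k\<bar> \<partial>lborel) <= L * min 1 (norm y)"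
    using tf_kernel_shift[OF \<eta>] by blast
  have [measurable]: "\<eta> \<in> borel_measurable borel" by (rule smooth_borel[OF tf_smooth[OF \<eta>]])
  define w where "w t = indicator {0..T} t * t ^ m" for t :: real
  have w: "integrable lborel w" unfolding w_def[abs_def] by (rule integrable_Icc_power)
  have [measurable]: "w \<in> borel_measurable borel" using w by (auto dest: borel_measurable_integrable)
  define W where "W = (\<integral>t. \<bar>w t\<bar> \<partial>lborel)"
  have W: "(\<integral>\<^sup>+t. ennreal \<bar>w t\<bar> \<partial>lborel) = ennreal W" "0 <= W"
    unfolding W_def using w by (auto intro: nn_integral_eq_integral)
  \<comment> \<open>Integrable majorant in t for the weight times the squared change of the
    slices.\<close>
  define v where "v t = \<bar>T\<bar> ^ m * (indicator {0<..T} t * t powr (-1/2))" for t :: real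
  have v: "integrable lborel v" unfolding v_def[abs_def] using integrable_powr[of "-1/2" T] by simp
  have v0: "0 <= v t" for t by (simp add: v_def)
  define Vv where "Vv = (\<integral>t. v t \<partial>lborel)"
  have Vv: "(\<integral>\<^sup>+t. ennreal (v t) \<partial>lborel) = ennreal Vv" "0 <= Vv"
    unfolding Vv_def using v v0 by (auto intro: nn_integral_eq_integral)
  show ?thesis
  proof (rule that[of "W * Vv * L\<^sup>2"])
    fix h :: "R3 => real" assume h: "sqiL h"
    have [measurable]: "h \<in> borel_measurable borel" using sqi_measurable[OF h] by simp
    define N where "N = nrmL h"
    have main: "(nrmL (%x. Jop T m \<eta> h (x + y) - Jop T m \<eta> h x))\<^sup>2 <= W * (Vv * L\<^sup>2 * N\<^sup>2 * sqrt (norm y))" for y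
    proof -
      define F where "F t x = aop \<eta> (%k. t *\<^sub>R k) h (x + y) - aop \<eta> (%k. t *\<^sub>R k) h x" for t x
      have mF: "case_prod F \<in> borel_measurable (borel \<Otimes>\<^sub>M borel)"
        using aop_joint_measurable[of \<eta> h y] aop_joint_measurable[of \<eta> h 0] unfolding F_def by simp
      have est: "sqiL (F t) & nrmL (F t) <= L * min 1 (norm y / t) * N" if t: "t > 0" for t
      proof -
        let ?\<eta> = "%k. \<eta> (k - (1 / t) *\<^sub>R y)"
        have tf': "tf ?\<eta>" using tf_shift[OF \<eta>, of "- ((1 / t) *\<^sub>R y)"] by simp
        interpret d: averaging "%k. ?\<eta> k - \<eta> k" "%k. t *\<^sub>R k"
          by (rule averaging_fixed[OF tf_diff[OF tf' \<eta>]])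
        have "AE x in lborel. F t x = aop (%k. ?\<eta> k - \<eta> k) (%k. t *\<^sub>R k) h x"
          using averaging.aop_sqi(3)[OF averaging_fixed[OF tf', of t] h] averaging.aop_sqi(3)[OF averaging_fixed[OF \<eta>, of t] h]
        proof eventually_elim
          case (elim x)
          have "aop \<eta> (%k. t *\<^sub>R k) h (x + y) = (\<integral>k. ?\<eta> (k + (1 / t) *\<^sub>R y) * h (x + t *\<^sub>R (k + (1 / t) *\<^sub>R y)) \<partial>lborel)"
            using t by (simp add: aop_def scaleR_add_right add_ac)
          also have "\<dots> = (\<integral>k. ?\<eta> k * h (x + t *\<^sub>R k) \<partial>lborel)"
            by (rule integral_shift) measurable
          finally show ?case using elim by (simp add: F_def aop_def left_diff_distrib)
        qed
        moreover have m2: "F t \<in> borel_measurable lborel" using measurable_Pair2[OF mF] by simp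
        moreover have s: "sqiL (aop (%k. ?\<eta> k - \<eta> k) (%k. t *\<^sub>R k) h)" by (rule d.aop_sqi(1)[OF h])
        ultimately have eq: "nrmL (F t) = nrmL (aop (%k. ?\<eta> k - \<eta> k) (%k. t *\<^sub>R k) h)" "sqiL (F t)"
        proof -
          assume ae: "AE x in lborel. F t x = aop (%k. ?\<eta> k - \<eta> k) (%k. t *\<^sub>R k) h x"
          show "nrmL (F t) = nrmL (aop (%k. ?\<eta> k - \<eta> k) (%k. t *\<^sub>R k) h)"
            using nrm_cong_AE[OF ae m2 sqi_measurable[OF s]] .
          have "integrable lborel (%x. (norm (F t x))\<^sup>2)"
            using s ae m2 sqi_measurable[OF s] unfolding sqi_def
            by (subst integrable_cong_AE[where g="%x. (norm (aop (%k. ?\<eta> k - \<eta> k) (%k. t *\<^sub>R k) h x))\<^sup>2"]) auto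
          then show "sqiL (F t)" using m2 by (simp add: sqi_def)
        qed
        have "d.W <= L * min 1 (norm y / t)"
          using L(2)[of "- ((1 / t) *\<^sub>R y)"] t by (simp add: d.W_def)
        then have "d.W * N <= L * min 1 (norm y / t) * N" by (intro mult_right_mono) (auto simp: N_def)
        then show ?thesis using eq d.aop_sqi(2)[OF h] by (simp add: N_def)
      qed
      have Vb: "(\<integral>\<^sup>+t. ennreal \<bar>w t\<bar> * (\<integral>\<^sup>+x. ennreal ((F t x)\<^sup>2) \<partial>lborel) \<partial>lborel) <= ennreal (Vv * L\<^sup>2 * N\<^sup>2 * sqrt (norm y))"
      proof -
        have "AE t in lborel. ennreal \<bar>w t\<bar> * (\<integral>\<^sup>+x. ennreal ((F t x)\<^sup>2) \<partial>lborel) <= ennreal (v t) * ennreal (L\<^sup>2 * N\<^sup>2 * sqrt (norm y))"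
          using AE_lborel_singleton[of "0::real"]
        proof eventually_elim
          case (elim t)
          show ?case
          proof (cases "t \<in> {0<..T}")
            case True
            then have t: "t > 0" "t <= T" by auto
            have "(nrmL (F t))\<^sup>2 <= (L * min 1 (norm y / t) * N)\<^sup>2"
              using est[OF t(1)] by (intro power_mono) auto
            also have "\<dots> = L\<^sup>2 * N\<^sup>2 * (min 1 (norm y / t))\<^sup>2" by (simp add: power_mult_distrib)
            also have "\<dots> <= L\<^sup>2 * N\<^sup>2 * sqrt (norm y / t)"
              using t by (intro mult_left_mono min1_le_sqrt) auto
            also have "sqrt (norm y / t) = t powr (-1/2) * sqrt (norm y)"
              using t by (simp add: real_sqrt_divide powr_minus_divide powr_half_sqrt)
            finally have n: "(nrmL (F t))\<^sup>2 <= L\<^sup>2 * N\<^sup>2 * (t powr (-1/2) * sqrt (norm y))" .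
            have wt: "\<bar>w t\<bar> <= \<bar>T\<bar> ^ m" using t by (auto simp: w_def indicator_def abs_mult intro!: power_mono)
            have "ennreal \<bar>w t\<bar> * (\<integral>\<^sup>+x. ennreal ((F t x)\<^sup>2) \<partial>lborel) = ennreal (\<bar>w t\<bar> * (nrmL (F t))\<^sup>2)"
              using nn_integral_sq[of lborel "F t"] est[OF t(1)] by (simp add: ennreal_mult)
            also have "\<dots> <= ennreal (\<bar>T\<bar> ^ m * (L\<^sup>2 * N\<^sup>2 * (t powr (-1/2) * sqrt (norm y))))"
              using n wt by (intro ennreal_leI mult_mono) auto
            also have "\<bar>T\<bar> ^ m * (L\<^sup>2 * N\<^sup>2 * (t powr (-1/2) * sqrt (norm y))) = v t * (L\<^sup>2 * N\<^sup>2 * sqrt (norm y))"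
              using True by (simp add: v_def)
            finally show ?thesis using v0 by (simp add: ennreal_mult)
          next
            case False
            then have "w t = 0" using elim by (auto simp: w_def indicator_def)
            then show ?thesis by simp
          qed
        qed
        then have "(\<integral>\<^sup>+t. ennreal \<bar>w t\<bar> * (\<integral>\<^sup>+x. ennreal ((F t x)\<^sup>2) \<partial>lborel) \<partial>lborel) <= (\<integral>\<^sup>+t. ennreal (v t) * ennreal (L\<^sup>2 * N\<^sup>2 * sqrt (norm y)) \<partial>lborel)"
          by (rule nn_integral_mono_AE)
        also have "\<dots> = ennreal Vv * ennreal (L\<^sup>2 * N\<^sup>2 * sqrt (norm y))"
          using v by (subst nn_integral_multc) (auto simp: Vv(1))
        finally show ?thesis using Vv(2) by (simp add: ennreal_mult mult.assoc)
      qed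
      have nn: "0 <= Vv * L\<^sup>2 * N\<^sup>2 * sqrt (norm y)" using Vv(2) by simp
      note J = jensen[OF _ mF eq_refl[OF W(1)] W(2) Vb nn]
      have sJ: "sqiL (Jop T m \<eta> h)" by (rule Jop_sqi[OF \<eta> h])
      have mJ[measurable]: "Jop T m \<eta> h \<in> borel_measurable borel" using sqi_measurable[OF sJ] by simp
      have "AE x in lborel. Jop T m \<eta> h (x + y) - Jop T m \<eta> h x = (\<integral>t. w t * F t x \<partial>lborel)"
        using Jop_iterated[OF \<eta> h, of T m] AE_shift[OF Jop_iterated[OF \<eta> h, of T m], of y]
      proof eventually_elim
        case (elim x)
        then show ?case by (simp add: F_def w_def right_diff_distrib)
      qed
      then have "nrmL (%x. Jop T m \<eta> h (x + y) - Jop T m \<eta> h x) = nrmL (%x. \<integral>t. w t * F t x \<partial>lborel)"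
        using sqi_measurable[OF J(1)] by (intro nrm_cong_AE) (auto simp: w_def)
      also have "\<dots> <= sqrt (W * (Vv * L\<^sup>2 * N\<^sup>2 * sqrt (norm y)))" by (rule J(2)) measurable
      finally have "(nrmL (%x. Jop T m \<eta> h (x + y) - Jop T m \<eta> h x))\<^sup>2 <= (sqrt (W * (Vv * L\<^sup>2 * N\<^sup>2 * sqrt (norm y))))\<^sup>2"
        by (intro power_mono) auto
      then show ?thesis using W(2) nn by simp
    qed
    show "hold (W * Vv * L\<^sup>2 * (nrmL h)\<^sup>2) (Jop T m \<eta> h)"
      unfolding hold_def using main Jop_sqi[OF \<eta> h] by (simp add: N_def mult_ac)
  qed (use W Vv in simp)
qed

text \<open>Weak convergence to 0 in L2 with a common bounded support. For norm bounded sequences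
  continuous test functions are enough, and they are what \<open>weak_subsequence\<close>
  provides.\<close>

definition weakly_null :: "real => (nat => R3 => 'b::euclidean_space) => bool" where
  "weakly_null r h \<longleftrightarrow> (\<forall>n. sqiL (h n)) & (\<forall>n x. x \<notin> cball 0 r --> h n x = 0) & (\<exists>M. \<forall>n. nrmL (h n) <= M)
     & (\<forall>\<kappa>. continuous_on UNIV \<kappa> --> (%n. ipL (h n) \<kappa>) \<longlonglongrightarrow> 0)"

lemma integral_scale:
  fixes f :: "R3 => real"
  assumes [measurable]: "f \<in> borel_measurable borel" and t: "t ~= 0"
  shows "\<bar>t\<bar> ^ 3 * (\<integral>k. f (x + t *\<^sub>R k) \<partial>lborel) = (\<integral>z. f z \<partial>lborel)"
  by (subst (2) lborel_affine[OF t, of x]) (simp add: integral_density integral_distr)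

lemma sqi_ball_L1:
  fixes h :: "R3 => real" assumes h: "sqiL h" "!!x. x \<notin> cball 0 r ==> h x = 0"
  shows "integrable lborel h" "(\<integral>x. \<bar>h x\<bar> \<partial>lborel) <= nrmL h * sqrt (measure lborel (cball (0::R3) r))"
proof -
  let ?I = "%x::R3. indicator (cball 0 r) x :: real"
  have s: "sqiL ?I"
    by (auto simp: sqi_def power2_eq_square indicator_inter_arith[symmetric] intro!: borel_measurable_indicator)
  have e: "(%x. \<bar>h x\<bar> * ?I x) = (%x. \<bar>h x\<bar>)"
  proof
    fix x show "\<bar>h x\<bar> * ?I x = \<bar>h x\<bar>" using h(2)[of x] by (cases "x \<in> cball 0 r") auto
  qed
  have s': "sqiL (%x. \<bar>h x\<bar>)" using h(1) by (auto simp: sqi_def)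
  have "integrable lborel (%x. \<bar>h x\<bar>)" using sqi_inner[OF s' s] e by simp
  then show "integrable lborel h" using sqi_measurable[OF h(1)] by (simp add: integrable_abs_iff)
  have "\<bar>ipL (%x. \<bar>h x\<bar>) ?I\<bar> <= nrmL (%x. \<bar>h x\<bar>) * nrmL ?I" by (rule ip_Cauchy_Schwarz[OF s' s])
  moreover have "nrmL ?I = sqrt (measure lborel (cball (0::R3) r))"
    by (simp add: nrm_def power2_eq_square indicator_inter_arith[symmetric])
  ultimately show "(\<integral>x. \<bar>h x\<bar> \<partial>lborel) <= nrmL h * sqrt (measure lborel (cball (0::R3) r))"
    using e by (simp add: ip_def nrm_def)
qed

text \<open>For fixed t > 0 the slice pairs h n with a continuous kernel, so it tends to 0 pointwise
  by weak convergence; uniform bounds and a common support then allow dominated convergence in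
  x.\<close>

lemma fixed_distance_null:
  fixes h :: "nat => R3 => real"
  assumes \<eta>: "tf \<eta>" and h: "weakly_null r h" and t: "t > 0"
  shows "(%n. (nrmL (aop \<eta> (%k. t *\<^sub>R k) (h n)))\<^sup>2) \<longlonglongrightarrow> 0"
proof -
  interpret averaging \<eta> "%k. t *\<^sub>R k" by (rule averaging_fixed[OF \<eta>])
  obtain M where M: "!!n. nrmL (h n) <= M" using h by (auto simp: weakly_null_def)
  have s: "sqiL (h n)" and off: "x \<notin> cball 0 r ==> h n x = 0" for n x using h by (auto simp: weakly_null_def)
  obtain B where B: "B > 0" "!!x. norm (\<eta> x) <= B" using tf_bounded[OF \<eta>] by blast
  obtain c where c: "c > 0" "!!x. x \<notin> cball 0 c ==> \<eta> x = 0" using tf_support[OF \<eta>] by blast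
  have [measurable]: "h n \<in> borel_measurable borel" for n using sqi_measurable[OF s] by simp
  define V where "V = sqrt (measure lborel (cball (0::R3) r))"
  \<comment> \<open>t^3 is the Jacobian of the substitution z = x + t k.\<close>
  have e: "t ^ 3 * aop \<eta> (%k. t *\<^sub>R k) (h n) x = ipL (h n) (%z. \<eta> ((1 / t) *\<^sub>R (z - x)))" for n x
    using integral_scale[of "%z. \<eta> ((1 / t) *\<^sub>R (z - x)) * h n z" t x] t by (simp add: aop_def ip_def mult.commute)
  have cont: "continuous_on UNIV (%z. \<eta> ((1 / t) *\<^sub>R (z - x)))" for x
    by (intro continuous_on_compose2[OF tf_continuous[OF \<eta>, of UNIV]] continuous_intros) auto
  have lim: "(%n. aop \<eta> (%k. t *\<^sub>R k) (h n) x) \<longlonglongrightarrow> 0" for x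
  proof -
    have "(%n. ipL (h n) (%z. \<eta> ((1 / t) *\<^sub>R (z - x)))) \<longlonglongrightarrow> 0"
      using h cont unfolding weakly_null_def by blast
    then have "(%n. t ^ 3 * aop \<eta> (%k. t *\<^sub>R k) (h n) x / t ^ 3) \<longlonglongrightarrow> 0 / t ^ 3"
      unfolding e[symmetric] using t by (intro tendsto_divide tendsto_const) auto
    then show ?thesis using t by simp
  qed
  have bd: "\<bar>aop \<eta> (%k. t *\<^sub>R k) (h n) x\<bar> <= B * (M * V) / t ^ 3" for n x
  proof -
    have "\<bar>ipL (h n) (%z. \<eta> ((1 / t) *\<^sub>R (z - x)))\<bar> <= (\<integral>z. B * \<bar>h n z\<bar> \<partial>lborel)"
      unfolding ip_def using B sqi_ball_L1(1)[OF s off]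
      by (intro order_trans[OF integral_abs_bound] integral_mono') (auto simp: abs_mult mult.commute[of B] intro!: mult_left_mono)
    also have "\<dots> <= B * (M * V)"
      using sqi_ball_L1(2)[where h="h n" and r=r, OF s off] mult_right_mono[OF M[of n], of V] B by (simp add: V_def)
    finally have "t ^ 3 * \<bar>aop \<eta> (%k. t *\<^sub>R k) (h n) x\<bar> <= B * (M * V)"
      using t by (simp add: e[symmetric] abs_mult)
    then show ?thesis using t by (simp add: field_simps)
  qed
  have sup: "aop \<eta> (%k. t *\<^sub>R k) (h n) x = 0" if "x \<notin> cball 0 (r + t * c)" for n x
  proof (rule aop_support[where K="cball 0 r" and S="cball 0 (t * c)"])
    show "- (t *\<^sub>R p) \<in> cball 0 (t * c)" if "\<eta> p ~= 0" for p
      using c(2)[of p] that t by auto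
    show "x \<notin> {y + z |y z. y \<in> cball 0 r & z \<in> cball 0 (t * c)}"
      using that norm_triangle_mono by fastforce
  qed (use off in auto)
  have "(%n. \<integral>x. (norm (aop \<eta> (%k. t *\<^sub>R k) (h n) x))\<^sup>2 \<partial>lborel) \<longlonglongrightarrow> (\<integral>x. 0 \<partial>(lborel::R3 measure))"
  proof (rule integral_dominated_convergence)
    show "integrable lborel (%x::R3. (B * (M * V) / t ^ 3)\<^sup>2 * indicator (cball 0 (r + t * c)) x)" by simp
    show "AE x in lborel. (%n. (norm (aop \<eta> (%k. t *\<^sub>R k) (h n) x))\<^sup>2) \<longlonglongrightarrow> 0"
    proof (rule AE_I2)
      fix x show "(%n. (norm (aop \<eta> (%k. t *\<^sub>R k) (h n) x))\<^sup>2) \<longlonglongrightarrow> 0"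
        using tendsto_power[OF tendsto_norm[OF lim[of x]], of 2] by simp
    qed
    show "AE x in lborel. norm ((norm (aop \<eta> (%k. t *\<^sub>R k) (h n) x))\<^sup>2) <= (B * (M * V) / t ^ 3)\<^sup>2 * indicator (cball 0 (r + t * c)) x" for n
    proof (rule AE_I2)
      fix x
      show "norm ((norm (aop \<eta> (%k. t *\<^sub>R k) (h n) x))\<^sup>2) <= (B * (M * V) / t ^ 3)\<^sup>2 * indicator (cball 0 (r + t * c)) x"
        using power_mono[OF bd abs_ge_zero, of n x 2] sup[of x n] by (cases "x \<in> cball 0 (r + t * c)") auto
    qed
    show "(%x. (norm (aop \<eta> (%k. t *\<^sub>R k) (h n) x))\<^sup>2) \<in> borel_measurable lborel" for n
      using sqi_measurable[OF aop_sqi(1)[OF s[of n]]] by measurable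
  qed simp
  then show ?thesis by (simp add: nrm_sq)
qed

text \<open>Compactness of \<open>Jop\<close>: the slices tend to 0 in L2 for each t > 0 with a
  uniform bound, so the right-hand side of \<open>jensen\<close> tends to 0 by dominated convergence
  in t.\<close>

lemma Jop_null:
  fixes h :: "nat => R3 => real"
  assumes \<eta>: "tf \<eta>" and h: "weakly_null r h"
  shows "(%n. nrmL (Jop T m \<eta> (h n))) \<longlonglongrightarrow> 0"
proof -
  obtain M where M: "!!n. nrmL (h n) <= M" using h by (auto simp: weakly_null_def)
  have M0: "0 <= M" using order_trans[OF nrm_nonneg M] .
  have s: "sqiL (h n)" for n using h by (auto simp: weakly_null_def)
  have [measurable]: "h n \<in> borel_measurable borel" for n using sqi_measurable[OF s] by simp
  have [measurable]: "\<eta> \<in> borel_measurable borel" by (rule smooth_borel[OF tf_smooth[OF \<eta>]])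
  define w where "w t = indicator {0..T} t * t ^ m" for t :: real
  have w: "integrable lborel w" unfolding w_def[abs_def] by (rule integrable_Icc_power)
  have [measurable]: "w \<in> borel_measurable borel" using w by (auto dest: borel_measurable_integrable)
  define W where "W = (\<integral>t. \<bar>w t\<bar> \<partial>lborel)"
  have W: "(\<integral>\<^sup>+t. ennreal \<bar>w t\<bar> \<partial>lborel) = ennreal W" "0 <= W"
    unfolding W_def using w by (auto intro: nn_integral_eq_integral)
  define E where "E = averaging.W \<eta>"
  have est: "sqiL (aop \<eta> (%k. t *\<^sub>R k) (h n))" "(nrmL (aop \<eta> (%k. t *\<^sub>R k) (h n)))\<^sup>2 <= (E * M)\<^sup>2" for t n
  proof -
    interpret averaging \<eta> "%k. t *\<^sub>R k" by (rule averaging_fixed[OF \<eta>])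
    show "sqiL (aop \<eta> (%k. t *\<^sub>R k) (h n))" by (rule aop_sqi(1)[OF s])
    have "nrmL (aop \<eta> (%k. t *\<^sub>R k) (h n)) <= E * M"
      unfolding E_def using aop_sqi(2)[OF s] mult_left_mono[OF M W0] by (rule order_trans)
    then show "(nrmL (aop \<eta> (%k. t *\<^sub>R k) (h n)))\<^sup>2 <= (E * M)\<^sup>2" by (intro power_mono) auto
  qed
  define b where "b n t = (nrmL (aop \<eta> (%k. t *\<^sub>R k) (h n)))\<^sup>2" for n t
  have mb: "b n \<in> borel_measurable borel" for n
    unfolding b_def nrm_sq using aop_joint_measurable[of \<eta> "h n" 0] by simp measurable
  have lim: "(%n. \<integral>t. \<bar>w t\<bar> * b n t \<partial>lborel) \<longlonglongrightarrow> (\<integral>t. 0 \<partial>(lborel::real measure))"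
  proof (rule integral_dominated_convergence)
    note mb[measurable]
    show "(%t. \<bar>w t\<bar> * b n t) \<in> borel_measurable lborel" for n by measurable
    show "integrable lborel (%t. \<bar>w t\<bar> * (E * M)\<^sup>2)" using w by simp
    show "AE t in lborel. norm (\<bar>w t\<bar> * b n t) <= \<bar>w t\<bar> * (E * M)\<^sup>2" for n
      using est(2) by (intro AE_I2) (auto simp: b_def abs_mult intro!: mult_left_mono)
    show "AE t in lborel. (%n. \<bar>w t\<bar> * b n t) \<longlonglongrightarrow> 0"
      using AE_lborel_singleton[of "0::real"]
    proof eventually_elim
      case (elim t)
      show ?case
      proof (cases "t > 0")
        case True
        then show ?thesis using tendsto_mult[OF tendsto_const fixed_distance_null[OF \<eta> h True], of "\<bar>w t\<bar>"] by (simp add: b_def)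
      qed (use elim in \<open>simp add: w_def indicator_def\<close>)
    qed
  qed simp
  have bound: "nrmL (Jop T m \<eta> (h n)) <= sqrt (W * (\<integral>t. \<bar>w t\<bar> * b n t \<partial>lborel))" for n
  proof -
    have mF: "(%(t, x). aop \<eta> (%k. t *\<^sub>R k) (h n) x) \<in> borel_measurable (borel \<Otimes>\<^sub>M borel)"
      using aop_joint_measurable[of \<eta> "h n" 0] by simp
    have ib: "integrable lborel (%t. \<bar>w t\<bar> * b n t)"
    proof (rule Bochner_Integration.integrable_bound)
      show "integrable lborel (%t. \<bar>w t\<bar> * (E * M)\<^sup>2)" using w by simp
      show "AE t in lborel. norm (\<bar>w t\<bar> * b n t) <= norm (\<bar>w t\<bar> * (E * M)\<^sup>2)"
        using est(2) by (intro AE_I2) (auto simp: b_def abs_mult intro!: mult_left_mono)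
    qed (use mb in measurable)
    have nn: "0 <= (\<integral>t. \<bar>w t\<bar> * b n t \<partial>lborel)" by (simp add: b_def)
    have V: "(\<integral>\<^sup>+t. ennreal \<bar>w t\<bar> * (\<integral>\<^sup>+x. ennreal ((aop \<eta> (%k. t *\<^sub>R k) (h n) x)\<^sup>2) \<partial>lborel) \<partial>lborel) = ennreal (\<integral>t. \<bar>w t\<bar> * b n t \<partial>lborel)"
    proof -
      have "(\<integral>\<^sup>+x. ennreal ((aop \<eta> (%k. t *\<^sub>R k) (h n) x)\<^sup>2) \<partial>lborel) = ennreal (b n t)" for t
        using nn_integral_sq[OF est(1)[of t n]] by (simp add: b_def)
      then show ?thesis using nn_integral_eq_integral[OF ib] by (simp add: ennreal_mult[symmetric] b_def)
    qed
    note J = jensen[where F="%t. aop \<eta> (%k. t *\<^sub>R k) (h n)", OF _ mF eq_refl[OF W(1)] W(2) eq_refl[OF V] nn]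
    have "AE x in lborel. Jop T m \<eta> (h n) x = (\<integral>t. w t * aop \<eta> (%k. t *\<^sub>R k) (h n) x \<partial>lborel)"
      using Jop_iterated[OF \<eta> s[of n], of T m] by eventually_elim (simp add: w_def)
    then have "nrmL (Jop T m \<eta> (h n)) = nrmL (%x. \<integral>t. w t * aop \<eta> (%k. t *\<^sub>R k) (h n) x \<partial>lborel)"
      using sqi_measurable[OF J(1)] sqi_measurable[OF Jop_sqi[OF \<eta> s]] by (intro nrm_cong_AE) auto
    also have "\<dots> <= sqrt (W * (\<integral>t. \<bar>w t\<bar> * b n t \<partial>lborel))" by (rule J(2)) measurable
    finally show ?thesis .
  qed
  have "(%n. sqrt (W * (\<integral>t. \<bar>w t\<bar> * b n t \<partial>lborel))) \<longlonglongrightarrow> sqrt (W * 0)"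
    using lim by (intro tendsto_intros) simp
  then have "(%n. sqrt (W * (\<integral>t. \<bar>w t\<bar> * b n t \<partial>lborel))) \<longlonglongrightarrow> 0" by simp
  then show ?thesis by (rule Lim_null_comparison[rotated]) (simp add: bound)
qed

text \<open>One power of t less than \<open>Wt\<close>. The quotient form makes m = 0 yield the
  non-integrable weight 1/t, and the half-open interval leaves out t = 0.\<close>

definition Wsing :: "real => nat => (R3 => real) => real \<times> R3 => real" where
  "Wsing T m \<eta> p = indicator {0<..T} (fst p) * (fst p ^ m / fst p) * \<eta> (snd p)"

lemma fst_borel[measurable]: "fst \<in> borel_measurable (borel :: (real \<times> R3) measure)"
  and snd_borel[measurable]: "snd \<in> borel_measurable (borel :: (real \<times> R3) measure)"
  by (intro borel_measurable_continuous_onI continuous_intros)+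

lemma Wsing_measurable[measurable]:
  assumes [measurable]: "\<eta> \<in> borel_measurable borel" shows "Wsing T m \<eta> \<in> borel_measurable borel"
  unfolding Wsing_def[abs_def] by measurable

text \<open>Moving the derivative onto \<eta> costs a factor 1/t. Since \<open>pd j \<eta>\<close>
  has integral 0, the value \<phi>(y) can be subtracted for free, and the Lipschitz bound of \<phi>
  then cancels the 1/t.\<close>

lemma Iop_singular:
  assumes \<eta>: "tf \<eta>" and \<phi>: "tf \<phi>"
  shows "pd j (Iop T m \<eta> \<phi>) y = (\<integral>p. Wsing T m (pd j \<eta>) p * (\<phi> (y - ray p) - \<phi> y) \<partial>lborel)"
proof -
  obtain C where C: "C > 0" "!!x y. norm (\<phi> x - \<phi> y) <= C * norm (x - y)" using tf_lipschitz[OF \<phi>] by blast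
  obtain c where c: "c > 0" "!!x. x \<notin> cball 0 c ==> pd j \<eta> x = 0" using tf_support[OF tf_pd[OF \<eta>]] by blast
  have [measurable]: "\<phi> \<in> borel_measurable borel" "pd j \<eta> \<in> borel_measurable borel"
    using smooth_borel[OF tf_smooth] \<phi> tf_pd[OF \<eta>] by blast+
  have int: "integrable lborel (%p. Wsing T m (pd j \<eta>) p * (\<phi> (y - ray p) - \<phi> y))"
  proof (rule Bochner_Integration.integrable_bound)
    show "integrable lborel (%p. (indicator {0..T} (fst p) * fst p ^ m) * (C * c * \<bar>pd j \<eta> (snd p)\<bar>))"
      using tf_integrable[OF tf_pd[OF \<eta>], of j] by (intro integrable_product integrable_Icc_power) simp
    show "(%p. Wsing T m (pd j \<eta>) p * (\<phi> (y - ray p) - \<phi> y)) \<in> borel_measurable lborel"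
      by measurable
    show "AE p in lborel. norm (Wsing T m (pd j \<eta>) p * (\<phi> (y - ray p) - \<phi> y)) \<le>
       norm ((indicator {0..T} (fst p) * fst p ^ m) * (C * c * \<bar>pd j \<eta> (snd p)\<bar>))"
    proof (rule AE_I2)
      fix p :: "real \<times> R3"
      show "norm (Wsing T m (pd j \<eta>) p * (\<phi> (y - ray p) - \<phi> y)) \<le>
       norm ((indicator {0..T} (fst p) * fst p ^ m) * (C * c * \<bar>pd j \<eta> (snd p)\<bar>))"
      proof (cases "fst p \<in> {0<..T} & snd p \<in> cball 0 c")
        case True
        then have t: "0 < fst p" "fst p <= T" "norm (snd p) <= c" by auto
        have "\<bar>\<phi> (y - ray p) - \<phi> y\<bar> <= C * (fst p * c)"
          using C(2)[of "y - ray p" y] t C(1)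
            order_trans[OF _ mult_left_mono[OF mult_left_mono[OF t(3), of "fst p"], of C], of "\<bar>\<phi> (y - ray p) - \<phi> y\<bar>"]
          by (auto simp: ray_def)
        then have "(fst p ^ m / fst p) * \<bar>pd j \<eta> (snd p)\<bar> * \<bar>\<phi> (y - ray p) - \<phi> y\<bar> <= (fst p ^ m / fst p) * \<bar>pd j \<eta> (snd p)\<bar> * (C * (fst p * c))"
          using t by (intro mult_left_mono) auto
        then show ?thesis using t C(1) c(1) by (simp add: Wsing_def abs_mult mult_ac)
      next
        case False
        then have "Wsing T m (pd j \<eta>) p = 0" using c(2)[of "snd p"] by (auto simp: Wsing_def indicator_def)
        then show ?thesis by simp
      qed
    qed
  qed
  have int': "integrable (lborel \<Otimes>\<^sub>M lborel) (%(t, k). Wsing T m (pd j \<eta>) (t, k) * (\<phi> (y - ray (t, k)) - \<phi> y))"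
    using int by (simp add: lborel_prod case_prod_beta')
  have "pd j (Iop T m \<eta> \<phi>) y = (\<integral>t. indicator {0..T} t * t ^ m * (\<integral>k. \<eta> k * pd j \<phi> (y - t *\<^sub>R k) \<partial>lborel) \<partial>lborel)"
    by (simp add: Iop_pd[OF \<eta> \<phi>] Iop_iterated(1)[OF \<eta> tf_pd[OF \<phi>]])
  also have "\<dots> = (\<integral>t. (\<integral>k. Wsing T m (pd j \<eta>) (t, k) * (\<phi> (y - ray (t, k)) - \<phi> y) \<partial>lborel) \<partial>lborel)"
  proof (rule integral_cong_AE)
    show "(%t. indicator {0..T} t * t ^ m * (\<integral>k. \<eta> k * pd j \<phi> (y - t *\<^sub>R k) \<partial>lborel)) \<in> borel_measurable lborel"
      using Iop_iterated(2)[OF \<eta> tf_pd[OF \<phi>]] by (rule borel_measurable_integrable)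
    show "(%t. \<integral>k. Wsing T m (pd j \<eta>) (t, k) * (\<phi> (y - ray (t, k)) - \<phi> y) \<partial>lborel) \<in> borel_measurable lborel"
      using lborel_pair.integrable_fst[OF int'] by (rule borel_measurable_integrable)
    show "AE t in lborel. indicator {0..T} t * t ^ m * (\<integral>k. \<eta> k * pd j \<phi> (y - t *\<^sub>R k) \<partial>lborel) =
      (\<integral>k. Wsing T m (pd j \<eta>) (t, k) * (\<phi> (y - ray (t, k)) - \<phi> y) \<partial>lborel)"
      using AE_lborel_singleton[of "0::real"]
    proof eventually_elim
      case (elim t)
      show ?case
      proof (cases "t \<in> {0<..T}")
        case True
        have s: "smooth (%k. \<phi> (y + (- t) *\<^sub>R k))"
          using tf_smooth[OF \<phi>] by (simp only: smooth_iff_ck) (blast intro: ck_affine)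
        have i1: "integrable lborel (%k. pd j \<eta> k * \<phi> (y - t *\<^sub>R k))"
          using tf_integrable[OF tf_mult1[OF tf_pd[OF \<eta>] s]] by simp
        have "(\<integral>k. Wsing T m (pd j \<eta>) (t, k) * (\<phi> (y - ray (t, k)) - \<phi> y) \<partial>lborel)
            = (\<integral>k. t ^ m / t * (pd j \<eta> k * \<phi> (y - t *\<^sub>R k) - \<phi> y * pd j \<eta> k) \<partial>lborel)"
          using True by (intro Bochner_Integration.integral_cong refl) (simp add: Wsing_def ray_def right_diff_distrib mult_ac diff_divide_distrib)
        also have "\<dots> = t ^ m / t * ((\<integral>k. pd j \<eta> k * \<phi> (y - t *\<^sub>R k) \<partial>lborel) - \<phi> y * (\<integral>k. pd j \<eta> k \<partial>lborel))"
          using i1 tf_integrable[OF tf_pd[OF \<eta>], of j] by simp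
        also have "\<dots> = t ^ m / t * (t * (\<integral>k. \<eta> k * pd j \<phi> (y - t *\<^sub>R k) \<partial>lborel))"
          by (simp add: integral_pd_zero[OF \<eta>] direction_by_parts[OF \<eta> \<phi>])
        finally show ?thesis using True by simp
      qed (use elim in \<open>auto simp: Wsing_def indicator_def\<close>)
    qed
  qed
  also have "\<dots> = (\<integral>p. Wsing T m (pd j \<eta>) p * (\<phi> (y - ray p) - \<phi> y) \<partial>lborel)"
    using lborel_pair.integral_fst[OF int'] by (simp add: lborel_prod case_prod_beta')
  finally show ?thesis .
qed

text \<open>Y is the singular average of increments of Z. Interpolating the Hoelder bound with the
  norm, the square norm of an increment by a is at most 2 sqrt B times the norm of Z times
  |a|^(1/4), a positive power that tames 1/t. With B fixed, Y becomes small as soon as Z does; this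
  replaces compactness.\<close>

lemma singular_adjoint:
  assumes \<eta>: "tf \<eta>" and T: "T >= 0"
  obtains C where "C >= 0"
    "!!B (Z :: R3 => real). hold B Z ==> (!!x. x \<notin> cball 0 r ==> Z x = 0) ==> 0 <= B ==> \<exists>Y. sqiL Y & (nrmL Y)\<^sup>2 <= C * (sqrt B * nrmL Z) \<and>
      (\<forall>\<phi>. tf \<phi> --> ipL Z (pd j (Iop T m \<eta> \<phi>)) = ipL Y \<phi>)"
proof -
  obtain c where c: "c > 0" "!!x. x \<notin> cball 0 c ==> pd j \<eta> x = 0" using tf_support[OF tf_pd[OF \<eta>]] by blast
  have [measurable]: "pd j \<eta> \<in> borel_measurable borel"
    using smooth_borel[OF tf_smooth] tf_pd[OF \<eta>] by blast
  have int_abs: "integrable lborel (%k. \<bar>pd j \<eta> k\<bar>)" using tf_integrable[OF tf_pd[OF \<eta>], of j] by simp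
  \<comment> \<open>1/t is split as t^(-7/8) t^(-1/8): the first factor is integrable and is the
    weight in \<open>jensen\<close>; the square t^(-1/4) of the second is exactly compensated by the
    t^(1/4) from the interpolated increments.\<close>
  define u where "u p = indicator {0<..T} (fst p) * fst p powr (-7/8) * \<bar>pd j \<eta> (snd p)\<bar>" for p :: "real \<times> R3"
  have u: "integrable lborel u" "!!p. 0 <= u p"
    unfolding u_def[abs_def] using integrable_product[OF integrable_powr[of "-7/8" T] int_abs] by auto
  have [measurable]: "u \<in> borel_measurable borel" using u(1) by (auto dest: borel_measurable_integrable)
  define U where "U = (\<integral>p. u p \<partial>lborel)"
  have U: "(\<integral>\<^sup>+p. ennreal (u p) \<partial>lborel) = ennreal U"
    unfolding U_def by (rule nn_integral_eq_integral[OF u(1)]) (simp only: u(2) AE_I2)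
  have U0: "0 <= U" unfolding U_def by (rule integral_nonneg_AE) (simp only: u(2) AE_I2)
  \<comment> \<open>Common majorant for the two Fubini exchanges: it dominates
    |\<open>Wsing\<close>| t^(1/4), and t^(-3/4) is integrable.\<close>
  define v where "v p = T ^ m * (indicator {0<..T} (fst p) * fst p powr (-3/4) * \<bar>pd j \<eta> (snd p)\<bar>)" for p :: "real \<times> R3"
  have v: "integrable lborel v" "!!p. 0 <= v p"
    unfolding v_def[abs_def] using integrable_product[OF integrable_powr[of "-3/4" T] int_abs] T by auto
  define D where "D = T ^ (2 * m) * (2 * c powr (1/4))"
  show ?thesis
  proof (rule that[of "U * U * D"])
    fix B and Z :: "R3 => real" assume Z: "hold B Z" and off: "!!x. x \<notin> cball 0 r ==> Z x = 0" and B: "0 <= B"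
    have sZ: "sqiL Z" using Z by (simp add: hold_def)
    have [measurable]: "Z \<in> borel_measurable borel" using sqi_measurable[OF sZ] by simp
    define N where "N = nrmL Z"
    define S where "S = sqrt B * N"
    have S0: "0 <= S" using B by (simp add: S_def N_def)
    have \<Delta>: "sqiL (%x. Z (x + a) - Z x)" for a by (intro sqi_diff sqi_shift sZ)
    have \<Delta>1: "(nrmL (%x. Z (x + a) - Z x))\<^sup>2 <= B * sqrt (norm a)" for a using Z by (simp add: hold_def)
    have \<Delta>2: "(nrmL (%x. Z (x + a) - Z x))\<^sup>2 <= 2 * S * norm a powr (1/4)" for a
    proof -
      have "nrmL (%x. Z (x + a) - Z x) <= 2 * N"
        using nrm_triangle_diff[OF sqi_shift(1)[OF sZ, of a] sZ] sqi_shift(2)[OF sZ, of a] by (simp add: N_def)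
      then have "(nrmL (%x. Z (x + a) - Z x))\<^sup>2 <= (2 * N)\<^sup>2" by (intro power_mono) auto
      then have "(nrmL (%x. Z (x + a) - Z x))\<^sup>2 <= sqrt ((B * sqrt (norm a)) * (2 * N)\<^sup>2)"
        using \<Delta>1 by (intro min_le_geometric) auto
      also have "\<dots> = 2 * S * sqrt (sqrt (norm a))"
        by (simp add: real_sqrt_mult S_def N_def)
      also have "sqrt (sqrt (norm a)) = norm a powr (1/4)"
        by (simp add: powr_half_sqrt[symmetric] powr_powr)
      finally show ?thesis .
    qed
    define F where "F p x = sgn (pd j \<eta> (snd p)) * (fst p ^ m * fst p powr (-1/8)) * (Z (x + ray p) - Z x)" for p x
    have mF: "case_prod F \<in> borel_measurable (borel \<Otimes>\<^sub>M borel)" unfolding F_def by measurable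
    have uF: "u p * F p x = Wsing T m (pd j \<eta>) p * (Z (x + ray p) - Z x)" for p x
    proof (cases "fst p \<in> {0<..T}")
      case True
      then have t: "fst p > 0" by simp
      have "fst p powr (-7/8) * fst p powr (-1/8) = 1 / fst p"
        using t by (simp add: powr_add[symmetric] powr_minus_divide)
      moreover have "\<bar>pd j \<eta> (snd p)\<bar> * sgn (pd j \<eta> (snd p)) = pd j \<eta> (snd p)" by (simp add: abs_mult_sgn)
      ultimately have "u p * F p x = (1 / fst p) * (pd j \<eta> (snd p)) * fst p ^ m * (Z (x + ray p) - Z x)"
        using True by (simp add: u_def F_def mult_ac)
      then show ?thesis using True by (simp add: Wsing_def)
    qed (simp add: u_def Wsing_def)
    have V: "(\<integral>\<^sup>+p. ennreal \<bar>u p\<bar> * (\<integral>\<^sup>+x. ennreal ((F p x)\<^sup>2) \<partial>lborel) \<partial>lborel) <= ennreal (U * D * S)"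
    proof -
      have "ennreal \<bar>u p\<bar> * (\<integral>\<^sup>+x. ennreal ((F p x)\<^sup>2) \<partial>lborel) <= ennreal (u p) * ennreal (D * S)" for p
      proof (cases "u p = 0")
        case False
        then have t: "0 < fst p" "fst p <= T" and k: "norm (snd p) <= c"
          using c(2)[of "snd p"] by (auto simp: u_def indicator_def split: if_splits)
        have "(\<integral>\<^sup>+x. ennreal ((F p x)\<^sup>2) \<partial>lborel) <= (\<integral>\<^sup>+x. ennreal ((fst p ^ m * fst p powr (-1/8))\<^sup>2) * ennreal ((norm (Z (x + ray p) - Z x))\<^sup>2) \<partial>lborel)"
        proof (intro nn_integral_mono)
          fix x
          have "\<bar>sgn (pd j \<eta> (snd p))\<bar> <= 1" by (simp add: abs_sgn_eq)
          then have "(sgn (pd j \<eta> (snd p)))\<^sup>2 <= 1" by (simp add: abs_square_le_1)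
          then have "(sgn (pd j \<eta> (snd p)))\<^sup>2 * ((fst p ^ m * fst p powr (-1/8))\<^sup>2 * (Z (x + ray p) - Z x)\<^sup>2) <= 1 * ((fst p ^ m * fst p powr (-1/8))\<^sup>2 * (Z (x + ray p) - Z x)\<^sup>2)"
            by (intro mult_right_mono) auto
          then have "(F p x)\<^sup>2 <= (fst p ^ m * fst p powr (-1/8))\<^sup>2 * (Z (x + ray p) - Z x)\<^sup>2"
            by (simp add: F_def power_mult_distrib mult.assoc)
          then show "ennreal ((F p x)\<^sup>2) <= ennreal ((fst p ^ m * fst p powr (-1/8))\<^sup>2) * ennreal ((norm (Z (x + ray p) - Z x))\<^sup>2)"
            by (simp add: ennreal_mult[symmetric] ennreal_leI)
        qed
        also have "\<dots> = ennreal ((fst p ^ m * fst p powr (-1/8))\<^sup>2 * (nrmL (%x. Z (x + ray p) - Z x))\<^sup>2)"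
          using nn_integral_sq[OF \<Delta>[of "ray p"]] by (simp add: nn_integral_cmult ennreal_mult)
        also have "\<dots> <= ennreal (D * S)"
        proof (rule ennreal_leI)
          have "norm (ray p) powr (1/4) <= (fst p * c) powr (1/4)"
            using t k by (intro powr_mono2) (auto simp: ray_def intro: mult_left_mono)
          also have "\<dots> = fst p powr (1/4) * c powr (1/4)" using t c by (simp add: powr_mult)
          finally have "2 * S * norm (ray p) powr (1/4) <= 2 * S * (fst p powr (1/4) * c powr (1/4))"
            using S0 by (intro mult_left_mono) auto
          then have "(nrmL (%x. Z (x + ray p) - Z x))\<^sup>2 <= 2 * S * (fst p powr (1/4) * c powr (1/4))"
            using \<Delta>2[of "ray p"] by linarith
          then have "(fst p ^ m * fst p powr (-1/8))\<^sup>2 * (nrmL (%x. Z (x + ray p) - Z x))\<^sup>2 \<le>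
             (fst p ^ m * fst p powr (-1/8))\<^sup>2 * (2 * S * (fst p powr (1/4) * c powr (1/4)))"
            by (intro mult_left_mono) auto
          also have "(fst p powr (-1/8))\<^sup>2 * fst p powr (1/4) = 1"
            using t by (simp add: power2_eq_square powr_add[symmetric])
          then have "(fst p ^ m * fst p powr (-1/8))\<^sup>2 * (2 * S * (fst p powr (1/4) * c powr (1/4))) = (fst p ^ m)\<^sup>2 * (2 * c powr (1/4)) * S"
            by (simp add: power_mult_distrib)
          also have "\<dots> <= T ^ (2 * m) * (2 * c powr (1/4)) * S"
            using t S0 by (intro mult_right_mono) (auto simp: power_mult[symmetric] mult.commute[of m] intro: power_mono)
          finally show "(fst p ^ m * fst p powr (-1/8))\<^sup>2 * (nrmL (%x. Z (x + ray p) - Z x))\<^sup>2 <= D * S"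
            by (simp add: D_def)
        qed
        finally show ?thesis using u(2)[of p] by (simp add: mult_left_mono)
      qed simp
      then have "(\<integral>\<^sup>+p. ennreal \<bar>u p\<bar> * (\<integral>\<^sup>+x. ennreal ((F p x)\<^sup>2) \<partial>lborel) \<partial>lborel) <= (\<integral>\<^sup>+p. ennreal (u p) * ennreal (D * S) \<partial>lborel)"
        by (rule nn_integral_mono)
      also have "\<dots> = ennreal (U * D * S)"
        using T by (simp add: nn_integral_multc U U0 ennreal_mult mult.assoc D_def S0)
      finally show ?thesis .
    qed
    have D0: "0 <= D" using T by (simp add: D_def)
    have nn: "0 <= U * D * S" using U0 S0 D0 by simp
    have Uabs: "(\<integral>\<^sup>+p. ennreal \<bar>u p\<bar> \<partial>lborel) <= ennreal U" using U u(2) by simp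
    note J = jensen[OF _ mF Uabs U0 V nn]
    define Y where "Y x = (\<integral>p. u p * F p x \<partial>lborel)" for x
    have sY: "sqiL Y" unfolding Y_def using J(1) by simp
    have nY: "(nrmL Y)\<^sup>2 <= U * U * D * S"
    proof -
      have "nrmL Y <= sqrt (U * (U * D * S))" unfolding Y_def using J(2) by simp
      then have "(nrmL Y)\<^sup>2 <= (sqrt (U * (U * D * S)))\<^sup>2" by (intro power_mono) auto
      then show ?thesis using nn U0 by (simp add: mult.assoc)
    qed
    have dual: "ipL Z (pd j (Iop T m \<eta> \<phi>)) = ipL Y \<phi>" if \<phi>: "tf \<phi>" for \<phi>
    proof -
      have [measurable]: "\<phi> \<in> borel_measurable borel" by (rule smooth_borel[OF tf_smooth[OF \<phi>]])
      have sp: "sqiL \<phi>" by (rule tf_sqi[OF \<phi>])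
      obtain L where L: "L > 0" "!!x y. norm (\<phi> x - \<phi> y) <= L * norm (x - y)" using tf_lipschitz[OF \<phi>] by blast
      define z where "z = (\<integral>x. \<bar>Z x\<bar> \<partial>lborel)"
      have iz: "integrable lborel Z" by (rule sqi_ball_L1(1)[OF sZ off])
      have nz: "(\<integral>\<^sup>+x. ennreal \<bar>Z x\<bar> \<partial>lborel) = ennreal z" "0 <= z"
        unfolding z_def using iz by (auto intro: nn_integral_eq_integral)
      have vb: "\<bar>Wsing T m (pd j \<eta>) p\<bar> * fst p powr (1/4) <= v p" for p
      proof (cases "fst p \<in> {0<..T}")
        case True
        then have t: "0 < fst p" "fst p <= T" by auto
        have "fst p powr (1/4) / fst p = fst p powr (-3/4)"
          using t powr_diff[of "fst p" "1/4" 1] by simp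
        moreover have "\<bar>Wsing T m (pd j \<eta>) p\<bar> * fst p powr (1/4) = fst p ^ m * ((fst p powr (1/4) / fst p) * \<bar>pd j \<eta> (snd p)\<bar>)"
          using True t by (simp add: Wsing_def abs_mult mult_ac)
        ultimately have "\<bar>Wsing T m (pd j \<eta>) p\<bar> * fst p powr (1/4) = fst p ^ m * (fst p powr (-3/4) * \<bar>pd j \<eta> (snd p)\<bar>)"
          by simp
        also have "\<dots> <= T ^ m * (fst p powr (-3/4) * \<bar>pd j \<eta> (snd p)\<bar>)"
          using t by (intro mult_right_mono power_mono) auto
        finally show ?thesis using True by (simp add: v_def)
      qed (simp add: Wsing_def v_def)
      \<comment> \<open>The Lipschitz bound of \<phi> supplies a full power of t; t^(1/4) is charged
        to v and the rest is at most T^(3/4).\<close>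
      have fin1: "(\<integral>\<^sup>+p. \<integral>\<^sup>+x. ennreal \<bar>Z x * (Wsing T m (pd j \<eta>) p * (\<phi> (x - ray p) - \<phi> x))\<bar> \<partial>lborel \<partial>lborel) < \<infinity>"
      proof -
        define K where "K = L * c * T powr (3/4) * z"
        have K0: "0 <= K" using L c nz by (simp add: K_def)
        have "(\<integral>\<^sup>+x. ennreal \<bar>Z x * (Wsing T m (pd j \<eta>) p * (\<phi> (x - ray p) - \<phi> x))\<bar> \<partial>lborel) <= ennreal (v p * K)" for p
        proof (cases "Wsing T m (pd j \<eta>) p = 0")
          case False
          then have t: "0 < fst p" "fst p <= T" and k: "norm (snd p) <= c"
            using c(2)[of "snd p"] by (auto simp: Wsing_def indicator_def split: if_splits)
          have l: "\<bar>\<phi> (x - ray p) - \<phi> x\<bar> <= L * (fst p * c)" for x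
          proof -
            have "norm (ray p) <= fst p * c" using t k by (simp add: ray_def mult_left_mono)
            then have "L * norm (ray p) <= L * (fst p * c)" using L(1) by simp
            then show ?thesis using L(2)[of "x - ray p" x] by simp
          qed
          have "(\<integral>\<^sup>+x. ennreal \<bar>Z x * (Wsing T m (pd j \<eta>) p * (\<phi> (x - ray p) - \<phi> x))\<bar> \<partial>lborel) <=
            (\<integral>\<^sup>+x. ennreal (\<bar>Wsing T m (pd j \<eta>) p\<bar> * (L * (fst p * c))) * ennreal \<bar>Z x\<bar> \<partial>lborel)"
          proof (intro nn_integral_mono)
            fix x
            have "\<bar>Z x * (Wsing T m (pd j \<eta>) p * (\<phi> (x - ray p) - \<phi> x))\<bar> = \<bar>Wsing T m (pd j \<eta>) p\<bar> * \<bar>\<phi> (x - ray p) - \<phi> x\<bar> * \<bar>Z x\<bar>"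
              by (simp add: abs_mult)
            also have "\<dots> <= \<bar>Wsing T m (pd j \<eta>) p\<bar> * (L * (fst p * c)) * \<bar>Z x\<bar>"
              using l by (intro mult_right_mono mult_left_mono) auto
            finally show "ennreal \<bar>Z x * (Wsing T m (pd j \<eta>) p * (\<phi> (x - ray p) - \<phi> x))\<bar> <= ennreal (\<bar>Wsing T m (pd j \<eta>) p\<bar> * (L * (fst p * c))) * ennreal \<bar>Z x\<bar>"
              using t L c by (subst ennreal_mult[symmetric]) (auto intro!: ennreal_leI)
          qed
          also have "\<dots> = ennreal (\<bar>Wsing T m (pd j \<eta>) p\<bar> * (L * (fst p * c)) * z)"
            using nz t L c by (subst nn_integral_cmult) (auto simp: ennreal_mult)
          also have "\<dots> <= ennreal (v p * K)"
          proof (rule ennreal_leI)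
            have "fst p = fst p powr (1/4) * fst p powr (3/4)" using t by (simp add: powr_add[symmetric])
            also have "\<dots> <= fst p powr (1/4) * T powr (3/4)" using t by (intro mult_left_mono powr_mono2) auto
            finally have "\<bar>Wsing T m (pd j \<eta>) p\<bar> * fst p <= \<bar>Wsing T m (pd j \<eta>) p\<bar> * (fst p powr (1/4) * T powr (3/4))"
              by (intro mult_left_mono) auto
            also have "\<dots> <= v p * T powr (3/4)" using mult_right_mono[OF vb[of p], of "T powr (3/4)"] by (simp add: mult.assoc)
            finally have "(\<bar>Wsing T m (pd j \<eta>) p\<bar> * fst p) * (L * c * z) <= (v p * T powr (3/4)) * (L * c * z)"
              using L c nz by (intro mult_right_mono) auto
            then show "\<bar>Wsing T m (pd j \<eta>) p\<bar> * (L * (fst p * c)) * z <= v p * K" by (simp add: K_def mult_ac)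
          qed
          finally show ?thesis .
        qed simp
        then have "(\<integral>\<^sup>+p. \<integral>\<^sup>+x. ennreal \<bar>Z x * (Wsing T m (pd j \<eta>) p * (\<phi> (x - ray p) - \<phi> x))\<bar> \<partial>lborel \<partial>lborel) <= (\<integral>\<^sup>+p. ennreal (v p * K) \<partial>lborel)"
          by (rule nn_integral_mono)
        also have "\<dots> < \<infinity>" using v K0 by (subst nn_integral_eq_integral) auto
        finally show ?thesis .
      qed
      \<comment> \<open>Here the factor t^(1/4) comes from the Hoelder modulus of Z, through
        Cauchy-Schwarz in x.\<close>
      have fin2: "(\<integral>\<^sup>+p. \<integral>\<^sup>+x. ennreal \<bar>(u p * F p x) * \<phi> x\<bar> \<partial>lborel \<partial>lborel) < \<infinity>"
      proof -
        define K where "K = sqrt B * c powr (1/4) * nrmL \<phi>"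
        have K0: "0 <= K" using B by (simp add: K_def)
        have "(\<integral>\<^sup>+x. ennreal \<bar>(u p * F p x) * \<phi> x\<bar> \<partial>lborel) <= ennreal (v p * K)" for p
        proof (cases "Wsing T m (pd j \<eta>) p = 0")
          case False
          then have t: "0 < fst p" "fst p <= T" and k: "norm (snd p) <= c"
            using c(2)[of "snd p"] by (auto simp: Wsing_def indicator_def split: if_splits)
          let ?\<Delta> = "%x. \<bar>Z (x + ray p) - Z x\<bar>" and ?\<psi> = "%x. \<bar>\<phi> x\<bar>"
          have sa: "sqiL ?\<Delta>" "sqiL ?\<psi>" using \<Delta>[of "ray p"] sp by (auto simp: sqi_def)
          have na: "nrmL ?\<Delta> = nrmL (%x. Z (x + ray p) - Z x)" "nrmL ?\<psi> = nrmL \<phi>" by (simp_all add: nrm_def)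
          have n1: "nrmL (%x. Z (x + ray p) - Z x) <= sqrt B * (fst p powr (1/4) * c powr (1/4))"
          proof (rule power2_le_imp_le)
            have "norm (ray p) <= fst p * c" using t k by (simp add: ray_def mult_left_mono)
            then have "B * sqrt (norm (ray p)) <= B * sqrt (fst p * c)" using B by (intro mult_left_mono) auto
            also have "\<dots> = (sqrt B * (fst p powr (1/4) * c powr (1/4)))\<^sup>2"
            proof -
              have q: "(z powr (1/4))\<^sup>2 = sqrt z" if "z > 0" for z :: real
                using that by (simp add: power2_eq_square powr_add[symmetric] powr_half_sqrt)
              show ?thesis using B t(1) c(1) by (simp add: power_mult_distrib q real_sqrt_mult)
            qed
            finally show "(nrmL (%x. Z (x + ray p) - Z x))\<^sup>2 <= (sqrt B * (fst p powr (1/4) * c powr (1/4)))\<^sup>2"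
              using \<Delta>1[of "ray p"] by linarith
          qed (use B in auto)
          have "(\<integral>\<^sup>+x. ennreal \<bar>(u p * F p x) * \<phi> x\<bar> \<partial>lborel) = (\<integral>\<^sup>+x. ennreal \<bar>Wsing T m (pd j \<eta>) p\<bar> * ennreal (?\<Delta> x * ?\<psi> x) \<partial>lborel)"
            by (simp add: uF abs_mult ennreal_mult[symmetric] mult.assoc)
          also have "\<dots> = ennreal \<bar>Wsing T m (pd j \<eta>) p\<bar> * ennreal (ipL ?\<Delta> ?\<psi>)"
            using sqi_inner[OF sa] by (subst nn_integral_cmult) (auto simp: nn_integral_eq_integral ip_def)
          also have "\<dots> <= ennreal \<bar>Wsing T m (pd j \<eta>) p\<bar> * ennreal (sqrt B * (fst p powr (1/4) * c powr (1/4)) * nrmL \<phi>)"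
            using ip_Cauchy_Schwarz[OF sa] mult_right_mono[OF n1, of "nrmL \<phi>"]
            by (intro mult_left_mono ennreal_leI) (auto simp: na)
          also have "\<dots> = ennreal (\<bar>Wsing T m (pd j \<eta>) p\<bar> * fst p powr (1/4) * K)"
            using B by (simp add: ennreal_mult[symmetric] K_def mult_ac)
          also have "\<dots> <= ennreal (v p * K)" using vb[of p] K0 by (intro ennreal_leI mult_right_mono)
          finally show ?thesis .
        qed (simp add: uF)
        then have "(\<integral>\<^sup>+p. \<integral>\<^sup>+x. ennreal \<bar>(u p * F p x) * \<phi> x\<bar> \<partial>lborel \<partial>lborel) <= (\<integral>\<^sup>+p. ennreal (v p * K) \<partial>lborel)"
          by (rule nn_integral_mono)
        also have "\<dots> < \<infinity>" using v K0 by (subst nn_integral_eq_integral) auto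
        finally show ?thesis .
      qed
      have "ipL Z (pd j (Iop T m \<eta> \<phi>)) = (\<integral>x. \<integral>p. Z x * (Wsing T m (pd j \<eta>) p * (\<phi> (x - ray p) - \<phi> x)) \<partial>lborel \<partial>lborel)"
        by (simp add: ip_def Iop_singular[OF \<eta> \<phi>])
      also have "\<dots> = (\<integral>p. \<integral>x. Z x * (Wsing T m (pd j \<eta>) p * (\<phi> (x - ray p) - \<phi> x)) \<partial>lborel \<partial>lborel)"
        by (rule fubini_swap[where f="%p x. Z x * (Wsing T m (pd j \<eta>) p * (\<phi> (x - ray p) - \<phi> x))", OF _ fin1, symmetric]) measurable
      \<comment> \<open>For fixed p, translating x by the ray moves the increment from \<phi> to
        Z.\<close>
      also have "\<dots> = (\<integral>p. \<integral>x. (u p * F p x) * \<phi> x \<partial>lborel \<partial>lborel)"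
      proof (rule Bochner_Integration.integral_cong[OF refl])
        fix p
        have i: "integrable lborel (%x. Z x * \<phi> (x - ray p))" "integrable lborel (%x. Z x * \<phi> x)" "integrable lborel (%x. Z (x + ray p) * \<phi> x)"
          using sqi_inner[OF sZ sqi_shift(1)[OF sp, of "- ray p"]] sqi_inner[OF sZ sp] sqi_inner[OF sqi_shift(1)[OF sZ, of "ray p"] sp] by simp_all
        have "(\<integral>x. Z x * (Wsing T m (pd j \<eta>) p * (\<phi> (x - ray p) - \<phi> x)) \<partial>lborel) = (\<integral>x. Wsing T m (pd j \<eta>) p * (Z x * \<phi> (x - ray p) - Z x * \<phi> x) \<partial>lborel)"
          by (intro Bochner_Integration.integral_cong refl) (simp add: algebra_simps)
        also have "\<dots> = Wsing T m (pd j \<eta>) p * ((\<integral>x. Z x * \<phi> (x - ray p) \<partial>lborel) - (\<integral>x. Z x * \<phi> x \<partial>lborel))"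
          using i by simp
        also have "(\<integral>x. Z x * \<phi> (x - ray p) \<partial>lborel) = (\<integral>x. Z (x + ray p) * \<phi> x \<partial>lborel)"
          using integral_shift[of "%x. Z x * \<phi> (x - ray p)" "ray p"] by simp
        also have "Wsing T m (pd j \<eta>) p * ((\<integral>x. Z (x + ray p) * \<phi> x \<partial>lborel) - (\<integral>x. Z x * \<phi> x \<partial>lborel)) =
          (\<integral>x. Wsing T m (pd j \<eta>) p * (Z (x + ray p) * \<phi> x - Z x * \<phi> x) \<partial>lborel)"
          using i by simp
        also have "\<dots> = (\<integral>x. (u p * F p x) * \<phi> x \<partial>lborel)"
          by (intro Bochner_Integration.integral_cong refl) (simp add: uF algebra_simps)
        finally show "(\<integral>x. Z x * (Wsing T m (pd j \<eta>) p * (\<phi> (x - ray p) - \<phi> x)) \<partial>lborel) = (\<integral>x. (u p * F p x) * \<phi> x \<partial>lborel)" .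
      qed
      also have "\<dots> = (\<integral>x. \<integral>p. (u p * F p x) * \<phi> x \<partial>lborel \<partial>lborel)"
        by (rule fubini_swap[where f="%p x. (u p * F p x) * \<phi> x", OF _ fin2]) (unfold F_def, measurable)
      also have "\<dots> = ipL Y \<phi>" by (simp add: ip_def Y_def)
      finally show ?thesis .
    qed
    show "\<exists>Y. sqiL Y & (nrmL Y)\<^sup>2 <= U * U * D * (sqrt B * nrmL Z) \<and>
      (\<forall>\<phi>. tf \<phi> --> ipL Z (pd j (Iop T m \<eta> \<phi>)) = ipL Y \<phi>)"
      using sY nY dual by (intro exI[of _ Y]) (auto simp: S_def N_def)
  qed (use U0 T in \<open>simp add: D_def\<close>)
qed

section \<open>Compact operators acting on test functions\<close>

lemma vec_sqi_shift:
  fixes h :: "R3 => 'b::euclidean_space" assumes "sqiL h"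
  shows "sqiL (%x. h (x + a))" "nrmL (%x. h (x + a)) = nrmL h"
proof -
  have [measurable]: "h \<in> borel_measurable borel" using sqi_measurable[OF assms] by simp
  have e: "(\<integral>\<^sup>+x. ennreal ((norm (h (x + a)))\<^sup>2) \<partial>lborel) = ennreal ((nrmL h)\<^sup>2)"
    using nn_integral_sq[OF assms] nn_integral_shift[of "%x. ennreal ((norm (h x))\<^sup>2)" a] by simp
  have "sqiL (%x. h (x + a)) & nrmL (%x. h (x + a)) <= nrmL h"
    by (rule sqi_if_nn_integral) (simp_all add: e)
  then show s: "sqiL (%x. h (x + a))" by simp
  have "ennreal ((nrmL (%x. h (x + a)))\<^sup>2) = ennreal ((nrmL h)\<^sup>2)"
    using nn_integral_sq[OF s] e by simp
  then show "nrmL (%x. h (x + a)) = nrmL h" by (simp add: power2_eq_iff_nonneg)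
qed

lemma hold_mono: "hold A Z ==> A <= B ==> hold B Z"
  unfolding hold_def using mult_right_mono[of A B] by (meson order_trans real_sqrt_ge_zero norm_ge_zero)

lemma square_sum_le: "(a + b)\<^sup>2 <= 2 * a\<^sup>2 + 2 * (b::real)\<^sup>2"
  using sum_squares_bound[of a b] by (simp add: power2_sum)

lemma hold_add: assumes "hold A Y" "hold B Z" shows "hold (2 * A + 2 * B) (%x. Y x + Z x)"
  unfolding hold_def
proof (intro conjI allI)
  have s: "sqiL Y" "sqiL Z" using assms by (auto simp: hold_def)
  then show "sqiL (%x. Y x + Z x)" by (rule sqi_add)
  fix y
  have d: "sqiL (%x. Y (x + y) - Y x)" "sqiL (%x. Z (x + y) - Z x)"
    by (intro sqi_diff vec_sqi_shift s)+
  have "nrmL (%x. Y (x + y) + Z (x + y) - (Y x + Z x)) <= nrmL (%x. Y (x + y) - Y x) + nrmL (%x. Z (x + y) - Z x)"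
    using nrm_triangle[OF d] by (simp add: algebra_simps)
  then have "(nrmL (%x. Y (x + y) + Z (x + y) - (Y x + Z x)))\<^sup>2 <= (nrmL (%x. Y (x + y) - Y x) + nrmL (%x. Z (x + y) - Z x))\<^sup>2"
    by (intro power_mono) auto
  also have "\<dots> <= 2 * (nrmL (%x. Y (x + y) - Y x))\<^sup>2 + 2 * (nrmL (%x. Z (x + y) - Z x))\<^sup>2"
    by (rule square_sum_le)
  also have "\<dots> <= 2 * (A * sqrt (norm y)) + 2 * (B * sqrt (norm y))"
    using assms by (intro add_mono mult_left_mono) (auto simp: hold_def)
  finally show "(nrmL (%x. Y (x + y) + Z (x + y) - (Y x + Z x)))\<^sup>2 <= (2 * A + 2 * B) * sqrt (norm y)"
    by (simp add: algebra_simps)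
qed

lemma hold_linear:
  fixes L :: "'a::euclidean_space => 'b::euclidean_space"
  assumes L: "linear L" obtains C where "C >= 0" "!!A Z. hold A Z ==> hold (C * A) (%x. L (Z x))"
proof -
  have bl: "bounded_linear L" using L linear_conv_bounded_linear by blast
  obtain C where C: "C > 0" "!!f::R3 => 'a. sqiL f ==> nrmL (%x. L (f x)) <= C * nrmL f"
    using nrm_linear[OF bl] by blast
  show ?thesis
  proof (rule that[of "C\<^sup>2"])
    fix A and Z :: "R3 => 'a" assume Z: "hold A Z"
    have s: "sqiL Z" using Z by (simp add: hold_def)
    show "hold (C\<^sup>2 * A) (%x. L (Z x))" unfolding hold_def
    proof (intro conjI allI)
      show "sqiL (%x. L (Z x))" by (rule sqi_linear[OF bl s])
      fix y
      have "nrmL (%x. L (Z (x + y) - Z x)) <= C * nrmL (%x. Z (x + y) - Z x)"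
        by (intro C sqi_diff vec_sqi_shift s)
      then have "(nrmL (%x. L (Z (x + y)) - L (Z x)))\<^sup>2 <= (C * nrmL (%x. Z (x + y) - Z x))\<^sup>2"
        by (intro power_mono) (auto simp: linear_diff[OF L])
      also have "\<dots> <= C\<^sup>2 * (A * sqrt (norm y))"
        using Z unfolding power_mult_distrib hold_def by (intro mult_left_mono) auto
      finally show "(nrmL (%x. L (Z (x + y)) - L (Z x)))\<^sup>2 <= C\<^sup>2 * A * sqrt (norm y)" by simp
    qed
  qed simp
qed

text \<open>Bounded and Lipschitz, so that multiplication respects \<open>hold\<close>. Unlike
  cutoffs, constants are included; they serve when only a matrix component is extracted.\<close>

definition multiplier :: "(R3 => real) => bool" where
  "multiplier \<chi>' \<longleftrightarrow> smooth \<chi>' & (\<exists>b. \<forall>x y. \<bar>\<chi>' x\<bar> <= b & \<bar>\<chi>' x - \<chi>' y\<bar> <= b * norm (x - y))"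

lemma multiplier_const: "multiplier (%x. c)"
  unfolding multiplier_def by (auto simp: smooth_const intro!: exI[of _ "\<bar>c\<bar>"])

lemma multiplier_tf: assumes "tf f" shows "multiplier f"
proof -
  obtain B where B: "B > 0" "!!x. norm (f x) <= B" using tf_bounded[OF assms] by blast
  obtain L where L: "L > 0" "!!x y. norm (f x - f y) <= L * norm (x - y)" using tf_lipschitz[OF assms] by blast
  have "\<bar>f x\<bar> <= B + L & \<bar>f x - f y\<bar> <= (B + L) * norm (x - y)" for x y
  proof -
    have "L * norm (x - y) <= (B + L) * norm (x - y)" by (rule mult_right_mono) (use B in auto)
    then show ?thesis using B(2)[of x] L(2)[of x y] L(1) by auto
  qed
  then show ?thesis using assms by (auto simp: multiplier_def tf_smooth)
qed

lemma multiplier_sqi: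
  fixes Z :: "R3 => 'b::euclidean_space"
  assumes "multiplier f" "sqiL Z" shows "sqiL (%x. f x *\<^sub>R Z x)"
  using assms by (auto simp: multiplier_def smooth_borel intro!: sqi_mult_bounded)

lemma multiplier_nrm:
  assumes "multiplier f"
  obtains C where "C > 0" "!!Z :: R3 => 'b::euclidean_space. sqiL Z ==> nrmL (%x. f x *\<^sub>R Z x) <= C * nrmL Z"
proof -
  obtain b where b: "!!x. \<bar>f x\<bar> <= b" using assms by (auto simp: multiplier_def)
  have "norm (f x *\<^sub>R Z x) <= (\<bar>b\<bar> + 1) * norm (Z x)" for x and Z :: "R3 => 'b"
    using b[of x] by (auto intro!: mult_right_mono)
  then show ?thesis using multiplier_sqi[OF assms] by (intro that[of "\<bar>b\<bar> + 1"] nrm_bound) (auto simp: sqi_def)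
qed

text \<open>The increment of f Z is f at the shifted point times the increment of Z, plus the
  increment of f times Z. The second part is of size min(1, |y|), which \<open>min1_le_sqrt\<close>
  turns into the required modulus; this is where the norm of Z enters the constant.\<close>

lemma hold_multiplier:
  assumes f: "multiplier f"
  obtains C where "C >= 0" "!!A (Z :: R3 => 'b::euclidean_space). hold A Z ==> hold (C * A + C * (nrmL Z)\<^sup>2) (%x. f x *\<^sub>R Z x)"
proof -
  obtain b where b: "!!x. \<bar>f x\<bar> <= b" "!!x y. \<bar>f x - f y\<bar> <= b * norm (x - y)" using f by (auto simp: multiplier_def)
  have b0: "0 <= b" using b(1)[of 0] by linarith
  have [measurable]: "f \<in> borel_measurable borel" using f by (auto simp: multiplier_def smooth_borel)
  show ?thesis
  proof (rule that[of "8 * b\<^sup>2"])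
    fix A and Z :: "R3 => 'b" assume Z: "hold A Z"
    have s: "sqiL Z" using Z by (simp add: hold_def)
    have [measurable]: "Z \<in> borel_measurable borel" using sqi_measurable[OF s] by simp
    show "hold (8 * b\<^sup>2 * A + 8 * b\<^sup>2 * (nrmL Z)\<^sup>2) (%x. f x *\<^sub>R Z x)" unfolding hold_def
    proof (intro conjI allI)
      show "sqiL (%x. f x *\<^sub>R Z x)" by (rule multiplier_sqi[OF f s])
      fix y
      have d: "sqiL (%x. Z (x + y) - Z x)" by (intro sqi_diff vec_sqi_shift s)
      have s1: "sqiL (%x. f (x + y) *\<^sub>R (Z (x + y) - Z x))" by (rule sqi_mult_bounded[OF d _ b(1)]) measurable
      have df: "\<bar>f (x + y) - f x\<bar> <= 2 * b * min 1 (norm y)" for x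
        using b(2)[of "x + y" x] b(1)[of x] b(1)[of "x + y"] b0 mult_nonneg_nonneg[OF b0 norm_ge_zero[of y]] by (auto simp: min_def)
      have s2: "sqiL (%x. (f (x + y) - f x) *\<^sub>R Z x)" by (rule sqi_mult_bounded[OF s _ df]) measurable
      have n1: "nrmL (%x. f (x + y) *\<^sub>R (Z (x + y) - Z x)) <= b * nrmL (%x. Z (x + y) - Z x)"
        using b0 b(1) sqi_measurable[OF s1] by (intro nrm_bound[OF d]) (auto intro!: mult_right_mono)
      have n2: "nrmL (%x. (f (x + y) - f x) *\<^sub>R Z x) <= (2 * b * min 1 (norm y)) * nrmL Z"
        using b0 df sqi_measurable[OF s2] by (intro nrm_bound[OF s]) (auto intro!: mult_right_mono)
      have "(nrmL (%x. f (x + y) *\<^sub>R Z (x + y) - f x *\<^sub>R Z x)) <= b * nrmL (%x. Z (x + y) - Z x) + (2 * b * min 1 (norm y)) * nrmL Z"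
        using order_trans[OF nrm_triangle[OF s1 s2] add_mono[OF n1 n2]] by (simp add: algebra_simps)
      then have "(nrmL (%x. f (x + y) *\<^sub>R Z (x + y) - f x *\<^sub>R Z x))\<^sup>2 <= (b * nrmL (%x. Z (x + y) - Z x) + (2 * b * min 1 (norm y)) * nrmL Z)\<^sup>2"
        by (intro power_mono) auto
      also have "\<dots> <= 2 * (b * nrmL (%x. Z (x + y) - Z x))\<^sup>2 + 2 * ((2 * b * min 1 (norm y)) * nrmL Z)\<^sup>2"
        by (rule square_sum_le)
      also have "\<dots> <= 2 * (b\<^sup>2 * (A * sqrt (norm y))) + 2 * (4 * b\<^sup>2 * sqrt (norm y) * (nrmL Z)\<^sup>2)"
      proof (intro add_mono mult_left_mono)
        show "(b * nrmL (%x. Z (x + y) - Z x))\<^sup>2 <= b\<^sup>2 * (A * sqrt (norm y))"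
          using Z unfolding power_mult_distrib hold_def by (intro mult_left_mono) auto
        have "4 * b\<^sup>2 * (min 1 (norm y))\<^sup>2 * (nrmL Z)\<^sup>2 <= 4 * b\<^sup>2 * sqrt (norm y) * (nrmL Z)\<^sup>2"
          by (intro mult_right_mono mult_left_mono min1_le_sqrt) auto
        then show "((2 * b * min 1 (norm y)) * nrmL Z)\<^sup>2 <= 4 * b\<^sup>2 * sqrt (norm y) * (nrmL Z)\<^sup>2"
          by (simp add: power_mult_distrib)
      qed auto
      also have "\<dots> <= (8 * b\<^sup>2 * A + 8 * b\<^sup>2 * (nrmL Z)\<^sup>2) * sqrt (norm y)"
      proof -
        have "0 <= A * sqrt (norm y)" using Z unfolding hold_def by (meson order_trans zero_le_power2)
        then have "0 <= 6 * (b\<^sup>2 * (A * sqrt (norm y)))" by simp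
        then show ?thesis by (simp add: algebra_simps)
      qed
      finally show "(nrmL (%x. f (x + y) *\<^sub>R Z (x + y) - f x *\<^sub>R Z x))\<^sup>2 <= (8 * b\<^sup>2 * A + 8 * b\<^sup>2 * (nrmL Z)\<^sup>2) * sqrt (norm y)" .
    qed
  qed simp
qed

text \<open>The factor and the adjoint of L are moved onto the continuous test function.\<close>

lemma weakly_null_multiplier:
  fixes L :: "'a::euclidean_space => 'b::euclidean_space"
  assumes h: "weakly_null r h" and f: "multiplier f" and L: "linear L"
  shows "weakly_null r (%n x. f x *\<^sub>R L (h n x))"
proof -
  have bl: "bounded_linear L" using L linear_conv_bounded_linear by blast
  obtain C where C: "C > 0" "!!g::R3 => 'a. sqiL g ==> nrmL (%x. L (g x)) <= C * nrmL g"
    using nrm_linear[OF bl] by blast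
  obtain D where D: "D > 0" "!!Z :: R3 => 'b. sqiL Z ==> nrmL (%x. f x *\<^sub>R Z x) <= D * nrmL Z"
    using multiplier_nrm[OF f] by blast
  obtain M where M: "!!n. nrmL (h n) <= M" using h by (auto simp: weakly_null_def)
  have s: "sqiL (h n)" and off: "x \<notin> cball 0 r ==> h n x = 0" for n x using h by (auto simp: weakly_null_def)
  have sL: "sqiL (%x. L (h n x))" for n by (rule sqi_linear[OF bl s])
  have "nrmL (%x. f x *\<^sub>R L (h n x)) <= D * (C * M)" for n
  proof -
    have "nrmL (%x. L (h n x)) <= C * M"
      using C(2)[OF s, of n] mult_left_mono[OF M, of C n] C(1) by linarith
    then have "D * nrmL (%x. L (h n x)) <= D * (C * M)" using D(1) by simp
    then show ?thesis using D(2)[OF sL, of n] by linarith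
  qed
  moreover have "(%n. ipL (%x. f x *\<^sub>R L (h n x)) \<kappa>) \<longlonglongrightarrow> 0" if \<kappa>: "continuous_on UNIV \<kappa>" for \<kappa>
  proof -
    have "continuous_on UNIV (%x. f x *\<^sub>R adjoint L (\<kappa> x))"
    proof (rule continuous_on_scaleR)
      show "continuous_on UNIV f" by (rule smooth_continuous) (use f in \<open>simp add: multiplier_def\<close>)
      show "continuous_on UNIV (%x. adjoint L (\<kappa> x))"
        by (rule linear_continuous_on_compose[OF \<kappa> adjoint_linear[OF L]])
    qed
    moreover have "ipL (%x. f x *\<^sub>R L (h n x)) \<kappa> = ipL (h n) (%x. f x *\<^sub>R adjoint L (\<kappa> x))" for n
      by (simp add: ip_def adjoint_works[OF L])
    ultimately show ?thesis using h by (simp add: weakly_null_def)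
  qed
  ultimately show ?thesis
    using multiplier_sqi[OF f sL] off linear_0[OF L] by (auto simp: weakly_null_def)
qed

text \<open>k is given on test functions only, whereas the sequences are merely in L2. All analytic
  properties are therefore demanded of the transpose K, with compactness in the form weakly null to
  strongly null.\<close>

definition adjoint_op :: "((R3 => 'a::euclidean_space) => R3 => 'b::euclidean_space) => ((R3 => 'b) => R3 => 'a) => bool" where
  "adjoint_op k K \<longleftrightarrow> (\<forall>h. sqiL h --> sqiL (K h) & (\<forall>\<phi>. tf \<phi> --> ipL (K h) \<phi> = ipL h (k \<phi>))) \<and>
          (\<exists>c\<ge>0. \<forall>h. sqiL h --> nrmL (K h) <= c * nrmL h) \<and>
          (\<exists>c\<ge>0. \<forall>h. sqiL h --> hold (c * (nrmL h)\<^sup>2) (K h)) \<and>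
          (\<forall>r. \<exists>r'. \<forall>h. (\<forall>x. x \<notin> cball 0 r --> h x = 0) --> (\<forall>x. x \<notin> cball 0 r' --> K h x = 0)) \<and>
          (\<forall>r h. weakly_null r h --> (%n. nrmL (K (h n))) \<longlonglongrightarrow> 0)"

text \<open>Operators that gain one derivative and spread supports by at most C. The last clause
  concerns the order 0 operator \<open>pd j\<close> after k: it is controlled on the adjoint side
  and for arguments with a Hoelder modulus, as in \<open>singular_adjoint\<close>. The class allows
  matrix-valued homotopy operators to be treated by composition rules alone.\<close>

definition nice :: "R3 set => ((R3 => 'a::euclidean_space) => R3 => 'b::euclidean_space) => bool" where
  "nice C k \<longleftrightarrow>
     (\<forall>\<phi>. tf \<phi> --> tf (k \<phi>) & tsupp (k \<phi>) \<subseteq> {y + s | y s. y \<in> tsupp \<phi> & s \<in> C}) \<and>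
     (\<exists>K. adjoint_op k K) \<and>
     (\<forall>j r. \<exists>c\<ge>0. \<forall>B Z. 0 <= B & hold B Z & (\<forall>x. x \<notin> cball 0 r --> Z x = 0) -->
        (\<exists>Y. sqiL Y & (nrmL Y)\<^sup>2 <= c * (sqrt B * nrmL Z) \<and>
           (\<forall>\<phi>. tf \<phi> --> ipL Z (pd j (k \<phi>)) = ipL Y \<phi>)))"

lemma nice_Iop:
  assumes \<eta>: "tf \<eta>" and T: "0 <= T"
  shows "nice (rays T (tsupp \<eta>)) (Iop T m \<eta>)"
  unfolding nice_def
proof (intro conjI allI impI)
  fix \<phi> :: "R3 => real" assume "tf \<phi>"
  then show "tf (Iop T m \<eta> \<phi>)" "tsupp (Iop T m \<eta> \<phi>) \<subseteq> {y + s |y s. y \<in> tsupp \<phi> & s \<in> rays T (tsupp \<eta>)}"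
    using Iop_tf[OF \<eta>] by auto
next
  obtain c where c: "c >= 0" "!!h. sqiL h ==> nrmL (Jop T m \<eta> h) <= c * nrmL h"
    using Jop_bounded[OF \<eta>] by blast
  obtain d where d: "d >= 0" "!!h. sqiL h ==> hold (d * (nrmL h)\<^sup>2) (Jop T m \<eta> h)"
    using Jop_hold[OF \<eta>] by blast
  have "bounded (rays T (tsupp \<eta>))" by (intro compact_imp_bounded compact_rays tf_compact \<eta>)
  then obtain s where s: "rays T (tsupp \<eta>) \<subseteq> cball 0 s" by (auto simp: bounded_iff subset_eq)
  show "\<exists>K. adjoint_op (Iop T m \<eta>) K"
    unfolding adjoint_op_def
  proof (intro exI[of _ "Jop T m \<eta>"] conjI)
    show "\<forall>r. \<exists>r'. \<forall>h. (\<forall>x. x \<notin> cball 0 r --> h x = 0) --> (\<forall>x. x \<notin> cball 0 r' --> Jop T m \<eta> h x = 0)"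
    proof
      fix r
      show "\<exists>r'. \<forall>h. (\<forall>x. x \<notin> cball 0 r --> h x = 0) --> (\<forall>x. x \<notin> cball 0 r' --> Jop T m \<eta> h x = 0)"
        using Jop_support[OF \<eta> _ s] by (intro exI[of _ "r + s"]) blast
    qed
  qed (use c d Jop_sqi[OF \<eta>] Jop_dual[OF \<eta>] tf_sqi Jop_null[OF \<eta>] in blast)+
next
  fix j r
  obtain C where "C >= 0"
    "!!B Z. hold B Z ==> (!!x. x \<notin> cball 0 r ==> Z x = 0) ==> 0 <= B ==> \<exists>Y. sqiL Y & (nrmL Y)\<^sup>2 <= C * (sqrt B * nrmL Z) \<and>
      (\<forall>\<phi>. tf \<phi> --> ipL Z (pd j (Iop T m \<eta> \<phi>)) = ipL Y \<phi>)"
    using singular_adjoint[OF \<eta> T, where r=r and m=m and j=j] by blast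
  then show "\<exists>c\<ge>0. \<forall>B Z. 0 <= B & hold B Z & (\<forall>x. x \<notin> cball 0 r --> Z x = 0) -->
        (\<exists>Y. sqiL Y & (nrmL Y)\<^sup>2 <= c * (sqrt B * nrmL Z) \<and>
           (\<forall>\<phi>. tf \<phi> --> ipL Z (pd j (Iop T m \<eta> \<phi>)) = ipL Y \<phi>))"
    by (intro exI[of _ C]) blast
qed

lemma nice_tf: "nice C k ==> tf \<phi> ==> tf (k \<phi>)" by (simp add: nice_def)
lemma nice_tsupp: "nice C k ==> tf \<phi> ==> tsupp (k \<phi>) \<subseteq> {y + s | y s. y \<in> tsupp \<phi> & s \<in> C}" by (simp add: nice_def)

lemma nice_mono: assumes "nice C k" "C \<subseteq> D" shows "nice D k"
proof -
  have "{y + s | y s. y \<in> tsupp \<phi> & s \<in> C} \<subseteq> {y + s | y s. y \<in> tsupp \<phi> & s \<in> D}" for \<phi> :: "R3 => 'a" using assms(2) by auto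
  then have 1: "\<forall>\<phi>. tf \<phi> --> tf (k \<phi>) & tsupp (k \<phi>) \<subseteq> {y + s | y s. y \<in> tsupp \<phi> & s \<in> D}"
    using nice_tf[OF assms(1)] nice_tsupp[OF assms(1)] by (meson subset_trans)
  show ?thesis unfolding nice_def
    by (rule conjI[OF 1 assms(1)[unfolded nice_def, THEN conjunct2]])
qed

lemma nice_adjoint: "nice C k ==> \<exists>K. adjoint_op k K" unfolding nice_def by (rule conjunct1[OF conjunct2])

lemma
  assumes K: "adjoint_op k K"
  shows adjoint_sqi: "sqiL h ==> sqiL (K h)"
    and adjoint_dual: "sqiL h ==> tf \<phi> ==> ipL (K h) \<phi> = ipL h (k \<phi>)"
    and adjoint_bounded: "\<exists>c\<ge>0. \<forall>h. sqiL h --> nrmL (K h) <= c * nrmL h"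
    and adjoint_hold: "\<exists>c\<ge>0. \<forall>h. sqiL h --> hold (c * (nrmL h)\<^sup>2) (K h)"
    and adjoint_support: "\<exists>r'. \<forall>h. (\<forall>x. x \<notin> cball 0 r --> h x = 0) --> (\<forall>x. x \<notin> cball 0 r' --> K h x = 0)"
    and adjoint_null: "weakly_null r h' ==> (%n. nrmL (K (h' n))) \<longlonglongrightarrow> 0"
proof -
  note K' = K[unfolded adjoint_op_def]
  show "sqiL h ==> sqiL (K h)" "sqiL h ==> tf \<phi> ==> ipL (K h) \<phi> = ipL h (k \<phi>)"
    using K'[THEN conjunct1] by simp_all
  show "\<exists>c\<ge>0. \<forall>h. sqiL h --> nrmL (K h) <= c * nrmL h"
    by (rule K'[THEN conjunct2, THEN conjunct1])
  show "\<exists>c\<ge>0. \<forall>h. sqiL h --> hold (c * (nrmL h)\<^sup>2) (K h)"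
    by (rule K'[THEN conjunct2, THEN conjunct2, THEN conjunct1])
  show "\<exists>r'. \<forall>h. (\<forall>x. x \<notin> cball 0 r --> h x = 0) --> (\<forall>x. x \<notin> cball 0 r' --> K h x = 0)"
    using K'[THEN conjunct2, THEN conjunct2, THEN conjunct2, THEN conjunct1] by (rule spec)
  show "weakly_null r h' ==> (%n. nrmL (K (h' n))) \<longlonglongrightarrow> 0"
    using K'[THEN conjunct2, THEN conjunct2, THEN conjunct2, THEN conjunct2] by simp
qed

lemma nice_singular:
  "nice C k ==> \<exists>c\<ge>0. \<forall>B Z. 0 <= B & hold B Z & (\<forall>x. x \<notin> cball 0 r --> Z x = 0) -->
        (\<exists>Y. sqiL Y & (nrmL Y)\<^sup>2 <= c * (sqrt B * nrmL Z) \<and>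
           (\<forall>\<phi>. tf \<phi> --> ipL Z (pd j (k \<phi>)) = ipL Y \<phi>))"
  unfolding nice_def by simp

lemma niceI:
  assumes "!!\<phi>. tf \<phi> ==> tf (k \<phi>)" "!!\<phi>. tf \<phi> ==> tsupp (k \<phi>) \<subseteq> {y + s | y s. y \<in> tsupp \<phi> & s \<in> C}"
    "!!h. sqiL h ==> sqiL (K h)"
    "!!h \<phi>. sqiL h ==> tf \<phi> ==> ipL (K h) \<phi> = ipL h (k \<phi>)"
    "c >= 0" "!!h. sqiL h ==> nrmL (K h) <= c * nrmL h"
    "d >= 0" "!!h. sqiL h ==> hold (d * (nrmL h)\<^sup>2) (K h)"
    "!!r. \<exists>r'. \<forall>h. (\<forall>x. x \<notin> cball 0 r --> h x = 0) --> (\<forall>x. x \<notin> cball 0 r' --> K h x = 0)"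
    "!!r h. weakly_null r h ==> (%n. nrmL (K (h n))) \<longlonglongrightarrow> 0"
    "!!j r. \<exists>c\<ge>0. \<forall>B Z. 0 <= B & hold B Z & (\<forall>x. x \<notin> cball 0 r --> Z x = 0) -->
        (\<exists>Y. sqiL Y & (nrmL Y)\<^sup>2 <= c * (sqrt B * nrmL Z) \<and>
           (\<forall>\<phi>. tf \<phi> --> ipL Z (pd j (k \<phi>)) = ipL Y \<phi>))"
  shows "nice C k"
proof -
  have "adjoint_op k K" unfolding adjoint_op_def
    using assms(3-10) by (intro conjI exI[of _ c] exI[of _ d]) simp_all
  then show ?thesis unfolding nice_def using assms(1,2,11) by (intro conjI) auto
qed

section \<open>Composition rules for the operator class\<close>

lemma nice_zero: "nice C (%\<phi> x. 0)"
proof (rule niceI[where K="%h x. 0" and c=0 and d=0])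
  show "\<exists>c\<ge>0. \<forall>B Z. 0 <= B & hold B Z & (\<forall>x. x \<notin> cball 0 r --> Z x = 0) -->
        (\<exists>Y. sqiL Y & (nrmL Y)\<^sup>2 <= c * (sqrt B * nrmL Z) \<and>
           (\<forall>\<phi>. tf \<phi> --> ipL Z (pd j (%x. 0)) = ipL Y \<phi>))" for j r
    by (intro exI[of _ 0] conjI allI impI exI[of _ "%x. 0"]) (auto simp: sqi_zero nrm_def ip_def pd_const)
qed (auto simp: tf_zero sqi_zero ip_def nrm_def hold_def tsupp_def)

lemma nice_add:
  fixes k1 k2 :: "(R3 => 'a::euclidean_space) => R3 => 'b::euclidean_space"
  assumes n1: "nice C k1" and n2: "nice C k2"
  shows "nice C (%\<phi> x. k1 \<phi> x + k2 \<phi> x)"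
proof -
  obtain K1 where aK1: "adjoint_op k1 K1" using nice_adjoint[OF n1] by (elim exE)
  obtain c1 where c1: "c1 >= 0" "\<forall>h. sqiL h --> nrmL (K1 h) <= c1 * nrmL h"
    using adjoint_bounded[OF aK1] by (elim exE conjE)
  obtain d1 where d1: "d1 >= 0" "\<forall>h. sqiL h --> hold (d1 * (nrmL h)\<^sup>2) (K1 h)"
    using adjoint_hold[OF aK1] by (elim exE conjE)
  note K1 = adjoint_sqi[OF aK1] adjoint_dual[OF aK1] c1(1) c1(2)[rule_format] d1(1) d1(2)[rule_format] adjoint_support[OF aK1] adjoint_null[OF aK1]
  obtain K2 where aK2: "adjoint_op k2 K2" using nice_adjoint[OF n2] by (elim exE)
  obtain c2 where c2: "c2 >= 0" "\<forall>h. sqiL h --> nrmL (K2 h) <= c2 * nrmL h"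
    using adjoint_bounded[OF aK2] by (elim exE conjE)
  obtain d2 where d2: "d2 >= 0" "\<forall>h. sqiL h --> hold (d2 * (nrmL h)\<^sup>2) (K2 h)"
    using adjoint_hold[OF aK2] by (elim exE conjE)
  note K2 = adjoint_sqi[OF aK2] adjoint_dual[OF aK2] c2(1) c2(2)[rule_format] d2(1) d2(2)[rule_format] adjoint_support[OF aK2] adjoint_null[OF aK2]
  show ?thesis
  proof (rule niceI[where K="%h x. K1 h x + K2 h x" and c="c1 + c2" and d="2 * d1 + 2 * d2"])
    show "tf (%x. k1 \<phi> x + k2 \<phi> x)" if "tf \<phi>" for \<phi> by (intro tf_add nice_tf[OF n1] nice_tf[OF n2] that)
    show "tsupp (%x. k1 \<phi> x + k2 \<phi> x) \<subseteq> {y + s |y s. y \<in> tsupp \<phi> & s \<in> C}" if "tf \<phi>" for \<phi>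
    proof -
      have "tsupp (%x. k1 \<phi> x + k2 \<phi> x) \<subseteq> tsupp (k1 \<phi>) \<union> tsupp (k2 \<phi>)"
        by (rule tsupp_subset) (auto simp: closed_tsupp tsuppD)
      then show ?thesis using nice_tsupp[OF n1 that] nice_tsupp[OF n2 that] by blast
    qed
    show "sqiL (%x. K1 h x + K2 h x)" if "sqiL h" for h using K1(1) K2(1) that by (intro sqi_add)
    show "ipL (%x. K1 h x + K2 h x) \<phi> = ipL h (%x. k1 \<phi> x + k2 \<phi> x)" if "sqiL h" "tf \<phi>" for h \<phi>
      using K1(1,2) K2(1,2) that nice_tf[OF n1] nice_tf[OF n2] by (simp add: ip_add_left ip_add_right tf_sqi)
    show "nrmL (%x. K1 h x + K2 h x) <= (c1 + c2) * nrmL h" if "sqiL h" for h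
      using order_trans[OF nrm_triangle[OF K1(1)[OF that] K2(1)[OF that]] add_mono[OF K1(4)[OF that] K2(4)[OF that]]]
      by (simp add: algebra_simps)
    show "hold ((2 * d1 + 2 * d2) * (nrmL h)\<^sup>2) (%x. K1 h x + K2 h x)" if "sqiL h" for h
      using hold_add[OF K1(6)[OF that] K2(6)[OF that]] by (simp add: algebra_simps)
    show "\<exists>r'. \<forall>h. (\<forall>x. x \<notin> cball 0 r --> h x = 0) --> (\<forall>x. x \<notin> cball 0 r' --> K1 h x + K2 h x = 0)" for r
    proof -
      obtain r1 where "\<forall>h. (\<forall>x. x \<notin> cball 0 r --> h x = 0) --> (\<forall>x. x \<notin> cball 0 r1 --> K1 h x = 0)" using K1(7) by blast
      moreover obtain r2 where "\<forall>h. (\<forall>x. x \<notin> cball 0 r --> h x = 0) --> (\<forall>x. x \<notin> cball 0 r2 --> K2 h x = 0)" using K2(7) by blast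
      ultimately show ?thesis by (intro exI[of _ "max r1 r2"]) auto
    qed
    show "(%n. nrmL (%x. K1 (h n) x + K2 (h n) x)) \<longlonglongrightarrow> 0" if h: "weakly_null r h" for r h
    proof (rule Lim_null_comparison)
      have "sqiL (h n)" for n using h by (simp add: weakly_null_def)
      then show "\<forall>\<^sub>F n in sequentially. norm (nrmL (%x. K1 (h n) x + K2 (h n) x)) <= nrmL (K1 (h n)) + nrmL (K2 (h n))"
        using nrm_triangle[OF K1(1) K2(1)] by simp
      show "(%n. nrmL (K1 (h n)) + nrmL (K2 (h n))) \<longlonglongrightarrow> 0"
        using tendsto_add[OF K1(8)[OF h] K2(8)[OF h]] by simp
    qed
    fix j r
    obtain c where c: "c >= 0" "\<forall>B Z. 0 <= B & hold B Z & (\<forall>x. x \<notin> cball 0 r --> Z x = 0) -->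
      (\<exists>Y. sqiL Y & (nrmL Y)\<^sup>2 <= c * (sqrt B * nrmL Z) & (\<forall>\<phi>. tf \<phi> --> ipL Z (pd j (k1 \<phi>)) = ipL Y \<phi>))"
      using nice_singular[OF n1, of r j] by (elim exE conjE)
    obtain d where d: "d >= 0" "\<forall>B Z. 0 <= B & hold B Z & (\<forall>x. x \<notin> cball 0 r --> Z x = 0) -->
      (\<exists>Y. sqiL Y & (nrmL Y)\<^sup>2 <= d * (sqrt B * nrmL Z) & (\<forall>\<phi>. tf \<phi> --> ipL Z (pd j (k2 \<phi>)) = ipL Y \<phi>))"
      using nice_singular[OF n2, of r j] by (elim exE conjE)
    show "\<exists>c\<ge>0. \<forall>B Z. 0 <= B & hold B Z & (\<forall>x. x \<notin> cball 0 r --> Z x = 0) -->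
        (\<exists>Y. sqiL Y & (nrmL Y)\<^sup>2 <= c * (sqrt B * nrmL Z) \<and>
           (\<forall>\<phi>. tf \<phi> --> ipL Z (pd j (%x. k1 \<phi> x + k2 \<phi> x)) = ipL Y \<phi>))"
    proof (intro exI[of _ "2 * c + 2 * d"] conjI allI impI)
      fix B and Z :: "R3 => 'b" assume Z: "0 <= B & hold B Z & (\<forall>x. x \<notin> cball 0 r --> Z x = 0)"
      obtain Y1 where Y1: "sqiL Y1" "(nrmL Y1)\<^sup>2 <= c * (sqrt B * nrmL Z)" "!!\<phi>. tf \<phi> ==> ipL Z (pd j (k1 \<phi>)) = ipL Y1 \<phi>"
        using c(2)[rule_format, OF Z] by blast
      obtain Y2 where Y2: "sqiL Y2" "(nrmL Y2)\<^sup>2 <= d * (sqrt B * nrmL Z)" "!!\<phi>. tf \<phi> ==> ipL Z (pd j (k2 \<phi>)) = ipL Y2 \<phi>"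
        using d(2)[rule_format, OF Z] by blast
      have sZ: "sqiL Z" using Z by (simp add: hold_def)
      show "\<exists>Y. sqiL Y & (nrmL Y)\<^sup>2 <= (2 * c + 2 * d) * (sqrt B * nrmL Z) \<and>
           (\<forall>\<phi>. tf \<phi> --> ipL Z (pd j (%x. k1 \<phi> x + k2 \<phi> x)) = ipL Y \<phi>)"
      proof (intro exI[of _ "%x. Y1 x + Y2 x"] conjI allI impI)
        show "sqiL (%x. Y1 x + Y2 x)" by (intro sqi_add Y1 Y2)
        have "(nrmL (%x. Y1 x + Y2 x))\<^sup>2 <= (nrmL Y1 + nrmL Y2)\<^sup>2"
          by (intro power_mono nrm_triangle Y1 Y2) auto
        also have "\<dots> <= 2 * (nrmL Y1)\<^sup>2 + 2 * (nrmL Y2)\<^sup>2" by (rule square_sum_le)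
        finally show "(nrmL (%x. Y1 x + Y2 x))\<^sup>2 <= (2 * c + 2 * d) * (sqrt B * nrmL Z)"
          using Y1(2) Y2(2) by (simp add: algebra_simps)
        fix \<phi> :: "R3 => 'a" assume \<phi>: "tf \<phi>"
        have "pd j (%x. k1 \<phi> x + k2 \<phi> x) = (%x. pd j (k1 \<phi>) x + pd j (k2 \<phi>) x)"
          by (intro ext pd_add smooth_differentiable tf_smooth nice_tf[OF n1] nice_tf[OF n2] \<phi>)
        then show "ipL Z (pd j (%x. k1 \<phi> x + k2 \<phi> x)) = ipL (%x. Y1 x + Y2 x) \<phi>"
          using Y1 Y2 \<phi> sZ nice_tf[OF n1] nice_tf[OF n2] by (simp add: ip_add_left ip_add_right tf_sqi tf_pd)
      qed
    qed (use c d in auto)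
  qed (use K1 K2 in auto)
qed

lemma nice_sum: "(!!i. i \<in> I ==> nice C (k i)) ==> nice C (%\<phi> x. \<Sum>i\<in>I. k i \<phi> x)"
  by (induction I rule: infinite_finite_induct) (auto intro: nice_add nice_zero)

text \<open>A constant linear map commutes with \<open>pd j\<close>, so its adjoint can be applied
  to h and Z before the given K.\<close>

lemma nice_post:
  fixes k :: "(R3 => 'a::euclidean_space) => R3 => 'b::euclidean_space" and L :: "'b => 'c::euclidean_space"
  assumes n: "nice C k" and L: "linear L"
  shows "nice C (%\<phi> x. L (k \<phi> x))"
proof -
  obtain K where aK: "adjoint_op k K" using nice_adjoint[OF n] by (elim exE)
  obtain c where c: "c >= 0" "\<forall>h. sqiL h --> nrmL (K h) <= c * nrmL h"
    using adjoint_bounded[OF aK] by (elim exE conjE)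
  obtain d where d: "d >= 0" "\<forall>h. sqiL h --> hold (d * (nrmL h)\<^sup>2) (K h)"
    using adjoint_hold[OF aK] by (elim exE conjE)
  note K = adjoint_sqi[OF aK] adjoint_dual[OF aK] c(1) c(2)[rule_format] d(1) d(2)[rule_format] adjoint_support[OF aK] adjoint_null[OF aK]
  have bl: "bounded_linear L" using L linear_conv_bounded_linear by blast
  have L': "linear (adjoint L)" by (rule adjoint_linear[OF L])
  then have bl': "bounded_linear (adjoint L)" using linear_conv_bounded_linear by blast
  have adj: "ipL (%x. adjoint L (h x)) g = ipL h (%x. L (g x))" for h g
    by (simp add: ip_def inner_commute[of "adjoint L _"] adjoint_works[OF L] inner_commute)
  obtain l where l: "l > 0" "!!f::R3 => 'c. sqiL f ==> nrmL (%x. adjoint L (f x)) <= l * nrmL f"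
    using nrm_linear[OF bl'] by blast
  obtain e where e: "e >= 0" "!!A (Z::R3 => 'c). hold A Z ==> hold (e * A) (%x. adjoint L (Z x))"
    using hold_linear[OF L'] by blast
  have sL: "sqiL (%x. adjoint L (h x))" if "sqiL h" for h by (rule sqi_linear[OF bl' that])
  show ?thesis
  proof (rule niceI[where K="%h. K (%x. adjoint L (h x))" and c="c * l" and d="d * l\<^sup>2"])
    show "tf (%x. L (k \<phi> x))" if "tf \<phi>" for \<phi> by (intro tf_linear[OF bl] nice_tf[OF n] that)
    show "tsupp (%x. L (k \<phi> x)) \<subseteq> {y + s |y s. y \<in> tsupp \<phi> & s \<in> C}" if "tf \<phi>" for \<phi>
    proof -
      have "tsupp (%x. L (k \<phi> x)) \<subseteq> tsupp (k \<phi>)"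
        by (rule tsupp_subset) (auto simp: closed_tsupp tsuppD linear_0[OF L])
      then show ?thesis using nice_tsupp[OF n that] by blast
    qed
    show "sqiL (K (%x. adjoint L (h x)))" if "sqiL h" for h using K(1) sL that by blast
    show "ipL (K (%x. adjoint L (h x))) \<phi> = ipL h (%x. L (k \<phi> x))" if "sqiL h" "tf \<phi>" for h \<phi>
      using K(2)[OF sL] that by (simp add: adj)
    show "nrmL (K (%x. adjoint L (h x))) <= c * l * nrmL h" if "sqiL h" for h
      using K(4)[OF sL[OF that]] mult_left_mono[OF l(2)[OF that] K(3)] by (simp add: mult.assoc)
    show "hold (d * l\<^sup>2 * (nrmL h)\<^sup>2) (K (%x. adjoint L (h x)))" if "sqiL h" for h
    proof (rule hold_mono[OF K(6)[OF sL[OF that]]])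
      have "(nrmL (%x. adjoint L (h x)))\<^sup>2 <= (l * nrmL h)\<^sup>2" using l(2)[OF that] by (intro power_mono) auto
      then show "d * (nrmL (%x. adjoint L (h x)))\<^sup>2 <= d * l\<^sup>2 * (nrmL h)\<^sup>2"
        using mult_left_mono[OF _ K(5)] by (simp add: power_mult_distrib mult.assoc)
    qed
    show "\<exists>r'. \<forall>h. (\<forall>x. x \<notin> cball 0 r --> h x = 0) --> (\<forall>x. x \<notin> cball 0 r' --> K (%x. adjoint L (h x)) x = 0)" for r
    proof -
      obtain r1 where r1: "\<forall>h. (\<forall>x. x \<notin> cball 0 r --> h x = 0) --> (\<forall>x. x \<notin> cball 0 r1 --> K h x = 0)" using K(7) by blast
      show ?thesis
      proof (intro exI[of _ r1] allI impI)
        fix h :: "R3 => 'c" and x :: R3 assume "\<forall>x. x \<notin> cball 0 r --> h x = 0" "x \<notin> cball 0 r1"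
        then show "K (%x. adjoint L (h x)) x = 0"
          using r1[rule_format, of "%x. adjoint L (h x)" x] linear_0[OF L'] by auto
      qed
    qed
    show "(%n. nrmL (K (%x. adjoint L (h n x)))) \<longlonglongrightarrow> 0" if h: "weakly_null r h" for r h
      using K(8)[of r "%n x. adjoint L (h n x)"] weakly_null_multiplier[OF h multiplier_const[of 1] L'] by simp
    fix j r
    obtain b where b: "b >= 0" "\<forall>B Z. 0 <= B & hold B Z & (\<forall>x. x \<notin> cball 0 r --> Z x = 0) -->
      (\<exists>Y. sqiL Y & (nrmL Y)\<^sup>2 <= b * (sqrt B * nrmL Z) & (\<forall>\<phi>. tf \<phi> --> ipL Z (pd j (k \<phi>)) = ipL Y \<phi>))"
      using nice_singular[OF n, of r j] by (elim exE conjE)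
    show "\<exists>c\<ge>0. \<forall>B Z. 0 <= B & hold B Z & (\<forall>x. x \<notin> cball 0 r --> Z x = 0) -->
        (\<exists>Y. sqiL Y & (nrmL Y)\<^sup>2 <= c * (sqrt B * nrmL Z) \<and>
           (\<forall>\<phi>. tf \<phi> --> ipL Z (pd j (%x. L (k \<phi> x))) = ipL Y \<phi>))"
    proof (intro exI[of _ "b * (sqrt e * l)"] conjI allI impI)
      fix B and Z :: "R3 => 'c" assume Z: "0 <= B & hold B Z & (\<forall>x. x \<notin> cball 0 r --> Z x = 0)"
      have sZ: "sqiL Z" using Z by (simp add: hold_def)
      obtain Y where Y: "sqiL Y" "(nrmL Y)\<^sup>2 <= b * (sqrt (e * B) * nrmL (%x. adjoint L (Z x)))"
        "!!\<phi>. tf \<phi> ==> ipL (%x. adjoint L (Z x)) (pd j (k \<phi>)) = ipL Y \<phi>"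
      proof -
        have "0 <= e * B & hold (e * B) (%x. adjoint L (Z x)) & (\<forall>x. x \<notin> cball 0 r --> adjoint L (Z x) = 0)"
          using Z e linear_0[OF L'] by auto
        from b(2)[rule_format, OF this] show ?thesis using that by blast
      qed
      show "\<exists>Y. sqiL Y & (nrmL Y)\<^sup>2 <= b * (sqrt e * l) * (sqrt B * nrmL Z) \<and>
           (\<forall>\<phi>. tf \<phi> --> ipL Z (pd j (%x. L (k \<phi> x))) = ipL Y \<phi>)"
      proof (intro exI[of _ Y] conjI allI impI Y)
        have "b * (sqrt (e * B) * nrmL (%x. adjoint L (Z x))) <= b * (sqrt (e * B) * (l * nrmL Z))"
          using b(1) e(1) Z l(2)[OF sZ] by (intro mult_left_mono) auto
        then show "(nrmL Y)\<^sup>2 <= b * (sqrt e * l) * (sqrt B * nrmL Z)"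
          using Y(2) by (simp add: real_sqrt_mult mult_ac)
        fix \<phi> :: "R3 => 'a" assume \<phi>: "tf \<phi>"
        have "pd j (%x. L (k \<phi> x)) = (%x. L (pd j (k \<phi>) x))"
          by (intro ext pd_linear smooth_differentiable tf_smooth nice_tf[OF n] \<phi> bl)
        then show "ipL Z (pd j (%x. L (k \<phi> x))) = ipL Y \<phi>" using Y(3)[OF \<phi>] by (simp add: adj)
      qed
    qed (use b e l in auto)
  qed (use K l in auto)
qed

text \<open>A variable factor placed before k stays inside \<open>pd j\<close> and is not
  differentiated: in the singular clause it only multiplies the representing Y. For K it multiplies
  the output, which is why \<open>hold_multiplier\<close> is needed.\<close>

lemma nice_pre:
  fixes k :: "(R3 => 'b::euclidean_space) => R3 => 'c::euclidean_space" and L :: "'a::euclidean_space => 'b"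
  assumes n: "nice C k" and L: "linear L" and f: "multiplier f"
  shows "nice C (%\<phi>. k (%x. f x *\<^sub>R L (\<phi> x)))"
proof -
  obtain K where aK: "adjoint_op k K" using nice_adjoint[OF n] by (elim exE)
  obtain c where c: "c >= 0" "\<forall>h. sqiL h --> nrmL (K h) <= c * nrmL h"
    using adjoint_bounded[OF aK] by (elim exE conjE)
  obtain d where d: "d >= 0" "\<forall>h. sqiL h --> hold (d * (nrmL h)\<^sup>2) (K h)"
    using adjoint_hold[OF aK] by (elim exE conjE)
  note K = adjoint_sqi[OF aK] adjoint_dual[OF aK] c(1) c(2)[rule_format] d(1) d(2)[rule_format] adjoint_support[OF aK] adjoint_null[OF aK]
  have bl: "bounded_linear L" using L linear_conv_bounded_linear by blast
  have L': "linear (adjoint L)" by (rule adjoint_linear[OF L])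
  then have bl': "bounded_linear (adjoint L)" using linear_conv_bounded_linear by blast
  have sf: "smooth f" using f by (simp add: multiplier_def)
  have tfL: "tf (%x. f x *\<^sub>R L (\<phi> x))" if "tf \<phi>" for \<phi> by (intro tf_scaleR2[OF sf] tf_linear[OF bl] that)
  define M where "M h x = f x *\<^sub>R adjoint L (h x)" for h x
  have adj: "ipL (M h) \<phi> = ipL h (%x. f x *\<^sub>R L (\<phi> x))" for h \<phi>
    by (simp add: ip_def M_def inner_commute[of "adjoint L _"] adjoint_works[OF L] inner_commute)
  obtain l where l: "l > 0" "!!f::R3 => 'b. sqiL f ==> nrmL (%x. adjoint L (f x)) <= l * nrmL f"
    using nrm_linear[OF bl'] by blast
  obtain m where m: "m > 0" "!!Z::R3 => 'a. sqiL Z ==> nrmL (%x. f x *\<^sub>R Z x) <= m * nrmL Z"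
    using multiplier_nrm[OF f] by blast
  obtain e where e: "e >= 0" "!!A (Z::R3 => 'b). hold A Z ==> hold (e * A) (%x. adjoint L (Z x))"
    using hold_linear[OF L'] by blast
  obtain g where g: "g >= 0" "!!A (Z::R3 => 'a). hold A Z ==> hold (g * A + g * (nrmL Z)\<^sup>2) (%x. f x *\<^sub>R Z x)"
    using hold_multiplier[OF f] by blast
  have sL: "sqiL (%x. adjoint L (h x))" if "sqiL h" for h by (rule sqi_linear[OF bl' that])
  have sM: "sqiL (M h)" if "sqiL h" for h unfolding M_def by (rule multiplier_sqi[OF f sL[OF that]])
  have nM: "nrmL (M h) <= m * l * nrmL h" if "sqiL h" for h
    unfolding M_def using m(2)[OF sL[OF that]] mult_left_mono[OF l(2)[OF that] less_imp_le[OF m(1)]] by (simp add: mult.assoc)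
  show ?thesis
  proof (rule niceI[where K="%h. M (K h)" and c="m * l * c" and d="g * (e * d) + g * (l * c)\<^sup>2"])
    show "tf (k (%x. f x *\<^sub>R L (\<phi> x)))" if "tf \<phi>" for \<phi> by (rule nice_tf[OF n tfL[OF that]])
    show "tsupp (k (%x. f x *\<^sub>R L (\<phi> x))) \<subseteq> {y + s |y s. y \<in> tsupp \<phi> & s \<in> C}" if "tf \<phi>" for \<phi>
    proof -
      have "tsupp (%x. f x *\<^sub>R L (\<phi> x)) \<subseteq> tsupp \<phi>"
        by (rule tsupp_subset) (auto simp: closed_tsupp tsuppD linear_0[OF L])
      then show ?thesis using nice_tsupp[OF n tfL[OF that]] by blast
    qed
    show "sqiL (M (K h))" if "sqiL h" for h using K(1) sM that by blast
    show "ipL (M (K h)) \<phi> = ipL h (k (%x. f x *\<^sub>R L (\<phi> x)))" if "sqiL h" "tf \<phi>" for h \<phi>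
      using K(2)[OF that(1) tfL[OF that(2)]] by (simp add: adj)
    show "nrmL (M (K h)) <= m * l * c * nrmL h" if "sqiL h" for h
    proof -
      have "m * l * nrmL (K h) <= m * l * (c * nrmL h)"
        by (rule mult_left_mono[OF K(4)[OF that]]) (use m(1) l(1) in simp)
      then show ?thesis using nM[OF K(1)[OF that]] by (simp add: mult.assoc)
    qed
    show "hold ((g * (e * d) + g * (l * c)\<^sup>2) * (nrmL h)\<^sup>2) (M (K h))" if "sqiL h" for h
    proof -
      have "nrmL (%x. adjoint L (K h x)) <= l * (c * nrmL h)"
        using l(2)[OF K(1)[OF that]] mult_left_mono[OF K(4)[OF that] less_imp_le[OF l(1)]] by linarith
      then have "(nrmL (%x. adjoint L (K h x)))\<^sup>2 <= (l * c * nrmL h)\<^sup>2" by (intro power_mono) (auto simp: mult.assoc)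
      then have "g * (nrmL (%x. adjoint L (K h x)))\<^sup>2 <= g * (l * c * nrmL h)\<^sup>2" using g(1) by (rule mult_left_mono)
      then have "g * (e * (d * (nrmL h)\<^sup>2)) + g * (nrmL (%x. adjoint L (K h x)))\<^sup>2 <= (g * (e * d) + g * (l * c)\<^sup>2) * (nrmL h)\<^sup>2"
        by (simp add: algebra_simps power_mult_distrib)
      then show ?thesis unfolding M_def by (rule hold_mono[OF g(2)[OF e(2)[OF K(6)[OF that]]]])
    qed
    show "\<exists>r'. \<forall>h. (\<forall>x. x \<notin> cball 0 r --> h x = 0) --> (\<forall>x. x \<notin> cball 0 r' --> M (K h) x = 0)" for r
    proof -
      obtain r1 where "\<forall>h. (\<forall>x. x \<notin> cball 0 r --> h x = 0) --> (\<forall>x. x \<notin> cball 0 r1 --> K h x = 0)" using K(7) by blast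
      then show ?thesis by (intro exI[of _ r1]) (auto simp: M_def linear_0[OF L'])
    qed
    show "(%n. nrmL (M (K (h n)))) \<longlonglongrightarrow> 0" if h: "weakly_null r h" for r h
    proof (rule Lim_null_comparison)
      have "sqiL (h n)" for n using h by (simp add: weakly_null_def)
      then show "\<forall>\<^sub>F n in sequentially. norm (nrmL (M (K (h n)))) <= m * l * nrmL (K (h n))"
        using nM[OF K(1)] by simp
      show "(%n. m * l * nrmL (K (h n))) \<longlonglongrightarrow> 0"
        using tendsto_mult[OF tendsto_const K(8)[OF h], of "m * l"] by simp
    qed
    fix j r
    obtain b where b: "b >= 0" "\<forall>B Z. 0 <= B & hold B Z & (\<forall>x. x \<notin> cball 0 r --> Z x = 0) -->
      (\<exists>Y. sqiL Y & (nrmL Y)\<^sup>2 <= b * (sqrt B * nrmL Z) & (\<forall>\<phi>. tf \<phi> --> ipL Z (pd j (k \<phi>)) = ipL Y \<phi>))"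
      using nice_singular[OF n, of r j] by (elim exE conjE)
    show "\<exists>c\<ge>0. \<forall>B Z. 0 <= B & hold B Z & (\<forall>x. x \<notin> cball 0 r --> Z x = 0) -->
        (\<exists>Y. sqiL Y & (nrmL Y)\<^sup>2 <= c * (sqrt B * nrmL Z) \<and>
           (\<forall>\<phi>. tf \<phi> --> ipL Z (pd j (k (%x. f x *\<^sub>R L (\<phi> x)))) = ipL Y \<phi>))"
    proof (intro exI[of _ "(m * l)\<^sup>2 * b"] conjI allI impI)
      fix B and Z :: "R3 => 'c" assume Z: "0 <= B & hold B Z & (\<forall>x. x \<notin> cball 0 r --> Z x = 0)"
      obtain Y where Y: "sqiL Y" "(nrmL Y)\<^sup>2 <= b * (sqrt B * nrmL Z)"
        "!!\<phi>. tf \<phi> ==> ipL Z (pd j (k \<phi>)) = ipL Y \<phi>"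
        using b(2)[rule_format, OF Z] by blast
      show "\<exists>Y. sqiL Y & (nrmL Y)\<^sup>2 <= (m * l)\<^sup>2 * b * (sqrt B * nrmL Z) \<and>
           (\<forall>\<phi>. tf \<phi> --> ipL Z (pd j (k (%x. f x *\<^sub>R L (\<phi> x)))) = ipL Y \<phi>)"
      proof (intro exI[of _ "M Y"] conjI allI impI sM Y)
        have "(nrmL (M Y))\<^sup>2 <= (m * l * nrmL Y)\<^sup>2" using nM[OF Y(1)] by (intro power_mono) auto
        also have "\<dots> = (m * l)\<^sup>2 * (nrmL Y)\<^sup>2" by (simp add: power_mult_distrib)
        also have "\<dots> <= (m * l)\<^sup>2 * (b * (sqrt B * nrmL Z))" using Y(2) by (rule mult_left_mono) simp
        finally show "(nrmL (M Y))\<^sup>2 <= (m * l)\<^sup>2 * b * (sqrt B * nrmL Z)" by (simp add: mult.assoc)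
        show "ipL Z (pd j (k (%x. f x *\<^sub>R L (\<phi> x)))) = ipL (M Y) \<phi>" if "tf \<phi>" for \<phi>
          using Y(3)[OF tfL[OF that]] by (simp add: adj)
      qed
    qed (use b in auto)
  qed (use K l m g e in auto)
qed

section \<open>Local decompositions\<close>

text \<open>Unit mass makes the ray identities reproduce the field exactly; support away from the
  unit ball ensures that a ray followed up to T has moved by at least T and so has left a given
  ball.\<close>

definition kernel :: "(R3 => real) => bool" where
  "kernel \<eta> \<longleftrightarrow> tf \<eta> & (\<integral>k. \<eta> k \<partial>lborel) = 1 & (\<forall>k\<in>tsupp \<eta>. 1 <= norm k)"

text \<open>The common pattern of both complexes on the side of test fields. P is the orthogonal
  projection onto symmetric or trace-free matrices, \<open>id1\<close> is the homotopy identity for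
  P-valued fields and \<open>id2\<close> makes \<open>k0\<close> a right inverse of D. Both
  identities hold where rays of parameter T leave the support. \<open>comm_nice\<close> says that
  \<open>k0\<close> absorbs the order left in the commutator of D with a cutoff.\<close>

locale homotopy =
  fixes P :: "M3 => M3" and R :: "(R3 => M3) => R3 => M3" and M :: "3 => M3 => M3"
    and D :: "(R3 => M3) => R3 => 'b::euclidean_space"
    and k0 :: "real => (R3 => real) => (R3 => 'b) => R3 => M3"
    and k1 :: "real => (R3 => real) => (R3 => M3) => R3 => M3"
  assumes P_linear: "linear P" and P_adj: "P a \<bullet> b = a \<bullet> P b" and P_idem: "P (P a) = P a"
    and M_linear: "linear (M j)" and R_eq: "smooth \<Psi> ==> R \<Psi> = (%x. \<Sum>j\<in>UNIV. M j (pd j \<Psi> x))"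
    and D_smooth: "smooth \<Phi> ==> smooth (D \<Phi>)"
    and D_local: "open U ==> x \<in> U ==> (!!y. y \<in> U ==> \<Phi> y = \<Phi>' y) ==> D \<Phi> x = D \<Phi>' x"
    and D_zero: "D (%x. 0) x = 0"
    and k0_nice: "kernel \<eta> ==> 0 <= T ==> nice (rays T (tsupp \<eta>)) (k0 T \<eta>)"
    and k1_nice: "kernel \<eta> ==> 0 <= T ==> nice (rays T (tsupp \<eta>)) (k1 T \<eta>)"
    and k0_P: "P (k0 T \<eta> \<psi> x) = k0 T \<eta> \<psi> x"
    and id1: "kernel \<eta> ==> tf \<Phi> ==> (!!x. P (\<Phi> x) = \<Phi> x) ==> tsupp \<Phi> \<subseteq> cball 0 r ==> norm x <= r' ==> r + r' < T ==> 0 <= T ==>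
      P (k0 T \<eta> (D \<Phi>) x + R (k1 T \<eta> \<Phi>) x) = \<Phi> x"
    and id2: "kernel \<eta> ==> tf \<psi> ==> tsupp \<psi> \<subseteq> cball 0 r ==> norm x <= r' ==> r + r' < T ==> 0 <= T ==> D (k0 T \<eta> \<psi>) x = \<psi> x"
    and comm_nice: "kernel \<eta> ==> 0 <= T ==> tf f ==>
      nice (rays T (tsupp \<eta>)) (%\<Phi>. k0 T \<eta> (%x. D (%x. f x *\<^sub>R \<Phi> x) x - f x *\<^sub>R D \<Phi> x))"
begin

definition comm :: "(R3 => real) => (R3 => M3) => R3 => 'b" where
  "comm f \<Phi> x = D (%x. f x *\<^sub>R \<Phi> x) x - f x *\<^sub>R D \<Phi> x"

lemma P_bl: "bounded_linear P" using P_linear linear_conv_bounded_linear by blast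

lemma D_zero_off: "x \<notin> tsupp \<Phi> ==> D \<Phi> x = 0"
  using D_local[of "- tsupp \<Phi>" x \<Phi> "%x. 0"] D_zero by (simp add: closed_tsupp open_Compl tsuppD)

lemma D_tf: "tf \<Phi> ==> tf (D \<Phi>)"
  by (rule tfI[OF D_smooth[OF tf_smooth] tf_compact D_zero_off])

lemma comm_off: "x \<notin> tsupp f ==> comm f \<Phi> x = 0"
proof -
  assume x: "x \<notin> tsupp f"
  have "D (%x. f x *\<^sub>R \<Phi> x) x = D (%x. 0) x"
    by (rule D_local[of "- tsupp f"]) (use x in \<open>auto simp: closed_tsupp open_Compl tsuppD\<close>)
  then show ?thesis using x by (simp add: comm_def D_zero tsuppD)
qed

lemma comm_tf: "tf f ==> smooth \<Phi> ==> tf (comm f \<Phi>)"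
proof (rule tfI[OF _ tf_compact comm_off])
  assume "tf f" "smooth \<Phi>"
  then show "smooth (comm f \<Phi>)"
    unfolding comm_def[abs_def]
    using smooth_diff[OF D_smooth[OF smooth_scaleR[OF tf_smooth]] smooth_scaleR[OF tf_smooth D_smooth]] by blast
qed

lemma R_tf: "tf \<Psi> ==> tf (R \<Psi>)"
  using M_linear linear_conv_bounded_linear
  by (subst R_eq[OF tf_smooth]) (auto intro!: tf_sum tf_linear[OF _ tf_pd])

lemma ip_P: "(!!x. P (\<Phi> x) = \<Phi> x) ==> ipL (%x. P (h x)) \<Phi> = ipL h \<Phi>"
  by (simp add: ip_def P_adj)

lemma ip_mult: fixes h \<phi> :: "R3 => 'c::euclidean_space"
  shows "ipL (%x. f x *\<^sub>R h x) \<phi> = ipL h (%x. f x *\<^sub>R \<phi> x)"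
  by (simp add: ip_def)

text \<open>The homotopy identity is used only where h lives; there P is self-adjoint and fixes h,
  so it disappears from the pairing.\<close>

lemma representation:
  assumes \<eta>: "kernel \<eta>" and T: "0 <= T" "r + r' < T" and \<Phi>: "tf \<Phi>" "!!x. P (\<Phi> x) = \<Phi> x" "tsupp \<Phi> \<subseteq> cball 0 r"
    and h: "sqiL h" "!!x. P (h x) = h x" "!!x. x \<notin> cball 0 r' ==> h x = 0"
  shows "ipL h \<Phi> = ipL h (k0 T \<eta> (D \<Phi>)) + ipL h (R (k1 T \<eta> \<Phi>))"
proof -
  have "h x \<bullet> \<Phi> x = h x \<bullet> (k0 T \<eta> (D \<Phi>) x + R (k1 T \<eta> \<Phi>) x)" for x
  proof (cases "x \<in> cball 0 r'")
    case True
    then have "\<Phi> x = P (k0 T \<eta> (D \<Phi>) x + R (k1 T \<eta> \<Phi>) x)" using id1[OF \<eta> \<Phi>, of x r' T] T by simp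
    then have "h x \<bullet> \<Phi> x = P (h x) \<bullet> (k0 T \<eta> (D \<Phi>) x + R (k1 T \<eta> \<Phi>) x)" by (simp add: P_adj)
    then show ?thesis using h(2) by simp
  qed (simp add: h(3))
  then have "ipL h \<Phi> = ipL h (%x. k0 T \<eta> (D \<Phi>) x + R (k1 T \<eta> \<Phi>) x)" by (simp add: ip_def)
  also have "\<dots> = ipL h (k0 T \<eta> (D \<Phi>)) + ipL h (R (k1 T \<eta> \<Phi>))"
    by (intro ip_add_right h tf_sqi R_tf nice_tf[OF k0_nice[OF \<eta> T(1)]] nice_tf[OF k1_nice[OF \<eta> T(1)]] D_tf \<Phi>)
  finally show ?thesis .
qed

text \<open>R after k is a sum of first derivatives of \<open>M j (k \<phi>)\<close>, each covered
  by the singular clause; taking roots gives bounds that can be summed by the triangle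
  inequality.\<close>

lemma nice_R_singular:
  fixes k :: "(R3 => 'c::euclidean_space) => R3 => M3"
  assumes n: "nice C k"
  shows "\<exists>c\<ge>0. \<forall>B Z. 0 <= B & hold B Z & (\<forall>x. x \<notin> cball 0 r --> Z x = 0) -->
        (\<exists>Y. sqiL Y & nrmL Y <= c * sqrt (sqrt B * nrmL Z) \<and>
           (\<forall>\<phi>. tf \<phi> --> ipL Z (R (k \<phi>)) = ipL Y \<phi>))"
proof -
  have "\<forall>j. \<exists>c. c >= 0 & (\<forall>B Z. 0 <= B & hold B Z & (\<forall>x. x \<notin> cball 0 r --> Z x = 0) -->
        (\<exists>Y. sqiL Y & (nrmL Y)\<^sup>2 <= c * (sqrt B * nrmL Z) \<and>
           (\<forall>\<phi>. tf \<phi> --> ipL Z (pd j (%x. M j (k \<phi> x))) = ipL Y \<phi>)))"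
    using nice_singular[OF nice_post[OF n M_linear]] by blast
  from choice[OF this] obtain c where c0: "\<forall>j. c j >= 0 & (\<forall>B Z. 0 <= B & hold B Z & (\<forall>x. x \<notin> cball 0 r --> Z x = 0) -->
        (\<exists>Y. sqiL Y & (nrmL Y)\<^sup>2 <= c j * (sqrt B * nrmL Z) \<and>
           (\<forall>\<phi>. tf \<phi> --> ipL Z (pd j (%x. M j (k \<phi> x))) = ipL Y \<phi>)))" by (elim exE)
  note c = c0[THEN spec, THEN conjunct1] c0[THEN spec, THEN conjunct2, rule_format]
  show ?thesis
  proof (intro exI[of _ "\<Sum>j\<in>UNIV. sqrt (c j)"] conjI allI impI)
    show "0 <= (\<Sum>j\<in>UNIV. sqrt (c j))" using c(1) by (intro sum_nonneg) simp
    fix B and Z :: "R3 => M3" assume Z: "0 <= B & hold B Z & (\<forall>x. x \<notin> cball 0 r --> Z x = 0)"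
    have "\<forall>j. \<exists>Y. sqiL Y & (nrmL Y)\<^sup>2 <= c j * (sqrt B * nrmL Z) \<and>
           (\<forall>\<phi>. tf \<phi> --> ipL Z (pd j (%x. M j (k \<phi> x))) = ipL Y \<phi>)" using c(2)[OF Z] by blast
    from choice[OF this] obtain Y where Y: "!!j. sqiL (Y j)" "!!j. (nrmL (Y j))\<^sup>2 <= c j * (sqrt B * nrmL Z)"
      "!!j \<phi>. tf \<phi> ==> ipL Z (pd j (%x. M j (k \<phi> x))) = ipL (Y j) \<phi>" by auto
    have sZ: "sqiL Z" using Z by (simp add: hold_def)
    have nS: "nrmL (%x. \<Sum>j\<in>I. Y j x) <= (\<Sum>j\<in>I. nrmL (Y j))" for I
    proof (induction I rule: infinite_finite_induct)
      case (insert i I)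
      then show ?case using nrm_triangle[OF Y(1)[of i] sqi_sum[of I lborel Y, OF Y(1)]] by simp
    qed (auto simp: nrm_def)
    show "\<exists>Y. sqiL Y & nrmL Y <= (\<Sum>j\<in>UNIV. sqrt (c j)) * sqrt (sqrt B * nrmL Z) \<and>
           (\<forall>\<phi>. tf \<phi> --> ipL Z (R (k \<phi>)) = ipL Y \<phi>)"
    proof (intro exI[of _ "%x. \<Sum>j\<in>UNIV. Y j x"] conjI allI impI)
      show "sqiL (%x. \<Sum>j\<in>UNIV. Y j x)" by (intro sqi_sum Y)
      have "nrmL (Y j) <= sqrt (c j) * sqrt (sqrt B * nrmL Z)" for j
        using real_le_rsqrt[OF Y(2)[of j]] by (simp add: real_sqrt_mult)
      then have "(\<Sum>j\<in>UNIV. nrmL (Y j)) <= (\<Sum>j\<in>UNIV. sqrt (c j) * sqrt (sqrt B * nrmL Z))" by (intro sum_mono)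
      then show "nrmL (%x. \<Sum>j\<in>UNIV. Y j x) <= (\<Sum>j\<in>UNIV. sqrt (c j)) * sqrt (sqrt B * nrmL Z)"
        using nS[of UNIV] by (simp add: sum_distrib_right)
      fix \<phi> :: "R3 => 'c" assume \<phi>: "tf \<phi>"
      have Mbl: "bounded_linear (M j)" for j using M_linear linear_conv_bounded_linear by blast
      have kt: "tf (k \<phi>)" by (rule nice_tf[OF n \<phi>])
      have "R (k \<phi>) = (%x. \<Sum>j\<in>UNIV. pd j (%x. M j (k \<phi> x)) x)"
        by (subst R_eq[OF tf_smooth[OF kt]], intro ext sum.cong refl, rule pd_linear[symmetric, OF smooth_differentiable[OF tf_smooth[OF kt]] Mbl])
      then have "ipL Z (R (k \<phi>)) = (\<Sum>j\<in>UNIV. ipL Z (pd j (%x. M j (k \<phi> x))))"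
        by (simp add: ip_sum_right sZ tf_sqi tf_pd tf_linear[OF Mbl kt])
      also have "\<dots> = ipL (%x. \<Sum>j\<in>UNIV. Y j x) \<phi>" using Y \<phi> by (simp add: ip_sum_left tf_sqi)
      finally show "ipL Z (R (k \<phi>)) = ipL (%x. \<Sum>j\<in>UNIV. Y j x) \<phi>" .
    qed
  qed
qed

text \<open>Rays of \<open>em\<close> stay in Ut, where the weak equation may be tested: the first
  pass gives a potential w and a remainder Z, both strongly null but not vanishing in B. Rays of
  \<open>ep\<close> stay in B, where g vanishes: applying the homotopy identity to Z with
  \<open>ep\<close> corrects the potential so that it vanishes in B.\<close>

lemma local_decomposition:
  fixes f1 f2 f3 :: "R3 => real"
  assumes Ut: "open Ut" and Bo: "open B" "B \<subseteq> Ut" and em: "kernel em" and ep: "kernel ep"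
    and Um: "!!y s. y \<in> Ut ==> (\<exists>t k. t >= 0 & k \<in> tsupp em & s = t *\<^sub>R k) ==> y + s \<in> Ut"
    and Bp: "!!y s. y \<in> B ==> (\<exists>t k. t >= 0 & k \<in> tsupp ep & s = t *\<^sub>R k) ==> y + s \<in> B"
    and f1: "tf f1" and f2: "tf f2" "!!x. x \<in> tsupp f1 ==> f2 x = 1" and f3: "tf f3" "!!x. x \<in> tsupp f2 ==> f3 x = 1"
    and g: "weakly_null r0 g" "!!n x. P (g n x) = g n x" "!!n x. x \<notin> tsupp f1 ==> g n x = 0" "!!n x. x \<in> B ==> g n x = 0"
    and F: "weakly_null r0 F" and weak: "!!n \<Psi>. tf \<Psi> ==> tsupp \<Psi> \<subseteq> Ut ==> ipL (g n) (R \<Psi>) = ipL (F n) \<Psi>"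
  shows "\<exists>u Y. (\<forall>n. sqiL (u n) & sqiL (Y n)) & (%n. nrmL (u n)) \<longlonglongrightarrow> 0 & (%n. nrmL (Y n)) \<longlonglongrightarrow> 0 \<and>
    (\<forall>n \<Phi>. tf \<Phi> & (\<forall>x. P (\<Phi> x) = \<Phi> x) & tsupp \<Phi> \<subseteq> Ut --> ipL (g n) \<Phi> = ipL (u n) (D \<Phi>) + ipL (Y n) \<Phi>) \<and>
    (\<forall>n. AE x in lborel. x \<in> B --> u n x = 0 & Y n x = 0) & (\<forall>n x. x \<notin> tsupp f2 --> u n x = 0) \<and>
    (\<forall>n. AE x in lborel. x \<in> Ut - tsupp f2 --> Y n x = 0)"
proof -
  obtain \<rho> where \<rho>: "\<rho> > 0" "tsupp f3 \<subseteq> cball 0 \<rho>"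
    using compact_imp_bounded[OF tf_compact[OF f3(1)]] by (auto simp: bounded_pos subset_eq)
  have s12: "tsupp f1 \<subseteq> tsupp f2"
  proof
    fix x assume "x \<in> tsupp f1"
    then show "x \<in> tsupp f2" using f2(2)[of x] tsuppD[of x f2] by fastforce
  qed
  have s23: "tsupp f2 \<subseteq> tsupp f3"
  proof
    fix x assume "x \<in> tsupp f2"
    then show "x \<in> tsupp f3" using f3(2)[of x] tsuppD[of x f3] by fastforce
  qed
  have gs: "sqiL (g n)" and Fs: "sqiL (F n)" for n using g(1) F by (auto simp: weakly_null_def)
  obtain G where G: "!!n. nrmL (g n) <= G" using g(1) by (auto simp: weakly_null_def)
  obtain FM where FM: "!!n. nrmL (F n) <= FM" using F by (auto simp: weakly_null_def)
  have goff: "g n x = 0" if "x \<notin> cball 0 \<rho>" for n x by (rule g(3)) (use that s12 s23 \<rho>(2) in blast)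
  \<comment> \<open>g and the test fields of the next step lie in the ball of radius \<rho>, and
    \<open>id1\<close> asks for T beyond the sum of the two radii.\<close>
  define T where "T = 2 * \<rho> + 1"
  have T: "0 <= T" "\<rho> + \<rho> < T" using \<rho> by (auto simp: T_def)
  note nk0 = k0_nice[OF em T(1)] and nk1 = k1_nice[OF em T(1)]
  note nc = comm_nice[OF em T(1), folded comm_def]
  obtain K0 where K0: "adjoint_op (k0 T em) K0" using nice_adjoint[OF nk0] by (elim exE)
  obtain K1 where K1: "adjoint_op (k1 T em) K1" using nice_adjoint[OF nk1] by (elim exE)
  obtain C3 where C3: "adjoint_op (%\<Phi>. k0 T em (comm f3 \<Phi>)) C3" using nice_adjoint[OF nc[OF f3(1)]] by (elim exE)
  obtain C2 where C2: "adjoint_op (%\<Phi>. k0 T em (comm f2 \<Phi>)) C2" using nice_adjoint[OF nc[OF f2(1)]] by (elim exE)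
  have mf3: "multiplier f3" and mf2: "multiplier f2" by (intro multiplier_tf f3 f2)+
  \<comment> \<open>The cut-off first potential. Z collects the commutator of D with the cutoff and
    the term coming from F, projected so that \<open>representation\<close> applies to it
    again.\<close>
  define w where "w n x = f3 x *\<^sub>R K0 (g n) x" for n x
  define Z where "Z n x = P (C3 (g n) x + f3 x *\<^sub>R K1 (F n) x)" for n x
  have ws: "sqiL (w n)" for n unfolding w_def by (intro multiplier_sqi[OF mf3] adjoint_sqi[OF K0] gs)
  have Z1s: "sqiL (%x. C3 (g n) x + f3 x *\<^sub>R K1 (F n) x)" for n
    by (intro sqi_add multiplier_sqi[OF mf3] adjoint_sqi[OF K1] adjoint_sqi[OF C3] gs Fs)
  have Zs: "sqiL (Z n)" for n unfolding Z_def by (rule sqi_linear[OF P_bl Z1s])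
  have ZP: "P (Z n x) = Z n x" for n x by (simp add: Z_def P_idem)
  \<comment> \<open>The support of \<open>k1 T em \<Phi>\<close> stays in Ut, so the weak equation
    replaces R by F.\<close>
  have step1: "ipL (g n) \<Phi> = ipL (K0 (g n)) (D \<Phi>) + ipL (K1 (F n)) \<Phi>"
    if \<Phi>: "tf \<Phi>" "!!x. P (\<Phi> x) = \<Phi> x" "tsupp \<Phi> \<subseteq> Ut" "tsupp \<Phi> \<subseteq> cball 0 \<rho>" for n \<Phi>
  proof -
    have "ipL (g n) \<Phi> = ipL (g n) (k0 T em (D \<Phi>)) + ipL (g n) (R (k1 T em \<Phi>))"
      by (rule representation[OF em T \<Phi>(1,2,4) gs g(2) goff])
    moreover have "tsupp (k1 T em \<Phi>) \<subseteq> Ut"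
      using nice_tsupp[OF nk1 \<Phi>(1)] \<Phi>(3) Um by (fastforce simp: rays_def)
    ultimately show ?thesis
      using weak[OF nice_tf[OF nk1 \<Phi>(1)], of n] adjoint_dual[OF K0 gs D_tf[OF \<Phi>(1)]] adjoint_dual[OF K1 Fs \<Phi>(1)] by simp
  qed
  have gcut: "ipL (g n) \<Phi> = ipL (g n) (%x. f x *\<^sub>R \<Phi> x)" if "!!x. x \<in> tsupp f1 ==> f x = 1" for n \<Phi> f
    unfolding ip_def
  proof (rule Bochner_Integration.integral_cong[OF refl])
    fix x show "g n x \<bullet> \<Phi> x = g n x \<bullet> (f x *\<^sub>R \<Phi> x)" using that[of x] g(3)[of x n] by (cases "x \<in> tsupp f1") auto
  qed
  have f31: "f3 x = 1" if "x \<in> tsupp f1" for x using f3(2) that s12 by blast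
  have cutP: "P (f x *\<^sub>R \<Phi> x) = f x *\<^sub>R \<Phi> x" if "P (\<Phi> x) = \<Phi> x" for f x and \<Phi> :: "R3 => M3"
    using that by (simp add: linear_scale[OF P_linear])
  have cut_tsupp: "tsupp (%x. f x *\<^sub>R \<Phi> x) \<subseteq> tsupp f \<inter> tsupp \<Phi>" for f and \<Phi> :: "R3 => 'z::real_normed_vector"
    by (rule tsupp_subset) (auto simp: closed_tsupp tsuppD)
  have D_split: "D (%x. f x *\<^sub>R \<Phi> x) = (%x. f x *\<^sub>R D \<Phi> x + comm f \<Phi> x)" for f \<Phi> by (auto simp: comm_def)
  have step2: "ipL (g n) \<Phi> = ipL (w n) (D \<Phi>) + ipL (Z n) \<Phi>"
    if \<Phi>: "tf \<Phi>" "!!x. P (\<Phi> x) = \<Phi> x" "tsupp \<Phi> \<subseteq> Ut" for n \<Phi>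
  proof -
    let ?\<Phi> = "%x. f3 x *\<^sub>R \<Phi> x"
    have t: "tf ?\<Phi>" by (intro tf_scaleR1 f3 tf_smooth \<Phi>)
    have tD: "tf (%x. f3 x *\<^sub>R D \<Phi> x)" by (intro tf_scaleR1 f3 tf_smooth D_tf \<Phi>)
    have tc: "tf (comm f3 \<Phi>)" by (intro comm_tf f3 tf_smooth \<Phi>)
    have "ipL (g n) \<Phi> = ipL (g n) ?\<Phi>" by (rule gcut[OF f31])
    also have "\<dots> = ipL (K0 (g n)) (D ?\<Phi>) + ipL (K1 (F n)) ?\<Phi>"
      using cut_tsupp[of f3 \<Phi>] \<Phi> \<rho>(2) cutP by (intro step1 t) auto
    also have "ipL (K0 (g n)) (D ?\<Phi>) = ipL (w n) (D \<Phi>) + ipL (C3 (g n)) \<Phi>"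
      unfolding D_split w_def ip_mult
      by (simp add: ip_add_right adjoint_sqi[OF K0 gs] tf_sqi tD tc adjoint_dual[OF K0 gs tc] adjoint_dual[OF C3 gs \<Phi>(1)])
    also have "ipL (w n) (D \<Phi>) + ipL (C3 (g n)) \<Phi> + ipL (K1 (F n)) ?\<Phi> =
      ipL (w n) (D \<Phi>) + ipL (%x. C3 (g n) x + f3 x *\<^sub>R K1 (F n) x) \<Phi>"
      by (simp add: ip_add_left adjoint_sqi[OF C3 gs] multiplier_sqi[OF mf3 adjoint_sqi[OF K1 Fs]] tf_sqi \<Phi>(1) ip_mult)
    also have "ipL (%x. C3 (g n) x + f3 x *\<^sub>R K1 (F n) x) \<Phi> = ipL (Z n) \<Phi>"
      unfolding Z_def by (rule ip_P[OF \<Phi>(2), symmetric])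
    finally show ?thesis .
  qed
  obtain rg where rg: "\<forall>h. (\<forall>x. x \<notin> cball 0 \<rho> --> h x = 0) --> (\<forall>x. x \<notin> cball 0 rg --> C3 h x = 0)"
    using adjoint_support[OF C3, of \<rho>] by (elim exE)
  define \<sigma> where "\<sigma> = max \<rho> rg"
  have Zoff: "Z n x = 0" if "x \<notin> cball 0 \<sigma>" for n x
  proof -
    have "C3 (g n) x = 0" using rg[rule_format, of "g n" x] goff that by (auto simp: \<sigma>_def)
    moreover have "f3 x = 0" using that \<rho>(2) by (intro tsuppD) (auto simp: \<sigma>_def)
    ultimately show ?thesis by (simp add: Z_def linear_0[OF P_linear])
  qed
  have woff: "w n x = 0" if "x \<notin> cball 0 \<rho>" for n x
  proof -
    have "x \<notin> tsupp f3" using that \<rho>(2) by blast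
    then show ?thesis by (simp add: w_def tsuppD)
  qed
  obtain cP where cP: "cP > 0" "!!f::R3 => M3. sqiL f ==> nrmL (%x. P (f x)) <= cP * nrmL f"
    using nrm_linear[OF P_bl] by blast
  obtain c3 where c3: "c3 > 0" "!!f::R3 => M3. sqiL f ==> nrmL (%x. f3 x *\<^sub>R f x) <= c3 * nrmL f"
    using multiplier_nrm[OF mf3] by blast
  obtain c3' where c3': "c3' > 0" "!!f::R3 => 'b. sqiL f ==> nrmL (%x. f3 x *\<^sub>R f x) <= c3' * nrmL f"
    using multiplier_nrm[OF mf3] by blast
  have wlim: "(%n. nrmL (w n)) \<longlonglongrightarrow> 0"
  proof (rule Lim_null_comparison)
    show "\<forall>\<^sub>F n in sequentially. norm (nrmL (w n)) <= c3' * nrmL (K0 (g n))"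
      using c3'(2)[OF adjoint_sqi[OF K0 gs]] by (simp add: w_def[abs_def])
    show "(%n. c3' * nrmL (K0 (g n))) \<longlonglongrightarrow> 0" using tendsto_mult[OF tendsto_const adjoint_null[OF K0 g(1)], of c3'] by simp
  qed
  have Zlim: "(%n. nrmL (Z n)) \<longlonglongrightarrow> 0"
  proof (rule Lim_null_comparison)
    show "\<forall>\<^sub>F n in sequentially. norm (nrmL (Z n)) <= cP * (nrmL (C3 (g n)) + c3 * nrmL (K1 (F n)))"
    proof (intro always_eventually allI)
      fix n
      have "nrmL (%x. C3 (g n) x + f3 x *\<^sub>R K1 (F n) x) <= nrmL (C3 (g n)) + c3 * nrmL (K1 (F n))"
        using nrm_triangle[OF adjoint_sqi[OF C3 gs] multiplier_sqi[OF mf3 adjoint_sqi[OF K1 Fs]], of n n] c3(2)[OF adjoint_sqi[OF K1 Fs], of n] by linarith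
      then have "cP * nrmL (%x. C3 (g n) x + f3 x *\<^sub>R K1 (F n) x) <= cP * (nrmL (C3 (g n)) + c3 * nrmL (K1 (F n)))"
        using cP(1) by simp
      then show "norm (nrmL (Z n)) <= cP * (nrmL (C3 (g n)) + c3 * nrmL (K1 (F n)))"
        using cP(2)[OF Z1s[of n]] by (simp add: Z_def[abs_def])
    qed
    have "(%n. cP * (nrmL (C3 (g n)) + c3 * nrmL (K1 (F n)))) \<longlonglongrightarrow> cP * (0 + c3 * 0)"
      by (intro tendsto_intros adjoint_null[OF C3 g(1)] adjoint_null[OF K1 F])
    then show "(%n. cP * (nrmL (C3 (g n)) + c3 * nrmL (K1 (F n)))) \<longlonglongrightarrow> 0" by simp
  qed
  \<comment> \<open>The modulus is uniform in n although the norms tend to 0; this is what the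
    singular operator requires.\<close>
  have "\<exists>A\<ge>0. \<forall>n. hold A (Z n)"
  proof -
    obtain d1 where d1: "d1 >= 0" "\<forall>h. sqiL h --> hold (d1 * (nrmL h)\<^sup>2) (C3 h)" using adjoint_hold[OF C3] by (elim exE conjE)
    obtain d2 where d2: "d2 >= 0" "\<forall>h. sqiL h --> hold (d2 * (nrmL h)\<^sup>2) (K1 h)" using adjoint_hold[OF K1] by (elim exE conjE)
    obtain b2 where b2: "b2 >= 0" "\<forall>h. sqiL h --> nrmL (K1 h) <= b2 * nrmL h" using adjoint_bounded[OF K1] by (elim exE conjE)
    obtain e where e: "e >= 0" "!!A (Z :: R3 => M3). hold A Z ==> hold (e * A + e * (nrmL Z)\<^sup>2) (%x. f3 x *\<^sub>R Z x)"
      using hold_multiplier[OF mf3] by blast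
    obtain p where p: "p >= 0" "!!A (Z :: R3 => M3). hold A Z ==> hold (p * A) (%x. P (Z x))" using hold_linear[OF P_linear] by blast
    define A where "A = p * (2 * (d1 * G\<^sup>2) + 2 * (e * (d2 * FM\<^sup>2) + e * (b2 * FM)\<^sup>2))"
    have "hold A (Z n)" for n
    proof -
      have "(nrmL (g n))\<^sup>2 <= G\<^sup>2" "(nrmL (F n))\<^sup>2 <= FM\<^sup>2" using G FM by (auto intro: power_mono)
      then have h1: "hold (d1 * G\<^sup>2) (C3 (g n))" "hold (d2 * FM\<^sup>2) (K1 (F n))"
        by - (rule hold_mono[OF d1(2)[rule_format, OF gs]] hold_mono[OF d2(2)[rule_format, OF Fs]], rule mult_left_mono, assumption, rule d1(1) d2(1))+
      have "nrmL (K1 (F n)) <= b2 * FM" using b2(2)[rule_format, OF Fs, of n] mult_left_mono[OF FM[of n] b2(1)] by linarith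
      then have "(nrmL (K1 (F n)))\<^sup>2 <= (b2 * FM)\<^sup>2" by (intro power_mono) auto
      then have "hold (e * (d2 * FM\<^sup>2) + e * (b2 * FM)\<^sup>2) (%x. f3 x *\<^sub>R K1 (F n) x)"
        by (intro hold_mono[OF e(2)[OF h1(2)]] add_left_mono mult_left_mono e(1))
      from p(2)[OF hold_add[OF h1(1) this]] show ?thesis by (simp add: A_def Z_def[abs_def])
    qed
    moreover have "A >= 0" using p(1) d1(1) d2(1) e(1) by (simp add: A_def)
    ultimately show ?thesis by blast
  qed
  then obtain A where A: "A >= 0" "!!n. hold A (Z n)" by blast
  \<comment> \<open>\<sigma> also covers the support of Z, which the adjoint \<open>C3\<close> may
    have enlarged.\<close>
  define T2 where "T2 = 2 * \<sigma> + 1"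
  have \<sigma>: "\<rho> <= \<sigma>" by (simp add: \<sigma>_def)
  have T2: "0 <= T2" "\<rho> + \<sigma> < T2" "\<rho> + \<rho> < T2" using \<rho> \<sigma> by (auto simp: T2_def)
  note mk0 = k0_nice[OF ep T2(1)] and mk1 = k1_nice[OF ep T2(1)]
  note mc = comm_nice[OF ep T2(1), folded comm_def]
  obtain L0 where L0: "adjoint_op (k0 T2 ep) L0" using nice_adjoint[OF mk0] by (elim exE)
  obtain E2 where E2: "adjoint_op (%\<Phi>. k0 T2 ep (comm f2 \<Phi>)) E2" using nice_adjoint[OF mc[OF f2(1)]] by (elim exE)
  obtain l0 where l0: "l0 >= 0" "\<forall>h. sqiL h --> nrmL (L0 h) <= l0 * nrmL h" using adjoint_bounded[OF L0] by (elim exE conjE)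
  obtain e2 where e2: "e2 >= 0" "\<forall>h. sqiL h --> nrmL (E2 h) <= e2 * nrmL h" using adjoint_bounded[OF E2] by (elim exE conjE)
  obtain cs where cs: "cs >= 0" "\<forall>B Z. 0 <= B & hold B Z & (\<forall>x. x \<notin> cball 0 \<sigma> --> Z x = 0) -->
        (\<exists>Y. sqiL Y & nrmL Y <= cs * sqrt (sqrt B * nrmL Z) \<and>
           (\<forall>\<phi>. tf \<phi> --> ipL Z (R (k1 T2 ep \<phi>)) = ipL Y \<phi>))"
    using nice_R_singular[OF mk1, of \<sigma>] by (elim exE conjE)
  have "\<exists>Y. sqiL Y & nrmL Y <= cs * sqrt (sqrt A * nrmL (Z n)) \<and>
           (\<forall>\<phi>. tf \<phi> --> ipL (Z n) (R (k1 T2 ep \<phi>)) = ipL Y \<phi>)" for n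
    using cs(2)[rule_format, of A "Z n"] A Zoff by blast
  then have "\<forall>n. \<exists>Y. sqiL Y & nrmL Y <= cs * sqrt (sqrt A * nrmL (Z n)) \<and>
           (\<forall>\<phi>. tf \<phi> --> ipL (Z n) (R (k1 T2 ep \<phi>)) = ipL Y \<phi>)" by blast
  from choice[OF this] obtain Y0 where Y0: "!!n. sqiL (Y0 n)" "!!n. nrmL (Y0 n) <= cs * sqrt (sqrt A * nrmL (Z n))"
    "!!n \<phi>. tf \<phi> ==> ipL (Z n) (R (k1 T2 ep \<phi>)) = ipL (Y0 n) \<phi>" by auto
  \<comment> \<open>The potential part of the second pass is added to w; its singular part is
    \<open>Y0\<close>.\<close>
  define u0 where "u0 n x = w n x + L0 (Z n) x" for n x
  have u0s: "sqiL (u0 n)" for n unfolding u0_def by (intro sqi_add ws adjoint_sqi[OF L0] Zs)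
  have step3: "ipL (g n) \<Phi> = ipL (u0 n) (D \<Phi>) + ipL (Y0 n) \<Phi>"
    if \<Phi>: "tf \<Phi>" "!!x. P (\<Phi> x) = \<Phi> x" "tsupp \<Phi> \<subseteq> Ut" "tsupp \<Phi> \<subseteq> cball 0 \<rho>" for n \<Phi>
  proof -
    have "ipL (Z n) \<Phi> = ipL (Z n) (k0 T2 ep (D \<Phi>)) + ipL (Z n) (R (k1 T2 ep \<Phi>))"
      by (rule representation[OF ep T2(1,2) \<Phi>(1,2,4) Zs ZP Zoff])
    then show ?thesis using step2[OF \<Phi>(1-3), of n] Y0(3)[OF \<Phi>(1), of n] adjoint_dual[OF L0 Zs D_tf[OF \<Phi>(1)], of n]
      by (simp add: u0_def[abs_def] ip_add_left ws adjoint_sqi[OF L0 Zs] tf_sqi D_tf \<Phi>(1))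
  qed
  \<comment> \<open>Test with \<open>k0 T2 ep \<psi>\<close>. It is supported in B, where g
    vanishes, and D maps it to \<psi> where w lives; so the identity of \<open>step2\<close> says
    that w + \<open>L0 (Z n)\<close> annihilates \<psi>.\<close>
  have vanish: "ipL (u0 n) \<psi> = 0" if \<psi>: "tf \<psi>" "tsupp \<psi> \<subseteq> B" "tsupp \<psi> \<subseteq> cball 0 \<rho>" for n \<psi>
  proof -
    let ?\<Phi> = "k0 T2 ep \<psi>"
    have t: "tf ?\<Phi>" by (rule nice_tf[OF mk0 \<psi>(1)])
    have tB: "tsupp ?\<Phi> \<subseteq> B" using nice_tsupp[OF mk0 \<psi>(1)] \<psi>(2) Bp by (fastforce simp: rays_def)
    have "g n x \<bullet> ?\<Phi> x = 0" for x using g(4)[of x n] tsuppD[of x ?\<Phi>] subsetD[OF tB, of x] by (cases "x \<in> B"; cases "x \<in> tsupp ?\<Phi>"; auto)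
    then have "0 = ipL (g n) ?\<Phi>" by (simp add: ip_def)
    also have "\<dots> = ipL (w n) (D ?\<Phi>) + ipL (Z n) ?\<Phi>"
      by (rule step2[OF t k0_P]) (use tB Bo in auto)
    also have "ipL (w n) (D ?\<Phi>) = ipL (w n) \<psi>" unfolding ip_def
    proof (rule Bochner_Integration.integral_cong[OF refl])
      fix x show "w n x \<bullet> D ?\<Phi> x = w n x \<bullet> \<psi> x"
        using id2[OF ep \<psi>(1,3), of x \<rho> T2] T2(1,3) woff[of x n] by (cases "x \<in> cball 0 \<rho>") auto
    qed
    also have "ipL (Z n) ?\<Phi> = ipL (L0 (Z n)) \<psi>" by (rule adjoint_dual[OF L0 Zs \<psi>(1), symmetric])
    finally show ?thesis by (simp add: u0_def[abs_def] ip_add_left ws adjoint_sqi[OF L0 Zs] tf_sqi \<psi>(1))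
  qed
  define u where "u n x = f2 x *\<^sub>R u0 n x" for n x
  \<comment> \<open>Cutting off u0 by f2 produces a commutator, paired with w and with
    \<open>L0 (Z n)\<close>; its adjoints on these two parts are \<open>C2\<close> and
    \<open>E2\<close>.\<close>
  define Y1 where "Y1 n x = f2 x *\<^sub>R Y0 n x + (C2 (g n) x + E2 (Z n) x)" for n x
  define Y where "Y n x = P (Y1 n x)" for n x
  have us: "sqiL (u n)" for n unfolding u_def by (intro multiplier_sqi[OF mf2] u0s)
  have Y1s: "sqiL (Y1 n)" for n unfolding Y1_def
    by (intro sqi_add multiplier_sqi[OF mf2] Y0 adjoint_sqi[OF C2] adjoint_sqi[OF E2] gs Zs)
  have Ys: "sqiL (Y n)" for n unfolding Y_def by (rule sqi_linear[OF P_bl Y1s])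
  have step4: "ipL (g n) \<Phi> = ipL (u n) (D \<Phi>) + ipL (Y n) \<Phi>"
    if \<Phi>: "tf \<Phi>" "!!x. P (\<Phi> x) = \<Phi> x" "tsupp \<Phi> \<subseteq> Ut" for n \<Phi>
  proof -
    let ?\<Phi> = "%x. f2 x *\<^sub>R \<Phi> x"
    have t: "tf ?\<Phi>" by (intro tf_scaleR1 f2 tf_smooth \<Phi>)
    have tD: "tf (%x. f2 x *\<^sub>R D \<Phi> x)" by (intro tf_scaleR1 f2 tf_smooth D_tf \<Phi>)
    have tc: "tf (comm f2 \<Phi>)" by (intro comm_tf f2 tf_smooth \<Phi>)
    \<comment> \<open>f3 equals 1 on the support of f2, which contains that of the commutator, so
      the cutoff hidden in w is invisible here.\<close>
    have e: "ipL (w n) (comm f2 \<Phi>) = ipL (K0 (g n)) (comm f2 \<Phi>)" unfolding ip_def w_def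
    proof (rule Bochner_Integration.integral_cong[OF refl])
      fix x show "(f3 x *\<^sub>R K0 (g n) x) \<bullet> comm f2 \<Phi> x = K0 (g n) x \<bullet> comm f2 \<Phi> x"
        using comm_off[of x f2 \<Phi>] f3(2)[of x] by (cases "x \<in> tsupp f2") auto
    qed
    have "ipL (g n) \<Phi> = ipL (g n) ?\<Phi>" by (rule gcut[OF f2(2)])
    also have "\<dots> = ipL (u0 n) (D ?\<Phi>) + ipL (Y0 n) ?\<Phi>"
      using cut_tsupp[of f2 \<Phi>] \<Phi> \<rho>(2) s23 cutP by (intro step3 t) auto
    also have "ipL (u0 n) (D ?\<Phi>) = ipL (u n) (D \<Phi>) + ipL (u0 n) (comm f2 \<Phi>)"
      unfolding D_split u_def ip_mult by (rule ip_add_right) (intro u0s tf_sqi tD tc)+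
    also have "ipL (u0 n) (comm f2 \<Phi>) = ipL (C2 (g n)) \<Phi> + ipL (E2 (Z n)) \<Phi>"
      using e adjoint_dual[OF K0 gs tc, of n] adjoint_dual[OF C2 gs \<Phi>(1), of n] adjoint_dual[OF L0 Zs tc, of n] adjoint_dual[OF E2 Zs \<Phi>(1), of n]
      by (simp add: u0_def[abs_def] ip_add_left ws adjoint_sqi[OF L0 Zs] tf_sqi tc)
    also have "ipL (u n) (D \<Phi>) + (ipL (C2 (g n)) \<Phi> + ipL (E2 (Z n)) \<Phi>) + ipL (Y0 n) ?\<Phi>
      = ipL (u n) (D \<Phi>) + ipL (Y1 n) \<Phi>"
      unfolding Y1_def by (simp add: ip_add_left sqi_add multiplier_sqi[OF mf2 Y0(1)] adjoint_sqi[OF C2 gs] adjoint_sqi[OF E2 Zs] tf_sqi \<Phi>(1) ip_mult)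
    also have "ipL (Y1 n) \<Phi> = ipL (Y n) \<Phi>" unfolding Y_def by (rule ip_P[OF \<Phi>(2), symmetric])
    finally show ?thesis .
  qed
  obtain c2 where c2: "c2 > 0" "!!f::R3 => M3. sqiL f ==> nrmL (%x. f2 x *\<^sub>R f x) <= c2 * nrmL f"
    using multiplier_nrm[OF mf2] by blast
  obtain c2' where c2': "c2' > 0" "!!f::R3 => 'b. sqiL f ==> nrmL (%x. f2 x *\<^sub>R f x) <= c2' * nrmL f"
    using multiplier_nrm[OF mf2] by blast
  have ulim: "(%n. nrmL (u n)) \<longlonglongrightarrow> 0"
  proof (rule Lim_null_comparison)
    show "\<forall>\<^sub>F n in sequentially. norm (nrmL (u n)) <= c2' * (nrmL (w n) + l0 * nrmL (Z n))"
    proof (intro always_eventually allI)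
      fix n
      have "nrmL (u0 n) <= nrmL (w n) + l0 * nrmL (Z n)"
        using nrm_triangle[OF ws adjoint_sqi[OF L0 Zs], of n n] l0(2)[rule_format, OF Zs, of n] by (simp add: u0_def[abs_def])
      then have "c2' * nrmL (u0 n) <= c2' * (nrmL (w n) + l0 * nrmL (Z n))" using c2'(1) by simp
      then show "norm (nrmL (u n)) <= c2' * (nrmL (w n) + l0 * nrmL (Z n))"
        using c2'(2)[OF u0s[of n]] by (simp add: u_def[abs_def])
    qed
    have "(%n. c2' * (nrmL (w n) + l0 * nrmL (Z n))) \<longlonglongrightarrow> c2' * (0 + l0 * 0)" by (intro tendsto_intros wlim Zlim)
    then show "(%n. c2' * (nrmL (w n) + l0 * nrmL (Z n))) \<longlonglongrightarrow> 0" by simp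
  qed
  have Ylim: "(%n. nrmL (Y n)) \<longlonglongrightarrow> 0"
  proof (rule Lim_null_comparison)
    let ?b = "%n. cP * (c2 * (cs * sqrt (sqrt A * nrmL (Z n))) + (nrmL (C2 (g n)) + e2 * nrmL (Z n)))"
    show "\<forall>\<^sub>F n in sequentially. norm (nrmL (Y n)) <= ?b n"
    proof (intro always_eventually allI)
      fix n
      have "nrmL (%x. f2 x *\<^sub>R Y0 n x) <= c2 * (cs * sqrt (sqrt A * nrmL (Z n)))"
        using c2(2)[OF Y0(1)[of n]] mult_left_mono[OF Y0(2)[of n] less_imp_le[OF c2(1)]] by linarith
      moreover have "nrmL (%x. C2 (g n) x + E2 (Z n) x) <= nrmL (C2 (g n)) + e2 * nrmL (Z n)"
        using nrm_triangle[OF adjoint_sqi[OF C2 gs] adjoint_sqi[OF E2 Zs], of n n] e2(2)[rule_format, OF Zs, of n] by linarith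
      moreover have "nrmL (Y1 n) <= nrmL (%x. f2 x *\<^sub>R Y0 n x) + nrmL (%x. C2 (g n) x + E2 (Z n) x)"
        unfolding Y1_def by (intro nrm_triangle sqi_add multiplier_sqi[OF mf2] Y0 adjoint_sqi[OF C2] adjoint_sqi[OF E2] gs Zs)
      ultimately have "cP * nrmL (Y1 n) <= ?b n" using cP(1) by simp
      then show "norm (nrmL (Y n)) <= ?b n" using cP(2)[OF Y1s[of n]] by (simp add: Y_def[abs_def])
    qed
    have "?b \<longlonglongrightarrow> cP * (c2 * (cs * sqrt (sqrt A * 0)) + (0 + e2 * 0))"
      by (intro tendsto_intros Zlim adjoint_null[OF C2 g(1)])
    then show "?b \<longlonglongrightarrow> 0" by simp
  qed
  have uB: "AE x in lborel. x \<in> B --> u n x = 0" for n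
  proof (rule fundamental_lemma[OF us Bo(1)])
    fix \<psi> :: "R3 => 'b" assume \<psi>: "tf \<psi>" "tsupp \<psi> \<subseteq> B"
    have "ipL (u n) \<psi> = ipL (u0 n) (%x. f2 x *\<^sub>R \<psi> x)" unfolding u_def by (rule ip_mult)
    also have "\<dots> = 0"
      using cut_tsupp[of f2 \<psi>] \<psi> s23 \<rho>(2) by (intro vanish tf_scaleR1 f2 tf_smooth \<psi>) auto
    finally show "ipL (u n) \<psi> = 0" .
  qed
  have uoff: "u n x = 0" if "x \<notin> tsupp f2" for n x using tsuppD[OF that] by (simp add: u_def)
  have PP: "ipL (Y n) \<psi> = ipL (Y n) (%x. P (\<psi> x))" for n \<psi> by (simp add: ip_def Y_def P_adj P_idem)
  have Pt: "tf (%x. P (\<psi> x))" "tsupp (%x. P (\<psi> x)) \<subseteq> tsupp \<psi>" if "tf \<psi>" for \<psi>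
    using tf_linear[OF P_bl that] tsupp_subset[OF closed_tsupp, of \<psi> "%x. P (\<psi> x)"] by (auto simp: tsuppD linear_0[OF P_linear])
  \<comment> \<open>For a test field supported in B both g and u drop out of the identity, leaving
    Y. Projecting the test field loses nothing because Y takes values in the range of P.\<close>
  have YB: "AE x in lborel. x \<in> B --> Y n x = 0" for n
  proof (rule fundamental_lemma[OF Ys Bo(1)])
    fix \<psi> :: "R3 => M3" assume \<psi>: "tf \<psi>" "tsupp \<psi> \<subseteq> B"
    let ?\<Phi> = "%x. P (\<psi> x)"
    have tB: "tsupp ?\<Phi> \<subseteq> B" using Pt(2)[OF \<psi>(1)] \<psi>(2) by blast
    have "ipL (g n) ?\<Phi> = ipL (u n) (D ?\<Phi>) + ipL (Y n) ?\<Phi>"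
      by (rule step4[OF Pt(1)[OF \<psi>(1)] P_idem]) (use tB Bo in auto)
    moreover have "g n x \<bullet> ?\<Phi> x = 0" for x using g(4)[of x n] tsuppD[of x ?\<Phi>] subsetD[OF tB, of x] by (cases "x \<in> B"; cases "x \<in> tsupp ?\<Phi>"; auto)
    then have "ipL (g n) ?\<Phi> = 0" by (simp add: ip_def)
    moreover have "ipL (u n) (D ?\<Phi>) = ipL (%x. 0) (D ?\<Phi>)" unfolding ip_def
    proof (rule integral_cong_AE)
      show "(%x. u n x \<bullet> D ?\<Phi> x) \<in> borel_measurable lborel" "(%x. 0 \<bullet> D ?\<Phi> x) \<in> borel_measurable lborel"
        using sqi_inner[OF us[of n] tf_sqi[OF D_tf[OF Pt(1)[OF \<psi>(1)]]]] by auto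
      show "AE x in lborel. u n x \<bullet> D ?\<Phi> x = 0 \<bullet> D ?\<Phi> x"
        using uB[of n]
      proof eventually_elim
        case (elim x)
        then show ?case using D_zero_off[of x ?\<Phi>] subsetD[OF tB, of x] by (cases "x \<in> B"; cases "x \<in> tsupp ?\<Phi>"; auto)
      qed
    qed
    ultimately show "ipL (Y n) \<psi> = 0" by (simp add: PP[of n \<psi>] ip_zero_left)
  qed
  have YU: "AE x in lborel. x \<in> Ut - tsupp f2 --> Y n x = 0" for n
  proof (rule fundamental_lemma[OF Ys])
    show "open (Ut - tsupp f2)" by (intro open_Diff Ut closed_tsupp)
    fix \<psi> :: "R3 => M3" assume \<psi>: "tf \<psi>" "tsupp \<psi> \<subseteq> Ut - tsupp f2"
    let ?\<Phi> = "%x. P (\<psi> x)"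
    have tU: "tsupp ?\<Phi> \<subseteq> Ut - tsupp f2" using Pt(2)[OF \<psi>(1)] \<psi>(2) by blast
    have "ipL (g n) ?\<Phi> = ipL (u n) (D ?\<Phi>) + ipL (Y n) ?\<Phi>"
      by (rule step4[OF Pt(1)[OF \<psi>(1)] P_idem]) (use tU in auto)
    moreover have "g n x \<bullet> ?\<Phi> x = 0 & u n x \<bullet> D ?\<Phi> x = 0" for x
    proof (cases "x \<in> tsupp f2")
      case True
      then have "x \<notin> tsupp ?\<Phi>" using tU by blast
      then show ?thesis by (simp add: tsuppD[of x ?\<Phi>] D_zero_off)
    next
      case False
      then have "x \<notin> tsupp f1" using s12 by blast
      then show ?thesis by (simp add: g(3) uoff False)
    qed
    then have "ipL (g n) ?\<Phi> = 0" "ipL (u n) (D ?\<Phi>) = 0" by (simp_all add: ip_def)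
    ultimately show "ipL (Y n) \<psi> = 0" by (simp add: PP[of n \<psi>])
  qed
  show ?thesis
  proof (intro exI[of _ u] exI[of _ Y] conjI allI impI ulim Ylim us Ys uoff YU)
    show "AE x in lborel. x \<in> B --> u n x = 0 & Y n x = 0" for n
      using uB[of n] YB[of n] by eventually_elim auto
  qed (use step4 in auto)
qed

end

section \<open>Homotopy formulas for the symmetric rotation and divergence complexes\<close>

text \<open>Moments of the kernel. A factor k_a is what the derivative along the ray t k brings
  in.\<close>

definition mom :: "3 => (R3 => real) => R3 => real" where "mom a \<eta> = (%k. k $ a * \<eta> k)"

lemma mom_commute: "mom a (mom b \<eta>) = mom b (mom a \<eta>)" by (auto simp: mom_def)

lemma tf_mom: "tf \<eta> ==> tf (mom a \<eta>)" unfolding mom_def by (rule tf_mult2[OF smooth_coord])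

lemma tsupp_mom: "tsupp (mom a \<eta>) \<subseteq> tsupp \<eta>"
  by (rule tsupp_subset[OF closed_tsupp]) (simp add: mom_def tsuppD)

lemma Iop_zero: "Iop T m \<eta> (%x. 0) = (%x. 0)" by (auto simp: Iop_def aop_def)

lemma Iop_add: assumes "tf \<eta>" "tf f" "tf g" shows "Iop T m \<eta> (%x. f x + g x) = (%x. Iop T m \<eta> f x + Iop T m \<eta> g x)"
  using averaging.aop_integrable_tf[OF averaging_Wt(2)[OF assms(1)] assms(2), of T m] averaging.aop_integrable_tf[OF averaging_Wt(2)[OF assms(1)] assms(3), of T m]
  by (auto simp: Iop_def aop_def distrib_left)

lemma Iop_uminus: "Iop T m \<eta> (%x. - f x) = (%x. - Iop T m \<eta> f x)" by (auto simp: Iop_def aop_def)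

lemma Iop_diff: "tf \<eta> ==> tf f ==> tf g ==> Iop T m \<eta> (%x. f x - g x) = (%x. Iop T m \<eta> f x - Iop T m \<eta> g x)"
  using Iop_add[of \<eta> f "%x. - g x"] by (simp add: tf_uminus Iop_uminus)

lemma Iop_sum: "tf \<eta> ==> (!!i. i \<in> A ==> tf (f i)) ==> Iop T m \<eta> (%x. \<Sum>i\<in>A. f i x) = (%x. \<Sum>i\<in>A. Iop T m \<eta> (f i) x)"
proof (induction A rule: infinite_finite_induct)
  case (insert a A)
  then show ?case using Iop_add[of \<eta> "f a" "%x. \<Sum>i\<in>A. f i x" T m] by (simp add: tf_sum)
qed (auto simp: Iop_zero)

text \<open>Here t is integrated first, in preparation for the fundamental theorem of calculus on
  each ray.\<close>

lemma iterated_ray: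
  assumes "integrable lborel (%p. Wt T m \<eta> p * f p)"
  shows "(\<integral>p. Wt T m \<eta> p * f p \<partial>lborel) = (\<integral>k. \<eta> k * (\<integral>t. indicator {0..T} t * t ^ m * f (t, k) \<partial>lborel) \<partial>lborel)"
proof -
  have i: "integrable (lborel \<Otimes>\<^sub>M lborel) (%(t, k). Wt T m \<eta> (t, k) * f (t, k))"
    using assms by (simp add: lborel_prod case_prod_beta')
  have e: "(\<integral>t. Wt T m \<eta> (t, k) * f (t, k) \<partial>lborel) = \<eta> k * (\<integral>t. indicator {0..T} t * t ^ m * f (t, k) \<partial>lborel)" for k
  proof -
    have "(%t. Wt T m \<eta> (t, k) * f (t, k)) = (%t. \<eta> k * (indicator {0..T} t * t ^ m * f (t, k)))" by (auto simp: Wt_def)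
    then show ?thesis by simp
  qed
  show ?thesis using lborel_pair.integral_snd[OF i] by (simp add: e lborel_prod case_prod_beta')
qed

text \<open>The derivative of the test function along the ray is integrated exactly; the hypothesis says that the ray has left
  the support at its far end.\<close>

lemma Iop_radial:
  assumes \<eta>: "tf \<eta>" and \<phi>: "tf \<phi>" and T: "0 <= T" and far: "!!k. \<eta> k ~= 0 ==> \<phi> (y - T *\<^sub>R k) = 0"
  shows "(\<Sum>j\<in>UNIV. Iop T 0 (mom j \<eta>) (pd j \<phi>) y) = (\<integral>k. \<eta> k \<partial>lborel) * \<phi> y"
    and "(\<Sum>j\<in>UNIV. Iop T 1 (mom j \<eta>) (pd j \<phi>) y) = Iop T 0 \<eta> \<phi> y"
proof -
  define q where "q p = (\<Sum>j\<in>UNIV. snd p $ j * pd j \<phi> (y - ray p))" for p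
  have i: "integrable lborel (%p. Wt T m (mom j \<eta>) p * pd j \<phi> (y + - ray p))" for m j
    by (rule averaging.aop_integrable_tf[OF averaging_Wt(2)[OF tf_mom[OF \<eta>]] tf_pd[OF \<phi>]])
  have e: "(%p. Wt T m \<eta> p * q p) = (%p. \<Sum>j\<in>UNIV. Wt T m (mom j \<eta>) p * pd j \<phi> (y + - ray p))" for m
    by (auto simp: q_def sum_distrib_left Wt_def mom_def mult_ac intro!: sum.cong)
  have iq: "integrable lborel (%p. Wt T m \<eta> p * q p)" for m unfolding e by (intro Bochner_Integration.integrable_sum i)
  have "(\<Sum>j\<in>UNIV. Iop T m (mom j \<eta>) (pd j \<phi>) y) = (\<integral>p. Wt T m \<eta> p * q p \<partial>lborel)" for m
    unfolding e Iop_def aop_def using i by (simp add: Bochner_Integration.integral_sum)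
  then have L: "(\<Sum>j\<in>UNIV. Iop T m (mom j \<eta>) (pd j \<phi>) y) = (\<integral>k. \<eta> k * (\<integral>t. indicator {0..T} t * t ^ m * q (t, k) \<partial>lborel) \<partial>lborel)" for m
    by (simp add: iterated_ray[OF iq])
  have d: "((%t. \<phi> (y - t *\<^sub>R k)) has_vector_derivative - q (t, k)) (at t within S)" for t k S
  proof -
    have "((%t. \<phi> (y - t *\<^sub>R k)) has_derivative (%s. \<Sum>j\<in>UNIV. (- (s *\<^sub>R k)) $ j *\<^sub>R pd j \<phi> (y - t *\<^sub>R k))) (at t within S)"
      by (rule has_derivative_compose[OF _ smooth_has_derivative[OF tf_smooth[OF \<phi>]]]) (auto intro!: derivative_eq_intros)
    then show ?thesis by (simp add: has_vector_derivative_def q_def ray_def sum_distrib_left sum_negf mult_ac)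
  qed
  have cont: "continuous_on S (%t. \<phi> (y - t *\<^sub>R k))" "continuous_on S (%t. q (t, k))" for k S
    unfolding q_def ray_def fst_conv snd_conv
    by (intro continuous_intros continuous_on_compose2[OF tf_continuous[OF \<phi>, of UNIV]] continuous_on_compose2[OF tf_continuous[OF tf_pd[OF \<phi>], of UNIV]]; simp)+
  have 0: "(\<integral>t. indicator {0..T} t * t ^ 0 * q (t, k) \<partial>lborel) = \<phi> y" if "\<eta> k ~= 0" for k
  proof -
    have "has_bochner_integral lborel (%t. indicator {0..T} t *\<^sub>R (- q (t, k))) (\<phi> (y - T *\<^sub>R k) - \<phi> (y - 0 *\<^sub>R k))"
      by (rule has_bochner_integral_FTC_Icc[OF T]) (auto intro!: d continuous_intros cont)
    from has_bochner_integral_integral_eq[OF this] show ?thesis using far[OF that] by simp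
  qed
  \<comment> \<open>For weight t the antiderivative is t times the value along the ray; the product
    rule leaves the integral of the value itself.\<close>
  have 1: "(\<integral>t. indicator {0..T} t * t ^ 1 * q (t, k) \<partial>lborel) = (\<integral>t. indicator {0..T} t * t ^ 0 * \<phi> (y - t *\<^sub>R k) \<partial>lborel)" if "\<eta> k ~= 0" for k
  proof -
    have "has_bochner_integral lborel (%t. indicator {0..T} t *\<^sub>R (t *\<^sub>R (- q (t, k)) + 1 *\<^sub>R \<phi> (y - t *\<^sub>R k))) (T *\<^sub>R \<phi> (y - T *\<^sub>R k) - 0 *\<^sub>R \<phi> (y - 0 *\<^sub>R k))"
      by (rule has_bochner_integral_FTC_Icc[OF T])
        (intro has_vector_derivative_scaleR d continuous_intros cont DERIV_ident)+
    from has_bochner_integral_integral_eq[OF this] have "(\<integral>t. indicator {0..T} t * \<phi> (y - t *\<^sub>R k) - indicator {0..T} t * (t * q (t, k)) \<partial>lborel) = 0"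
      using far[OF that] by (simp add: algebra_simps)
    moreover have "integrable lborel (%t. indicator {0..T} t * \<phi> (y - t *\<^sub>R k))" "integrable lborel (%t. indicator {0..T} t * (t * q (t, k)))"
      using borel_integrable_compact[of "{0..T}" "%t. \<phi> (y - t *\<^sub>R k)"] borel_integrable_compact[of "{0..T}" "%t. t * q (t, k)"]
      by (simp_all add: cont continuous_on_mult continuous_on_id)
    ultimately show ?thesis by (simp add: mult.assoc)
  qed
  have E0: "\<eta> k * (\<integral>t. indicator {0..T} t * t ^ 0 * q (t, k) \<partial>lborel) = \<eta> k * \<phi> y" for k using 0[of k] by (cases "\<eta> k = 0") auto
  show "(\<Sum>j\<in>UNIV. Iop T 0 (mom j \<eta>) (pd j \<phi>) y) = (\<integral>k. \<eta> k \<partial>lborel) * \<phi> y" unfolding L E0 by simp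
  have ip: "integrable lborel (%p. Wt T 0 \<eta> p * \<phi> (y + - ray p))" by (rule averaging.aop_integrable_tf[OF averaging_Wt(2)[OF \<eta>] \<phi>])
  have E1: "\<eta> k * (\<integral>t. indicator {0..T} t * t ^ 1 * q (t, k) \<partial>lborel) = \<eta> k * (\<integral>t. indicator {0..T} t * t ^ 0 * \<phi> (y + - ray (t, k)) \<partial>lborel)" for k
    using 1[of k] by (cases "\<eta> k = 0") (auto simp: ray_def)
  show "(\<Sum>j\<in>UNIV. Iop T 1 (mom j \<eta>) (pd j \<phi>) y) = Iop T 0 \<eta> \<phi> y"
    unfolding L E1 unfolding Iop_def aop_def iterated_ray[OF ip] ..
qed

lemma kernel_tf: "kernel \<eta> ==> tf \<eta>" by (simp add: kernel_def)

lemma kernel_far: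
  assumes "kernel \<eta>" "tsupp \<phi> \<subseteq> cball 0 r" "norm y <= r'" "r + r' < T" "0 <= T" "\<eta> k ~= 0"
  shows "\<phi> (y - T *\<^sub>R k) = 0"
proof -
  have "k \<in> tsupp \<eta>" using assms(6) tsuppD by blast
  then have "1 <= norm k" using assms(1) by (simp add: kernel_def)
  then have "T <= norm (T *\<^sub>R k)" using assms(5) mult_left_mono[of 1 "norm k" T] by simp
  moreover have "norm (T *\<^sub>R k) <= norm y + norm (y - T *\<^sub>R k)" using norm_triangle_ineq4[of y "y - T *\<^sub>R k"] by simp
  ultimately have "y - T *\<^sub>R k \<notin> cball 0 r" using assms(3,4) by simp
  then show ?thesis using assms(2) by (intro tsuppD) blast
qed

text \<open>\<open>nice\<close> sees k only on test functions, so k may be rewritten by identities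
  that need smoothness and compact support.\<close>

lemma nice_cong:
  assumes n: "nice C k" and e: "!!\<phi>. tf \<phi> ==> k' \<phi> = k \<phi>" shows "nice C k'"
proof -
  have "adjoint_op k' K \<longleftrightarrow> adjoint_op k K" for K by (simp add: adjoint_op_def e)
  then show ?thesis using n by (simp add: nice_def e)
qed

lemma nice_mat:
  assumes "!!i j. nice C (k i j)" shows "nice C (%\<phi> x. (\<chi> i j. k i j \<phi> x) :: M3)"
proof -
  have e: "(\<chi> i j. k i j \<phi> x) = (\<Sum>i\<in>UNIV. \<Sum>j\<in>UNIV. axis i (axis j (k i j \<phi> x)))" for \<phi> x
    by (simp add: vec_eq_iff axis_def sum_3 forall_3)
  have "linear (%r. axis i (axis j r) :: M3)" for i j
    using bounded_linear.linear[OF bounded_linear_compose[OF bounded_linear_axis bounded_linear_axis]] .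
  then show ?thesis unfolding e by (intro nice_sum nice_post[OF assms, where L="%r. axis i (axis j r)" for i j])
qed

lemma nice_entry:
  assumes "nice C k" "multiplier f" shows "nice C (%\<Phi>. k (%x. f x * (\<Phi> x :: M3) $ i $ j))"
  using nice_pre[OF assms(1) _ assms(2), of "%A::M3. A $ i $ j"] by (simp add: linear_iff)

lemma nice_comp:
  assumes "nice C k" shows "nice C (%\<psi>. k (%x. (\<psi> x :: R3) $ i))"
  using nice_pre[OF assms _ multiplier_const[of 1], of "%A::R3. A $ i"] by (simp add: linear_iff)

lemma nice_cmult: "nice C k ==> nice C (%\<phi> x. c * k \<phi> x :: real)"
  by (rule nice_post) (simp_all add: linear_iff distrib_left)

lemma nice_uminus: "nice C k ==> nice C (%\<phi> x. - k \<phi> x)"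
  by (rule nice_post) (simp_all add: linear_iff)

lemma nice_diff: "nice C k1 ==> nice C k2 ==> nice C (%\<phi> x. k1 \<phi> x - k2 \<phi> x)"
  using nice_add[of C k1 "%\<phi> x. - k2 \<phi> x"] nice_uminus[of C k2] by simp

lemma nice_Iop_sub: "tf \<kappa> ==> tsupp \<kappa> \<subseteq> tsupp \<eta> ==> 0 <= T ==> nice (rays T (tsupp \<eta>)) (Iop T m \<kappa>)"
  by (rule nice_mono[OF nice_Iop]) (auto simp: rays_def)

text \<open>The contraction \<epsilon>_cab h_ab with the permutation symbol, so that curls can be
  handled by index calculus.\<close>

definition cross :: "3 => (3 => 3 => real) => real" where
  "cross c h = (if c = 1 then h 2 3 - h 3 2 else if c = 2 then h 3 1 - h 1 3 else h 1 2 - h 2 1)"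

lemma nice_cross: "(!!a b. nice C (h a b)) ==> nice C (%\<Phi> x. cross c (%a b. h a b \<Phi> x))"
  by (cases "c = 1"; cases "c = 2") (simp_all add: cross_def nice_diff)

lemma smooth_cross: "(!!a b. smooth (h a b)) ==> smooth (%x. cross c (%a b. h a b x))"
  by (cases "c = 1"; cases "c = 2") (simp_all add: cross_def smooth_diff)

lemma tf_cross: "(!!a b. tf (h a b)) ==> tf (%x. cross c (%a b. h a b x))"
  by (cases "c = 1"; cases "c = 2") (simp_all add: cross_def tf_diff)

lemma pd_cross: "(!!a b. smooth (h a b)) ==> pd e (%x. cross c (%a b. h a b x)) x = cross c (%a b. pd e (h a b) x)"
  by (cases "c = 1"; cases "c = 2") (simp_all add: cross_def pd_diff)

lemma cross_uminus: "cross c (%a b. - h a b) = - cross c h"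
  by (simp add: cross_def)

lemma cross_sym: "(!!a b. h a b = h b a) ==> cross c h = 0" by (simp add: cross_def)

text \<open>The identity \<epsilon>_dec \<epsilon>_cab = \<delta>_da \<delta>_eb - \<delta>_db
  \<delta>_ea.\<close>

lemma cross_cross: "cross d (%e c. cross c (B e)) = (\<Sum>e\<in>UNIV. B e d e) - (\<Sum>e\<in>UNIV. B e e d)"
  using exhaust_3[of d] by (auto simp: cross_def sum_3)

text \<open>The expansion of the product of two permutation symbols as a determinant of Kronecker symbols.\<close>

lemma cross_cross2: "cross d (%e j. cross i (B e j)) =
    (if d = i then (\<Sum>e\<in>UNIV. \<Sum>j\<in>UNIV. B e j e j - B e j j e) else 0)
    - (\<Sum>j\<in>UNIV. B i j d j - B j i d j) + (\<Sum>j\<in>UNIV. B i j j d - B j i j d)"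
  using exhaust_3[of d] exhaust_3[of i] by (elim disjE) (simp_all add: cross_def sum_3)

section \<open>The differential operators in index form, and the pointwise projections\<close>

lemma cRot_nth: "cRot F x $ l $ d = cross d (%e c. pd e (%y. F y $ l $ c) x)"
  using exhaust_3[of d] by (auto simp: cRot_def cross_def)

lemma pd_entry: "smooth F ==> pd j F x $ i $ c = pd j (%y. F y $ i $ c) x" for F :: "R3 => M3"
  by (rule pd_linear[OF smooth_differentiable bounded_linear_compose[OF bounded_linear_vec_nth bounded_linear_vec_nth], symmetric])

lemma smooth_cDiv: "smooth F ==> smooth (cDiv F)"
  unfolding cDiv_def[abs_def] by (intro smooth_vec smooth_sum smooth_pd smooth_nth)

lemma smooth_cdiv: "smooth v ==> smooth (cdiv v)"
  unfolding cdiv_def[abs_def] by (intro smooth_sum smooth_pd smooth_nth)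

lemma cDiv_nth: "cDiv F x $ i = (\<Sum>j\<in>UNIV. pd j (%y. F y $ i $ j) x)" by (simp add: cDiv_def)

lemma cDiv_local: assumes "open U" "x \<in> U" "!!y. y \<in> U ==> F y = F' y" shows "cDiv F x = cDiv F' x"
  unfolding vec_eq_iff cDiv_nth by (intro allI sum.cong refl pd_local[OF assms(1,2)]) (simp add: assms(3))

lemma cdivDiv_local: assumes "open U" "x \<in> U" "!!y. y \<in> U ==> F y = F' y" shows "cdivDiv F x = cdivDiv F' x"
  unfolding cdivDiv_def cdiv_def by (intro sum.cong refl pd_local[OF assms(1,2)]) (metis assms(1,3) cDiv_local)

text \<open>The matrix coefficient of the j-th derivative in the row-wise curl, that is, its symbol
  at the j-th unit vector.\<close>

definition curl_sym :: "3 => M3 => M3" where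
  "curl_sym j A = (\<chi> l d. cross d (%e c. if e = j then A $ l $ c else 0))"

lemma linear_curl_sym: "linear (curl_sym j)"
  by (auto simp: linear_iff curl_sym_def vec_eq_iff cross_def)

lemma cRot_eq: "smooth F ==> cRot F x = (\<Sum>j\<in>UNIV. curl_sym j (pd j F x))"
  by (simp add: vec_eq_iff cRot_nth curl_sym_def pd_entry[symmetric] sum_3 forall_3 cross_def)

lemma linear_symm: "linear symm" by (auto simp: linear_iff symm_def vec_eq_iff transpose_def algebra_simps)

lemma symm_nth: "symm A $ i $ j = (A $ i $ j + A $ j $ i) / 2" by (simp add: symm_def transpose_def)

lemma symm_inner: "symm A \<bullet> B = A \<bullet> symm B"
  by (simp add: inner_vec_def symm_nth sum_3 field_simps)

lemma symm_idem: "symm (symm A) = symm A" by (simp add: vec_eq_iff symm_nth add.commute)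

definition dev :: "M3 => M3" where "dev A = A - (trace A / 3) *\<^sub>R mat 1"

lemma trace_3: "trace (A :: M3) = A $ 1 $ 1 + A $ 2 $ 2 + A $ 3 $ 3" by (simp add: trace_def sum_3)

lemma dev_nth: "dev A $ i $ j = A $ i $ j - (if i = j then (A $ 1 $ 1 + A $ 2 $ 2 + A $ 3 $ 3) / 3 else 0)"
  by (simp add: dev_def mat_def trace_3)

lemma linear_dev: "linear dev" by (auto simp: linear_iff vec_eq_iff dev_nth field_simps)
lemma dev_inner: "dev A \<bullet> B = A \<bullet> dev B" by (simp add: inner_vec_def dev_nth sum_3 field_simps)
lemma trace_dev: "trace (dev A) = 0" by (simp add: trace_3 dev_nth field_simps)
lemma dev_trace0: "trace A = 0 ==> dev A = A" by (simp add: dev_def)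
lemma dev_idem: "dev (dev A) = dev A" by (rule dev_trace0[OF trace_dev])

section \<open>Homotopy operators for symmetric fields: Rot and divDiv\<close>

definition k0S :: "real => (R3 => real) => (R3 => real) => R3 => M3" where
  "k0S T \<eta> \<psi> x = (\<chi> i j. Iop T 1 (mom i (mom j \<eta>)) \<psi> x)"

text \<open>The second sum is the ray average of Div \<Phi> with density t k_l k_a \<eta>, with its
  derivatives already moved onto the kernel (\<open>Iop_div\<close>), so that \<Phi> enters
  undifferentiated.\<close>

definition k1S :: "real => (R3 => real) => (R3 => M3) => R3 => M3" where
  "k1S T \<eta> \<Phi> x = (\<chi> l c. - cross c (%a b. Iop T 0 (mom a \<eta>) (%x. \<Phi> x $ l $ b) x +
     (\<Sum>j\<in>UNIV. Iop T 0 (pd j (mom l (mom a \<eta>))) (%x. \<Phi> x $ b $ j) x)))"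

lemma mom_sub: "tsupp (mom a (mom b \<eta>)) \<subseteq> tsupp \<eta>" "tsupp (pd j (mom a (mom b \<eta>))) \<subseteq> tsupp \<eta>"
  using tsupp_mom tsupp_pd by blast+

lemma nice_entry1: "nice C k ==> nice C (%\<Phi>. k (%x. (\<Phi> x :: M3) $ i $ j))"
  using nice_entry[OF _ multiplier_const[of 1]] by simp

lemma nice_k0S: "tf \<eta> ==> 0 <= T ==> nice (rays T (tsupp \<eta>)) (k0S T \<eta>)"
  unfolding k0S_def[abs_def] by (intro nice_mat nice_Iop_sub tf_mom mom_sub)

lemma nice_k1S: "tf \<eta> ==> 0 <= T ==> nice (rays T (tsupp \<eta>)) (k1S T \<eta>)"
  unfolding k1S_def[abs_def]
  by (intro nice_mat nice_uminus nice_cross nice_add nice_sum nice_entry1 nice_Iop_sub tf_mom tf_pd tsupp_mom mom_sub)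

lemma Iop_div: "tf \<kappa> ==> tf \<Phi> ==>
   (\<Sum>j\<in>UNIV. Iop T 0 (pd j \<kappa>) (%x. (\<Phi> x :: M3) $ b $ j) x) = Iop T 1 \<kappa> (%x. cDiv \<Phi> x $ b) x"
  by (simp add: cDiv_nth Iop_sum tf_pd tf_nth flip: Iop_rule2)

lemma Iop_div0: "tf \<kappa> ==> tf \<Phi> ==>
   (\<Sum>j\<in>UNIV. Iop T m \<kappa> (pd j (%x. (\<Phi> x :: M3) $ b $ j)) x) = Iop T m \<kappa> (%x. cDiv \<Phi> x $ b) x"
  by (simp add: cDiv_nth Iop_sum tf_pd tf_nth)

lemma tf_cDiv: "tf \<Phi> ==> tf (cDiv \<Phi>)"
  unfolding cDiv_def[abs_def] by (intro tf_vec tf_sum tf_pd tf_nth)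

lemma tsupp_cDiv: "tsupp (cDiv \<Phi>) \<subseteq> tsupp \<Phi>"
proof (rule tsupp_subset[OF closed_tsupp])
  fix x assume "x \<notin> tsupp \<Phi>"
  then have "cDiv \<Phi> x = cDiv (%x. 0) x" by (intro cDiv_local[of "- tsupp \<Phi>"]) (auto simp: closed_tsupp tsuppD open_Compl)
  then show "cDiv \<Phi> x = 0" by (simp add: vec_eq_iff cDiv_nth pd_const)
qed

lemma tsupp_nth: "tsupp (%x. f x $ i) \<subseteq> tsupp f" by (rule tsupp_subset[OF closed_tsupp]) (simp add: tsuppD)

lemma radial:
  assumes k: "kernel \<eta>" and \<phi>: "tf \<phi>" and b: "tsupp \<phi> \<subseteq> cball 0 r" "norm x <= r'" "r + r' < T" "0 <= T"
  shows "(\<Sum>j\<in>UNIV. Iop T 0 (mom j \<eta>) (pd j \<phi>) x) = \<phi> x"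
    and "(\<Sum>j\<in>UNIV. Iop T 1 (mom l (mom j \<eta>)) (pd j \<phi>) x) = Iop T 0 (mom l \<eta>) \<phi> x"
proof -
  show "(\<Sum>j\<in>UNIV. Iop T 0 (mom j \<eta>) (pd j \<phi>) x) = \<phi> x"
    using Iop_radial(1)[OF kernel_tf[OF k] \<phi> b(4) kernel_far[OF k b]] k by (simp add: kernel_def)
  show "(\<Sum>j\<in>UNIV. Iop T 1 (mom l (mom j \<eta>)) (pd j \<phi>) x) = Iop T 0 (mom l \<eta>) \<phi> x"
    unfolding mom_commute[of l] by (rule Iop_radial(2)[OF tf_mom[OF kernel_tf[OF k]] \<phi> b(4) kernel_far[OF k b]]) (auto simp: mom_def)
qed

lemma pd_sum: "(!!i. i \<in> A ==> smooth (f i)) ==> pd j (%x. \<Sum>i\<in>A. f i x) x = (\<Sum>i\<in>A. pd j (f i) x)"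
  by (induction A rule: infinite_finite_induct) (auto simp: pd_const pd_add smooth_differentiable smooth_sum)

lemma tsupp_entry: "tsupp (%x. (F x :: M3) $ i $ j) \<subseteq> tsupp F"
  by (rule tsupp_subset[OF closed_tsupp]) (simp add: tsuppD)

lemma Iop_smooth: "tf \<eta> ==> tf \<phi> ==> smooth (Iop T m \<eta> \<phi>)" by (rule tf_smooth[OF Iop_tf(1)])

text \<open>By \<open>cross_cross\<close> the curl of the potential is a radial sum, which
  reproduces \<Phi> by \<open>radial\<close>, minus a sum of divergences, whose second-order part
  cancels against \<open>k0S\<close>. The rest is skew in l and d and disappears on
  symmetrisation.\<close>

lemma rot_k1S:
  assumes k: "kernel \<eta>" and \<Phi>: "tf \<Phi>" and b: "tsupp \<Phi> \<subseteq> cball 0 r" "norm x <= r'" "r + r' < T" "0 <= T"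
  shows "k0S T \<eta> (cdivDiv \<Phi>) x $ l $ d + cRot (k1S T \<eta> \<Phi>) x $ l $ d =
    \<Phi> x $ l $ d + Iop T 0 (mom l \<eta>) (%x. cDiv \<Phi> x $ d) x - Iop T 0 (mom d \<eta>) (%x. cDiv \<Phi> x $ l) x"
proof -
  note \<eta> = kernel_tf[OF k]
  define A where "A l a b y = Iop T 0 (mom a \<eta>) (%x. \<Phi> x $ l $ b) y + Iop T 1 (mom l (mom a \<eta>)) (%x. cDiv \<Phi> x $ b) y" for l a b y
  have k1: "(%y. k1S T \<eta> \<Phi> y $ l $ c) = (%y. - cross c (%a b. A l a b y))" for l c
    by (simp add: k1S_def A_def Iop_div tf_mom \<eta> \<Phi>)
  have sA: "smooth (A l a b)" for l a b
    unfolding A_def[abs_def] by (intro smooth_add Iop_smooth tf_mom \<eta> tf_nth tf_cDiv \<Phi>)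
  have dA: "pd e (A l a b) y = Iop T 0 (mom a \<eta>) (pd e (%x. \<Phi> x $ l $ b)) y + Iop T 1 (mom l (mom a \<eta>)) (pd e (%x. cDiv \<Phi> x $ b)) y" for e l a b y
    unfolding A_def[abs_def]
    by (simp add: pd_add smooth_differentiable Iop_smooth tf_mom \<eta> tf_nth tf_cDiv \<Phi> Iop_pd)
  have s: "tsupp (%x. \<Phi> x $ l $ d) \<subseteq> cball 0 r" "tsupp (%x. cDiv \<Phi> x $ d) \<subseteq> cball 0 r"
    using tsupp_entry[of \<Phi> l d] tsupp_nth[of "cDiv \<Phi>" d] tsupp_cDiv[of \<Phi>] b(1) by blast+
  have "cRot (k1S T \<eta> \<Phi>) x $ l $ d = (\<Sum>e\<in>UNIV. pd e (A l e d) x) - (\<Sum>e\<in>UNIV. pd e (A l d e) x)"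
    unfolding cRot_nth k1 by (simp add: pd_uminus smooth_cross sA pd_cross cross_uminus cross_cross)
  also have "(\<Sum>e\<in>UNIV. pd e (A l e d) x) = \<Phi> x $ l $ d + Iop T 0 (mom l \<eta>) (%x. cDiv \<Phi> x $ d) x"
    unfolding dA sum.distrib
    using radial(1)[OF k tf_nth[OF tf_nth[OF \<Phi>]] s(1) b(2-4)] radial(2)[OF k tf_nth[OF tf_cDiv[OF \<Phi>]] s(2) b(2-4)] by simp
  also have "(\<Sum>e\<in>UNIV. pd e (A l d e) x) = Iop T 0 (mom d \<eta>) (%x. cDiv \<Phi> x $ l) x + Iop T 1 (mom l (mom d \<eta>)) (cdivDiv \<Phi>) x"
    unfolding dA sum.distrib Iop_div0[OF tf_mom[OF \<eta>] \<Phi>] cdivDiv_def cdiv_def[abs_def]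
    by (simp add: Iop_sum tf_mom \<eta> tf_pd tf_nth tf_cDiv \<Phi>)
  finally show ?thesis by (simp add: k0S_def)
qed

text \<open>\<open>radial\<close> is applied twice: density t k_i k_j is first reduced to density
  k_i, then to the value. The factor t is what two nested integrations along the same ray amount
  to.\<close>

lemma divDiv_k0S:
  assumes k: "kernel \<eta>" and \<psi>: "tf \<psi>" and b: "tsupp \<psi> \<subseteq> cball 0 r" "norm x <= r'" "r + r' < T" "0 <= T"
  shows "cdivDiv (k0S T \<eta> \<psi>) x = \<psi> x"
proof -
  note \<eta> = kernel_tf[OF k]
  have "(%y. cDiv (k0S T \<eta> \<psi>) y $ i) = (%y. \<Sum>j\<in>UNIV. Iop T 1 (mom i (mom j \<eta>)) (pd j \<psi>) y)" for i
    by (simp add: cDiv_nth k0S_def Iop_pd tf_mom \<eta> \<psi>)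
  then have "cdivDiv (k0S T \<eta> \<psi>) x = (\<Sum>i\<in>UNIV. \<Sum>j\<in>UNIV. Iop T 1 (mom i (mom j \<eta>)) (pd j (pd i \<psi>)) x)"
    by (simp add: cdivDiv_def cdiv_def pd_sum Iop_smooth Iop_pd tf_mom \<eta> \<psi> tf_pd pd_commute[OF \<psi>, of _ i for i])
  also have "\<dots> = (\<Sum>i\<in>UNIV. Iop T 0 (mom i \<eta>) (pd i \<psi>) x)"
    using tsupp_pd[of _ \<psi>] b by (intro sum.cong refl radial(2)[OF k tf_pd[OF \<psi>], where r=r and r'=r']) auto
  also have "\<dots> = \<psi> x" by (rule radial(1)[OF k \<psi> b])
  finally show ?thesis .
qed

text \<open>Arranged so that the first-order terms are outer derivatives of products: the single
  factor t in \<open>k0S\<close> pays for exactly one derivative, and \<open>Iop_rule2\<close> moves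
  it onto the kernel.\<close>

lemma divDiv_commutator:
  assumes f: "tf f" and \<Phi>: "tf \<Phi>"
  shows "cdivDiv (%x. f x *\<^sub>R \<Phi> x) x - f x * cdivDiv \<Phi> x = (\<Sum>i\<in>UNIV. \<Sum>j\<in>UNIV.
    pd i (%x. pd j f x * \<Phi> x $ i $ j) x + pd j (%x. pd i f x * \<Phi> x $ i $ j) x - pd j (pd i f) x * \<Phi> x $ i $ j)"
proof -
  have s: "smooth (%x. \<Phi> x $ i $ j)" "smooth f" for i j by (intro smooth_nth tf_smooth \<Phi> f)+
  have c: "cdivDiv F x = (\<Sum>i\<in>UNIV. \<Sum>j\<in>UNIV. pd i (pd j (%x. F x $ i $ j)) x)" if "smooth F" for F
    using that by (simp add: cdivDiv_def cdiv_def cDiv_nth[abs_def] pd_sum smooth_pd smooth_nth)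
  have "pd i (pd j (%x. f x * \<Phi> x $ i $ j)) x = f x * pd i (pd j (%x. \<Phi> x $ i $ j)) x +
    (pd i (%x. pd j f x * \<Phi> x $ i $ j) x + pd j (%x. pd i f x * \<Phi> x $ i $ j) x - pd j (pd i f) x * \<Phi> x $ i $ j)" for i j
    using s by (simp add: pd_mult pd_add smooth_differentiable smooth_mult smooth_pd)
  then show ?thesis using s
    by (simp add: c smooth_scaleR tf_smooth \<Phi> f sum.distrib sum_subtractf sum_distrib_left)
qed

lemma comm_nice_S:
  assumes \<eta>: "tf \<eta>" and T: "0 <= T" and f: "tf f"
  shows "nice (rays T (tsupp \<eta>)) (%\<Phi>. k0S T \<eta> (%x. cdivDiv (%x. f x *\<^sub>R \<Phi> x) x - f x *\<^sub>R cdivDiv \<Phi> x))"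
proof (rule nice_cong)
  let ?\<kappa> = "%a b. mom a (mom b \<eta>)"
  let ?k = "%\<Phi> x. \<chi> a b. \<Sum>i\<in>UNIV. \<Sum>j\<in>UNIV. Iop T 0 (pd i (?\<kappa> a b)) (%x. pd j f x * \<Phi> x $ i $ j) x +
    Iop T 0 (pd j (?\<kappa> a b)) (%x. pd i f x * \<Phi> x $ i $ j) x - Iop T 1 (?\<kappa> a b) (%x. pd j (pd i f) x * \<Phi> x $ i $ j) x"
  show "nice (rays T (tsupp \<eta>)) ?k"
    by (intro nice_mat nice_sum nice_diff nice_add nice_entry nice_Iop_sub multiplier_tf tf_pd f tf_mom \<eta> T mom_sub)
  fix \<Phi> :: "R3 => M3" assume \<Phi>: "tf \<Phi>"
  have t: "tf (%x. g x * \<Phi> x $ i $ j)" if "tf g" for g i j by (intro tf_mult1 that smooth_nth tf_smooth \<Phi>)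
  show "k0S T \<eta> (%x. cdivDiv (%x. f x *\<^sub>R \<Phi> x) x - f x *\<^sub>R cdivDiv \<Phi> x) = ?k \<Phi>"
    by (auto simp: k0S_def vec_eq_iff divDiv_commutator[OF f \<Phi>] Iop_sum Iop_add Iop_diff tf_mom \<eta> tf_sum tf_add tf_diff tf_pd t f
        Iop_rule2[of _ _ T 0, simplified])
qed

interpretation SymRot: homotopy symm cRot curl_sym cdivDiv k0S k1S
proof (rule homotopy.intro)
  fix \<eta> f :: "R3 => real" and T r r' and \<Phi> :: "R3 => M3" and x :: R3
  show "kernel \<eta> ==> 0 <= T ==> nice (rays T (tsupp \<eta>)) (k0S T \<eta>)" "kernel \<eta> ==> 0 <= T ==> nice (rays T (tsupp \<eta>)) (k1S T \<eta>)"
    by (intro nice_k0S nice_k1S kernel_tf; assumption)+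
  show "kernel \<eta> ==> 0 <= T ==> tf f ==> nice (rays T (tsupp \<eta>)) (%\<Phi>. k0S T \<eta> (%x. cdivDiv (%x. f x *\<^sub>R \<Phi> x) x - f x *\<^sub>R cdivDiv \<Phi> x))"
    by (rule comm_nice_S[OF kernel_tf])
  assume a: "kernel \<eta>" "tf \<Phi>" "!!x. symm (\<Phi> x) = \<Phi> x" "tsupp \<Phi> \<subseteq> cball 0 r" "norm x <= r'" "r + r' < T" "0 <= T"
  have "\<Phi> x $ i $ j = \<Phi> x $ j $ i" for i j by (metis a(3) symm_nth add.commute)
  then have "(k0S T \<eta> (cdivDiv \<Phi>) x $ i $ j + cRot (k1S T \<eta> \<Phi>) x $ i $ j + (k0S T \<eta> (cdivDiv \<Phi>) x $ j $ i + cRot (k1S T \<eta> \<Phi>) x $ j $ i)) / 2 = \<Phi> x $ i $ j" for i j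
    unfolding rot_k1S[OF a(1,2,4-7)] by simp
  then show "symm (k0S T \<eta> (cdivDiv \<Phi>) x + cRot (k1S T \<eta> \<Phi>) x) = \<Phi> x"
    by (simp add: vec_eq_iff symm_nth)
next
  fix U :: "R3 set" and x and \<Phi> \<Phi>' :: "R3 => M3"
  assume "open U" "x \<in> U" "!!y. y \<in> U ==> \<Phi> y = \<Phi>' y"
  then show "cdivDiv \<Phi> x = cdivDiv \<Phi>' x" by (rule cdivDiv_local)
next
  fix \<eta> :: "R3 => real" and \<psi> :: "R3 => real" and r r' T :: real and x :: R3
  assume "kernel \<eta>" "tf \<psi>" "tsupp \<psi> \<subseteq> cball 0 r" "norm x <= r'" "r + r' < T" "0 <= T"
  then show "cdivDiv (k0S T \<eta> \<psi>) x = \<psi> x" by (rule divDiv_k0S)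
next
  fix \<eta> :: "R3 => real" and \<psi> :: "R3 => real" and T :: real and x :: R3
  show "symm (k0S T \<eta> \<psi> x) = k0S T \<eta> \<psi> x" by (simp add: vec_eq_iff symm_nth k0S_def mom_commute)
next
  fix \<Psi> :: "R3 => M3" assume "smooth \<Psi>"
  then show "cRot \<Psi> = (%x. \<Sum>j\<in>UNIV. curl_sym j (pd j \<Psi> x))" by (simp add: fun_eq_iff cRot_eq)
qed (simp_all add: linear_symm linear_curl_sym symm_inner symm_idem cdivDiv_def smooth_cdiv smooth_cDiv,
    simp add: cdiv_def cDiv_nth pd_const)

section \<open>Homotopy operators for trace-free fields: Rot after symmetrisation, and Div\<close>

definition k0T :: "real => (R3 => real) => (R3 => R3) => R3 => M3" where
  "k0T T \<eta> \<psi> x = - dev (\<chi> i j. Iop T 0 (mom j \<eta>) (%x. \<psi> x $ i) x +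
     (1/2) * (\<Sum>a\<in>UNIV. Iop T 0 (pd i (mom a (mom j \<eta>))) (%x. \<psi> x $ a) x))"

text \<open>Of the form -(W + grad v), where W is the row-wise ray potential and v a correction;
  only the transpose of grad v contributes to the Rot of the symmetric part.\<close>

definition k1T :: "real => (R3 => real) => (R3 => M3) => R3 => M3" where
  "k1T T \<eta> \<Phi> x = (\<chi> i j. - (cross j (%a b. Iop T 0 (mom a \<eta>) (%x. \<Phi> x $ i $ b) x) +
     cross i (%a b. \<Sum>c\<in>UNIV. Iop T 0 (pd j (mom c (mom a \<eta>))) (%x. \<Phi> x $ c $ b) x)))"

lemma linear_minus_dev: "linear (%A. - dev A)"
  using linear_compose_neg[OF linear_dev] .

lemma nice_k0T: "tf \<eta> ==> 0 <= T ==> nice (rays T (tsupp \<eta>)) (k0T T \<eta>)"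
  unfolding k0T_def[abs_def]
  by (intro nice_post[OF _ linear_minus_dev] nice_mat nice_add nice_cmult nice_sum nice_comp nice_Iop_sub tf_mom tf_pd tsupp_mom mom_sub)

lemma nice_k1T: "tf \<eta> ==> 0 <= T ==> nice (rays T (tsupp \<eta>)) (k1T T \<eta>)"
  unfolding k1T_def[abs_def]
  by (intro nice_mat nice_uminus nice_cross nice_add nice_sum nice_entry1 nice_Iop_sub tf_mom tf_pd tsupp_mom mom_sub)

lemma pd_neg_half: "smooth f ==> pd j (%x. - f x / 2 :: real) x = - pd j f x / 2"
  using pd_cmult[of f j "-1/2" x] by simp

text \<open>Symmetrising splits the curl into four sums. The curl of grad v vanishes, the transpose
  of grad v cancels the gradient term left by the transpose of W, and the two W terms together give
  twice \<Phi>. A multiple of the identity survives, which \<open>dev\<close> annihilates.\<close>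

lemma rot_symm_k1T:
  assumes k: "kernel \<eta>" and \<Phi>: "tf \<Phi>" and tr: "!!x. trace (\<Phi> x) = 0"
    and b: "tsupp \<Phi> \<subseteq> cball 0 r" "norm x <= r'" "r + r' < T" "0 <= T"
  shows "\<exists>s. \<forall>i d. cRot (%x. symm (k1T T \<eta> \<Phi> x)) x $ i $ d = \<Phi> x $ i $ d -
    (Iop T 0 (mom d \<eta>) (%x. cDiv \<Phi> x $ i) x + (1/2) * (\<Sum>a\<in>UNIV. Iop T 0 (pd i (mom a (mom d \<eta>))) (%x. cDiv \<Phi> x $ a) x)) +
    (if d = i then s else 0)"
proof -
  note \<eta> = kernel_tf[OF k]
  note t = tf_nth[OF tf_nth[OF \<Phi>]]
  define W where "W i j y = cross j (%a b. Iop T 0 (mom a \<eta>) (%x. \<Phi> x $ i $ b) y)" for i j y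
  define v where "v i y = cross i (%a b. \<Sum>c\<in>UNIV. Iop T 1 (mom c (mom a \<eta>)) (%x. \<Phi> x $ c $ b) y)" for i y
  have tW: "tf (W i j)" for i j unfolding W_def[abs_def] by (intro tf_cross Iop_tf(1) tf_mom \<eta> t)
  have tv: "tf (v i)" for i unfolding v_def[abs_def] by (intro tf_cross tf_sum Iop_tf(1) tf_mom \<eta> t)
  have dW: "pd e (W i j) y = cross j (%a b. Iop T 0 (mom a \<eta>) (pd e (%x. \<Phi> x $ i $ b)) y)" for e i j y
    unfolding W_def[abs_def] by (simp add: pd_cross Iop_smooth Iop_pd tf_mom \<eta> t)
  have dv: "pd e (v i) = (%y. cross i (%a b. \<Sum>c\<in>UNIV. Iop T 1 (mom c (mom a \<eta>)) (pd e (%x. \<Phi> x $ c $ b)) y))" for e i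
    unfolding v_def[abs_def] by (rule ext) (simp add: pd_cross smooth_sum pd_sum Iop_smooth Iop_pd tf_mom \<eta> t)
  have ddv: "pd f (pd e (v i)) y = cross i (%a b. \<Sum>c\<in>UNIV. Iop T 1 (mom c (mom a \<eta>)) (pd f (pd e (%x. \<Phi> x $ c $ b))) y)" for e f i y
    unfolding dv by (simp add: pd_cross smooth_sum pd_sum Iop_smooth Iop_pd tf_mom \<eta> t tf_pd)
  have k1: "k1T T \<eta> \<Phi> y $ i $ j = - (W i j y + pd j (v i) y)" for i j y
    using Iop_rule2[OF tf_mom[OF tf_mom[OF \<eta>]] t, of T 0] by (simp add: k1T_def W_def dv)
  have sk: "(%y. symm (k1T T \<eta> \<Phi> y) $ i $ j) = (%y. - (W i j y + W j i y + pd j (v i) y + pd i (v j) y) / 2)" for i j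
    by (auto simp: symm_nth k1)
  have R: "cRot (%x. symm (k1T T \<eta> \<Phi> x)) x $ i $ d = - (1/2) *
    (cross d (%e j. pd e (W i j) x) + cross d (%e j. pd e (W j i) x) + cross d (%e j. pd e (pd j (v i)) x) + cross d (%e j. pd e (pd i (v j)) x))" for i d
  proof -
    have "pd e (%y. - (W i j y + W j i y + pd j (v i) y + pd i (v j) y) / 2) x =
      - (pd e (W i j) x + pd e (W j i) x + pd e (pd j (v i)) x + pd e (pd i (v j)) x) / 2" for e j
      by (simp only: pd_neg_half pd_add smooth_differentiable smooth_add tf_smooth tW tf_pd tv)
    then show ?thesis by (simp only: cRot_nth sk) (simp add: cross_def field_simps)
  qed
  have s: "tsupp (%x. \<Phi> x $ i $ j) \<subseteq> cball 0 r" "tsupp (pd l (%x. \<Phi> x $ i $ j)) \<subseteq> cball 0 r" for i j l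
    using tsupp_entry[of \<Phi> i j] tsupp_pd[of l "%x. \<Phi> x $ i $ j"] b(1) by blast+
  note r1 = radial(1)[OF k t s(1) b(2-4)] and r2 = radial(2)[OF k tf_pd[OF t] s(2) b(2-4)]
  note dv0 = Iop_div0[OF tf_mom[OF \<eta>] \<Phi>]
  define g where "g i = (%x. cDiv \<Phi> x $ i)" for i
  have a: "cross d (%e j. pd e (W i j) x) = Iop T 0 (mom d \<eta>) (g i) x - \<Phi> x $ i $ d" for i d
    unfolding dW cross_cross r1 dv0 g_def ..
  \<comment> \<open>Vanishing trace removes the gradient of the trace that
    \<open>cross_cross2\<close> produces.\<close>
  have trd: "(\<Sum>j\<in>UNIV. Iop T 0 (mom d \<eta>) (pd i (%x. \<Phi> x $ j $ j)) x) = 0" for i d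
  proof -
    have "(%y. \<Sum>j\<in>UNIV. pd i (%x. \<Phi> x $ j $ j) y) = (%y. pd i (%x. \<Sum>j\<in>UNIV. \<Phi> x $ j $ j) y)"
      by (simp add: pd_sum tf_smooth t)
    also have "\<dots> = (%y. 0)" using tr by (simp add: trace_def pd_const)
    finally have "(%y. \<Sum>j\<in>UNIV. pd i (%x. \<Phi> x $ j $ j) y) = (%y. 0)" .
    then show ?thesis using Iop_sum[OF tf_mom[OF \<eta>], of UNIV "%j. pd i (%x. \<Phi> x $ j $ j)" T 0 d] by (simp add: tf_pd t Iop_zero fun_eq_iff)
  qed
  \<comment> \<open>The coefficient of \<delta>_di in \<open>cross_cross2\<close>; its value is
    never computed.\<close>
  define s0 where "s0 = (\<Sum>e\<in>UNIV. \<Sum>j\<in>UNIV. Iop T 0 (mom e \<eta>) (pd e (%x. \<Phi> x $ j $ j)) x - Iop T 0 (mom j \<eta>) (pd e (%x. \<Phi> x $ j $ e)) x)"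
  have b': "cross d (%e j. pd e (W j i) x) = (if d = i then s0 else 0) + Iop T 0 (mom d \<eta>) (g i) x
      + (\<Sum>j\<in>UNIV. Iop T 0 (mom j \<eta>) (pd i (%x. \<Phi> x $ j $ d)) x) - \<Phi> x $ i $ d" for i d
    unfolding dW cross_cross2 s0_def[symmetric] unfolding sum_subtractf trd dv0 r1 by (simp add: g_def)
  have c: "cross d (%e j. pd e (pd j (v i)) x) = 0" for i d by (rule cross_sym) (simp add: pd_commute[OF tv])
  have gi: "(\<Sum>e\<in>UNIV. Iop T 1 \<kappa> (pd e (pd i (%x. \<Phi> x $ c $ e))) x) = Iop T 1 \<kappa> (pd i (g c)) x" if "tf \<kappa>" for \<kappa> i c
  proof -
    have "pd i (g c) = (%y. \<Sum>e\<in>UNIV. pd e (pd i (%x. \<Phi> x $ c $ e)) y)"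
      by (rule ext) (simp add: g_def cDiv_nth pd_sum smooth_pd tf_smooth t pd_commute[OF t, of i])
    then show ?thesis by (simp add: Iop_sum that tf_pd t)
  qed
  have d: "cross d (%e j. pd e (pd i (v j)) x) = (\<Sum>c\<in>UNIV. Iop T 1 (mom c (mom d \<eta>)) (pd i (g c)) x)
      - (\<Sum>c\<in>UNIV. Iop T 0 (mom c \<eta>) (pd i (%x. \<Phi> x $ c $ d)) x)" for i d
    unfolding ddv cross_cross
    by (subst (1 2) sum.swap) (simp only: gi[OF tf_mom[OF tf_mom[OF \<eta>]]] r2)
  have "tf (g c)" for c unfolding g_def by (intro tf_nth tf_cDiv \<Phi>)
  then have "Iop T 1 (mom c (mom d \<eta>)) (pd i (g c)) x = Iop T 0 (pd i (mom c (mom d \<eta>))) (g c) x" for c d i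
    using Iop_rule2[OF tf_mom[OF tf_mom[OF \<eta>]], of "g c" T 0 c d i] by simp
  then show ?thesis
    by (intro exI[of _ "- s0 / 2"] allI) (simp add: R a b' c d g_def algebra_simps)
qed

text \<open>The row-wise ray integral alone inverts Div, but removing its trace adds a gradient. A
  correction with coefficient c adds c times that gradient to the divergence, and the trace part
  subtracts (1 + c)/3 times it; c = 1/2 balances the two.\<close>

lemma Div_k0T:
  assumes k: "kernel \<eta>" and \<psi>: "tf \<psi>" and b: "tsupp \<psi> \<subseteq> cball 0 r" "norm x <= r'" "r + r' < T" "0 <= T"
  shows "- cDiv (k0T T \<eta> \<psi>) x = \<psi> x"
proof -
  note \<eta> = kernel_tf[OF k]
  note t = tf_nth[OF \<psi>]
  define N where "N i j y = Iop T 0 (mom j \<eta>) (%x. \<psi> x $ i) y + (1/2) * (\<Sum>a\<in>UNIV. Iop T 1 (mom a (mom j \<eta>)) (pd i (%x. \<psi> x $ a)) y)" for i j y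
  have sI: "smooth (%y. \<Sum>a\<in>UNIV. Iop T 1 (mom a (mom j \<eta>)) (pd i (%x. \<psi> x $ a)) y)" for i j
    by (intro smooth_sum Iop_smooth tf_mom \<eta> tf_pd t)
  have sN: "smooth (N i j)" for i j
    unfolding N_def[abs_def] by (intro smooth_add smooth_mult smooth_const sI Iop_smooth tf_mom \<eta> t)
  have dN: "pd e (N i j) y = Iop T 0 (mom j \<eta>) (pd e (%x. \<psi> x $ i)) y + (1/2) * (\<Sum>a\<in>UNIV. Iop T 1 (mom a (mom j \<eta>)) (pd e (pd i (%x. \<psi> x $ a))) y)" for e i j y
    unfolding N_def[abs_def]
    by (subst pd_add) (simp_all add: smooth_differentiable smooth_mult smooth_const sI Iop_smooth tf_mom \<eta> t pd_cmult pd_sum Iop_pd tf_pd del: times_divide_eq_left One_nat_def)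
  have k0: "(%y. k0T T \<eta> \<psi> y $ i $ j) = (%y. - (N i j y - (1/3) * (if i = j then N 1 1 y + N 2 2 y + N 3 3 y else 0)))" for i j
    using Iop_rule2[OF tf_mom[OF tf_mom[OF \<eta>]] t, of T 0] by (auto simp: k0T_def dev_nth N_def)
  have s: "tsupp (%x. \<psi> x $ i) \<subseteq> cball 0 r" "tsupp (pd l (%x. \<psi> x $ i)) \<subseteq> cball 0 r" for i l
    using tsupp_nth[of \<psi> i] tsupp_pd[of l "%x. \<psi> x $ i"] b(1) by blast+
  note r1 = radial(1)[OF k t s(1) b(2-4)] and r2 = radial(2)[OF k tf_pd[OF t] s(2) b(2-4)]
  have dd: "pd j (k0e) x = - (pd j (N i j) x - (1/3) * (if i = j then pd i (N 1 1) x + pd i (N 2 2) x + pd i (N 3 3) x else 0))"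
    if "k0e = (%y. k0T T \<eta> \<psi> y $ i $ j)" for i j k0e
    unfolding that k0
    by (cases "i = j") (simp_all add: pd_uminus pd_diff pd_cmult pd_add smooth_differentiable sN smooth_add smooth_diff smooth_mult smooth_const del: times_divide_eq_left)
  have A: "(\<Sum>j\<in>UNIV. pd j (N i j) x) = \<psi> x $ i + (1/2) * (\<Sum>a\<in>UNIV. Iop T 0 (mom a \<eta>) (pd i (%x. \<psi> x $ a)) x)" for i
  proof -
    have "(\<Sum>j\<in>UNIV. \<Sum>a\<in>UNIV. Iop T 1 (mom a (mom j \<eta>)) (pd j (pd i (%x. \<psi> x $ a))) x) = (\<Sum>a\<in>UNIV. Iop T 0 (mom a \<eta>) (pd i (%x. \<psi> x $ a)) x)"
      by (subst sum.swap) (simp only: r2)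
    then show ?thesis unfolding dN sum.distrib r1 by (simp flip: sum_distrib_left sum_divide_distrib)
  qed
  have B: "(\<Sum>j\<in>UNIV. pd i (N j j) x) = (3/2) * (\<Sum>a\<in>UNIV. Iop T 0 (mom a \<eta>) (pd i (%x. \<psi> x $ a)) x)" for i
  proof -
    have "(\<Sum>j\<in>UNIV. \<Sum>a\<in>UNIV. Iop T 1 (mom a (mom j \<eta>)) (pd i (pd j (%x. \<psi> x $ a))) x) = (\<Sum>a\<in>UNIV. Iop T 0 (mom a \<eta>) (pd i (%x. \<psi> x $ a)) x)"
      by (subst sum.swap, subst pd_commute[OF t]) (simp only: r2)
    then show ?thesis unfolding dN sum.distrib by (simp flip: sum_distrib_left sum_divide_distrib)
  qed
  have "(- cDiv (k0T T \<eta> \<psi>) x) $ i = (\<Sum>j\<in>UNIV. pd j (N i j) x) - (1/3) * (\<Sum>j\<in>UNIV. pd i (N j j) x)" for i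
    using exhaust_3[of i] unfolding vector_uminus_component cDiv_nth dd[OF refl] by (auto simp: sum_3)
  then show ?thesis by (simp add: vec_eq_iff A B)
qed

lemma Div_commutator:
  "smooth f ==> smooth \<Phi> ==> - cDiv (%x. f x *\<^sub>R \<Phi> x) x - f x *\<^sub>R (- cDiv \<Phi> x) = (\<chi> i. - (\<Sum>j\<in>UNIV. pd j f x * \<Phi> x $ i $ j))"
  by (simp add: vec_eq_iff cDiv_nth pd_mult smooth_nth sum.distrib sum_distrib_left)

lemma comm_nice_T:
  assumes \<eta>: "tf \<eta>" and T: "0 <= T" and f: "tf f"
  shows "nice (rays T (tsupp \<eta>)) (%\<Phi>. k0T T \<eta> (%x. - cDiv (%x. f x *\<^sub>R \<Phi> x) x - f x *\<^sub>R (- cDiv \<Phi> x)))"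
proof (rule nice_cong)
  let ?k = "%\<Phi> x. - dev (\<chi> i j. - (\<Sum>l\<in>UNIV. Iop T 0 (mom j \<eta>) (%x. pd l f x * \<Phi> x $ i $ l) x) +
     (1/2) * (\<Sum>a\<in>UNIV. - (\<Sum>l\<in>UNIV. Iop T 0 (pd i (mom a (mom j \<eta>))) (%x. pd l f x * \<Phi> x $ a $ l) x)))"
  show "nice (rays T (tsupp \<eta>)) ?k"
    by (intro nice_post[OF _ linear_minus_dev] nice_mat nice_sum nice_uminus nice_cmult nice_add nice_entry nice_Iop_sub multiplier_tf tf_pd f tf_mom \<eta> T mom_sub tsupp_mom)
  fix \<Phi> :: "R3 => M3" assume \<Phi>: "tf \<Phi>"
  have t: "tf (%x. pd l f x * \<Phi> x $ i $ j)" for l i j by (intro tf_mult1 tf_pd f smooth_nth tf_smooth \<Phi>)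
  show "k0T T \<eta> (%x. - cDiv (%x. f x *\<^sub>R \<Phi> x) x - f x *\<^sub>R (- cDiv \<Phi> x)) = ?k \<Phi>"
    by (rule ext) (simp only: k0T_def Div_commutator[OF tf_smooth[OF f] tf_smooth[OF \<Phi>]] vec_lambda_beta Iop_uminus Iop_sum[OF tf_mom[OF \<eta>] t]
      Iop_sum[OF tf_pd[OF tf_mom[OF tf_mom[OF \<eta>]]] t])
qed

text \<open>R is the operator against which symRot is tested: pairing symRot T with \<Psi> is
  pairing T with Rot of the symmetric part of \<Psi>. The sign in D is compensated in
  \<open>k0T\<close>.\<close>

interpretation DevDiv: homotopy dev "%\<Psi>. cRot (%x. symm (\<Psi> x))" "%j A. curl_sym j (symm A)" "%\<Phi> x. - cDiv \<Phi> x" k0T k1T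
proof (rule homotopy.intro)
  fix \<eta> f :: "R3 => real" and T r r' and \<Phi> :: "R3 => M3" and x :: R3
  show "kernel \<eta> ==> 0 <= T ==> nice (rays T (tsupp \<eta>)) (k0T T \<eta>)" "kernel \<eta> ==> 0 <= T ==> nice (rays T (tsupp \<eta>)) (k1T T \<eta>)"
    by (intro nice_k0T nice_k1T kernel_tf; assumption)+
  show "kernel \<eta> ==> 0 <= T ==> tf f ==> nice (rays T (tsupp \<eta>)) (%\<Phi>. k0T T \<eta> (%x. - cDiv (%x. f x *\<^sub>R \<Phi> x) x - f x *\<^sub>R (- cDiv \<Phi> x)))"
    by (rule comm_nice_T[OF kernel_tf])
  have sb: "bounded_linear symm" using linear_symm linear_conv_bounded_linear by blast
  show "smooth \<Phi> ==> cRot (%x. symm (\<Phi> x)) = (%x. \<Sum>j\<in>UNIV. curl_sym j (symm (pd j \<Phi> x)))"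
    by (simp add: fun_eq_iff cRot_eq smooth_linear[OF sb] pd_linear[OF smooth_differentiable sb])
  show "linear (%A. curl_sym j (symm A))" for j using linear_compose[OF linear_symm linear_curl_sym] by (simp add: o_def)
  assume a: "kernel \<eta>" "tf \<Phi>" "!!x. dev (\<Phi> x) = \<Phi> x" "tsupp \<Phi> \<subseteq> cball 0 r" "norm x <= r'" "r + r' < T" "0 <= T"
  have "trace (\<Phi> x) = 0" for x by (metis a(3) trace_dev)
  from rot_symm_k1T[OF a(1,2) this a(4-7)] obtain s where s: "\<forall>i d. cRot (%x. symm (k1T T \<eta> \<Phi> x)) x $ i $ d = \<Phi> x $ i $ d -
    (Iop T 0 (mom d \<eta>) (%x. cDiv \<Phi> x $ i) x + (1/2) * (\<Sum>a\<in>UNIV. Iop T 0 (pd i (mom a (mom d \<eta>))) (%x. cDiv \<Phi> x $ a) x)) +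
    (if d = i then s else 0)" by (elim exE)
  let ?N = "\<chi> i d. Iop T 0 (mom d \<eta>) (%x. cDiv \<Phi> x $ i) x + (1/2) * (\<Sum>a\<in>UNIV. Iop T 0 (pd i (mom a (mom d \<eta>))) (%x. cDiv \<Phi> x $ a) x)"
  have R: "cRot (%x. symm (k1T T \<eta> \<Phi> x)) x = \<Phi> x - ?N + s *\<^sub>R mat 1" using s by (auto simp: vec_eq_iff mat_def)
  have "(\<chi> i j. Iop T 0 (mom j \<eta>) (%x. (- cDiv \<Phi> x) $ i) x + (1/2) * (\<Sum>a\<in>UNIV. Iop T 0 (pd i (mom a (mom j \<eta>))) (%x. (- cDiv \<Phi> x) $ a) x)) = - ?N"
    by (simp add: vec_eq_iff Iop_uminus sum_negf)
  then have K: "k0T T \<eta> (%x. - cDiv \<Phi> x) x = dev ?N" unfolding k0T_def by (simp only: linear_neg[OF linear_dev] minus_minus)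
  have "dev (mat 1) = 0" by (simp add: dev_def trace_3 mat_def)
  then show "dev (k0T T \<eta> (%x. - cDiv \<Phi> x) x + cRot (%x. symm (k1T T \<eta> \<Phi> x)) x) = \<Phi> x"
    unfolding K R by (simp only: linear_add[OF linear_dev] linear_diff[OF linear_dev] linear_scale[OF linear_dev] dev_idem a(3)) simp
next
  fix \<eta> :: "R3 => real" and T and \<psi> :: "R3 => R3" and x :: R3
  show "dev (k0T T \<eta> \<psi> x) = k0T T \<eta> \<psi> x" by (simp add: k0T_def linear_neg[OF linear_dev] dev_idem)
next
  fix U :: "R3 set" and x and \<Phi> \<Phi>' :: "R3 => M3"
  assume "open U" "x \<in> U" "!!y. y \<in> U ==> \<Phi> y = \<Phi>' y"
  then show "- cDiv \<Phi> x = - cDiv \<Phi>' x" using cDiv_local[of U x \<Phi> \<Phi>'] by simp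
next
  fix \<eta> :: "R3 => real" and \<psi> :: "R3 => R3" and r r' T :: real and x :: R3
  assume "kernel \<eta>" "tf \<psi>" "tsupp \<psi> \<subseteq> cball 0 r" "norm x <= r'" "r + r' < T" "0 <= T"
  then show "- cDiv (k0T T \<eta> \<psi>) x = \<psi> x" by (rule Div_k0T)
qed (simp_all add: linear_dev dev_inner dev_idem smooth_uminus smooth_cDiv, simp add: vec_eq_iff cDiv_nth pd_const)

section \<open>Lipschitz charts\<close>

text \<open>A normalised bump around v; with norm of v at least 2 and radius at most 1 its support
  avoids the open unit ball.\<close>

lemma kernel_exists:
  assumes v: "2 <= norm v" and d: "0 < \<delta>" "\<delta> <= 1"
  obtains \<eta> where "kernel \<eta>" "tsupp \<eta> \<subseteq> cball v \<delta>"
proof -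
  have r: "0 < \<delta> / 2" "\<delta> / 2 < \<delta>" using d by auto
  obtain f :: "R3 => real" where f: "smooth f" "!!x. x \<in> cball v (\<delta>/2) ==> f x = 1" "!!x. x \<notin> ball v \<delta> ==> f x = 0"
    "!!x. 0 <= f x" "!!x. f x <= 1" "!!x. x \<in> ball v \<delta> ==> f x > 0"
    by (rule smooth_bump[OF r, of v]) blast
  have s: "tsupp f \<subseteq> cball v \<delta>" by (rule tsupp_subset) (auto intro: f(3))
  have t: "tf f" by (rule tfI[OF f(1) compact_cball[of v \<delta>]]) (auto intro: f(3))
  have i: "integrable lborel f" by (rule tf_integrable[OF t])
  have "(\<integral>x. indicator (cball v (\<delta>/2)) x \<partial>lborel) <= (\<integral>x. f x \<partial>lborel)"
  proof (rule integral_mono[OF _ i])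
    show "integrable lborel (indicator (cball v (\<delta>/2)) :: R3 => real)" by (rule integrable_real_indicator) auto
  qed (use f(2,4) in \<open>auto simp: indicator_def\<close>)
  then have "measure lborel (cball v (\<delta>/2)) <= (\<integral>x. f x \<partial>lborel)" by simp
  moreover have "0 < measure lborel (cball v (\<delta>/2))" by (rule content_cball_pos) (use d in simp)
  ultimately have pos: "0 < (\<integral>x. f x \<partial>lborel)" by linarith
  define \<eta> where "\<eta> x = f x * inverse (\<integral>x. f x \<partial>lborel)" for x
  have "tf \<eta>" unfolding \<eta>_def[abs_def] by (intro tf_mult1 t smooth_const)
  moreover have s': "tsupp \<eta> \<subseteq> cball v \<delta>" by (rule tsupp_subset) (auto simp: \<eta>_def f(3))
  moreover have "(\<integral>x. \<eta> x \<partial>lborel) = 1" using pos by (simp add: \<eta>_def)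
  moreover have "1 <= norm k" if "k \<in> tsupp \<eta>" for k
  proof -
    have "dist v k <= \<delta>" using s' that by auto
    then show ?thesis using v d norm_triangle_ineq2[of v k] by (simp add: dist_norm)
  qed
  ultimately have "kernel \<eta>" by (simp add: kernel_def)
  then show ?thesis using s' by (rule that)
qed

text \<open>The geometry consumed by \<open>local_decomposition\<close>. Inside V, Ut consists, up
  to a null set, of points of \<Omega> and of the piece B of the exterior reached across \<Sigma>;
  on B the zero extension vanishes. Frontier points not in Ut belong to the closure of \<Sigma>',
  near which the fields paired with the sequence vanish.\<close>

definition patch :: "R3 set => R3 set => R3 set => R3 set => bool" where
  "patch \<Omega> \<Sigma> \<Sigma>' V \<longleftrightarrow> open V & (\<exists>Ut B em ep. open Ut & open B & B \<subseteq> Ut & kernel em & kernel ep \<and>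
     (\<forall>y\<in>Ut. \<forall>t\<ge>0. \<forall>k\<in>tsupp em. y + t *\<^sub>R k \<in> Ut) & (\<forall>y\<in>B. \<forall>t\<ge>0. \<forall>k\<in>tsupp ep. y + t *\<^sub>R k \<in> B) \<and>
     \<Omega> \<inter> V \<subseteq> Ut & \<Omega> \<inter> B \<inter> V = {} & (AE y in lborel. y \<in> Ut \<inter> V --> y \<in> \<Omega> | y \<in> B) \<and>
     frontier \<Omega> \<inter> V \<inter> Ut \<subseteq> \<Sigma> & frontier \<Omega> \<inter> V - Ut \<subseteq> closure \<Sigma>')"

text \<open>No exterior has to be respected here: Ut is the whole space and B is empty, so every
  kernel preserves both.\<close>

lemma patch_interior: assumes "open \<Omega>" shows "patch \<Omega> \<Sigma> \<Sigma>' \<Omega>"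
proof -
  obtain \<eta> where \<eta>: "kernel \<eta>" using kernel_exists[of "2 *\<^sub>R axis 1 1" 1] by (auto simp: norm_axis_1)
  have "frontier \<Omega> \<inter> \<Omega> = {}" using assms by (simp add: frontier_disjoint_eq)
  then show ?thesis unfolding patch_def
    by (intro conjI exI[of _ UNIV] exI[of _ "{}"] exI[of _ \<eta>] assms) (auto simp: \<eta>)
qed

section \<open>Geometry of a single chart\<close>

context
  fixes \<Omega> U :: "R3 set" and x0 Q h
  assumes op: "open \<Omega>" and chart: "lipschitz_chart \<Omega> x0 U Q h"
begin

abbreviation "z y \<equiv> Q (y - x0)"

lemma Q: "orthogonal_transformation Q" and U: "open U" "x0 \<in> U"
  and \<Omega>U: "y \<in> U ==> y \<in> \<Omega> \<longleftrightarrow> z y $ 3 < h (z y $ 1, z y $ 2)"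
  using chart by (auto simp: lipschitz_chart_def)

lemma Qlin: "linear Q" using Q by (simp add: orthogonal_transformation_def)

lemma Qinv: "Q (inv Q a) = a" "norm (inv Q a) = norm a" "linear (inv Q)"
  using Q orthogonal_transformation_inv[OF Q] orthogonal_transformation_surj[OF Q]
  by (auto simp: surj_f_inv_f orthogonal_transformation_norm orthogonal_transformation_def)

lemma z_move: "z (y + t *\<^sub>R inv Q a) = z y + t *\<^sub>R a"
proof -
  have "y + t *\<^sub>R inv Q a - x0 = (y - x0) + t *\<^sub>R inv Q a" by simp
  then show ?thesis by (simp only: linear_add[OF Qlin] linear_scale[OF Qlin] Qinv)
qed

lemma z_cont: "continuous_on S z"
  using linear_continuous_on_compose[OF _ Qlin, of S "%y. y - x0"] by (simp add: continuous_intros)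

lemma h_lip: obtains C where "C >= 0" "!!a b c d. \<bar>h (a, b) - h (c, d)\<bar> <= C * (\<bar>a - c\<bar> + \<bar>b - d\<bar>)"
proof -
  obtain C where C: "C-lipschitz_on UNIV h" using chart by (auto simp: lipschitz_chart_def)
  have "\<bar>h (a, b) - h (c, d)\<bar> <= C * (\<bar>a - c\<bar> + \<bar>b - d\<bar>)" for a b c d
  proof -
    have "dist (h (a, b)) (h (c, d)) <= C * dist (a, b) (c, d)" using C by (auto simp: lipschitz_on_def)
    also have "\<dots> <= C * (\<bar>a - c\<bar> + \<bar>b - d\<bar>)"
      using C sqrt_sum_squares_le_sum_abs[of "a - c" "b - d"] by (intro mult_left_mono) (auto simp: dist_Pair_Pair dist_real_def lipschitz_on_def)
    finally show ?thesis by (simp add: dist_real_def)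
  qed
  then show ?thesis using C by (intro that[of C]) (auto simp: lipschitz_on_def)
qed

lemma h_cont: "continuous_on S (%y. h (z y $ 1, z y $ 2))"
proof -
  have "continuous_on UNIV h" using chart by (auto simp: lipschitz_chart_def intro: lipschitz_on_continuous_on)
  then show ?thesis by (rule continuous_on_compose2) (auto intro!: continuous_intros z_cont)
qed

lemma open_below: "open {y. z y $ 3 < h (z y $ 1, z y $ 2)}" and open_above: "open {y. z y $ 3 > h (z y $ 1, z y $ 2)}"
  by (intro open_Collect_less continuous_intros z_cont h_cont)+

text \<open>Points above the graph have a neighbourhood off \<Omega>; a point on the graph is the
  limit of its downward shifts, which lie in \<Omega>.\<close>

lemma frontier_chart: "y \<in> U ==> y \<in> frontier \<Omega> \<longleftrightarrow> z y $ 3 = h (z y $ 1, z y $ 2)"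
proof
  assume y: "y \<in> U" "y \<in> frontier \<Omega>"
  then have "y \<notin> \<Omega>" using op by (simp add: frontier_def interior_open)
  then have "\<not> z y $ 3 < h (z y $ 1, z y $ 2)" using \<Omega>U y by blast
  moreover have "\<not> z y $ 3 > h (z y $ 1, z y $ 2)"
  proof
    assume "z y $ 3 > h (z y $ 1, z y $ 2)"
    then have "y \<in> U \<inter> {y. z y $ 3 > h (z y $ 1, z y $ 2)}" using y by simp
    moreover have "open (U \<inter> {y. z y $ 3 > h (z y $ 1, z y $ 2)})" using U open_above by blast
    moreover have "y \<in> closure \<Omega>" using y by (simp add: frontier_def)
    moreover have "U \<inter> {y. z y $ 3 > h (z y $ 1, z y $ 2)} \<inter> \<Omega> = {}" using \<Omega>U by fastforce
    ultimately show False using open_Int_closure_eq_empty by blast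
  qed
  ultimately show "z y $ 3 = h (z y $ 1, z y $ 2)" by linarith
next
  assume y: "y \<in> U" "z y $ 3 = h (z y $ 1, z y $ 2)"
  let ?p = "%t. y + t *\<^sub>R inv Q (vector [0, 0, -1])"
  have "(?p \<longlongrightarrow> y + 0 *\<^sub>R inv Q (vector [0, 0, -1])) (at_right 0)" by (intro tendsto_intros)
  then have p: "(?p \<longlongrightarrow> y) (at_right 0)" by simp
  have "\<forall>\<^sub>F t in at_right 0. ?p t \<in> U" using topological_tendstoD[OF p U(1) y(1)] .
  then have "\<forall>\<^sub>F t in at_right 0. ?p t \<in> \<Omega>"
    using eventually_at_right_less[of "0::real"] by eventually_elim (simp add: \<Omega>U z_move y)
  then have "\<forall>\<^sub>F t in at_right 0. ?p t \<in> closure \<Omega>" by eventually_elim (use closure_subset in blast)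
  then have "y \<in> closure \<Omega>" by (rule Lim_in_closed_set[OF closed_closure _ _ p]) simp
  moreover have "y \<notin> \<Omega>" using \<Omega>U y by simp
  ultimately show "y \<in> frontier \<Omega>" using op by (simp add: frontier_def interior_open)
qed

text \<open>The graph is the image of a coordinate plane under a Lipschitz map.\<close>

lemma graph_null: "AE y in lborel. z y $ 3 ~= h (z y $ 1, z y $ 2)"
proof -
  obtain C where C: "C >= 0" "!!a b c d. \<bar>h (a, b) - h (c, d)\<bar> <= C * (\<bar>a - c\<bar> + \<bar>b - d\<bar>)" using h_lip by blast
  let ?f = "%v. x0 + inv Q (v + h (v $ 1, v $ 2) *\<^sub>R axis 3 1)"
  have "negligible (?f ` {v. v $ 3 = 0})"
  proof (rule negligible_locally_Lipschitz_image)
    show "negligible {v :: R3. v $ 3 = 0}"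
      using negligible_standard_hyperplane_cart[of 3] by simp
    fix v :: R3
    have "norm (?f w - ?f v) <= (1 + 2 * C) * norm (w - v)" for w
    proof -
      have "?f w - ?f v = inv Q ((w - v) + (h (w $ 1, w $ 2) - h (v $ 1, v $ 2)) *\<^sub>R axis 3 1)"
        by (simp add: linear_diff[OF Qinv(3), symmetric] algebra_simps)
      then have "norm (?f w - ?f v) <= norm (w - v) + \<bar>h (w $ 1, w $ 2) - h (v $ 1, v $ 2)\<bar>"
        using norm_triangle_ineq[of "w - v" "(h (w $ 1, w $ 2) - h (v $ 1, v $ 2)) *\<^sub>R axis 3 1"] by (simp add: Qinv norm_axis_1)
      also have "\<bar>h (w $ 1, w $ 2) - h (v $ 1, v $ 2)\<bar> <= C * (norm (w - v) + norm (w - v))"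
        by (rule order_trans[OF C(2) mult_left_mono[OF add_mono C(1)]])
          (use component_le_norm_cart[of "w - v" 1] component_le_norm_cart[of "w - v" 2] in simp_all)
      finally show ?thesis by (simp add: algebra_simps)
    qed
    then show "\<exists>T B. open T & v \<in> T & (\<forall>y\<in>{v. v $ 3 = 0} \<inter> T. norm (?f y - ?f v) <= B * norm (y - v))"
      by (intro exI[of _ UNIV] exI[of _ "1 + 2 * C"]) auto
  qed simp
  moreover have "{y. z y $ 3 = h (z y $ 1, z y $ 2)} \<subseteq> ?f ` {v. v $ 3 = 0}"
  proof
    fix y assume y: "y \<in> {y. z y $ 3 = h (z y $ 1, z y $ 2)}"
    let ?v = "z y - (z y $ 3) *\<^sub>R axis 3 1"
    have v: "?v $ 1 = z y $ 1" "?v $ 2 = z y $ 2" "?v $ 3 = 0" by (simp_all add: axis_def)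
    have "inv Q (Q (y - x0)) = y - x0" using orthogonal_transformation_inj[OF Q] by simp
    moreover have "?v + h (?v $ 1, ?v $ 2) *\<^sub>R axis 3 1 = z y" unfolding v using y by simp
    ultimately have "?f ?v = y" by simp
    then show "y \<in> ?f ` {v. v $ 3 = 0}" using v(3) by (metis (mono_tags, lifting) imageI mem_Collect_eq)
  qed
  ultimately have "negligible {y. z y $ 3 = h (z y $ 1, z y $ 2)}" by (rule negligible_subset)
  moreover have "{y. z y $ 3 = h (z y $ 1, z y $ 2)} \<in> sets borel"
    by (intro borel_closed closed_Collect_eq continuous_intros z_cont h_cont)
  ultimately have "{y. z y $ 3 = h (z y $ 1, z y $ 2)} \<in> null_sets lborel"
    by (simp add: negligible_iff_null_sets null_sets_completion_iff)
  then show ?thesis by (rule AE_I'[of _ lborel]) auto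
qed

text \<open>The directions point out of the graph of \<open>h\<close> and away from the part of the boundary on which \<open>W\<close> ends; the
  vertical component dominates the Lipschitz constant of \<open>h\<close>.\<close>

lemma patch_chart:
  assumes W: "open W" and d: "0 < \<delta>" "\<delta> <= 1 / 2" and s: "\<bar>\<sigma>\<bar> = 1"
    and Ws: "!!y t a. y \<in> W ==> 0 <= t ==> \<bar>a $ 1\<bar> <= \<delta> ==> \<bar>a $ 2 + \<sigma>\<bar> <= \<delta> ==> y + t *\<^sub>R inv Q a \<in> W"
    and b: "!!y. y \<in> frontier \<Omega> ==> y \<in> U ==> y \<in> W ==> y \<in> \<Sigma>"
      "!!y. y \<in> frontier \<Omega> ==> y \<in> U ==> y \<notin> W ==> y \<in> closure \<Sigma>'"
  shows "patch \<Omega> \<Sigma> \<Sigma>' U"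
proof -
  obtain C where C: "C >= 0" "!!a b c d. \<bar>h (a, b) - h (c, d)\<bar> <= C * (\<bar>a - c\<bar> + \<bar>b - d\<bar>)" using h_lip by blast
  \<comment> \<open>A direction of the cone has horizontal components of total size at most 2, so h
    varies by at most 2 C t along it, while the vertical move is at least (M - \<delta>) t. The
    summand 2 also gives both centres norm at least 2.\<close>
  define M where "M = 2 * C + 2"
  define vm vp where "vm = inv Q (vector [0, - \<sigma>, - M])" and "vp = inv Q (vector [0, - \<sigma>, M])"
  have "norm vm >= 2" "norm vp >= 2"
    using component_le_norm_cart[of "vector [0, - \<sigma>, - M] :: R3" 3] component_le_norm_cart[of "vector [0, - \<sigma>, M] :: R3" 3] C(1)
    by (simp_all add: vm_def vp_def Qinv M_def)
  note n = this
  have d1: "\<delta> <= 1" using d by linarith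
  obtain em where em0: "kernel em" "tsupp em \<subseteq> cball vm \<delta>" using kernel_exists[OF n(1) d(1) d1] by blast
  obtain ep where ep0: "kernel ep" "tsupp ep \<subseteq> cball vp \<delta>" using kernel_exists[OF n(2) d(1) d1] by blast
  note e = em0 ep0
  have near: "\<exists>a. k = inv Q a & (\<forall>i. \<bar>a $ i - w $ i\<bar> <= \<delta>)" if "k \<in> cball (inv Q w) \<delta>" for k w
  proof (intro exI[of _ "Q k"] conjI allI)
    show "k = inv Q (Q k)" using orthogonal_transformation_inj[OF Q] by simp
    fix i
    have "norm (Q k - w) = norm (inv Q (Q k - w))" by (simp add: Qinv)
    also have "inv Q (Q k - w) = k - inv Q w" using orthogonal_transformation_inj[OF Q] by (simp add: linear_diff[OF Qinv(3)])
    also have "norm \<dots> <= \<delta>" using that by (simp add: dist_norm norm_minus_commute)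
    finally show "\<bar>Q k $ i - w $ i\<bar> <= \<delta>" using component_le_norm_cart[of "Q k - w" i] by simp
  qed
  have hmove: "\<bar>h (c + t * a $ 1, d' + t * a $ 2) - h (c, d')\<bar> <= t * (2 * C)"
    if "0 <= t" "\<bar>a $ 1\<bar> <= \<delta>" "\<bar>a $ 2 + \<sigma>\<bar> <= \<delta>" for t c d' and a :: R3
  proof -
    have "\<bar>a $ 1\<bar> + \<bar>a $ 2\<bar> <= 2" using that d s by linarith
    then have "C * (t * (\<bar>a $ 1\<bar> + \<bar>a $ 2\<bar>)) <= C * (t * 2)" using C(1) that by (intro mult_left_mono) auto
    then show ?thesis using C(2)[of "c + t * a $ 1" "d' + t * a $ 2" c d'] that by (simp add: abs_mult algebra_simps)
  qed
  \<comment> \<open>The sets of the patch are Ut = ?lo \<union> W and B = ?hi \<inter> W: the domain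
    side, enlarged by the exterior only over W.\<close>
  let ?lo = "{y. z y $ 3 < h (z y $ 1, z y $ 2)}" and ?hi = "{y. z y $ 3 > h (z y $ 1, z y $ 2)}"
  have lo: "y + t *\<^sub>R inv Q a \<in> ?lo" if "y \<in> ?lo" "0 <= t" "\<bar>a $ 1\<bar> <= \<delta>" "\<bar>a $ 2 + \<sigma>\<bar> <= \<delta>" "\<bar>a $ 3 + M\<bar> <= \<delta>" for y t a
  proof -
    have "t * (a $ 3) <= t * (- (2 * C))" using that d by (intro mult_left_mono) (auto simp: M_def)
    then show ?thesis using that(1) hmove[OF that(2-4), of "z y $ 1" "z y $ 2"] by (simp add: z_move)
  qed
  have hi: "y + t *\<^sub>R inv Q a \<in> ?hi" if "y \<in> ?hi" "0 <= t" "\<bar>a $ 1\<bar> <= \<delta>" "\<bar>a $ 2 + \<sigma>\<bar> <= \<delta>" "\<bar>a $ 3 - M\<bar> <= \<delta>" for y t a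
  proof -
    have "t * (2 * C) <= t * (a $ 3)" using that d by (intro mult_left_mono) (auto simp: M_def)
    then show ?thesis using that(1) hmove[OF that(2-4), of "z y $ 1" "z y $ 2"] by (simp add: z_move)
  qed
  have em: "y + t *\<^sub>R k \<in> ?lo \<union> W" if "y \<in> ?lo \<union> W" "0 <= t" "k \<in> tsupp em" for y t k
  proof -
    have "k \<in> cball vm \<delta>" using e(2) that(3) by blast
    from near[OF this[unfolded vm_def]] obtain a where a: "k = inv Q a" "\<forall>i. \<bar>a $ i - vector [0, - \<sigma>, - M] $ i\<bar> <= \<delta>" by (elim exE conjE)
    then show ?thesis using lo[of y t a] Ws[of y t a] that a(2)[rule_format, of 1] a(2)[rule_format, of 2] a(2)[rule_format, of 3] by auto
  qed
  have ep: "y + t *\<^sub>R k \<in> ?hi \<inter> W" if "y \<in> ?hi \<inter> W" "0 <= t" "k \<in> tsupp ep" for y t k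
  proof -
    have "k \<in> cball vp \<delta>" using e(4) that(3) by blast
    from near[OF this[unfolded vp_def]] obtain a where a: "k = inv Q a" "\<forall>i. \<bar>a $ i - vector [0, - \<sigma>, M] $ i\<bar> <= \<delta>" by (elim exE conjE)
    then show ?thesis using hi[of y t a] Ws[of y t a] that a(2)[rule_format, of 1] a(2)[rule_format, of 2] a(2)[rule_format, of 3] by auto
  qed
  have ae: "AE y in lborel. y \<in> (?lo \<union> W) \<inter> U --> y \<in> \<Omega> | y \<in> ?hi \<inter> W"
    using graph_null by eventually_elim (auto simp: \<Omega>U)
  show ?thesis unfolding patch_def
    by (intro conjI exI[of _ "?lo \<union> W"] exI[of _ "?hi \<inter> W"] exI[of _ em] exI[of _ ep] U e ae ballI allI impI em ep open_Un open_Int W open_below open_above)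
      (use b in \<open>auto simp: \<Omega>U frontier_chart\<close>)
qed

text \<open>y is approached along the graph by moving the second coordinate and letting the third
  follow h. This covers the interface of the two boundary parts, whose points satisfy neither strict
  inequality for g.\<close>

lemma boundary_near:
  assumes y: "y \<in> U" "y \<in> frontier \<Omega>" and S: "!!w t. w \<in> U ==> w \<in> frontier \<Omega> ==> 0 < t ==> z w $ 1 = z y $ 1 ==> z w $ 2 = z y $ 2 + \<sigma> * t ==> w \<in> S"
  shows "y \<in> closure S"
proof -
  let ?p = "%t. y + 1 *\<^sub>R inv Q (vector [0, \<sigma> * t, h (z y $ 1, z y $ 2 + \<sigma> * t) - z y $ 3])"
  have z3: "z y $ 3 = h (z y $ 1, z y $ 2)" using y frontier_chart by blast
  have hc: "continuous_on UNIV h" using chart by (auto simp: lipschitz_chart_def intro: lipschitz_on_continuous_on)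
  have "((%t. z y $ 2 + \<sigma> * t) \<longlongrightarrow> z y $ 2 + \<sigma> * 0) (at_right 0)" "((%t. \<sigma> * t) \<longlongrightarrow> \<sigma> * 0) (at_right 0)" by (intro tendsto_intros)+
  then have l: "((%t. z y $ 2 + \<sigma> * t) \<longlongrightarrow> z y $ 2) (at_right 0)" "((%t. \<sigma> * t) \<longlongrightarrow> 0) (at_right 0)" by simp_all
  have "((%t. h (z y $ 1, z y $ 2 + \<sigma> * t)) \<longlongrightarrow> h (z y $ 1, z y $ 2 + \<sigma> * 0)) (at_right 0)"
    by (rule continuous_on_tendsto_compose[OF hc]) (simp_all, intro tendsto_Pair tendsto_const l)
  then have "((%t. h (z y $ 1, z y $ 2 + \<sigma> * t) - z y $ 3) \<longlongrightarrow> 0) (at_right 0)" using z3 by (auto simp: LIM_zero_iff)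
  note l3 = this
  have "((%t. vector [0, \<sigma> * t, h (z y $ 1, z y $ 2 + \<sigma> * t) - z y $ 3] :: R3) \<longlongrightarrow> 0) (at_right 0)"
  proof (rule vec_tendstoI)
    fix i show "((%t. (vector [0, \<sigma> * t, h (z y $ 1, z y $ 2 + \<sigma> * t) - z y $ 3] :: R3) $ i) \<longlongrightarrow> 0 $ i) (at_right 0)"
      using l(2) l3 exhaust_3[of i] by (elim disjE) simp_all
  qed
  note lv = this
  have "bounded_linear (inv Q)" using Qinv(3) by (simp add: linear_conv_bounded_linear)
  from bounded_linear.tendsto[OF this lv]
  have "(?p \<longlongrightarrow> y + 1 *\<^sub>R inv Q 0) (at_right 0)" by (intro tendsto_add tendsto_scaleR tendsto_const)
  then have p: "(?p \<longlongrightarrow> y) (at_right 0)" by (simp only: linear_0[OF Qinv(3)] scaleR_zero_right add_0_right)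
  have "\<forall>\<^sub>F t in at_right 0. ?p t \<in> U" using topological_tendstoD[OF p U(1) y(1)] .
  then have "\<forall>\<^sub>F t in at_right 0. ?p t \<in> closure S"
    using eventually_at_right_less[of "0::real"]
  proof eventually_elim
    case (elim t)
    have "?p t \<in> S" by (rule S[OF elim(1) _ elim(2)]) (simp_all add: frontier_chart elim(1) z_move del: scaleR_one)
    then show ?case using closure_subset by blast
  qed
  then show ?thesis by (rule Lim_in_closed_set[OF closed_closure _ _ p]) simp
qed

end

text \<open>Both assignments of the roles are needed: the field that is zero-extended has its
  condition on \<Gamma>t in one embedding and on \<Gamma>n in the other. The three cases of the
  chart become W equal to the whole space, the empty set, or one side of the surface given by
  g.\<close>

lemma patch_boundary:
  assumes op: "open \<Omega>" and part: "strong_lipschitz_boundary_part \<Omega> \<Gamma>t" and x: "x \<in> frontier \<Omega>" and n: "\<Gamma>n = frontier \<Omega> - closure \<Gamma>t"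
  shows "\<exists>V. x \<in> V & patch \<Omega> \<Gamma>t \<Gamma>n V" "\<exists>V. x \<in> V & patch \<Omega> \<Gamma>n \<Gamma>t V"
proof -
  obtain U Q h where ch: "lipschitz_chart \<Omega> x U Q h" and alt: "\<Gamma>t \<inter> U = frontier \<Omega> \<inter> U | \<Gamma>t \<inter> U = {} \<or>
         (\<exists>g::real => real. (\<exists>C. C-lipschitz_on UNIV g) & \<Gamma>t \<inter> U = {y \<in> frontier \<Omega> \<inter> U. Q (y - x) $ 2 < g (Q (y - x) $ 1)})"
    using part x unfolding strong_lipschitz_boundary_part_def by blast
  have U: "open U" "x \<in> U" using ch by (auto simp: lipschitz_chart_def)
  have far: "y \<in> \<Gamma>n" if "y \<in> frontier \<Omega>" "y \<in> N" "open N" "N \<inter> \<Gamma>t = {}" for y N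
    using that open_Int_closure_eq_empty[of N \<Gamma>t] n by blast
  have near: "y \<in> closure \<Gamma>t" if "y \<in> \<Gamma>t" for y using that closure_subset by blast
  have near': "y \<in> closure \<Gamma>n" if "y \<in> \<Gamma>n" for y using that closure_subset by blast
  note pu = patch_chart[OF op ch open_UNIV, of "1/2" 1] and pe = patch_chart[OF op ch open_empty, of "1/2" 1]
  from alt have "patch \<Omega> \<Gamma>t \<Gamma>n U & patch \<Omega> \<Gamma>n \<Gamma>t U"
  proof (elim disjE exE conjE)
    assume a: "\<Gamma>t \<inter> U = frontier \<Omega> \<inter> U"
    show ?thesis
    proof
      show "patch \<Omega> \<Gamma>t \<Gamma>n U" by (rule pu) (use a in auto)
      show "patch \<Omega> \<Gamma>n \<Gamma>t U" by (rule pe) (use a near in auto)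
    qed
  next
    assume a: "\<Gamma>t \<inter> U = {}"
    then have f: "y \<in> \<Gamma>n" if "y \<in> frontier \<Omega>" "y \<in> U" for y using far[OF that U(1)] by blast
    show ?thesis
    proof
      show "patch \<Omega> \<Gamma>t \<Gamma>n U" by (rule pe) (use f near' in auto)
      show "patch \<Omega> \<Gamma>n \<Gamma>t U" by (rule pu) (use f in auto)
    qed
  next
    fix g C assume g: "C-lipschitz_on UNIV g" and a: "\<Gamma>t \<inter> U = {y \<in> frontier \<Omega> \<inter> U. Q (y - x) $ 2 < g (Q (y - x) $ 1)}"
    have C: "C >= 0" and gl: "\<bar>g a - g b\<bar> <= C * \<bar>a - b\<bar>" for a b using g by (auto simp: lipschitz_on_def dist_real_def)
    \<comment> \<open>Chosen so that C \<delta> \<le> 1 - \<delta>: a direction moves by at least 1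
      - \<delta> in the second coordinate, while g varies by at most C \<delta>.\<close>
    define \<delta> where "\<delta> = min (1/2) (1 / (1 + C))"
    have d: "0 < \<delta>" "\<delta> <= 1/2" using C by (auto simp: \<delta>_def)
    have "(1 + C) * \<delta> <= (1 + C) * (1 / (1 + C))" using C by (intro mult_left_mono) (auto simp: \<delta>_def)
    then have dC: "C * \<delta> <= 1 - \<delta>" using C by (simp add: distrib_right)
    have gm: "\<bar>g (c + t * b) - g c\<bar> <= t * (1 - \<delta>)" if "0 <= t" "\<bar>b\<bar> <= \<delta>" for c t b
    proof -
      have "\<bar>g (c + t * b) - g c\<bar> <= t * (C * \<bar>b\<bar>)" using gl[of "c + t * b" c] that by (simp add: abs_mult mult_ac)
      also have "\<dots> <= t * (1 - \<delta>)" using that dC mult_left_mono[OF that(2) C] by (intro mult_left_mono) auto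
      finally show ?thesis .
    qed
    have gc: "continuous_on S (%y. g (Q (y - x) $ 1))" for S
      by (rule continuous_on_compose2[OF lipschitz_on_continuous_on[OF g]]) (auto intro!: continuous_intros z_cont[OF op ch])
    have oL: "open {y. Q (y - x) $ 2 < g (Q (y - x) $ 1)}" and oG: "open {y. g (Q (y - x) $ 1) < Q (y - x) $ 2}"
      by (intro open_Collect_less continuous_intros z_cont[OF op ch] gc)+
    have f: "y \<in> \<Gamma>n" if "y \<in> frontier \<Omega>" "y \<in> U" "g (Q (y - x) $ 1) < Q (y - x) $ 2" for y
    proof (rule far[OF that(1)])
      show "open (U \<inter> {y. g (Q (y - x) $ 1) < Q (y - x) $ 2})" by (intro open_Int U oG)
      show "U \<inter> {y. g (Q (y - x) $ 1) < Q (y - x) $ 2} \<inter> \<Gamma>t = {}"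
      proof -
        have "Q (y - x) $ 2 < g (Q (y - x) $ 1)" if "y \<in> U" "y \<in> \<Gamma>t" for y using a that by blast
        then show ?thesis by fastforce
      qed
    qed (use that in auto)
    show ?thesis
    proof
      show "patch \<Omega> \<Gamma>t \<Gamma>n U"
      proof (rule patch_chart[OF op ch oL d, of 1])
        fix y and t :: real and b :: R3 assume h: "y \<in> {y. Q (y - x) $ 2 < g (Q (y - x) $ 1)}" "0 <= t" "\<bar>b $ 1\<bar> <= \<delta>" "\<bar>b $ 2 + 1\<bar> <= \<delta>"
        then have "t * (b $ 2) <= t * (- (1 - \<delta>))" by (intro mult_left_mono) auto
        then have "t * (b $ 2) <= - (t * (1 - \<delta>))" by (simp only: mult_minus_right)
        then show "y + t *\<^sub>R inv Q b \<in> {y. Q (y - x) $ 2 < g (Q (y - x) $ 1)}"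
          using h(1)[unfolded mem_Collect_eq] gm[OF h(2,3), of "Q (y - x) $ 1"]
          unfolding mem_Collect_eq z_move[OF op ch] vector_add_component vector_scaleR_component real_scaleR_def by linarith
      next
        fix y assume y: "y \<in> frontier \<Omega>" "y \<in> U" "y \<notin> {y. Q (y - x) $ 2 < g (Q (y - x) $ 1)}"
        show "y \<in> closure \<Gamma>n" by (rule boundary_near[OF op ch y(2,1), where \<sigma>=1]) (use y(3) in \<open>auto intro: f\<close>)
      qed (use a in auto)
      show "patch \<Omega> \<Gamma>n \<Gamma>t U"
      proof (rule patch_chart[OF op ch oG d, of "-1"])
        fix y and t :: real and b :: R3 assume h: "y \<in> {y. g (Q (y - x) $ 1) < Q (y - x) $ 2}" "0 <= t" "\<bar>b $ 1\<bar> <= \<delta>" "\<bar>b $ 2 + -1\<bar> <= \<delta>"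
        then have "t * (1 - \<delta>) <= t * (b $ 2)" by (intro mult_left_mono) auto
        then show "y + t *\<^sub>R inv Q b \<in> {y. g (Q (y - x) $ 1) < Q (y - x) $ 2}"
          using h(1)[unfolded mem_Collect_eq] gm[OF h(2,3), of "Q (y - x) $ 1"]
          unfolding mem_Collect_eq z_move[OF op ch] vector_add_component vector_scaleR_component real_scaleR_def by linarith
      next
        fix y assume y: "y \<in> frontier \<Omega>" "y \<in> U" "y \<notin> {y. g (Q (y - x) $ 1) < Q (y - x) $ 2}"
        show "y \<in> closure \<Gamma>t"
        proof (rule boundary_near[OF op ch y(2,1), where \<sigma>="-1"])
          fix w and t :: real
          assume w: "w \<in> U" "w \<in> frontier \<Omega>" "0 < t" "Q (w - x) $ 1 = Q (y - x) $ 1" "Q (w - x) $ 2 = Q (y - x) $ 2 + - 1 * t"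
          then have "Q (w - x) $ 2 < g (Q (w - x) $ 1)" using y(3) by simp
          then show "w \<in> \<Gamma>t" using w(1,2) a by blast
        qed
      next
        fix y assume "y \<in> frontier \<Omega>" "y \<in> U" "y \<in> {y. g (Q (y - x) $ 1) < Q (y - x) $ 2}"
        then show "y \<in> \<Gamma>n" by (intro f) simp_all
      qed simp
    qed
  qed
  then show "\<exists>V. x \<in> V & patch \<Omega> \<Gamma>t \<Gamma>n V" "\<exists>V. x \<in> V & patch \<Omega> \<Gamma>n \<Gamma>t V" using U by blast+
qed

lemma patch_cover:
  assumes op: "open \<Omega>" and part: "strong_lipschitz_boundary_part \<Omega> \<Gamma>t" and n: "\<Gamma>n = frontier \<Omega> - closure \<Gamma>t" and x: "x \<in> closure \<Omega>"
  shows "\<exists>V. x \<in> V & patch \<Omega> \<Gamma>t \<Gamma>n V" "\<exists>V. x \<in> V & patch \<Omega> \<Gamma>n \<Gamma>t V"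
proof -
  have "x \<in> \<Omega> | x \<in> frontier \<Omega>" using x op by (auto simp: frontier_def interior_open)
  then show "\<exists>V. x \<in> V & patch \<Omega> \<Gamma>t \<Gamma>n V" "\<exists>V. x \<in> V & patch \<Omega> \<Gamma>n \<Gamma>t V"
    using patch_interior[OF op] patch_boundary[OF op part _ n, of x] by blast+
qed

section \<open>Local compactness\<close>

abbreviation on :: "R3 set => (R3 => 'b::real_vector) => R3 => 'b" where "on \<Omega> f \<equiv> %x. indicator \<Omega> x *\<^sub>R f x"

lemma on_sqi: fixes f :: "R3 => 'b::euclidean_space" shows "\<Omega> \<in> sets borel ==> sqiL f ==> sqiL (on \<Omega> f)"
  by (rule sqi_mult_bounded[where B=1]) (auto simp: indicator_def)

lemma nrm_on_le: fixes f :: "R3 => 'b::euclidean_space" shows "\<Omega> \<in> sets borel ==> sqiL f ==> nrmL (on \<Omega> f) <= nrmL f"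
  using nrm_bound[of lborel f "on \<Omega> f" 1] sqi_measurable[OF on_sqi[of \<Omega> f]] by (auto simp: indicator_def)

lemma ip_limit:
  assumes s: "!!n. sqi M (f n)" "sqi M g" "sqi M \<psi>" and l: "(%n. nrm M (%x. f n x - g x)) \<longlonglongrightarrow> 0"
  shows "(%n. ip M (f n) \<psi>) \<longlonglongrightarrow> ip M g \<psi>"
proof (rule LIM_zero_cancel, rule Lim_null_comparison)
  show "\<forall>\<^sub>F n in sequentially. norm (ip M (f n) \<psi> - ip M g \<psi>) <= nrm M (%x. f n x - g x) * nrm M \<psi>"
    using ip_Cauchy_Schwarz[OF sqi_diff[OF s(1,2)] s(3)] by (simp add: ip_diff_left s)
  show "(%n. nrm M (%x. f n x - g x) * nrm M \<psi>) \<longlonglongrightarrow> 0" by (rule tendsto_mult_left_zero[OF l])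
qed

lemma nrm_limit:
  assumes s: "!!n. sqi M (f n)" "sqi M g" and l: "(%n. nrm M (%x. f n x - g x)) \<longlonglongrightarrow> 0"
  shows "(%n. nrm M (f n)) \<longlonglongrightarrow> nrm M g"
proof (rule LIM_zero_cancel, rule Lim_null_comparison[OF always_eventually l], rule allI)
  fix n
  show "norm (nrm M (f n) - nrm M g) <= nrm M (%x. f n x - g x)"
    using nrm_triangle[OF sqi_diff[OF s(1) s(2)] s(2), of n] nrm_triangle[OF sqi_diff[OF s(2) s(1)] s(1), of n n] by (simp add: nrm_minus_commute[of M g])
qed

lemma ball_continuous:
  fixes \<kappa> :: "R3 => 'b::euclidean_space"
  assumes k: "continuous_on UNIV \<kappa>" and b: "0 <= b" "!!x. x \<in> cball 0 r ==> norm (\<kappa> x) <= b"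
  shows "sqiL (on (cball 0 r) \<kappa>) & nrmL (on (cball 0 r) \<kappa>) <= b * sqrt (measure lborel (cball (0::R3) r))"
proof (rule sqi_if_nn_integral)
  have m: "\<kappa> \<in> borel_measurable borel" using k by (rule borel_measurable_continuous_onI)
  show "on (cball 0 r) \<kappa> \<in> borel_measurable lborel" by (intro borel_measurable_scaleR borel_measurable_indicator) (simp_all add: m)
  have "(\<integral>\<^sup>+x. ennreal ((norm (indicator (cball 0 r) x *\<^sub>R \<kappa> x))\<^sup>2) \<partial>lborel) <= (\<integral>\<^sup>+x. ennreal (b\<^sup>2) * indicator (cball (0::R3) r) x \<partial>lborel)"
    by (intro nn_integral_mono) (auto simp: indicator_def intro!: power_mono b)
  also have "\<dots> = ennreal ((b * sqrt (measure lborel (cball (0::R3) r)))\<^sup>2)"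
  proof -
    have "emeasure lborel (cball (0::R3) r) ~= top" using emeasure_cball_less_top[of "0::R3" r] by (metis less_irrefl)
    then show ?thesis by (simp add: nn_integral_cmult_indicator emeasure_eq_ennreal_measure ennreal_mult power_mult_distrib)
  qed
  finally show "(\<integral>\<^sup>+x. ennreal ((norm (on (cball 0 r) \<kappa> x))\<^sup>2) \<partial>lborel) <= ennreal ((b * sqrt (measure lborel (cball (0::R3) r)))\<^sup>2)" .
qed (use b in simp)

lemma ip_ball: "(!!x. x \<notin> cball 0 r ==> h x = 0) ==> ipL h \<kappa> = ipL h (on (cball 0 r) \<kappa>)" for h \<kappa> :: "R3 => 'b::euclidean_space"
  unfolding ip_def
proof (rule Bochner_Integration.integral_cong[OF refl])
  fix x assume "!!x. x \<notin> cball 0 r ==> h x = 0"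
  then show "h x \<bullet> \<kappa> x = h x \<bullet> on (cball 0 r) \<kappa> x" by (cases "x \<in> cball 0 r") auto
qed

lemma ball_sqi:
  fixes \<kappa> :: "R3 => 'b::euclidean_space"
  assumes "continuous_on UNIV \<kappa>" shows "sqiL (on (cball 0 r) \<kappa>)"
proof -
  have "compact (\<kappa> ` cball 0 r)" by (intro compact_continuous_image continuous_on_subset[OF assms]) auto
  then obtain b where "0 < b" "\<forall>y\<in>\<kappa> ` cball 0 r. norm y <= b" using compact_imp_bounded bounded_pos by metis
  then show ?thesis using ball_continuous[OF assms, of b r] by simp
qed

lemma weakly_null_add:
  fixes f g :: "nat => R3 => 'b::euclidean_space"
  assumes "weakly_null r f" "weakly_null r g" shows "weakly_null r (%n x. f n x + g n x)"
proof -
  obtain A B where AB: "\<forall>n. nrmL (f n) <= A" "\<forall>n. nrmL (g n) <= B" using assms by (auto simp: weakly_null_def)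
  have "nrmL (%x. f n x + g n x) <= A + B" for n
  proof -
    have "nrmL (%x. f n x + g n x) <= nrmL (f n) + nrmL (g n)"
      by (rule nrm_triangle) (use assms in \<open>simp_all add: weakly_null_def\<close>)
    then show ?thesis using AB by (meson add_mono order_trans)
  qed
  moreover have "(%n. ipL (%x. f n x + g n x) \<kappa>) \<longlonglongrightarrow> 0" if k: "continuous_on UNIV \<kappa>" for \<kappa>
  proof -
    have z: "x \<notin> cball 0 r ==> f n x = 0" "x \<notin> cball 0 r ==> g n x = 0" "sqiL (f n)" "sqiL (g n)" for n x
      using assms by (auto simp: weakly_null_def)
    have "ipL (%x. f n x + g n x) \<kappa> = ipL (f n) \<kappa> + ipL (g n) \<kappa>" for n
      using ip_ball[of r "f n" \<kappa>] ip_ball[of r "g n" \<kappa>] ip_ball[of r "%x. f n x + g n x" \<kappa>] z by (simp add: ip_add_left ball_sqi[OF k])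
    then show ?thesis using assms k tendsto_add[of "%n. ipL (f n) \<kappa>" 0 sequentially "%n. ipL (g n) \<kappa>" 0] by (simp add: weakly_null_def)
  qed
  ultimately show ?thesis using assms unfolding weakly_null_def by (simp add: sqi_add) blast
qed

lemma weakly_null_zero: "weakly_null r (%n x. 0)" by (auto simp: weakly_null_def sqi_zero ip_zero_left nrm_def)

lemma weakly_null_sum: "(!!i. i \<in> I ==> weakly_null r (f i)) ==> weakly_null r (%n x. \<Sum>i\<in>I. f i n x)"
  by (induction I rule: infinite_finite_induct) (auto simp: weakly_null_zero weakly_null_add)

text \<open>The \<open>N j\<close> are the coefficients of the formal adjoint of R, with the sign
  from integration by parts: Rot for the first complex, symRot for the second.\<close>

locale hilbert_complex = homotopy +
  fixes N :: "3 => M3 => M3"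
  assumes N_linear: "linear (N j)" and M_N: "M j a \<bullet> b = - (a \<bullet> N j b)"
begin

section \<open>Integration by parts on the domain and weak equations with boundary
  conditions\<close>

definition Ra :: "(R3 => M3) => R3 => M3" where "Ra \<phi> x = (\<Sum>j\<in>UNIV. N j (pd j \<phi> x))"

definition adm :: "R3 set => R3 set => (R3 => M3) => bool" where
  "adm \<Omega> \<Sigma> \<phi> \<longleftrightarrow> C_inf_Sigma \<Sigma> \<phi> & (\<forall>x\<in>\<Omega>. P (\<phi> x) = \<phi> x)"

lemma M_bl: "bounded_linear (M j)" and N_bl: "bounded_linear (N j)"
  using M_linear N_linear linear_conv_bounded_linear by blast+

lemma Ra_tf: "tf \<phi> ==> tf (Ra \<phi>)"
  unfolding Ra_def[abs_def] by (intro tf_sum tf_linear[OF N_bl] tf_pd)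

lemma Ra_local: "open U ==> x \<in> U ==> (!!y. y \<in> U ==> \<phi> y = \<phi>' y) ==> Ra \<phi> x = Ra \<phi>' x"
  unfolding Ra_def using pd_local[of U x \<phi> \<phi>'] by simp

lemma Ra_off: "x \<notin> tsupp \<phi> ==> Ra \<phi> x = 0"
  using Ra_local[of "- tsupp \<phi>" x \<phi> "%x. 0"] by (simp add: closed_tsupp open_Compl tsuppD Ra_def pd_const linear_0[OF N_linear])

lemma R_off: "tf \<Psi> ==> x \<notin> tsupp \<Psi> ==> R \<Psi> x = 0"
proof -
  assume a: "tf \<Psi>" "x \<notin> tsupp \<Psi>"
  have "pd j \<Psi> x = 0" for j by (rule tsuppD) (use a tsupp_pd in blast)
  then show ?thesis by (simp add: R_eq[OF tf_smooth[OF a(1)]] linear_0[OF M_linear])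
qed

lemma green: assumes \<phi>: "tf \<phi>" and \<Psi>: "tf \<Psi>" shows "ipL \<phi> (R \<Psi>) = ipL (Ra \<phi>) \<Psi>"
proof -
  have "ipL \<phi> (%x. M j (pd j \<Psi> x)) = ipL (%x. N j (pd j \<phi> x)) \<Psi>" for j
  proof -
    have tM: "tf (%x. M j (\<Psi> x))" by (rule tf_linear[OF M_bl \<Psi>])
    have "pd j (%x. M j (\<Psi> x) \<bullet> \<phi> x) x = \<phi> x \<bullet> M j (pd j \<Psi> x) - N j (pd j \<phi> x) \<bullet> \<Psi> x" for x
      using pd_bilinear[OF smooth_differentiable[OF tf_smooth[OF tM]] smooth_differentiable[OF tf_smooth[OF \<phi>]] bounded_bilinear_inner, of j x]
        pd_linear[OF smooth_differentiable[OF tf_smooth[OF \<Psi>]] M_bl, of j j x]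
        M_N[of j "\<Psi> x" "pd j \<phi> x"] by (simp add: inner_commute)
    then have "(\<integral>x. \<phi> x \<bullet> M j (pd j \<Psi> x) - N j (pd j \<phi> x) \<bullet> \<Psi> x \<partial>lborel) = 0"
      using integral_pd_zero[OF tf_bilinear1[OF bounded_bilinear_inner tM tf_smooth[OF \<phi>]], of j] by simp
    then show ?thesis unfolding ip_def
      by (subst (asm) Bochner_Integration.integral_diff)
        (intro sqi_inner tf_sqi \<phi> \<Psi> tf_linear[OF M_bl] tf_linear[OF N_bl] tf_pd | simp)+
  qed
  then show ?thesis unfolding R_eq[OF tf_smooth[OF \<Psi>]] Ra_def[abs_def]
    by (simp add: ip_sum_right ip_sum_left tf_sqi \<phi> \<Psi> tf_linear[OF M_bl] tf_linear[OF N_bl] tf_pd)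
qed

text \<open>The common support meets the closure of \<Omega> in a compact subset of \<Omega>. A
  cutoff that is 1 near it turns \<phi> into a test field inside \<Omega> without changing either
  pairing.\<close>

lemma green_domain:
  assumes op: "open \<Omega>" and \<phi>: "tf \<phi>" and \<Psi>: "tf \<Psi>" and d: "tsupp \<phi> \<inter> tsupp \<Psi> \<inter> frontier \<Omega> = {}"
  shows "ipL (on \<Omega> \<phi>) (R \<Psi>) = ipL (on \<Omega> (Ra \<phi>)) \<Psi>"
proof -
  let ?K = "tsupp \<phi> \<inter> tsupp \<Psi> \<inter> closure \<Omega>"
  have "?K \<subseteq> \<Omega>" using d op by (auto simp: frontier_def interior_open)
  moreover have "compact ?K" by (intro compact_Int_closed tf_compact closed_tsupp closed_closure \<phi>)
  ultimately obtain \<zeta> W where z: "tf \<zeta>" "tsupp \<zeta> \<subseteq> \<Omega>" "open W" "?K \<subseteq> W" "!!x. x \<in> W ==> \<zeta> x = (1::real)"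
    using smooth_cutoff[OF _ op] by metis
  have t: "tf (%x. \<zeta> x *\<^sub>R \<phi> x)" by (intro tf_scaleR1 z tf_smooth \<phi>)
  have E1: "on \<Omega> \<phi> x \<bullet> R \<Psi> x = (\<zeta> x *\<^sub>R \<phi> x) \<bullet> R \<Psi> x" for x
  proof (cases "x \<in> \<Omega>")
    case True
    show ?thesis
    proof (cases "x \<in> tsupp \<phi> \<inter> tsupp \<Psi>")
      case t: True
      then have "x \<in> ?K" using True closure_subset by blast
      then show ?thesis using z True by (simp add: subset_iff)
    qed (use R_off[OF \<Psi>] tsuppD[of x \<phi>] in auto)
  next
    case False
    then have "x \<notin> tsupp \<zeta>" using z(2) by blast
    then show ?thesis using False by (simp add: tsuppD)
  qed
  have E2: "on \<Omega> (Ra \<phi>) x \<bullet> \<Psi> x = Ra (%x. \<zeta> x *\<^sub>R \<phi> x) x \<bullet> \<Psi> x" for x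
  proof (cases "x \<in> \<Omega>")
    case True
    show ?thesis
    proof (cases "x \<in> tsupp \<Psi>")
      case p: True
      have "Ra \<phi> x = Ra (%x. \<zeta> x *\<^sub>R \<phi> x) x"
      proof (cases "x \<in> tsupp \<phi>")
        case f: True
        then have "x \<in> W" using True p z(4) closure_subset by blast
        then show ?thesis by (rule Ra_local[OF z(3)]) (simp add: z)
      next
        case False
        then show ?thesis by (intro Ra_local[of "- tsupp \<phi>"]) (auto simp: closed_tsupp open_Compl tsuppD)
      qed
      then show ?thesis using True by simp
    qed (simp add: tsuppD)
  next
    case False
    have "tsupp (%x. \<zeta> x *\<^sub>R \<phi> x) \<subseteq> tsupp \<zeta>" by (rule tsupp_subset[OF closed_tsupp]) (simp add: tsuppD)
    then have "x \<notin> tsupp (%x. \<zeta> x *\<^sub>R \<phi> x)" using False z(2) by blast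
    then show ?thesis using False by (simp add: Ra_off)
  qed
  show ?thesis using green[OF t \<Psi>] unfolding ip_def E1 E2 .
qed

text \<open>The equation Ra S = G with the boundary condition on \<Sigma> built in: test fields may
  reach the frontier in \<Sigma>, so the equation holds for the zero extension across it.\<close>

definition weakR :: "R3 set => R3 set => (R3 => M3) => (R3 => M3) => bool" where
  "weakR \<Omega> \<Sigma> S G \<longleftrightarrow> (\<forall>\<Psi>. tf \<Psi> & tsupp \<Psi> \<inter> frontier \<Omega> \<subseteq> \<Sigma> --> ipL S (R \<Psi>) = ipL G \<Psi>)"

lemma C_inf_Sigma_tf: "C_inf_Sigma \<Sigma> \<phi> ==> tf \<phi> & tsupp \<phi> \<inter> closure \<Sigma> = {}"
proof
  assume "C_inf_Sigma \<Sigma> \<phi>"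
  then obtain d where d: "smooth \<phi>" "compact (tsupp \<phi>)" "d > 0" "!!x y. x \<in> tsupp \<phi> ==> y \<in> \<Sigma> ==> d <= dist x y"
    by (auto simp: C_inf_Sigma_def)
  then show "tf \<phi>" by (simp add: tf_def)
  show "tsupp \<phi> \<inter> closure \<Sigma> = {}"
  proof (rule ccontr)
    assume "tsupp \<phi> \<inter> closure \<Sigma> ~= {}"
    then obtain x where x: "x \<in> tsupp \<phi>" "x \<in> closure \<Sigma>" by blast
    then obtain y where "y \<in> \<Sigma>" "dist y x < d" using d(3) closure_approachable by blast
    then show False using d(4)[OF x(1)] by (fastforce simp: dist_commute)
  qed
qed

lemma weakR_limit:
  assumes op: "open \<Omega>" and a: "!!m. C_inf_Sigma \<Sigma> (\<phi> m)" and s: "sqiL S" "sqiL G"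
    and l: "(%m. nrmL (%x. on \<Omega> (\<phi> m) x - S x)) \<longlonglongrightarrow> 0" "(%m. nrmL (%x. on \<Omega> (Ra (\<phi> m)) x - G x)) \<longlonglongrightarrow> 0"
  shows "weakR \<Omega> \<Sigma> S G"
  unfolding weakR_def
proof (intro allI impI, elim conjE)
  fix \<Psi> :: "R3 => M3" assume \<Psi>: "tf \<Psi>" "tsupp \<Psi> \<inter> frontier \<Omega> \<subseteq> \<Sigma>"
  have b: "\<Omega> \<in> sets borel" using op by (rule borel_open)
  have t: "tf (\<phi> m)" for m using C_inf_Sigma_tf[OF a] by blast
  have "tsupp (\<phi> m) \<inter> tsupp \<Psi> \<inter> frontier \<Omega> = {}" for m using C_inf_Sigma_tf[OF a[of m]] \<Psi>(2) closure_subset by blast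
  then have "ipL (on \<Omega> (\<phi> m)) (R \<Psi>) = ipL (on \<Omega> (Ra (\<phi> m))) \<Psi>" for m by (rule green_domain[OF op t \<Psi>(1)])
  moreover have "(%m. ipL (on \<Omega> (\<phi> m)) (R \<Psi>)) \<longlonglongrightarrow> ipL S (R \<Psi>)"
    by (rule ip_limit[OF on_sqi[OF b tf_sqi[OF t]] s(1) tf_sqi[OF R_tf[OF \<Psi>(1)]] l(1)])
  moreover have "(%m. ipL (on \<Omega> (Ra (\<phi> m))) \<Psi>) \<longlonglongrightarrow> ipL G \<Psi>"
    by (rule ip_limit[OF on_sqi[OF b tf_sqi[OF Ra_tf[OF t]]] s(2) tf_sqi[OF \<Psi>(1)] l(2)])
  ultimately show "ipL S (R \<Psi>) = ipL G \<Psi>" by (simp add: LIMSEQ_unique)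
qed

text \<open>An admissible \<open>Rf\<close> need not be P-valued off \<Omega>, nor supported in Ut.
  It is cut off near the relevant part of its support and projected; this changes no pairing, since
  u and Y vanish on B and almost all of Ut in V lies in \<Omega> or B.\<close>

lemma patch_estimate:
  assumes op: "open \<Omega>" and p: "patch \<Omega> \<Sigma> \<Sigma>' V" and f1: "tf f1" "tsupp f1 \<subseteq> V"
    and X: "weakly_null r X" "!!n x. P (X n x) = X n x" "!!n x. x \<notin> \<Omega> ==> X n x = 0" and G: "weakly_null r G"
    and w: "!!n. weakR \<Omega> \<Sigma> (X n) (G n)"
  shows "\<exists>a. a \<longlonglongrightarrow> (0::real) & (\<forall>n Rf. adm \<Omega> \<Sigma>' Rf -->
    \<bar>ipL (%x. f1 x *\<^sub>R X n x) Rf\<bar> <= a n * (nrmL (on \<Omega> (D Rf)) + nrmL (on \<Omega> Rf)))"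
proof -
  have bO: "\<Omega> \<in> sets borel" using op by (rule borel_open)
  have Xs: "sqiL (X n)" and Gs: "sqiL (G n)" for n using X(1) G by (auto simp: weakly_null_def)
  from p[unfolded patch_def] obtain Ut B em ep where V: "open V" and U: "open Ut" "open B" "B \<subseteq> Ut" "kernel em" "kernel ep"
     "\<forall>y\<in>Ut. \<forall>t\<ge>0. \<forall>k\<in>tsupp em. y + t *\<^sub>R k \<in> Ut" "\<forall>y\<in>B. \<forall>t\<ge>0. \<forall>k\<in>tsupp ep. y + t *\<^sub>R k \<in> B"
     "\<Omega> \<inter> V \<subseteq> Ut" "\<Omega> \<inter> B \<inter> V = {}" and ae: "AE y in lborel. y \<in> Ut \<inter> V --> y \<in> \<Omega> | y \<in> B"
     and fr: "frontier \<Omega> \<inter> V \<inter> Ut \<subseteq> \<Sigma>" "frontier \<Omega> \<inter> V - Ut \<subseteq> closure \<Sigma>'" by (elim conjE exE)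
  obtain f2 W2 where f2: "tf f2" "tsupp f2 \<subseteq> V" "tsupp f1 \<subseteq> W2" "!!x. x \<in> W2 ==> f2 x = (1::real)"
    using smooth_cutoff[OF tf_compact[OF f1(1)] V f1(2)] by metis
  obtain f3 W3 where f3: "tf f3" "tsupp f2 \<subseteq> W3" "!!x. x \<in> W3 ==> f3 x = (1::real)"
    using smooth_cutoff[OF tf_compact[OF f2(1)] open_UNIV] by (metis subset_UNIV)
  define g where "g n x = f1 x *\<^sub>R X n x" for n x
  \<comment> \<open>Product rule for f1 X, obtained by testing the equation for X with f1 \<Psi>,
    whose support meets the frontier within \<Sigma>.\<close>
  define F where "F n x = f1 x *\<^sub>R G n x + (\<Sum>j\<in>UNIV. pd j f1 x *\<^sub>R N j (X n x))" for n x
  have gw: "weakly_null r g" unfolding g_def[abs_def]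
    using weakly_null_multiplier[OF X(1) multiplier_tf[OF f1(1)] linear_id] by (simp add: id_def)
  have Fw: "weakly_null r F" unfolding F_def[abs_def]
    using weakly_null_multiplier[OF G multiplier_tf[OF f1(1)] linear_id] weakly_null_multiplier[OF X(1) multiplier_tf[OF tf_pd[OF f1(1)]] N_linear]
    by (intro weakly_null_add weakly_null_sum) (simp_all add: id_def)
  have gs: "sqiL (g n)" for n using gw by (simp add: weakly_null_def)
  have weak: "ipL (g n) (R \<Psi>) = ipL (F n) \<Psi>" if \<Psi>: "tf \<Psi>" "tsupp \<Psi> \<subseteq> Ut" for n \<Psi>
  proof -
    let ?\<Psi> = "%x. f1 x *\<^sub>R \<Psi> x"
    have t: "tf ?\<Psi>" by (intro tf_scaleR1 f1 tf_smooth \<Psi>)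
    have st: "tsupp ?\<Psi> \<subseteq> tsupp f1 \<inter> tsupp \<Psi>" by (rule tsupp_subset) (auto simp: closed_tsupp tsuppD)
    have tN: "tf (%x. pd j f1 x *\<^sub>R M j (\<Psi> x))" for j by (intro tf_scaleR1 tf_pd f1 tf_smooth tf_linear[OF M_bl] \<Psi>)
    have tR: "tf (%x. f1 x *\<^sub>R R \<Psi> x)" by (intro tf_scaleR1 f1 tf_smooth R_tf \<Psi>)
    have "pd j ?\<Psi> x = f1 x *\<^sub>R pd j \<Psi> x + pd j f1 x *\<^sub>R \<Psi> x" for j x
      using pd_bilinear[OF smooth_differentiable[OF tf_smooth[OF f1(1)]] smooth_differentiable[OF tf_smooth[OF \<Psi>(1)]] bounded_bilinear_scaleR, of j x] by (simp add: add.commute)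
    then have "R ?\<Psi> = (%x. f1 x *\<^sub>R R \<Psi> x + (\<Sum>j\<in>UNIV. pd j f1 x *\<^sub>R M j (\<Psi> x)))"
      by (simp add: R_eq[OF tf_smooth] t \<Psi> linear_add[OF M_linear] linear_scale[OF M_linear] sum.distrib scaleR_sum_right)
    then have "ipL (X n) (R ?\<Psi>) = ipL (X n) (%x. f1 x *\<^sub>R R \<Psi> x) + (\<Sum>j\<in>UNIV. ipL (X n) (%x. pd j f1 x *\<^sub>R M j (\<Psi> x)))"
      by (simp add: ip_add_right ip_sum_right Xs tf_sqi tN tR sqi_sum)
    moreover have "ipL (X n) (%x. pd j f1 x *\<^sub>R M j (\<Psi> x)) = - ipL (%x. pd j f1 x *\<^sub>R N j (X n x)) \<Psi>" for j
    proof -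
      have "X n x \<bullet> (pd j f1 x *\<^sub>R M j (\<Psi> x)) = - ((pd j f1 x *\<^sub>R N j (X n x)) \<bullet> \<Psi> x)" for x
        using M_N[of j "\<Psi> x" "X n x"] by (simp add: inner_commute)
      then show ?thesis by (simp add: ip_def)
    qed
    moreover have "ipL (X n) (R ?\<Psi>) = ipL (G n) ?\<Psi>"
      using w[of n] t st f1(2) \<Psi>(2) fr(1) unfolding weakR_def by blast
    moreover have "ipL (F n) \<Psi> = ipL (%x. f1 x *\<^sub>R G n x) \<Psi> + (\<Sum>j\<in>UNIV. ipL (%x. pd j f1 x *\<^sub>R N j (X n x)) \<Psi>)"
      unfolding F_def[abs_def]
      by (simp add: ip_add_left ip_sum_left sqi_sum tf_sqi \<Psi> multiplier_sqi multiplier_tf f1 tf_pd Gs Xs sqi_linear[OF N_bl])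
    ultimately show ?thesis unfolding g_def[abs_def] ip_mult by (simp add: sum_negf)
  qed
  have "\<exists>u Y. (\<forall>n. sqiL (u n) & sqiL (Y n)) & (%n. nrmL (u n)) \<longlonglongrightarrow> 0 & (%n. nrmL (Y n)) \<longlonglongrightarrow> 0 \<and>
    (\<forall>n \<Phi>. tf \<Phi> & (\<forall>x. P (\<Phi> x) = \<Phi> x) & tsupp \<Phi> \<subseteq> Ut --> ipL (g n) \<Phi> = ipL (u n) (D \<Phi>) + ipL (Y n) \<Phi>) \<and>
    (\<forall>n. AE x in lborel. x \<in> B --> u n x = 0 & Y n x = 0) & (\<forall>n x. x \<notin> tsupp f2 --> u n x = 0) \<and>
    (\<forall>n. AE x in lborel. x \<in> Ut - tsupp f2 --> Y n x = 0)"
  proof (rule local_decomposition[where em=em and ep=ep and ?f1.0=f1 and ?f3.0=f3 and F=F])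
    show "g n x = 0" if "x \<in> B" for n x
    proof (cases "x \<in> V")
      case True
      then show ?thesis using X(3)[of x n] U(9) that by (auto simp: g_def)
    next
      case False
      then have "x \<notin> tsupp f1" using f1(2) by blast
      then show ?thesis by (simp add: g_def tsuppD)
    qed
  qed (use U f1 f2 f3 gw Fw weak X(2) in \<open>auto simp: g_def tsuppD linear_scale[OF P_linear]\<close>)
  then obtain u Y where uY: "\<forall>n. sqiL (u n) & sqiL (Y n)" "(%n. nrmL (u n)) \<longlonglongrightarrow> 0" "(%n. nrmL (Y n)) \<longlonglongrightarrow> 0"
    "\<forall>n \<Phi>. tf \<Phi> & (\<forall>x. P (\<Phi> x) = \<Phi> x) & tsupp \<Phi> \<subseteq> Ut --> ipL (g n) \<Phi> = ipL (u n) (D \<Phi>) + ipL (Y n) \<Phi>"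
    "\<forall>n. AE x in lborel. x \<in> B --> u n x = 0 & Y n x = 0" "\<forall>n x. x \<notin> tsupp f2 --> u n x = 0"
    "\<forall>n. AE x in lborel. x \<in> Ut - tsupp f2 --> Y n x = 0" by (elim exE conjE)
  have us: "sqiL (u n)" and Ys: "sqiL (Y n)" for n using uY(1) by auto
  \<comment> \<open>Y is known to vanish off the support of f2 only inside Ut; the restriction makes
    the pairing with \<open>Rf\<close> on all of \<Omega> meaningful.\<close>
  define Y' where "Y' n = on (tsupp f2) (Y n)" for n
  have bt: "tsupp f2 \<in> sets borel" by (rule borel_closed[OF closed_tsupp])
  have Y's: "sqiL (Y' n)" for n unfolding Y'_def by (rule on_sqi[OF bt Ys])
  have est: "\<bar>ipL (g n) Rf\<bar> <= (nrmL (u n) + nrmL (Y n)) * (nrmL (on \<Omega> (D Rf)) + nrmL (on \<Omega> Rf))"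
    if a: "adm \<Omega> \<Sigma>' Rf" for n Rf
  proof -
    have Rt: "tf Rf" "tsupp Rf \<inter> closure \<Sigma>' = {}" using a C_inf_Sigma_tf by (auto simp: adm_def)
    have RP: "P (Rf x) = Rf x" if "x \<in> \<Omega>" for x using a that by (simp add: adm_def)
    let ?K = "tsupp Rf \<inter> closure \<Omega> \<inter> tsupp f2"
    have K: "compact ?K" by (intro compact_Int_closed tf_compact closed_tsupp closed_closure Rt)
    \<comment> \<open>A frontier point of \<open>?K\<close> keeps away from the closure of
      \<Sigma>', so the patch property places it in Ut.\<close>
    have "?K \<subseteq> Ut \<inter> V"
    proof
      fix x assume x: "x \<in> ?K"
      then have "x \<in> V" using f2(2) by blast
      moreover have "x \<in> \<Omega> | x \<in> frontier \<Omega>" using x op by (auto simp: frontier_def interior_open)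
      ultimately show "x \<in> Ut \<inter> V" using x U(8) fr(2) Rt(2) by blast
    qed
    then obtain \<zeta> W where z: "tf \<zeta>" "tsupp \<zeta> \<subseteq> Ut \<inter> V" "open W" "?K \<subseteq> W" "!!x. x \<in> W ==> \<zeta> x = (1::real)"
      using smooth_cutoff[OF K open_Int[OF U(1) V]] by metis
    let ?\<Phi> = "%x. \<zeta> x *\<^sub>R P (Rf x)"
    have t: "tf ?\<Phi>" by (intro tf_scaleR1 z tf_smooth tf_linear[OF P_bl] Rt)
    have PP: "P (?\<Phi> x) = ?\<Phi> x" for x by (simp add: linear_scale[OF P_linear] P_idem)
    have st: "tsupp ?\<Phi> \<subseteq> tsupp \<zeta>" by (rule tsupp_subset[OF closed_tsupp]) (simp add: tsuppD)
    have inK: "x \<in> W" if "x \<in> \<Omega>" "x \<in> tsupp f2" "x \<in> tsupp Rf" for x using that z(4) closure_subset by blast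
    have eq: "?\<Phi> x = Rf x" if "x \<in> \<Omega>" "x \<in> tsupp f2" for x
      using inK[OF that] z(5)[of x] RP[OF that(1)] tsuppD[of x Rf] by (cases "x \<in> tsupp Rf") (auto simp: linear_0[OF P_linear])
    have Deq: "D ?\<Phi> x = D Rf x" if x: "x \<in> \<Omega>" "x \<in> tsupp f2" for x
    proof (cases "x \<in> tsupp Rf")
      case True
      then have "x \<in> W \<inter> \<Omega>" using inK x by blast
      then show ?thesis by (rule D_local[OF open_Int[OF z(3) op]]) (simp add: z RP)
    next
      case False
      then show ?thesis by (intro D_local[of "- tsupp Rf"]) (auto simp: closed_tsupp open_Compl tsuppD linear_0[OF P_linear])
    qed
    have f12: "x \<in> tsupp f2" if "x \<in> tsupp f1" for x
      using f2(4)[of x] f2(3) that tsuppD[of x f2] by (metis subsetD zero_neq_one)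
    have "g n x \<bullet> Rf x = g n x \<bullet> ?\<Phi> x" for x
    proof (cases "x \<in> \<Omega> & x \<in> tsupp f1")
      case True
      then show ?thesis using eq f12 by simp
    next
      case False
      then have "g n x = 0" using X(3)[of x n] by (auto simp: g_def tsuppD)
      then show ?thesis by simp
    qed
    then have "ipL (g n) Rf = ipL (g n) ?\<Phi>" by (simp add: ip_def)
    also have "\<dots> = ipL (u n) (D ?\<Phi>) + ipL (Y n) ?\<Phi>" using uY(4) t PP st z(2) by blast
    also have "ipL (u n) (D ?\<Phi>) = ipL (u n) (on \<Omega> (D Rf))"
      unfolding ip_def
    proof (rule integral_cong_AE)
      show "(%x. u n x \<bullet> D ?\<Phi> x) \<in> borel_measurable lborel" "(%x. u n x \<bullet> on \<Omega> (D Rf) x) \<in> borel_measurable lborel"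
        by (intro borel_measurable_integrable sqi_inner us tf_sqi D_tf t on_sqi[OF bO] Rt)+
      show "AE x in lborel. u n x \<bullet> D ?\<Phi> x = u n x \<bullet> on \<Omega> (D Rf) x"
        using uY(5)[rule_format, of n] ae
      proof eventually_elim
        case (elim x)
        show ?case
        proof (cases "x \<in> \<Omega>")
          case True
          then show ?thesis using Deq[OF True] uY(6)[rule_format, of x n] by (cases "x \<in> tsupp f2") auto
        next
          case False
          have "D ?\<Phi> x = 0 | u n x = 0" using elim False st z(2) D_zero_off[of x ?\<Phi>] by blast
          then show ?thesis using False by auto
        qed
      qed
    qed
    also have "ipL (Y n) ?\<Phi> = ipL (Y' n) (on \<Omega> Rf)"
      unfolding ip_def
    proof (rule integral_cong_AE)
      show "(%x. Y n x \<bullet> ?\<Phi> x) \<in> borel_measurable lborel" "(%x. Y' n x \<bullet> on \<Omega> Rf x) \<in> borel_measurable lborel"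
        by (intro borel_measurable_integrable sqi_inner Ys Y's tf_sqi t on_sqi[OF bO] Rt)+
      show "AE x in lborel. Y n x \<bullet> ?\<Phi> x = Y' n x \<bullet> on \<Omega> Rf x"
        using uY(5)[rule_format, of n] ae uY(7)[rule_format, of n]
      proof eventually_elim
        case (elim x)
        have off: "?\<Phi> x = 0" if "x \<notin> Ut \<inter> V"
        proof -
          have "x \<notin> tsupp ?\<Phi>" using that st z(2) by blast
          then show ?thesis by (rule tsuppD)
        qed
        show ?case
        proof (cases "x \<in> \<Omega> & x \<in> tsupp f2")
          case True
          then show ?thesis using eq[of x] by (simp add: Y'_def)
        next
          case False
          have "?\<Phi> x = 0 | Y n x = 0" using elim False off by blast
          moreover have "Y' n x \<bullet> on \<Omega> Rf x = 0" using False by (auto simp: Y'_def indicator_def)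
          ultimately show ?thesis by auto
        qed
      qed
    qed
    finally have "\<bar>ipL (g n) Rf\<bar> <= \<bar>ipL (u n) (on \<Omega> (D Rf))\<bar> + \<bar>ipL (Y' n) (on \<Omega> Rf)\<bar>" by linarith
    also have "\<dots> <= nrmL (u n) * nrmL (on \<Omega> (D Rf)) + nrmL (Y' n) * nrmL (on \<Omega> Rf)"
      by (intro add_mono ip_Cauchy_Schwarz us Y's on_sqi[OF bO] tf_sqi D_tf Rt)
    also have "\<dots> <= nrmL (u n) * nrmL (on \<Omega> (D Rf)) + nrmL (Y n) * nrmL (on \<Omega> Rf)"
      using nrm_on_le[OF bt Ys[of n]] by (intro add_left_mono mult_right_mono) (auto simp: Y'_def nrm_def)
    also have "\<dots> <= (nrmL (u n) + nrmL (Y n)) * (nrmL (on \<Omega> (D Rf)) + nrmL (on \<Omega> Rf))"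
    proof -
      have "0 <= nrmL (u n) * nrmL (on \<Omega> Rf)" "0 <= nrmL (Y n) * nrmL (on \<Omega> (D Rf))" by (simp_all add: nrm_def)
      then show ?thesis by (simp add: algebra_simps)
    qed
    finally show ?thesis .
  qed
  have "(%n. nrmL (u n) + nrmL (Y n)) \<longlonglongrightarrow> 0" using tendsto_add[OF uY(2,3)] by simp
  then show ?thesis using est unfolding g_def[abs_def] by blast
qed

text \<open>The partition of unity multiplies X and not \<open>Rf\<close>, so the admissibility and
  the norms of \<open>Rf\<close> stay untouched.\<close>

lemma domain_estimate:
  assumes op: "open \<Omega>" and bd: "bounded \<Omega>" and p: "!!x. x \<in> closure \<Omega> ==> \<exists>V. x \<in> V & patch \<Omega> \<Sigma> \<Sigma>' V"
    and X: "weakly_null r X" "!!n x. P (X n x) = X n x" "!!n x. x \<notin> \<Omega> ==> X n x = 0" and G: "weakly_null r G"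
    and w: "!!n. weakR \<Omega> \<Sigma> (X n) (G n)"
  shows "\<exists>a. a \<longlonglongrightarrow> (0::real) & (\<forall>n Rf. adm \<Omega> \<Sigma>' Rf --> \<bar>ipL (X n) Rf\<bar> <= a n * (nrmL (on \<Omega> (D Rf)) + nrmL (on \<Omega> Rf)))"
proof -
  have "\<forall>x\<in>closure \<Omega>. \<exists>V. x \<in> V & patch \<Omega> \<Sigma> \<Sigma>' V" using p by blast
  from bchoice[OF this] obtain V where V: "\<forall>x\<in>closure \<Omega>. x \<in> V x & patch \<Omega> \<Sigma> \<Sigma>' (V x)" by (elim exE)
  obtain A \<theta> V0 where A: "finite A" "A \<subseteq> closure \<Omega>" "open V0" "closure \<Omega> \<subseteq> V0"
    "!!a. a \<in> A ==> tf (\<theta> a)" "!!a. a \<in> A ==> tsupp (\<theta> a) \<subseteq> V a"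
    "!!x. x \<in> V0 ==> (\<Sum>a\<in>A. \<theta> a x) = 1" "!!x. 0 <= (\<Sum>a\<in>A. \<theta> a x) & (\<Sum>a\<in>A. \<theta> a x) <= (1::real)"
    by (rule partition_of_unity[of "closure \<Omega>" V]) (use V bd in \<open>auto simp: patch_def compact_closure\<close>)
  have "\<forall>c\<in>A. \<exists>a. a \<longlonglongrightarrow> (0::real) & (\<forall>n Rf. adm \<Omega> \<Sigma>' Rf -->
    \<bar>ipL (%x. \<theta> c x *\<^sub>R X n x) Rf\<bar> <= a n * (nrmL (on \<Omega> (D Rf)) + nrmL (on \<Omega> Rf)))"
  proof
    fix c assume c: "c \<in> A"
    have "patch \<Omega> \<Sigma> \<Sigma>' (V c)" using V A(2) c by blast
    then show "\<exists>a. a \<longlonglongrightarrow> (0::real) & (\<forall>n Rf. adm \<Omega> \<Sigma>' Rf -->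
      \<bar>ipL (%x. \<theta> c x *\<^sub>R X n x) Rf\<bar> <= a n * (nrmL (on \<Omega> (D Rf)) + nrmL (on \<Omega> Rf)))"
      by (rule patch_estimate[OF op _ A(5)[OF c] A(6)[OF c] X G w])
  qed
  from bchoice[OF this] obtain a where a: "\<forall>c\<in>A. a c \<longlonglongrightarrow> (0::real) & (\<forall>n Rf. adm \<Omega> \<Sigma>' Rf -->
    \<bar>ipL (%x. \<theta> c x *\<^sub>R X n x) Rf\<bar> <= a c n * (nrmL (on \<Omega> (D Rf)) + nrmL (on \<Omega> Rf)))" by (elim exE)
  have Xs: "sqiL (X n)" for n using X(1) by (simp add: weakly_null_def)
  have "(%n. \<Sum>c\<in>A. a c n) \<longlonglongrightarrow> (\<Sum>c\<in>A. 0)" using a by (intro tendsto_sum) auto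
  moreover have "\<bar>ipL (X n) Rf\<bar> <= (\<Sum>c\<in>A. a c n) * (nrmL (on \<Omega> (D Rf)) + nrmL (on \<Omega> Rf))" if Rf: "adm \<Omega> \<Sigma>' Rf" for n Rf
  proof -
    have "X n = (%x. \<Sum>c\<in>A. \<theta> c x *\<^sub>R X n x)"
    proof
      fix x show "X n x = (\<Sum>c\<in>A. \<theta> c x *\<^sub>R X n x)"
        using A(4) A(7)[of x] X(3)[of x n] closure_subset[of \<Omega>] by (cases "x \<in> \<Omega>") (auto simp: scaleR_sum_left[symmetric])
    qed
    moreover have "tf Rf" using Rf C_inf_Sigma_tf by (auto simp: adm_def)
    ultimately have "ipL (X n) Rf = (\<Sum>c\<in>A. ipL (%x. \<theta> c x *\<^sub>R X n x) Rf)"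
      using ip_sum_left[of A lborel "%c x. \<theta> c x *\<^sub>R X n x" Rf] by (simp add: tf_sqi multiplier_sqi multiplier_tf A(5) Xs)
    also have "\<bar>\<dots>\<bar> <= (\<Sum>c\<in>A. a c n * (nrmL (on \<Omega> (D Rf)) + nrmL (on \<Omega> Rf)))"
      using a Rf by (intro order_trans[OF sum_abs] sum_mono) auto
    finally show ?thesis by (simp add: sum_distrib_right)
  qed
  ultimately show ?thesis by auto
qed

end

section \<open>Weak subsequences and weights\<close>

text \<open>Spanned by monomials scaled to be at most 1 on the ball of radius \<open>\<rho>\<close>.\<close>

inductive poly3 :: "real => (R3 => real) => bool" for \<rho> where
  mono: "poly3 \<rho> (%x. (x $ 1 / \<rho>) ^ a * (x $ 2 / \<rho>) ^ b * (x $ 3 / \<rho>) ^ c)"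
| add: "poly3 \<rho> f ==> poly3 \<rho> g ==> poly3 \<rho> (%x. f x + g x)"
| cmult: "poly3 \<rho> f ==> poly3 \<rho> (%x. c * f x)"

lemma poly3_coord: assumes "\<rho> ~= 0" shows "poly3 \<rho> f ==> poly3 \<rho> (%x. x $ j * f x)"
proof (induction rule: poly3.induct)
  case (mono a b c)
  have e: "(%x::R3. x $ j * ((x $ 1 / \<rho>) ^ a * (x $ 2 / \<rho>) ^ b * (x $ 3 / \<rho>) ^ c)) =
    (%x. \<rho> * ((x $ 1 / \<rho>) ^ (if j = 1 then Suc a else a) * (x $ 2 / \<rho>) ^ (if j = 2 then Suc b else b) * (x $ 3 / \<rho>) ^ (if j = 3 then Suc c else c)))"
    using exhaust_3[of j] assms by (elim disjE) (auto simp: fun_eq_iff)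
  show ?case unfolding e by (rule poly3.cmult[OF poly3.mono])
next
  case (add f g)
  then show ?case using poly3.add[OF add.IH] by (simp add: distrib_left)
next
  case (cmult f c)
  then show ?case using poly3.cmult[OF cmult.IH, of c] by (simp add: mult.left_commute)
qed

lemma poly3_zero: "poly3 \<rho> (%x. 0)" using poly3.cmult[OF poly3.mono, of \<rho> 0 0 0 0] by simp

lemma poly3_sum: "(!!i. i \<in> I ==> poly3 \<rho> (f i)) ==> poly3 \<rho> (%x. \<Sum>i\<in>I. f i x)"
  by (induction I rule: infinite_finite_induct) (auto intro: poly3_zero poly3.add)

text \<open>Proved in the stronger form that multiplication by p preserves \<open>poly3\<close>,
  since the class is generated without a product rule.\<close>

lemma poly3_real_polynomial:
  assumes r: "\<rho> ~= 0" and p: "real_polynomial_function (p :: R3 => real)" shows "poly3 \<rho> p"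
proof -
  have "\<forall>g. poly3 \<rho> g --> poly3 \<rho> (%x. p x * g x)"
    using p
  proof (induction rule: real_polynomial_function.induct)
    case (linear f)
    have "f x = (\<Sum>j\<in>UNIV. f (axis j 1) * x $ j)" for x
    proof -
      have "f x = f (\<Sum>j\<in>UNIV. (x $ j) *\<^sub>R axis j 1)" by (simp add: basis_expansion flip: scalar_mult_eq_scaleR)
      also have "\<dots> = (\<Sum>j\<in>UNIV. x $ j * f (axis j 1))"
        using linear by (simp add: bounded_linear.linear linear_sum linear_scale)
      finally show ?thesis by (simp add: mult.commute)
    qed
    note e = this
    show ?case
    proof (intro allI impI)
      fix g assume g: "poly3 \<rho> g"
      have "(%x. f x * g x) = (%x. \<Sum>j\<in>UNIV. f (axis j 1) * (x $ j * g x))"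
        by (rule ext, subst e) (simp add: sum_distrib_right mult.assoc)
      then show "poly3 \<rho> (%x. f x * g x)" using poly3_sum[of UNIV \<rho> "%j x. f (axis j 1) * (x $ j * g x)"] poly3.cmult[OF poly3_coord[OF r g]] by simp
    qed
  next
    case (const c)
    show ?case by (intro allI impI poly3.cmult)
  next
    case (add f g)
    show ?case
    proof (intro allI impI)
      fix k assume "poly3 \<rho> k"
      then have "poly3 \<rho> (%x. f x * k x)" "poly3 \<rho> (%x. g x * k x)" using add.IH by blast+
      then show "poly3 \<rho> (%x. (f x + g x) * k x)" unfolding distrib_right by (rule poly3.add)
    qed
  next
    case (mult f g)
    show ?case
    proof (intro allI impI)
      fix k assume "poly3 \<rho> k"
      then have "poly3 \<rho> (%x. g x * k x)" using mult.IH by blast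
      then show "poly3 \<rho> (%x. (f x * g x) * k x)" unfolding mult.assoc using mult.IH by blast
    qed
  qed
  then show ?thesis using poly3.mono[of \<rho> 0 0 0] by fastforce
qed

lemma poly3_continuous: "poly3 \<rho> f ==> continuous_on S f"
  by (induction rule: poly3.induct) (auto simp: divide_inverse intro!: continuous_intros)

text \<open>A diagonal subsequence makes the pairings with the countably many scaled monomials
  converge; Stone-Weierstrass and the norm bound extend this to continuous test functions.\<close>

lemma weak_subsequence:
  fixes f :: "nat => R3 => 'b::euclidean_space"
  assumes s: "!!n. sqiL (f n)" and z: "!!n x. x \<notin> cball 0 R ==> f n x = 0" and C: "!!n. nrmL (f n) <= C"
  shows "\<exists>r. strict_mono r & (\<forall>\<kappa>. continuous_on UNIV \<kappa> --> convergent (%n. ipL (f (r n)) \<kappa>))"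
proof -
  \<comment> \<open>At least 1 for division and at least R so that scaled coordinates are bounded by
    1 on the ball.\<close>
  define \<rho> where "\<rho> = max R 1"
  have \<rho>: "\<rho> > 0" "R <= \<rho>" by (auto simp: \<rho>_def)
  define v where "v = sqrt (measure lborel (cball (0::R3) R))"
  have v0: "0 <= v" by (simp add: v_def)
  have C0: "0 <= C" using C[of 0] by (simp add: nrm_def order_trans[of 0 "nrmL (f 0)"] real_sqrt_ge_zero)
  have zb: "ipL (f n) \<kappa> = ipL (f n) (on (cball 0 R) \<kappa>)" for n \<kappa> by (rule ip_ball) (rule z)
  have bound: "\<bar>ipL (f n) \<kappa>\<bar> <= C * (b * v)" if "continuous_on UNIV \<kappa>" "0 <= b" "!!x. x \<in> cball 0 R ==> norm (\<kappa> x) <= b" for n \<kappa> b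
  proof -
    note bc = ball_continuous[OF that]
    have "\<bar>ipL (f n) \<kappa>\<bar> <= nrmL (f n) * nrmL (on (cball 0 R) \<kappa>)"
      unfolding zb[of n \<kappa>] by (rule ip_Cauchy_Schwarz[OF s bc[THEN conjunct1]])
    also have "\<dots> <= C * (b * v)"
    proof (rule mult_mono[OF C _ C0])
      show "nrmL (on (cball 0 R) \<kappa>) <= b * v" using bc by (simp add: v_def)
    qed (simp add: nrm_def)
    finally show ?thesis .
  qed
  have add_rule: "ipL (f n) (%x. \<kappa> x + \<kappa>' x) = ipL (f n) \<kappa> + ipL (f n) \<kappa>'" if "continuous_on UNIV \<kappa>" "continuous_on UNIV \<kappa>'" for n \<kappa> \<kappa>'
    unfolding zb[of n "%x. \<kappa> x + \<kappa>' x"] zb[of n \<kappa>] zb[of n \<kappa>'] scaleR_add_right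
    by (rule ip_add_right[OF ball_sqi[OF that(1)] ball_sqi[OF that(2)] s])
  let ?m = "%i::(nat \<times> nat \<times> nat) \<times> 'b. %x::R3. ((x $ 1 / \<rho>) ^ fst (fst i) * (x $ 2 / \<rho>) ^ fst (snd (fst i)) * (x $ 3 / \<rho>) ^ snd (snd (fst i))) *\<^sub>R snd i"
  define I where "I = (UNIV :: (nat \<times> nat \<times> nat) set) \<times> (Basis :: 'b set)"
  have mb: "norm (ipL (f n) (?m i)) <= C * (1 * v)" if "i \<in> I" for n i
    unfolding real_norm_def
  proof (rule bound)
    show "continuous_on UNIV (?m i)" using \<rho> by (auto intro!: continuous_intros)
    fix x :: R3 assume "x \<in> cball 0 R"
    then have "\<bar>x $ j / \<rho>\<bar> <= 1" for j using component_le_norm_cart[of x j] \<rho> by simp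
    then have "\<bar>x $ j / \<rho>\<bar> ^ a <= 1" for j a by (intro power_le_one) auto
    then have "\<bar>x $ 1 / \<rho>\<bar> ^ fst (fst i) * \<bar>x $ 2 / \<rho>\<bar> ^ fst (snd (fst i)) * \<bar>x $ 3 / \<rho>\<bar> ^ snd (snd (fst i)) <= 1"
      by (intro mult_le_one) (auto intro!: mult_nonneg_nonneg)
    then show "norm (?m i x) <= 1" using that by (auto simp: I_def abs_mult power_abs)
  qed simp
  have cI: "countable I" unfolding I_def by (rule countable_SIGMA) (auto simp: countable_finite)
  obtain k where k: "strict_mono k" "!!i. i \<in> I ==> \<exists>l. (%n. ipL (f (k n)) (?m i)) \<longlonglongrightarrow> l"
    by (rule function_convergent_subsequence[of I "%n i. ipL (f n) (?m i)" "C * (1 * v)", OF cI mb]) blast+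
  have poly: "convergent (%n. ipL (f (k n)) (%x. p x *\<^sub>R b))" if "poly3 \<rho> p" "b \<in> Basis" for p b
    using that
  proof (induction rule: poly3.induct)
    case (mono a c d)
    then show ?case using k(2)[of "((a, c, d), b)"] by (auto simp: I_def convergent_def)
  next
    case (add g h)
    have "continuous_on UNIV (%x. g x *\<^sub>R b)" "continuous_on UNIV (%x. h x *\<^sub>R b)"
      using poly3_continuous add.hyps by (auto intro!: continuous_intros)
    from add_rule[OF this] show ?case using convergent_add[OF add.IH(1)[OF add.prems] add.IH(2)[OF add.prems]] by (simp add: scaleR_add_left)
  next
    case (cmult g c)
    have "ipL (f n) (%x. (c * g x) *\<^sub>R b) = c * ipL (f n) (%x. g x *\<^sub>R b)" for n by (simp add: ip_def mult.assoc)
    then show ?case using convergent_mult[OF convergent_const[of c] cmult.IH[OF cmult.prems]] by simp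
  qed
  have scalar: "convergent (%n. ipL (f (k n)) (%x. \<kappa> x *\<^sub>R b))" if \<kappa>: "continuous_on UNIV \<kappa>" and b: "b \<in> Basis" for \<kappa> :: "R3 => real" and b
  proof (rule real_Cauchy_convergent, rule CauchyI)
    fix e :: real assume e: "0 < e"
    \<comment> \<open>Makes the approximation error C d v at most e/4; the summand 1 covers C v =
      0.\<close>
    define d where "d = e / (4 * (C * v + 1))"
    have Cv: "0 <= C * v" using C0 v0 by simp
    have d: "d > 0" "C * (d * v) <= e / 4"
    proof -
      show "d > 0" using e Cv by (simp add: d_def)
      have "C * (d * v) = (C * v / (C * v + 1)) * (e / 4)" by (simp add: d_def mult_ac)
      also have "\<dots> <= 1 * (e / 4)" using Cv e by (intro mult_right_mono) auto
      finally show "C * (d * v) <= e / 4" by simp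
    qed
    obtain p where p: "real_polynomial_function p" "!!x. x \<in> cball (0::R3) R ==> \<bar>\<kappa> x - p x\<bar> < d"
      using Stone_Weierstrass_real_polynomial_function[OF compact_cball continuous_on_subset[OF \<kappa>] d(1), of 0 R] by auto
    have pp: "poly3 \<rho> p" using poly3_real_polynomial[OF _ p(1)] \<rho> by auto
    have cp: "continuous_on UNIV (%x. p x *\<^sub>R b)" "continuous_on UNIV (%x. (\<kappa> x - p x) *\<^sub>R b)"
      using poly3_continuous[OF pp] \<kappa> by (auto intro!: continuous_intros)
    have split: "ipL (f n) (%x. \<kappa> x *\<^sub>R b) = ipL (f n) (%x. p x *\<^sub>R b) + ipL (f n) (%x. (\<kappa> x - p x) *\<^sub>R b)" for n
      using add_rule[OF cp, of n] by (simp add: scaleR_diff_left)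
    have nb: "norm ((\<kappa> x - p x) *\<^sub>R b) <= d" if "x \<in> cball 0 R" for x using p(2)[OF that] b by simp
    have small: "\<bar>ipL (f n) (%x. (\<kappa> x - p x) *\<^sub>R b)\<bar> <= e / 4" for n
      using bound[OF cp(2) less_imp_le[OF d(1)] nb, of n] d(2) by linarith
    have "Cauchy (%n. ipL (f (k n)) (%x. p x *\<^sub>R b))" using poly[OF pp b] by (simp add: Cauchy_convergent_iff)
    then obtain M where M: "\<forall>m\<ge>M. \<forall>n\<ge>M. norm (ipL (f (k m)) (%x. p x *\<^sub>R b) - ipL (f (k n)) (%x. p x *\<^sub>R b)) < e / 4"
      using CauchyD[of _ "e/4"] e by fastforce
    show "\<exists>M. \<forall>m\<ge>M. \<forall>n\<ge>M. norm (ipL (f (k m)) (%x. \<kappa> x *\<^sub>R b) - ipL (f (k n)) (%x. \<kappa> x *\<^sub>R b)) < e"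
    proof (intro exI[of _ M] allI impI)
      fix m n assume "M <= m" "M <= n"
      then have "norm (ipL (f (k m)) (%x. p x *\<^sub>R b) - ipL (f (k n)) (%x. p x *\<^sub>R b)) < e / 4" using M by blast
      then show "norm (ipL (f (k m)) (%x. \<kappa> x *\<^sub>R b) - ipL (f (k n)) (%x. \<kappa> x *\<^sub>R b)) < e"
        using small[of "k m"] small[of "k n"] e unfolding split real_norm_def by linarith
    qed
  qed
  have "convergent (%n. ipL (f (k n)) \<kappa>)" if \<kappa>: "continuous_on UNIV \<kappa>" for \<kappa>
  proof -
    have "ipL (f n) \<kappa> = (\<Sum>b\<in>Basis. ipL (f n) (%x. (\<kappa> x \<bullet> b) *\<^sub>R b))" for n
    proof -
      have c: "continuous_on UNIV (%x. (\<kappa> x \<bullet> b) *\<^sub>R b)" for b using \<kappa> by (auto intro!: continuous_intros)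
      have "(\<Sum>b\<in>Basis. ipL (f n) (%x. (\<kappa> x \<bullet> b) *\<^sub>R b)) = (\<Sum>b\<in>Basis. ipL (f n) (on (cball 0 R) (%x. (\<kappa> x \<bullet> b) *\<^sub>R b)))"
        by (intro sum.cong refl zb)
      also have "\<dots> = ipL (f n) (%x. \<Sum>b\<in>Basis. on (cball 0 R) (%x. (\<kappa> x \<bullet> b) *\<^sub>R b) x)"
        by (rule ip_sum_right[symmetric, OF ball_sqi[OF c] s])
      also have "(%x. \<Sum>b\<in>Basis. on (cball 0 R) (%x. (\<kappa> x \<bullet> b) *\<^sub>R b) x) = on (cball 0 R) \<kappa>"
        by (rule ext, subst scaleR_sum_right[symmetric], subst euclidean_representation, rule refl)
      finally show ?thesis using zb[of n \<kappa>] by simp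
    qed
    then show ?thesis using \<kappa> by (auto intro!: convergent_sum scalar continuous_intros)
  qed
  then show ?thesis using k(1) by blast
qed

text \<open>Membership in a closure space comes with its own weak derivative, while the bounds
  concern the given one; both have the same norm.\<close>

lemma weak_unique:
  fixes G G0 :: "R3 => 'b::euclidean_space"
  assumes op: "open \<Omega>" and L: "L2 \<Omega> G" "L2 \<Omega> G0" and e: "!!\<Phi>. test_fun \<Omega> \<Phi> ==> l2inner \<Omega> G \<Phi> = l2inner \<Omega> G0 \<Phi>"
  shows "l2norm \<Omega> G = l2norm \<Omega> G0"
proof -
  let ?M = "lebesgue_on \<Omega>"
  have b: "\<Omega> \<in> sets borel" using op by (rule borel_open)
  have s: "sqi ?M G" "sqi ?M G0" using L by (simp_all add: L2_sqi)
  obtain g where g: "g \<in> borel_measurable borel" "!!x. x \<notin> \<Omega> ==> g x = 0" "AE x in ?M. G x = g x"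
    using borel_representative[OF b sqi_measurable[OF s(1)]] by blast
  obtain h where h: "h \<in> borel_measurable borel" "!!x. x \<notin> \<Omega> ==> h x = 0" "AE x in ?M. G0 x = h x"
    using borel_representative[OF b sqi_measurable[OF s(2)]] by blast
  have sg: "sqiL g" "sqiL h"
    using sqi_representative[OF b sqi_measurable[OF s(1)] g] sqi_representative[OF b sqi_measurable[OF s(2)] h] s by auto
  have "AE x in lborel. x \<in> \<Omega> --> g x - h x = 0"
  proof (rule fundamental_lemma[OF sqi_diff[OF sg] op])
    fix \<psi> :: "R3 => 'b" assume \<psi>: "tf \<psi>" "tsupp \<psi> \<subseteq> \<Omega>"
    then have "ip ?M G \<psi> = ip ?M G0 \<psi>" using e[of \<psi>] by (simp add: test_fun_iff l2inner_ip)
    then show "ipL (%x. g x - h x) \<psi> = 0"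
      using ip_representative[OF b sqi_measurable[OF s(1)] g, of \<psi>] ip_representative[OF b sqi_measurable[OF s(2)] h, of \<psi>] smooth_borel[OF tf_smooth[OF \<psi>(1)]]
      by (simp add: ip_diff_left sg tf_sqi \<psi>)
  qed
  then have "AE x in lborel. g x = h x" by eventually_elim (use g h in force)
  then have "nrmL g = nrmL h" using g(1) h(1) by (intro nrm_cong_AE) auto
  moreover have "nrm ?M G = nrmL g" by (rule nrm_representative[OF b sqi_measurable[OF s(1)] g])
  moreover have "nrm ?M G0 = nrmL h" by (rule nrm_representative[OF b sqi_measurable[OF s(2)] h])
  ultimately show ?thesis by (simp add: l2norm_nrm)
qed

lemma ip_scaleR_left: "ip M (%x. a *\<^sub>R f x) g = a * ip M f g" by (simp add: ip_def)
lemma ip_scaleR_right: "ip M f (%x. a *\<^sub>R g x) = a * ip M f g" by (simp add: ip_def)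

lemma nrm_square: "(nrm M f)\<^sup>2 = ip M f f" by (simp add: nrm_def ip_def power2_norm_eq_inner integral_nonneg_AE)

lemma
  fixes f :: "R3 => 'b::euclidean_space"
  assumes b: "\<Omega> \<in> sets borel" and f: "f \<in> borel_measurable borel"
  shows nrm_on: "nrm (lebesgue_on \<Omega>) f = nrmL (on \<Omega> f)"
    and ip_on: "\<phi> \<in> borel_measurable borel ==> ip (lebesgue_on \<Omega>) f \<phi> = ipL (on \<Omega> f) \<phi>"
    and sqi_on: "sqi (lebesgue_on \<Omega>) f \<longleftrightarrow> sqiL (on \<Omega> f)"
proof -
  have m: "on \<Omega> f \<in> borel_measurable borel" using b f by (intro borel_measurable_scaleR borel_measurable_indicator)
  have e: "AE x in lebesgue_on \<Omega>. f x = on \<Omega> f x" by (simp add: AE_lebesgue_on[OF b])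
  note p = b borel_measurable_lebesgue_on[OF f] m _ e
  show "nrm (lebesgue_on \<Omega>) f = nrmL (on \<Omega> f)" by (rule nrm_representative[OF p]) simp
  show "\<phi> \<in> borel_measurable borel ==> ip (lebesgue_on \<Omega>) f \<phi> = ipL (on \<Omega> f) \<phi>" by (rule ip_representative[OF p]) simp_all
  show "sqi (lebesgue_on \<Omega>) f \<longleftrightarrow> sqiL (on \<Omega> f)" by (rule sqi_representative[OF p]) simp
qed

text \<open>Both index sequences tend to infinity, so the pairings of the two subsequences have
  equal limits; no weak limit has to be constructed.\<close>

lemma weakly_null_differences:
  fixes f :: "nat => R3 => 'b::euclidean_space"
  assumes s: "!!n. sqiL (f n)" and z: "!!n x. x \<notin> cball 0 R ==> f n x = 0" and C: "!!n. nrmL (f n) <= C"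
    and c: "!!\<kappa>. continuous_on UNIV \<kappa> ==> convergent (%n. ipL (f n) \<kappa>)" and pq: "!!n. n <= p n" "!!n. n <= q n"
  shows "weakly_null R (%n x. f (p n) x - f (q n) x)"
  unfolding weakly_null_def
proof (intro conjI allI impI exI[of _ "C + C"])
  show "sqiL (%x. f (p n) x - f (q n) x)" for n by (intro sqi_diff s)
  show "f (p n) x - f (q n) x = 0" if "x \<notin> cball 0 R" for n x using z[OF that] by simp
  show "nrmL (%x. f (p n) x - f (q n) x) <= C + C" for n
    using nrm_triangle_diff[OF s s, of "p n" "q n"] C[of "p n"] C[of "q n"] by linarith
  fix \<kappa> :: "R3 => 'b" assume k: "continuous_on UNIV \<kappa>"
  obtain l where l: "(%n. ipL (f n) \<kappa>) \<longlonglongrightarrow> l" using c[OF k] by (auto simp: convergent_def)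
  have "filterlim p at_top sequentially" "filterlim q at_top sequentially"
    using pq by (intro filterlim_at_top_mono[OF filterlim_ident] always_eventually allI; simp)+
  then have "(%n. ipL (f (p n)) \<kappa> - ipL (f (q n)) \<kappa>) \<longlonglongrightarrow> l - l"
    by (intro tendsto_diff filterlim_compose[OF l])
  moreover have "ipL (%x. f (p n) x - f (q n) x) \<kappa> = ipL (f (p n)) \<kappa> - ipL (f (q n)) \<kappa>" for n
  proof -
    have "ipL (%x. f (p n) x - f (q n) x) \<kappa> = ipL (%x. f (p n) x - f (q n) x) (on (cball 0 R) \<kappa>)"
      by (rule ip_ball) (simp add: z)
    also have "\<dots> = ipL (f (p n)) (on (cball 0 R) \<kappa>) - ipL (f (q n)) (on (cball 0 R) \<kappa>)"
      by (rule ip_diff_left[OF s s ball_sqi[OF k]])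
    also have "\<dots> = ipL (f (p n)) \<kappa> - ipL (f (q n)) \<kappa>"
      using ip_ball[of R "f (p n)" \<kappa>] ip_ball[of R "f (q n)" \<kappa>] z by simp
    finally show ?thesis .
  qed
  ultimately show "(%n. ipL (%x. f (p n) x - f (q n) x) \<kappa>) \<longlonglongrightarrow> 0" by simp
qed

text \<open>\<open>V\<close> is described through P, which covers both matrix spaces at once. The
  bound c is strictly positive because \<open>w_coercive\<close> divides by it.\<close>

locale weight =
  fixes \<Omega> :: "R3 set" and V :: "(R3 => M3) => bool" and P :: "M3 => M3" and w :: "(R3 => M3) => R3 => M3" and c :: real
  assumes V_iff: "V S \<longleftrightarrow> L2 \<Omega> S & (AE x in lebesgue_on \<Omega>. P (S x) = S x)" and P_bounded: "bounded_linear P"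
    and adm_w: "admissible_weight \<Omega> V w" and c: "0 < c" "!!S. V S ==> l2norm \<Omega> (w S) <= c * l2norm \<Omega> S"
begin

abbreviation "LM \<equiv> lebesgue_on \<Omega>"

lemma V_sqi: "V S ==> sqi LM S" by (simp add: V_iff L2_sqi)
lemma wV: "V S ==> V (w S)" using adm_w by (simp add: admissible_weight_def)
lemma w_bound: "V S ==> nrm LM (w S) <= c * nrm LM S" using c(2) by (simp add: l2norm_nrm)
lemma w_sym: "V S ==> V T ==> ip LM (w S) T = ip LM S (w T)" using adm_w by (simp add: admissible_weight_def l2inner_ip)
lemma w_linear: "V S ==> V T ==> AE x in LM. w (%y. a *\<^sub>R S y + b *\<^sub>R T y) x = a *\<^sub>R w S x + b *\<^sub>R w T x"
  using adm_w unfolding admissible_weight_def by blast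
lemma w_surj: "V T ==> \<exists>S. V S & (AE x in LM. w S x = T x)" using adm_w unfolding admissible_weight_def by blast

lemma V_combination: assumes "V S" "V T" shows "V (%y. a *\<^sub>R S y + b *\<^sub>R T y)"
proof -
  have "AE x in LM. P (S x) = S x" "AE x in LM. P (T x) = T x" using assms by (simp_all add: V_iff)
  then have "AE x in LM. P (a *\<^sub>R S x + b *\<^sub>R T x) = a *\<^sub>R S x + b *\<^sub>R T x"
    by eventually_elim (simp add: linear_add linear_scale bounded_linear.linear[OF P_bounded])
  then show ?thesis using V_sqi[OF assms(1)] V_sqi[OF assms(2)] by (simp add: V_iff L2_sqi sqi_add sqi_scaleR)
qed

lemma w_nonneg: assumes "V S" shows "0 <= ip LM (w S) S"
proof (cases "AE x in LM. S x = 0")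
  case True
  have "ip LM S (w S) = ip LM (%x. 0) (w S)"
    by (rule ip_cong_AE[OF True]) (use sqi_measurable V_sqi assms wV in auto)
  then show ?thesis using w_sym[OF assms assms] by (simp add: ip_zero_left)
next
  case False
  have "\<forall>S. V S --> \<not> (AE x in LM. S x = 0) --> 0 < ip LM (w S) S"
    using adm_w unfolding admissible_weight_def l2inner_ip by (elim conjE)
  then show ?thesis using assms False by (simp add: less_imp_le)
qed

text \<open>Nonnegativity of the form at \<open>S - t w S\<close> with \<open>t = 1/c\<close>.\<close>

lemma w_coercive: assumes S: "V S" shows "(nrm LM (w S))\<^sup>2 <= c * ip LM (w S) S"
proof -
  define y where "y = w S"
  have y: "V y" unfolding y_def by (rule wV[OF S])
  note s = V_sqi[OF S] V_sqi[OF y] V_sqi[OF wV[OF y]]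
  let ?T = "%x. 1 *\<^sub>R S x + (- 1 / c) *\<^sub>R y x"
  have T: "V ?T" by (rule V_combination[OF S y])
  have m: "sqi LM (%x. 1 *\<^sub>R y x + (- 1 / c) *\<^sub>R w y x)" by (intro sqi_add sqi_scaleR s)
  have "0 <= ip LM (w ?T) ?T" by (rule w_nonneg[OF T])
  also have "\<dots> = ip LM (%x. 1 *\<^sub>R y x + (- 1 / c) *\<^sub>R w y x) ?T"
    by (rule ip_cong_AE[OF w_linear[OF S y, of 1 "- 1 / c", folded y_def]]) (use sqi_measurable V_sqi T wV m in auto)
  also have "\<dots> = ip LM y S + (- 1 / c) * ip LM y y + (- 1 / c) * ip LM (w y) S + (- 1 / c) * (- 1 / c) * ip LM (w y) y"
  proof -
    have "ip LM z ?T = ip LM z S + (- 1 / c) * ip LM z y" if "sqi LM z" for z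
      using ip_add_right[OF sqi_scaleR[OF s(1)] sqi_scaleR[OF s(2)] that, of 1 "- 1 / c"] unfolding ip_scaleR_right by simp
    from this[OF s(2)] this[OF s(3)] show ?thesis
      using ip_add_left[OF sqi_scaleR[OF s(2)] sqi_scaleR[OF s(3)] V_sqi[OF T], of 1 "- 1 / c"] unfolding ip_scaleR_left by (simp add: diff_divide_distrib)
  qed
  also have "ip LM (w y) S = ip LM y y" using w_sym[OF y S] by (simp add: y_def)
  finally have q: "0 <= ip LM y S - 2 * ((nrm LM y)\<^sup>2 / c) + ip LM (w y) y / (c * c)" by (simp add: nrm_square field_simps)
  have "ip LM (w y) y <= nrm LM (w y) * nrm LM y" using ip_Cauchy_Schwarz[OF s(3) s(2)] by linarith
  also have "\<dots> <= c * nrm LM y * nrm LM y" by (rule mult_right_mono[OF w_bound[OF y] nrm_nonneg])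
  finally have "ip LM (w y) y / (c * c) <= (nrm LM y)\<^sup>2 / c" using c(1) by (simp add: field_simps power2_eq_square)
  then have "(nrm LM y)\<^sup>2 / c <= ip LM y S" using q by linarith
  then show ?thesis using c(1) by (simp add: y_def field_simps)
qed

lemma w_diff: assumes "V S" "V T"
  shows "V (%x. S x - T x)" "AE x in LM. w (%x. S x - T x) x = w S x - w T x"
  using V_combination[OF assms, of 1 "-1"] w_linear[OF assms, of 1 "-1"] by simp_all

text \<open>The images w (S n) converge by completeness, and surjectivity of w lifts the limit to
  S0. The weighted norm of S n - S0 is then controlled by Cauchy-Schwarz: its image under w tends to
  0 and it is bounded itself.\<close>

lemma wnorm_limit:
  assumes S: "!!n. V (S n)" "!!n. nrm LM (S n) <= C"
    and cau: "!!e. e > 0 ==> \<exists>N. \<forall>m\<ge>N. \<forall>n\<ge>N. nrm LM (%x. w (S m) x - w (S n) x) <= e"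
  shows "\<exists>S0. V S0 & (%n. wnorm \<Omega> w (%x. S n x - S0 x)) \<longlonglongrightarrow> 0"
proof -
  have ws: "sqi LM (w (S n))" for n using V_sqi wV S(1) by blast
  obtain R0 where R0: "sqi LM R0" "(%n. nrm LM (%x. w (S n) x - R0 x)) \<longlonglongrightarrow> 0"
    using sqi_complete[OF ws cau] by blast
  obtain cP where cP: "cP > 0" "!!f. sqi LM f ==> nrm LM (%x. P (f x)) <= cP * nrm LM f" using nrm_linear[OF P_bounded, of LM] by blast
  \<comment> \<open>P fixes every w (S n), so R0 differs from its projection by no more than a
    multiple of its distance to w (S n); hence R0 lies in the range of w.\<close>
  have "nrm LM (%x. P (R0 x) - R0 x) <= (cP + 1) * nrm LM (%x. w (S n) x - R0 x)" for n
  proof -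
    have d: "sqi LM (%x. w (S n) x - R0 x)" by (intro sqi_diff ws R0)
    have "AE x in LM. P (w (S n) x) = w (S n) x" using wV[OF S(1)[of n]] by (simp add: V_iff)
    then have "AE x in LM. P (R0 x) - R0 x = (w (S n) x - R0 x) - P (w (S n) x - R0 x)"
      by eventually_elim (simp add: linear_diff bounded_linear.linear[OF P_bounded])
    then have "nrm LM (%x. P (R0 x) - R0 x) = nrm LM (%x. (w (S n) x - R0 x) - P (w (S n) x - R0 x))"
      by (rule nrm_cong_AE) (intro sqi_measurable sqi_diff d R0 sqi_linear[OF P_bounded])+
    also have "\<dots> <= nrm LM (%x. w (S n) x - R0 x) + nrm LM (%x. P (w (S n) x - R0 x))"
      by (rule nrm_triangle_diff[OF d sqi_linear[OF P_bounded d]])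
    finally show ?thesis using cP(2)[OF d] by (simp add: distrib_right)
  qed
  then have "nrm LM (%x. P (R0 x) - R0 x) <= (cP + 1) * 0"
    by (intro LIMSEQ_le_const[OF tendsto_mult[OF tendsto_const R0(2)]]) auto
  then have "nrm LM (%x. P (R0 x) - R0 x) = 0" using nrm_nonneg[of LM "%x. P (R0 x) - R0 x"] by simp
  then have "AE x in LM. P (R0 x) - R0 x = 0" by (subst (asm) nrm_eq_0) (intro sqi_diff sqi_linear[OF P_bounded] R0)+
  then have "V R0" using R0(1) by (simp add: V_iff L2_sqi)
  then obtain S0 where S0: "V S0" "AE x in LM. w S0 x = R0 x" using w_surj by blast
  have b: "ip LM (w (%x. S n x - S0 x)) (%x. S n x - S0 x) <= nrm LM (%x. w (S n) x - R0 x) * (C + nrm LM S0)" for n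
  proof -
    note v = w_diff(1)[OF S(1)[of n] S0(1)]
    have "AE x in LM. w (%x. S n x - S0 x) x = w (S n) x - R0 x"
      using w_diff(2)[OF S(1)[of n] S0(1)] S0(2) by eventually_elim simp
    then have e: "nrm LM (w (%x. S n x - S0 x)) = nrm LM (%x. w (S n) x - R0 x)"
      by (rule nrm_cong_AE) (intro sqi_measurable sqi_diff ws R0 V_sqi[OF wV[OF v]])+
    have "nrm LM (%x. S n x - S0 x) <= C + nrm LM S0"
      using nrm_triangle_diff[OF V_sqi[OF S(1)[of n]] V_sqi[OF S0(1)]] S(2)[of n] by linarith
    then have "nrm LM (w (%x. S n x - S0 x)) * nrm LM (%x. S n x - S0 x) <= nrm LM (w (%x. S n x - S0 x)) * (C + nrm LM S0)"
      by (rule mult_left_mono[OF _ nrm_nonneg])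
    then show ?thesis using ip_Cauchy_Schwarz[OF V_sqi[OF wV[OF v]] V_sqi[OF v]] unfolding e by linarith
  qed
  have t: "(%n. sqrt (nrm LM (%x. w (S n) x - R0 x) * (C + nrm LM S0))) \<longlonglongrightarrow> sqrt (0 * (C + nrm LM S0))"
    by (intro tendsto_intros R0)
  have "(%n. wnorm \<Omega> w (%x. S n x - S0 x)) \<longlonglongrightarrow> 0"
  proof (rule Lim_null_comparison)
    show "\<forall>\<^sub>F n in sequentially. norm (wnorm \<Omega> w (%x. S n x - S0 x)) <= sqrt (nrm LM (%x. w (S n) x - R0 x) * (C + nrm LM S0))"
    proof (rule always_eventually, rule allI)
      fix n
      have "0 <= ip LM (w (%x. S n x - S0 x)) (%x. S n x - S0 x)" by (rule w_nonneg[OF w_diff(1)[OF S(1)[of n] S0(1)]])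
      then show "norm (wnorm \<Omega> w (%x. S n x - S0 x)) <= sqrt (nrm LM (%x. w (S n) x - R0 x) * (C + nrm LM S0))"
        using real_sqrt_le_mono[OF b[of n]] by (simp only: wnorm_def l2inner_ip real_norm_def abs_of_nonneg real_sqrt_ge_zero)
    qed
    show "(%n. sqrt (nrm LM (%x. w (S n) x - R0 x) * (C + nrm LM S0))) \<longlonglongrightarrow> 0" using t by (simp only: mult_zero_left real_sqrt_zero)
  qed
  then show ?thesis using S0(1) by blast
qed

end

section \<open>Compactness\<close>

context hilbert_complex
begin

lemma weakR_diff:
  assumes "weakR \<Omega> \<Sigma> S G" "weakR \<Omega> \<Sigma> S' G'" "sqiL S" "sqiL S'" "sqiL G" "sqiL G'"
  shows "weakR \<Omega> \<Sigma> (%x. S x - S' x) (%x. G x - G' x)"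
  unfolding weakR_def
proof (intro allI impI, elim conjE)
  fix \<Psi> :: "R3 => M3" assume \<Psi>: "tf \<Psi>" "tsupp \<Psi> \<inter> frontier \<Omega> \<subseteq> \<Sigma>"
  then have "ipL S (R \<Psi>) = ipL G \<Psi>" "ipL S' (R \<Psi>) = ipL G' \<Psi>" using assms(1,2) unfolding weakR_def by blast+
  then show "ipL (%x. S x - S' x) (R \<Psi>) = ipL (%x. G x - G' x) \<Psi>"
    using assms(3-6) by (simp add: ip_diff_left tf_sqi R_tf \<Psi>(1))
qed

lemma zero_extension:
  assumes op: "open \<Omega>" and S: "L2 \<Omega> S" "AE x in lebesgue_on \<Omega>. P (S x) = S x" and G: "L2 \<Omega> G"
    and a: "!!m. C_inf_Sigma \<Sigma> (\<phi> m)" and l: "(%m. l2norm \<Omega> (%x. \<phi> m x - S x)) \<longlonglongrightarrow> 0" "(%m. l2norm \<Omega> (%x. Ra (\<phi> m) x - G x)) \<longlonglongrightarrow> 0"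
  shows "\<exists>X H. sqiL X & sqiL H & (\<forall>x. x \<notin> \<Omega> --> X x = 0) & (\<forall>x. x \<notin> \<Omega> --> H x = 0) & (\<forall>x. P (X x) = X x) \<and>
    nrmL X = l2norm \<Omega> S & nrmL H = l2norm \<Omega> G & weakR \<Omega> \<Sigma> X H & (AE x in lebesgue_on \<Omega>. S x = X x)"
proof -
  let ?M = "lebesgue_on \<Omega>"
  have b: "\<Omega> \<in> sets borel" using op by (rule borel_open)
  have s: "sqi ?M S" "sqi ?M G" using S G by (simp_all add: L2_sqi)
  obtain X0 where X0: "X0 \<in> borel_measurable borel" "!!x. x \<notin> \<Omega> ==> X0 x = 0" "AE x in ?M. S x = X0 x"
    using borel_representative[OF b sqi_measurable[OF s(1)]] by blast
  obtain H where H: "H \<in> borel_measurable borel" "!!x. x \<notin> \<Omega> ==> H x = 0" "AE x in ?M. G x = H x"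
    using borel_representative[OF b sqi_measurable[OF s(2)]] by blast
  \<comment> \<open>Projecting the representative makes P X = X hold at every point, as the local
    decomposition requires, without changing it almost everywhere on \<Omega>.\<close>
  define X where "X x = P (X0 x)" for x
  have X: "X \<in> borel_measurable borel" "!!x. x \<notin> \<Omega> ==> X x = 0" "AE x in ?M. S x = X x"
  proof -
    show "X \<in> borel_measurable borel" unfolding X_def[abs_def]
      by (rule measurable_compose[OF X0(1) borel_measurable_continuous_onI[OF linear_continuous_on[OF P_bl]]])
    show "X x = 0" if "x \<notin> \<Omega>" for x using X0(2)[OF that] by (simp add: X_def linear_0[OF P_linear])
    show "AE x in ?M. S x = X x" using S(2) X0(3) by eventually_elim (simp add: X_def)
  qed
  have sX: "sqiL X" using sqi_representative[OF b sqi_measurable[OF s(1)] X] s by simp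
  have sH: "sqiL H" using sqi_representative[OF b sqi_measurable[OF s(2)] H] s by simp
  have t: "tf (\<phi> m)" for m using C_inf_Sigma_tf[OF a] by blast
  have dist: "nrmL (%x. on \<Omega> f x - Y x) = nrm ?M (%x. f x - T x)"
    if f: "tf f" and Y: "Y \<in> borel_measurable borel" "!!x. x \<notin> \<Omega> ==> Y x = 0" "AE x in ?M. T x = Y x" and T: "sqi ?M T" for f Y T :: "R3 => M3"
  proof (rule nrm_representative[OF b, symmetric])
    have mf: "f \<in> borel_measurable borel" by (rule smooth_borel[OF tf_smooth[OF f]])
    show "(%x. f x - T x) \<in> borel_measurable ?M"
      by (intro borel_measurable_diff borel_measurable_lebesgue_on[OF mf] sqi_measurable[OF T])
    show "(%x. on \<Omega> f x - Y x) \<in> borel_measurable borel"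
      using b mf Y(1) by (intro borel_measurable_diff borel_measurable_scaleR borel_measurable_indicator)
    have "AE x in ?M. x \<in> \<Omega>" by (simp add: AE_lebesgue_on[OF b])
    then show "AE x in ?M. f x - T x = on \<Omega> f x - Y x" using Y(3) by eventually_elim simp
  qed (simp add: Y)
  have "weakR \<Omega> \<Sigma> X H"
    by (rule weakR_limit[OF op a sX sH]) (use l in \<open>simp_all add: dist[OF t X s(1)] dist[OF Ra_tf[OF t] H s(2)] l2norm_nrm\<close>)
  moreover have "nrmL X = l2norm \<Omega> S" "nrmL H = l2norm \<Omega> G"
    using nrm_representative[OF b sqi_measurable[OF s(1)] X] nrm_representative[OF b sqi_measurable[OF s(2)] H] by (simp_all add: l2norm_nrm)
  ultimately show ?thesis using sX sH X H
    by (intro exI[of _ X] exI[of _ H]) (simp add: X_def P_idem)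
qed

text \<open>Smooth approximants carry the estimate to the weighted field E, which enters only
  through its norm and that of its image u.\<close>

lemma pairing_bound:
  assumes op: "open \<Omega>" and h: "sqiL h" "!!x. x \<notin> \<Omega> ==> h x = 0"
    and e: "!!Rf. adm \<Omega> \<Sigma>' Rf ==> \<bar>ipL h Rf\<bar> <= a * (nrmL (on \<Omega> (D Rf)) + nrmL (on \<Omega> Rf))"
    and \<phi>: "!!m. adm \<Omega> \<Sigma>' (\<phi> m)" and E: "L2 \<Omega> E" "L2 \<Omega> u"
    and l: "(%m. l2norm \<Omega> (%x. \<phi> m x - E x)) \<longlonglongrightarrow> 0" "(%m. l2norm \<Omega> (%x. D (\<phi> m) x - u x)) \<longlonglongrightarrow> 0"
  shows "\<bar>ip (lebesgue_on \<Omega>) E h\<bar> <= a * (l2norm \<Omega> u + l2norm \<Omega> E)"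
proof -
  let ?M = "lebesgue_on \<Omega>"
  have b: "\<Omega> \<in> sets borel" using op by (rule borel_open)
  have s: "sqi ?M E" "sqi ?M u" using E by (simp_all add: L2_sqi)
  have t: "tf (\<phi> m)" for m using \<phi> C_inf_Sigma_tf by (auto simp: adm_def)
  have sf: "sqi ?M f" if "tf f" for f :: "R3 => 'c::euclidean_space"
    unfolding sqi_on[OF b smooth_borel[OF tf_smooth[OF that]]] by (rule on_sqi[OF b tf_sqi[OF that]])
  have mh: "h \<in> borel_measurable borel" using sqi_measurable[OF h(1)] by simp
  have "on \<Omega> h = h" using h(2) by (auto simp: indicator_def)
  then have sh: "sqi ?M h" using h(1) by (simp add: sqi_on[OF b mh])
  have "ip ?M (\<phi> m) h = ipL h (\<phi> m)" for m
  proof -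
    have "on \<Omega> (\<phi> m) x \<bullet> h x = h x \<bullet> \<phi> m x" for x using h(2)[of x] by (cases "x \<in> \<Omega>") (auto simp: inner_commute)
    then show ?thesis using ip_on[OF b smooth_borel[OF tf_smooth[OF t]] mh] by (simp add: ip_def)
  qed
  then have "\<bar>ip ?M (\<phi> m) h\<bar> <= a * (nrm ?M (D (\<phi> m)) + nrm ?M (\<phi> m))" for m
    using e[OF \<phi>] by (simp add: nrm_on[OF b smooth_borel[OF tf_smooth[OF t]]] nrm_on[OF b smooth_borel[OF tf_smooth[OF D_tf[OF t]]]])
  moreover have "(%m. \<bar>ip ?M (\<phi> m) h\<bar>) \<longlonglongrightarrow> \<bar>ip ?M E h\<bar>"
    by (intro tendsto_rabs ip_limit[OF sf[OF t] s(1) sh l(1)[unfolded l2norm_nrm]])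
  moreover have "(%m. a * (nrm ?M (D (\<phi> m)) + nrm ?M (\<phi> m))) \<longlonglongrightarrow> a * (nrm ?M u + nrm ?M E)"
    by (intro tendsto_mult tendsto_add tendsto_const nrm_limit[OF sf[OF t] s(1) l(1)[unfolded l2norm_nrm]] nrm_limit[OF sf[OF D_tf[OF t]] s(2) l(2)[unfolded l2norm_nrm]])
  ultimately show ?thesis unfolding l2norm_nrm by (intro LIMSEQ_le) auto
qed

text \<open>If the images under w were not Cauchy, there would be pairs of arbitrarily late indices
  at distance more than e. The differences XX of the fields are weakly null, so
  \<open>domain_estimate\<close> sends their pairings with either image to 0, while by
  \<open>w_coercive\<close> the pairing with the difference of the images stays above e^2 / c. The
  subsequence is chosen before w is used on it.\<close>

theorem weighted_compactness:
  fixes S :: "nat => R3 => M3"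
  assumes op: "open \<Omega>" and bd: "bounded \<Omega>" and p: "!!x. x \<in> closure \<Omega> ==> \<exists>V. x \<in> V & patch \<Omega> \<Sigma> \<Sigma>' V"
    and V: "!!S. V S \<longleftrightarrow> L2 \<Omega> S & (AE x in lebesgue_on \<Omega>. P (S x) = S x)" and w: "admissible_weight \<Omega> V w"
    and S: "!!n. V (S n)" "!!n. l2norm \<Omega> (S n) <= C"
    and rot: "!!n. \<exists>\<phi> G. (\<forall>m. C_inf_Sigma \<Sigma> (\<phi> m)) & L2 \<Omega> G & l2norm \<Omega> G <= C \<and>
      (%m. l2norm \<Omega> (%x. \<phi> m x - S n x)) \<longlonglongrightarrow> 0 & (%m. l2norm \<Omega> (%x. Ra (\<phi> m) x - G x)) \<longlonglongrightarrow> 0"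
    and div: "!!n. \<exists>\<phi> u. (\<forall>m. adm \<Omega> \<Sigma>' (\<phi> m)) & L2 \<Omega> u & l2norm \<Omega> u <= C \<and>
      (%m. l2norm \<Omega> (%x. \<phi> m x - w (S n) x)) \<longlonglongrightarrow> 0 & (%m. l2norm \<Omega> (%x. D (\<phi> m) x - u x)) \<longlonglongrightarrow> 0"
  shows "\<exists>r S0. strict_mono r & V S0 & (%n. wnorm \<Omega> w (%x. S (r n) x - S0 x)) \<longlonglongrightarrow> 0"
proof -
  let ?M = "lebesgue_on \<Omega>"
  obtain c0 where c0: "\<forall>S. V S --> l2norm \<Omega> (w S) <= c0 * l2norm \<Omega> S" using w unfolding admissible_weight_def by blast
  define c where "c = \<bar>c0\<bar> + 1"
  interpret weight \<Omega> V P w c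
  proof (rule weight.intro)
    show "l2norm \<Omega> (w S) <= c * l2norm \<Omega> S" if "V S" for S
    proof -
      have "c0 * l2norm \<Omega> S <= c * l2norm \<Omega> S" by (rule mult_right_mono) (auto simp: c_def l2norm_nrm nrm_nonneg)
      then show ?thesis using c0[rule_format, OF that] by linarith
    qed
    show "0 < c" by (simp add: c_def)
  qed (rule V w P_bl)+
  have C0: "0 <= C" using S(2)[of 0] nrm_nonneg[of ?M "S 0"] unfolding l2norm_nrm by linarith
  \<comment> \<open>Bounds the graph norm of every weighted field: C for its image under D and c C
    for the field itself.\<close>
  define K where "K = C + c * C"
  have K: "0 <= K" using C0 c(1) by (simp add: K_def)
  obtain R where R: "\<Omega> \<subseteq> cball 0 R" using bd by (auto simp: bounded_iff subset_iff)
  have "\<exists>XH. sqiL (fst XH) & sqiL (snd XH) & (\<forall>x. x \<notin> \<Omega> --> fst XH x = 0) & (\<forall>x. x \<notin> \<Omega> --> snd XH x = 0) & (\<forall>x. P (fst XH x) = fst XH x) \<and>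
    nrmL (fst XH) <= C & nrmL (snd XH) <= C & weakR \<Omega> \<Sigma> (fst XH) (snd XH) & (AE x in ?M. S n x = fst XH x)" for n
  proof -
    from rot[of n] obtain \<phi> G where r: "\<forall>m. C_inf_Sigma \<Sigma> (\<phi> m)" "L2 \<Omega> G" "l2norm \<Omega> G <= C"
      "(%m. l2norm \<Omega> (%x. \<phi> m x - S n x)) \<longlonglongrightarrow> 0" "(%m. l2norm \<Omega> (%x. Ra (\<phi> m) x - G x)) \<longlonglongrightarrow> 0" by (elim exE conjE)
    from zero_extension[OF op S(1)[unfolded V, THEN conjunct1] S(1)[unfolded V, THEN conjunct2] r(2) r(1)[rule_format] r(4,5)]
    obtain X H where "sqiL X & sqiL H & (\<forall>x. x \<notin> \<Omega> --> X x = 0) & (\<forall>x. x \<notin> \<Omega> --> H x = 0) & (\<forall>x. P (X x) = X x) \<and>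
      nrmL X = l2norm \<Omega> (S n) & nrmL H = l2norm \<Omega> G & weakR \<Omega> \<Sigma> X H & (AE x in ?M. S n x = X x)" by (elim exE)
    then show ?thesis using S(2)[of n] r(3) by (intro exI[of _ "(X, H)"]) simp
  qed
  then have "\<forall>n. \<exists>XH. sqiL (fst XH) & sqiL (snd XH) & (\<forall>x. x \<notin> \<Omega> --> fst XH x = 0) & (\<forall>x. x \<notin> \<Omega> --> snd XH x = 0) & (\<forall>x. P (fst XH x) = fst XH x) \<and>
    nrmL (fst XH) <= C & nrmL (snd XH) <= C & weakR \<Omega> \<Sigma> (fst XH) (snd XH) & (AE x in ?M. S n x = fst XH x)" by (rule allI)
  from choice[OF this] obtain XH where XH: "\<forall>n. sqiL (fst (XH n)) & sqiL (snd (XH n)) & (\<forall>x. x \<notin> \<Omega> --> fst (XH n) x = 0) & (\<forall>x. x \<notin> \<Omega> --> snd (XH n) x = 0) & (\<forall>x. P (fst (XH n) x) = fst (XH n) x) \<and>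
    nrmL (fst (XH n)) <= C & nrmL (snd (XH n)) <= C & weakR \<Omega> \<Sigma> (fst (XH n)) (snd (XH n)) & (AE x in ?M. S n x = fst (XH n) x)" by (elim exE)
  define X H where "X n = fst (XH n)" and "H n = snd (XH n)" for n
  have X: "sqiL (X n)" "!!x. x \<notin> \<Omega> ==> X n x = 0" "!!x. P (X n x) = X n x" "nrmL (X n) <= C" "AE x in ?M. S n x = X n x"
    and H: "sqiL (H n)" "!!x. x \<notin> \<Omega> ==> H n x = 0" "nrmL (H n) <= C" and XHw: "weakR \<Omega> \<Sigma> (X n) (H n)" for n
    using XH[rule_format, of n] unfolding X_def H_def by (elim conjE; simp)+
  have zX: "X n x = 0" "H n x = 0" if "x \<notin> cball 0 R" for n x using X(2) H(2) that R by blast+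
  have "\<exists>r. strict_mono r & (\<forall>\<kappa>. continuous_on UNIV \<kappa> --> convergent (%n. ipL (X (r n)) \<kappa>))"
    by (rule weak_subsequence[OF X(1) _ X(4)]) (rule zX(1))
  then obtain r1 where r1: "strict_mono r1" "\<forall>\<kappa>. continuous_on UNIV \<kappa> --> convergent (%n. ipL (X (r1 n)) \<kappa>)" by (elim exE conjE)
  have "\<exists>r. strict_mono r & (\<forall>\<kappa>. continuous_on UNIV \<kappa> --> convergent (%n. ipL (H (r1 (r n))) \<kappa>))"
    by (rule weak_subsequence[of "%n. H (r1 n)", OF H(1) _ H(3)]) (rule zX(2))
  then obtain r2 where r2: "strict_mono r2" "\<forall>\<kappa>. continuous_on UNIV \<kappa> --> convergent (%n. ipL (H (r1 (r2 n))) \<kappa>)" by (elim exE conjE)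
  define r where "r n = r1 (r2 n)" for n
  have r: "strict_mono r" using strict_mono_o[OF r1(1) r2(1)] by (simp add: r_def[abs_def] o_def)
  have cX: "convergent (%n. ipL (X (r n)) \<kappa>)" if "continuous_on UNIV \<kappa>" for \<kappa>
    using convergent_subseq_convergent[OF r1(2)[rule_format, OF that] r2(1)] by (simp add: o_def r_def)
  have cH: "convergent (%n. ipL (H (r n)) \<kappa>)" if "continuous_on UNIV \<kappa>" for \<kappa>
    using r2(2)[rule_format, OF that] by (simp add: r_def)
  have ws: "sqi ?M (w (S n))" for n using V_sqi wV S(1) by blast
  have cauchy: "\<exists>N. \<forall>m\<ge>N. \<forall>n\<ge>N. nrm ?M (%x. w (S (r m)) x - w (S (r n)) x) <= e" if e: "e > 0" for e
  proof (rule ccontr)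
    assume "\<nexists>N. \<forall>m\<ge>N. \<forall>n\<ge>N. nrm ?M (%x. w (S (r m)) x - w (S (r n)) x) <= e"
    then have ex: "\<forall>N. \<exists>m\<ge>N. \<exists>n\<ge>N. e < nrm ?M (%x. w (S (r m)) x - w (S (r n)) x)"
      by (simp only: not_ex not_all not_imp not_le simp_thms)
    have "\<forall>N. \<exists>mn. fst mn >= N & snd mn >= N & nrm ?M (%x. w (S (r (fst mn))) x - w (S (r (snd mn))) x) > e"
    proof
      fix N
      from ex[rule_format, of N] obtain m n where "N <= m" "N <= n" "e < nrm ?M (%x. w (S (r m)) x - w (S (r n)) x)" by (elim exE conjE)
      then show "\<exists>mn. fst mn >= N & snd mn >= N & nrm ?M (%x. w (S (r (fst mn))) x - w (S (r (snd mn))) x) > e"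
        by (intro exI[of _ "(m, n)"]) simp
    qed
    from choice[OF this] obtain mn where mn: "\<forall>N. fst (mn N) >= N & snd (mn N) >= N & nrm ?M (%x. w (S (r (fst (mn N)))) x - w (S (r (snd (mn N)))) x) > e" by (elim exE)
    define p' q' where "p' N = fst (mn N)" and "q' N = snd (mn N)" for N
    have pq: "N <= p' N" "N <= q' N" and big: "nrm ?M (%x. w (S (r (p' N))) x - w (S (r (q' N))) x) > e" for N
      using mn by (auto simp: p'_def q'_def)
    define XX HH where "XX N x = X (r (p' N)) x - X (r (q' N)) x" and "HH N x = H (r (p' N)) x - H (r (q' N)) x" for N x
    have wn: "weakly_null R XX" "weakly_null R HH" unfolding XX_def[abs_def] HH_def[abs_def]
      by (rule weakly_null_differences[of "%n. X (r n)", OF X(1) zX(1) X(4) cX pq], assumption+)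
        (rule weakly_null_differences[of "%n. H (r n)", OF H(1) zX(2) H(3) cH pq], assumption+)
    have XX: "P (XX N x) = XX N x" "x \<notin> \<Omega> ==> XX N x = 0" "sqiL (XX N)" for N x
      using X by (simp_all add: XX_def[abs_def] linear_diff[OF P_linear] sqi_diff)
    have ww: "weakR \<Omega> \<Sigma> (XX N) (HH N)" for N
      unfolding XX_def[abs_def] HH_def[abs_def] by (intro weakR_diff XHw X H)
    have "\<exists>a. a \<longlonglongrightarrow> (0::real) & (\<forall>n Rf. adm \<Omega> \<Sigma>' Rf --> \<bar>ipL (XX n) Rf\<bar> <= a n * (nrmL (on \<Omega> (D Rf)) + nrmL (on \<Omega> Rf)))"
      by (rule domain_estimate[OF op bd _ wn(1) XX(1) _ wn(2) ww]) (rule p XX(2), assumption)+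
    then obtain a where a: "a \<longlonglongrightarrow> 0" "\<forall>n Rf. adm \<Omega> \<Sigma>' Rf --> \<bar>ipL (XX n) Rf\<bar> <= a n * (nrmL (on \<Omega> (D Rf)) + nrmL (on \<Omega> Rf))" by (elim exE conjE)
    \<comment> \<open>k and N are independent: each weighted field is paired as a whole with the
      difference XX N, and the bound depends only on its graph norm.\<close>
    have pb: "\<bar>ip ?M (w (S k)) (XX N)\<bar> <= \<bar>a N\<bar> * K" for k N
    proof -
      from div[of k] obtain \<phi> u where d: "\<forall>m. adm \<Omega> \<Sigma>' (\<phi> m)" "L2 \<Omega> u" "l2norm \<Omega> u <= C"
        "(%m. l2norm \<Omega> (%x. \<phi> m x - w (S k) x)) \<longlonglongrightarrow> 0" "(%m. l2norm \<Omega> (%x. D (\<phi> m) x - u x)) \<longlonglongrightarrow> 0" by (elim exE conjE)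
      have "\<bar>ip ?M (w (S k)) (XX N)\<bar> <= a N * (l2norm \<Omega> u + l2norm \<Omega> (w (S k)))"
        by (rule pairing_bound[OF op XX(3) XX(2) a(2)[rule_format] d(1)[rule_format] _ d(2,4,5)]) (use ws in \<open>auto simp: L2_sqi\<close>)
      also have "\<dots> <= \<bar>a N\<bar> * (l2norm \<Omega> u + l2norm \<Omega> (w (S k)))" by (rule mult_right_mono) (auto simp: l2norm_nrm nrm_nonneg)
      also have "\<dots> <= \<bar>a N\<bar> * K"
      proof (rule mult_left_mono)
        have "c * l2norm \<Omega> (S k) <= c * C" using S(2)[of k] c(1) by simp
        then show "l2norm \<Omega> u + l2norm \<Omega> (w (S k)) <= K" using d(3) c(2)[OF S(1)[of k]] unfolding K_def by linarith
      qed simp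
      finally show ?thesis .
    qed
    have est: "e\<^sup>2 <= c * (2 * (\<bar>a N\<bar> * K))" for N
    proof -
      let ?S = "S (r (p' N))" and ?T = "S (r (q' N))"
      note d = w_diff[OF S(1)[of "r (p' N)"] S(1)[of "r (q' N)"]]
      have sXX: "sqi ?M (XX N)"
      proof -
        have "on \<Omega> (XX N) = XX N" using XX(2) by (auto simp: indicator_def)
        then show ?thesis using XX(3)[of N] sqi_on[OF borel_open[OF op], of "XX N"] sqi_measurable[OF XX(3)[of N]] by simp
      qed
      have sd: "sqi ?M (%x. w ?S x - w ?T x)" by (intro sqi_diff ws)
      have "e\<^sup>2 <= (nrm ?M (%x. w ?S x - w ?T x))\<^sup>2" using big[of N] e by (intro power_mono) auto
      also have "nrm ?M (%x. w ?S x - w ?T x) = nrm ?M (w (%x. ?S x - ?T x))"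
        by (rule nrm_cong_AE[symmetric, OF d(2)]) (intro sqi_measurable sd V_sqi wV d(1))+
      also have "(nrm ?M (w (%x. ?S x - ?T x)))\<^sup>2 <= c * ip ?M (w (%x. ?S x - ?T x)) (%x. ?S x - ?T x)" by (rule w_coercive[OF d(1)])
      also have "ip ?M (w (%x. ?S x - ?T x)) (%x. ?S x - ?T x) = ip ?M (%x. w ?S x - w ?T x) (%x. ?S x - ?T x)"
        by (rule ip_cong_AE[OF d(2)]) (intro sqi_measurable sd V_sqi wV d(1))+
      also have "\<dots> = ip ?M (%x. ?S x - ?T x) (%x. w ?S x - w ?T x)" by (rule ip_commute)
      also have "\<dots> = ip ?M (XX N) (%x. w ?S x - w ?T x)"
      proof (rule ip_cong_AE)
        show "AE x in ?M. ?S x - ?T x = XX N x" using X(5)[of "r (p' N)"] X(5)[of "r (q' N)"] by eventually_elim (simp add: XX_def)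
      qed (intro sqi_measurable sd sXX V_sqi d(1))+
      also have "\<dots> = ip ?M (w ?S) (XX N) - ip ?M (w ?T) (XX N)"
        by (subst ip_commute) (rule ip_diff_left[OF ws ws sXX])
      also have "c * \<dots> <= c * (2 * (\<bar>a N\<bar> * K))"
      proof (rule mult_left_mono)
        show "ip ?M (w ?S) (XX N) - ip ?M (w ?T) (XX N) <= 2 * (\<bar>a N\<bar> * K)"
          using pb[of "r (p' N)" N] pb[of "r (q' N)" N] by linarith
      qed (use c(1) in simp)
      finally show ?thesis .
    qed
    have "(%N. c * (2 * (\<bar>a N\<bar> * K))) \<longlonglongrightarrow> c * (2 * (\<bar>0\<bar> * K))" by (intro tendsto_intros a(1))
    then have "e\<^sup>2 <= c * (2 * (\<bar>0\<bar> * K))" by (rule LIMSEQ_le_const) (use est in auto)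
    then show False using e by simp
  qed
  have "\<exists>S0. V S0 & (%n. wnorm \<Omega> w (%x. S (r n) x - S0 x)) \<longlonglongrightarrow> 0"
    by (rule wnorm_limit[of "%n. S (r n)" C]) (use S cauchy in \<open>auto simp: l2norm_nrm\<close>)
  then show ?thesis using r by blast
qed

end

text \<open>The row-wise curl is formally self-adjoint, so its symbol serves as its own
  \<open>N\<close> in the first complex.\<close>

lemma curl_sym_antisymmetric: "curl_sym j a \<bullet> b = - (a \<bullet> curl_sym j b)"
  using exhaust_3[of j] by (elim disjE) (simp_all add: inner_vec_def curl_sym_def sum_3 cross_def)

interpretation SymRot: hilbert_complex symm cRot curl_sym cdivDiv k0S k1S curl_sym
  by (rule hilbert_complex.intro[OF SymRot.homotopy_axioms hilbert_complex_axioms.intro[OF linear_curl_sym curl_sym_antisymmetric]])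

interpretation DevDiv: hilbert_complex dev "%\<Psi>. cRot (%x. symm (\<Psi> x))" "%j A. curl_sym j (symm A)" "%\<Phi> x. - cDiv \<Phi> x" k0T k1T "%j A. symm (curl_sym j A)"
proof (rule hilbert_complex.intro[OF DevDiv.homotopy_axioms hilbert_complex_axioms.intro])
  show "linear (%A. symm (curl_sym j A))" for j using linear_compose[OF linear_curl_sym linear_symm] by (simp add: o_def)
  show "curl_sym j (symm a) \<bullet> b = - (a \<bullet> symm (curl_sym j b))" for j a b by (simp add: curl_sym_antisymmetric symm_inner)
qed

section \<open>The spaces of the theorem as data of the two abstract complexes\<close>

lemma symm_iff: "symm A = A \<longleftrightarrow> transpose A = A"
  by (auto simp: vec_eq_iff symm_nth transpose_def)

lemma dev_iff: "dev A = A \<longleftrightarrow> trace A = 0"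
  using trace_dev[of A] dev_trace0[of A] by metis

lemma SymRot_Ra: "smooth \<phi> ==> SymRot.Ra \<phi> = cRot \<phi>" by (simp add: fun_eq_iff SymRot.Ra_def cRot_eq)

lemma DevDiv_Ra: "smooth \<phi> ==> DevDiv.Ra \<phi> = csymRot \<phi>"
  by (simp add: fun_eq_iff DevDiv.Ra_def csymRot_def cRot_eq linear_sum[OF linear_symm])

lemma C_inf_S_adm: "C_inf_S \<Omega> \<Sigma> \<phi> \<longleftrightarrow> SymRot.adm \<Omega> \<Sigma> \<phi>" by (simp add: C_inf_S_def SymRot.adm_def symm_iff)
lemma C_inf_T_adm: "C_inf_T \<Omega> \<Sigma> \<phi> \<longleftrightarrow> DevDiv.adm \<Omega> \<Sigma> \<phi>" by (simp add: C_inf_T_def DevDiv.adm_def dev_iff)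

lemma Rot_data:
  assumes op: "open \<Omega>" and H: "H_S_Rot \<Omega> \<Sigma> S" and G: "weak_Rot \<Omega> S G"
  shows "\<exists>\<phi> G'. (\<forall>m. C_inf_Sigma \<Sigma> (\<phi> m)) & L2 \<Omega> G' & l2norm \<Omega> G' = l2norm \<Omega> G \<and>
      (%m. l2norm \<Omega> (%x. \<phi> m x - S x)) \<longlonglongrightarrow> 0 & (%m. l2norm \<Omega> (%x. SymRot.Ra (\<phi> m) x - G' x)) \<longlonglongrightarrow> 0"
proof -
  from H[unfolded H_S_Rot_def] obtain G' \<phi> where h: "weak_Rot \<Omega> S G'" "\<forall>n. C_inf_S \<Omega> \<Sigma> (\<phi> n)"
    "(%n. l2norm \<Omega> (%x. \<phi> n x - S x)) \<longlonglongrightarrow> 0" "(%n. l2norm \<Omega> (%x. cRot (\<phi> n) x - G' x)) \<longlonglongrightarrow> 0" by (elim conjE exE)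
  have "smooth (\<phi> n)" "C_inf_Sigma \<Sigma> (\<phi> n)" for n using h(2) by (simp_all add: C_inf_S_def C_inf_Sigma_def)
  moreover have "l2norm \<Omega> G' = l2norm \<Omega> G" by (rule weak_unique[OF op]) (use h(1) G in \<open>auto simp: weak_Rot_def\<close>)
  ultimately show ?thesis using h by (intro exI[of _ \<phi>] exI[of _ G']) (simp add: SymRot_Ra weak_Rot_def)
qed

lemma divDiv_data:
  assumes op: "open \<Omega>" and H: "H_S_divDiv \<Omega> \<Sigma> S" and u: "weak_divDiv \<Omega> S u"
  shows "\<exists>\<phi> u'. (\<forall>m. SymRot.adm \<Omega> \<Sigma> (\<phi> m)) & L2 \<Omega> u' & l2norm \<Omega> u' = l2norm \<Omega> u \<and>
      (%m. l2norm \<Omega> (%x. \<phi> m x - S x)) \<longlonglongrightarrow> 0 & (%m. l2norm \<Omega> (%x. cdivDiv (\<phi> m) x - u' x)) \<longlonglongrightarrow> 0"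
proof -
  from H[unfolded H_S_divDiv_def] obtain u' \<phi> where h: "weak_divDiv \<Omega> S u'" "\<forall>n. C_inf_S \<Omega> \<Sigma> (\<phi> n)"
    "(%n. l2norm \<Omega> (%x. \<phi> n x - S x)) \<longlonglongrightarrow> 0" "(%n. l2norm \<Omega> (%x. cdivDiv (\<phi> n) x - u' x)) \<longlonglongrightarrow> 0" by (elim conjE exE)
  have "l2norm \<Omega> u' = l2norm \<Omega> u" by (rule weak_unique[OF op]) (use h(1) u in \<open>auto simp: weak_divDiv_def\<close>)
  then show ?thesis using h by (intro exI[of _ \<phi>] exI[of _ u']) (simp add: C_inf_S_adm weak_divDiv_def)
qed

lemma symRot_data:
  assumes op: "open \<Omega>" and H: "H_T_symRot \<Omega> \<Sigma> S" and G: "weak_symRot \<Omega> S G"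
  shows "\<exists>\<phi> G'. (\<forall>m. C_inf_Sigma \<Sigma> (\<phi> m)) & L2 \<Omega> G' & l2norm \<Omega> G' = l2norm \<Omega> G \<and>
      (%m. l2norm \<Omega> (%x. \<phi> m x - S x)) \<longlonglongrightarrow> 0 & (%m. l2norm \<Omega> (%x. DevDiv.Ra (\<phi> m) x - G' x)) \<longlonglongrightarrow> 0"
proof -
  from H[unfolded H_T_symRot_def] obtain G' \<phi> where h: "weak_symRot \<Omega> S G'" "\<forall>n. C_inf_T \<Omega> \<Sigma> (\<phi> n)"
    "(%n. l2norm \<Omega> (%x. \<phi> n x - S x)) \<longlonglongrightarrow> 0" "(%n. l2norm \<Omega> (%x. csymRot (\<phi> n) x - G' x)) \<longlonglongrightarrow> 0" by (elim conjE exE)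
  have "smooth (\<phi> n)" "C_inf_Sigma \<Sigma> (\<phi> n)" for n using h(2) by (simp_all add: C_inf_T_def C_inf_Sigma_def)
  moreover have "l2norm \<Omega> G' = l2norm \<Omega> G" by (rule weak_unique[OF op]) (use h(1) G in \<open>auto simp: weak_symRot_def\<close>)
  ultimately show ?thesis using h by (intro exI[of _ \<phi>] exI[of _ G']) (simp add: DevDiv_Ra weak_symRot_def)
qed

lemma Div_data:
  assumes op: "open \<Omega>" and H: "H_T_Div \<Omega> \<Sigma> S" and v: "weak_Div \<Omega> S v"
  shows "\<exists>\<phi> u. (\<forall>m. DevDiv.adm \<Omega> \<Sigma> (\<phi> m)) & L2 \<Omega> u & l2norm \<Omega> u = l2norm \<Omega> v \<and>
      (%m. l2norm \<Omega> (%x. \<phi> m x - S x)) \<longlonglongrightarrow> 0 & (%m. l2norm \<Omega> (%x. - cDiv (\<phi> m) x - u x)) \<longlonglongrightarrow> 0"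
proof -
  from H[unfolded H_T_Div_def] obtain v' \<phi> where h: "weak_Div \<Omega> S v'" "\<forall>n. C_inf_T \<Omega> \<Sigma> (\<phi> n)"
    "(%n. l2norm \<Omega> (%x. \<phi> n x - S x)) \<longlonglongrightarrow> 0" "(%n. l2norm \<Omega> (%x. cDiv (\<phi> n) x - v' x)) \<longlonglongrightarrow> 0" by (elim conjE exE)
  have "l2norm \<Omega> v' = l2norm \<Omega> v" by (rule weak_unique[OF op]) (use h(1) v in \<open>auto simp: weak_Div_def\<close>)
  moreover have "l2norm \<Omega> (%x. - cDiv (\<phi> m) x - - v' x) = l2norm \<Omega> (%x. cDiv (\<phi> m) x - v' x)" for m
    using nrm_minus_commute[of "lebesgue_on \<Omega>" "cDiv (\<phi> m)" v'] by (simp add: l2norm_nrm)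
  moreover have "L2 \<Omega> (%x. - v' x)" using h(1) by (simp add: weak_Div_def L2_sqi sqi_uminus)
  moreover have "l2norm \<Omega> (%x. - v' x) = l2norm \<Omega> v'" by (simp add: l2norm_def)
  ultimately show ?thesis using h by (intro exI[of _ \<phi>] exI[of _ "%x. - v' x"]) (simp add: C_inf_T_adm)
qed

theorem theorem3p12:
  fixes \<Omega> \<Gamma>t :: "R3 set"
    and \<epsilon> \<mu> :: "(R3 \<Rightarrow> M3) \<Rightarrow> (R3 \<Rightarrow> M3)"
  assumes "strong_lipschitz_domain \<Omega>" and "bounded \<Omega>"
    and "strong_lipschitz_boundary_part \<Omega> \<Gamma>t"
    and "admissible_weight \<Omega> (L2S \<Omega>) \<epsilon>"
    and "admissible_weight \<Omega> (L2T \<Omega>) \<mu>"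
  defines "\<Gamma>n \<equiv> frontier \<Omega> - closure \<Gamma>t"
  shows
   "(\<forall>(S::nat \<Rightarrow> R3 \<Rightarrow> M3) G D C.
       (\<forall>n. H_S_Rot \<Omega> \<Gamma>t (S n) \<and> H_S_divDiv \<Omega> \<Gamma>n (\<epsilon> (S n)) \<and>
            weak_Rot \<Omega> (S n) (G n) \<and> weak_divDiv \<Omega> (\<epsilon> (S n)) (D n) \<and>
            l2norm \<Omega> (S n) + l2norm \<Omega> (G n) + l2norm \<Omega> (D n) \<le> C) \<longrightarrow>
       (\<exists>r S0. strict_mono r \<and> L2S \<Omega> S0 \<and>
          (\<lambda>n. wnorm \<Omega> \<epsilon> (\<lambda>x. S (r n) x - S0 x)) \<longlonglongrightarrow> 0))
  \<and> (\<forall>(T::nat \<Rightarrow> R3 \<Rightarrow> M3) v G C.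
       (\<forall>n. H_T_Div \<Omega> \<Gamma>t (\<mu> (T n)) \<and> H_T_symRot \<Omega> \<Gamma>n (T n) \<and>
            weak_Div \<Omega> (\<mu> (T n)) (v n) \<and> weak_symRot \<Omega> (T n) (G n) \<and>
            l2norm \<Omega> (T n) + l2norm \<Omega> (v n) + l2norm \<Omega> (G n) \<le> C) \<longrightarrow>
       (\<exists>r T0. strict_mono r \<and> L2T \<Omega> T0 \<and>
          (\<lambda>n. wnorm \<Omega> \<mu> (\<lambda>x. T (r n) x - T0 x)) \<longlonglongrightarrow> 0))"
proof (intro conjI allI impI)
  have op: "open \<Omega>" using assms(1) by (simp add: strong_lipschitz_domain_def)
  note cover = patch_cover[OF op assms(3) \<Gamma>n_def[THEN meta_eq_to_obj_eq]]
  have nn: "0 <= l2norm \<Omega> f" for f :: "R3 => 'c::euclidean_space" by (simp add: l2norm_nrm nrm_nonneg)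
  fix S :: "nat => R3 => M3" and G D C
  assume a: "\<forall>n. H_S_Rot \<Omega> \<Gamma>t (S n) & H_S_divDiv \<Omega> \<Gamma>n (\<epsilon> (S n)) \<and>
            weak_Rot \<Omega> (S n) (G n) & weak_divDiv \<Omega> (\<epsilon> (S n)) (D n) \<and>
            l2norm \<Omega> (S n) + l2norm \<Omega> (G n) + l2norm \<Omega> (D n) <= C"
  have le: "l2norm \<Omega> (S n) <= C" "l2norm \<Omega> (G n) <= C" "l2norm \<Omega> (D n) <= C" for n
    using a[rule_format, of n] nn[of "S n"] nn[of "G n"] nn[of "D n"] by linarith+
  show "\<exists>r S0. strict_mono r & L2S \<Omega> S0 & (%n. wnorm \<Omega> \<epsilon> (%x. S (r n) x - S0 x)) \<longlonglongrightarrow> 0"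
  \<comment> \<open>S is the field extended by zero across \<Gamma>t, and \<epsilon> S supplies the
    paired fields that vanish near \<Gamma>n.\<close>
  proof (rule SymRot.weighted_compactness[OF op assms(2) cover(1) _ assms(4)])
    show "L2S \<Omega> S \<longleftrightarrow> L2 \<Omega> S & (AE x in lebesgue_on \<Omega>. symm (S x) = S x)" for S by (simp add: L2S_def symm_iff)
    show "L2S \<Omega> (S n)" for n using a by (simp add: H_S_Rot_def)
    show "l2norm \<Omega> (S n) <= C" for n by (rule le)
    show "\<exists>\<phi> G. (\<forall>m. C_inf_Sigma \<Gamma>t (\<phi> m)) & L2 \<Omega> G & l2norm \<Omega> G <= C \<and>
      (%m. l2norm \<Omega> (%x. \<phi> m x - S n x)) \<longlonglongrightarrow> 0 & (%m. l2norm \<Omega> (%x. SymRot.Ra (\<phi> m) x - G x)) \<longlonglongrightarrow> 0" for n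
    proof -
      have "H_S_Rot \<Omega> \<Gamma>t (S n)" "weak_Rot \<Omega> (S n) (G n)" using a by blast+
      from Rot_data[OF op this] le(2)[of n] show ?thesis by (elim ex_forward conjE) simp
    qed
    show "\<exists>\<phi> u. (\<forall>m. SymRot.adm \<Omega> \<Gamma>n (\<phi> m)) & L2 \<Omega> u & l2norm \<Omega> u <= C \<and>
      (%m. l2norm \<Omega> (%x. \<phi> m x - \<epsilon> (S n) x)) \<longlonglongrightarrow> 0 & (%m. l2norm \<Omega> (%x. cdivDiv (\<phi> m) x - u x)) \<longlonglongrightarrow> 0" for n
    proof -
      have "H_S_divDiv \<Omega> \<Gamma>n (\<epsilon> (S n))" "weak_divDiv \<Omega> (\<epsilon> (S n)) (D n)" using a by blast+
      from divDiv_data[OF op this] le(3)[of n] show ?thesis by (elim ex_forward conjE) simp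
    qed
  qed
next
  have op: "open \<Omega>" using assms(1) by (simp add: strong_lipschitz_domain_def)
  note cover = patch_cover[OF op assms(3) \<Gamma>n_def[THEN meta_eq_to_obj_eq]]
  have nn: "0 <= l2norm \<Omega> f" for f :: "R3 => 'c::euclidean_space" by (simp add: l2norm_nrm nrm_nonneg)
  fix T :: "nat => R3 => M3" and v G C
  assume a: "\<forall>n. H_T_Div \<Omega> \<Gamma>t (\<mu> (T n)) & H_T_symRot \<Omega> \<Gamma>n (T n) \<and>
            weak_Div \<Omega> (\<mu> (T n)) (v n) & weak_symRot \<Omega> (T n) (G n) \<and>
            l2norm \<Omega> (T n) + l2norm \<Omega> (v n) + l2norm \<Omega> (G n) <= C"
  have le: "l2norm \<Omega> (T n) <= C" "l2norm \<Omega> (v n) <= C" "l2norm \<Omega> (G n) <= C" for n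
    using a[rule_format, of n] nn[of "T n"] nn[of "v n"] nn[of "G n"] by linarith+
  show "\<exists>r T0. strict_mono r & L2T \<Omega> T0 & (%n. wnorm \<Omega> \<mu> (%x. T (r n) x - T0 x)) \<longlonglongrightarrow> 0"
  \<comment> \<open>The boundary parts exchange roles: T is extended by zero across \<Gamma>n, and
    \<mu> T carries its condition on \<Gamma>t.\<close>
  proof (rule DevDiv.weighted_compactness[OF op assms(2) cover(2) _ assms(5)])
    show "L2T \<Omega> S \<longleftrightarrow> L2 \<Omega> S & (AE x in lebesgue_on \<Omega>. dev (S x) = S x)" for S by (simp add: L2T_def dev_iff)
    show "L2T \<Omega> (T n)" for n using a by (simp add: H_T_symRot_def)
    show "l2norm \<Omega> (T n) <= C" for n by (rule le)
    show "\<exists>\<phi> G. (\<forall>m. C_inf_Sigma \<Gamma>n (\<phi> m)) & L2 \<Omega> G & l2norm \<Omega> G <= C \<and>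
      (%m. l2norm \<Omega> (%x. \<phi> m x - T n x)) \<longlonglongrightarrow> 0 & (%m. l2norm \<Omega> (%x. DevDiv.Ra (\<phi> m) x - G x)) \<longlonglongrightarrow> 0" for n
    proof -
      have "H_T_symRot \<Omega> \<Gamma>n (T n)" "weak_symRot \<Omega> (T n) (G n)" using a by blast+
      from symRot_data[OF op this] le(3)[of n] show ?thesis by (elim ex_forward conjE) simp
    qed
    show "\<exists>\<phi> u. (\<forall>m. DevDiv.adm \<Omega> \<Gamma>t (\<phi> m)) & L2 \<Omega> u & l2norm \<Omega> u <= C \<and>
      (%m. l2norm \<Omega> (%x. \<phi> m x - \<mu> (T n) x)) \<longlonglongrightarrow> 0 & (%m. l2norm \<Omega> (%x. - cDiv (\<phi> m) x - u x)) \<longlonglongrightarrow> 0" for n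
    proof -
      have "H_T_Div \<Omega> \<Gamma>t (\<mu> (T n))" "weak_Div \<Omega> (\<mu> (T n)) (v n)" using a by blast+
      from Div_data[OF op this] le(2)[of n] show ?thesis by (elim ex_forward conjE) simp
    qed
  qed
qed

end
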